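(* Fix $\beta>0$ and let $s>1/2$. Let $f:\mathbb R\to\mathbb C$ be continuous with $f(x)\to 0$ as $|x|\to\infty$, let $F(\theta)=f(T(\theta))$ with $T(\theta)=M_\beta^{-1}(e^{i\theta})$, assume $F\in H^s(\mathbb T)$, and assume that $f$ lies in appropriate function spaces to make the norms below finite. Let $\mathcal R_n f$ be the rational interpolant of $f$, $n>1$. Then, with constants $C_{r,s}$, $C_{\epsilon,s}$, $C_{s,t}$, $C_{j,s}$ that depend only on the indicated parameters (and on the fixed $\beta$), and not on $n$ or $f$: 1. For every integer $r\ge 0$ with $r<s-1/2$, $$\|\mathcal R_n f-f\|_{C_0^r(\mathbb R)}\le C_{r,s}\,n^{1/2+r-s}\,\|F\|_{H^s(\mathbb T)}.$$ 2. For every $\epsilon>0$ with $s>1+\epsilon$ and every $t<s$, $$\|\mathcal R_n f-f\|_{H^t(\mathbb R)}\le \left[C_{\epsilon,s}\,n^{1+\epsilon-s}+C_{s,t}\,n^{t-s}\right]\|F\|_{H^s(\mathbb T)}.$$ 3. For every $\epsilon>0$ with $s>3/2+\epsilon$, $$\left|\,\mathrm{p.v.}\!\int_{\mathbb R}\left(\mathcal R_n f(x)-f(x)\right)dx\right|\le C_{\epsilon,s}\,n^{3/2+\epsilon-s}\,\|F\|_{H^s(\mathbb T)}.$$ 4. For every integer $j>0$, $$\|\mathcal D^j[\mathcal R_n f-f]\|_{L^1(\mathbb R)}\le C_{j,s}\,n^{j-s}\,\|F\|_{H^s(\mathbb T)}.$$ Here the constants $C_{\epsilon,s}$ (which may differ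 in each line) are unbounded as $\epsilon\to0^+$.
   Context: $\mathbb T=[0,2\pi)$, regarded as the periodic interval. For $F\in L^2(\mathbb T)$, $\hat F_k=\frac1{2\pi}\int_0^{2\pi}e^{-ik\theta}F(\theta)\,d\theta$, and $H^s(\mathbb T)$ is the space of $F\in L^2(\mathbb T)$ with $\|F\|_{H^s(\mathbb T)}=\big(\sum_{k\in\mathbb Z}(1+|k|)^{2s}|\hat F_k|^2\big)^{1/2}<\infty$. For $s>1/2$, elements of $H^s(\mathbb T)$ are identified with their continuous periodic representatives. The Fourier transform is $\mathcal F f(k)=\int_{\mathbb R}e^{-ikx}f(x)\,dx$. $H^t(\mathbb R)$ is the space of $f\in L^2(\mathbb R)$ with $\|f\|_{H^t(\mathbb R)}=\big(\int_{\mathbb R}(1+|k|)^{2t}|\mathcal F f(k)|^2dk\big)^{1/2}<\infty$. $\mathcal D$ denotes (weak or strong) differentiation, and $\|g\|_{L^1(\mathbb R)}=\int_{\mathbb R}|g(x)|\,dx$. $C_0^r(\mathbb R)$ is the space of $f:\mathbb R\to\mathbb C$ with $\mathcal D^rf$ continuous and $\lim_{|x|\to\infty}\mathcal D^jf(x)=0$ for $j=0,\dots,r$, with norm $\sum_{j=0}^r\sup_{x\in\mathbb R}|\mathcal D^jf(x)|$. The principal value integral is $\mathrm{p.v.}\int_{\mathbb R}g(x)\,dx=\lim_{R\to\infty}\int_{-R}^Rg(x)\,dx$. For $\beta>0$ let $M_\beta(z)=\frac{z-i\beta}{z+i\beta}$, $M_\beta^{-1}(z)=\frac{\beta}{i}\frac{z+1}{z-1}$,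 and $T(\theta)=M_\beta^{-1}(e^{i\theta})$, a bijection from $(0,2\pi)$ to $\mathbb R$. For $f$ vanishing at infinity, $F(\theta)=f(T(\theta))$ for $\theta\in(0,2\pi)$ and $F(0)=F(2\pi)=0$. For $n\in\mathbb N$ let $\theta_\ell=2\pi\ell/n$ ($\ell=0,\dots,n-1$), $n_+=\lfloor n/2\rfloor$, $n_-=\lfloor(n-1)/2\rfloor$, $\tilde F_k=\frac1n\sum_{\ell=0}^{n-1}e^{-ik\theta_\ell}F(\theta_\ell)$, and $\mathcal I_nF(\theta)=\sum_{k=-n_-}^{n_+}e^{ik\theta}\tilde F_k$ (the trigonometric interpolant of $F$ at the $\theta_\ell$). The rational interpolant of $f$ is $\mathcal R_nf(x)=\mathcal I_nF(T^{-1}(x))=\sum_{k=-n_-}^{n_+}\tilde F_k\,M_\beta(x)^k$.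
   Formalization: Item 4 is stated only for integers 0 < j ≤ s; for j > s no uniform constant exists (n = 2, F = e^{iNθ} − 1 with N even gives R_2 f = 0, ‖D^j f‖_{L¹} ~ N^j, but ‖F‖_{H^s} ~ N^s). *)

theory Defs
  imports "HOL-Analysis.Analysis"
begin

section \<open>Sobolev spaces on the periodic interval\<close>

definition circle_fourier :: "(real \<Rightarrow> complex) \<Rightarrow> int \<Rightarrow> complex" where
  "circle_fourier F k =
     complex_of_real (1 / (2 * pi)) * (LINT \<theta>:{0..2*pi}|lborel. cis (- (of_int k * \<theta>)) * F \<theta>)"

definition in_L2_circle :: "(real \<Rightarrow> complex) \<Rightarrow> bool" where
  "in_L2_circle F \<longleftrightarrow>
     set_borel_measurable lborel {0..<2*pi} F \<and>
     set_integrable lborel {0..<2*pi} (\<lambda>\<theta>. (norm (F \<theta>))\<^sup>2)"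

definition in_H_circle :: "real \<Rightarrow> (real \<Rightarrow> complex) \<Rightarrow> bool" where
  "in_H_circle s F \<longleftrightarrow>
     in_L2_circle F \<and>
     (\<lambda>k::int. (1 + real_of_int \<bar>k\<bar>) powr (2 * s) * (norm (circle_fourier F k))\<^sup>2) summable_on UNIV"

definition H_circle_norm :: "real \<Rightarrow> (real \<Rightarrow> complex) \<Rightarrow> real" where
  "H_circle_norm s F =
     sqrt (\<Sum>\<^sub>\<infinity>k::int. (1 + real_of_int \<bar>k\<bar>) powr (2 * s) * (norm (circle_fourier F k))\<^sup>2)"

section \<open>Function spaces on the real line\<close>

definition in_L2_real :: "(real \<Rightarrow> complex) \<Rightarrow> bool" where
  "in_L2_real f \<longleftrightarrow> f \<in> borel_measurable lborel \<and> integrable lborel (\<lambda>x. (norm (f x))\<^sup>2)"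

text \<open>
  The integral defining the Fourier transform need not converge absolutely for a square-integrable
  function (the rational interpolants only decay like \<open>1/x\<close>), so the transform is the usual
  extension to all of \<open>L\<^sup>2\<close>: the limit in \<open>L\<^sup>2\<close> of the transforms of the truncations to \<open>[-R, R]\<close>.
  It is determined up to null sets.
\<close>

definition has_L2_fourier :: "(real \<Rightarrow> complex) \<Rightarrow> (real \<Rightarrow> complex) \<Rightarrow> bool" where
  "has_L2_fourier f g \<longleftrightarrow>
     in_L2_real g \<and>
     ((\<lambda>R::real. \<integral>\<^sup>+k. ennreal ((norm (g k - (LINT x:{-R..R}|lborel. cis (- (k * x)) * f x)))\<^sup>2) \<partial>lborel)
        \<longlongrightarrow> 0) at_top"

definition fourier :: "(real \<Rightarrow> complex) \<Rightarrow> real \<Rightarrow> complex" where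
  "fourier f = (SOME g. has_L2_fourier f g)"

definition in_H_real :: "real \<Rightarrow> (real \<Rightarrow> complex) \<Rightarrow> bool" where
  "in_H_real t f \<longleftrightarrow>
     in_L2_real f \<and>
     integrable lborel (\<lambda>k. (1 + \<bar>k\<bar>) powr (2 * t) * (norm (fourier f k))\<^sup>2)"

definition H_real_norm :: "real \<Rightarrow> (real \<Rightarrow> complex) \<Rightarrow> real" where
  "H_real_norm t f = sqrt (LINT k|lborel. (1 + \<bar>k\<bar>) powr (2 * t) * (norm (fourier f k))\<^sup>2)"

definition strong_deriv :: "nat \<Rightarrow> (real \<Rightarrow> complex) \<Rightarrow> real \<Rightarrow> complex" where
  "strong_deriv j = (\<lambda>g x. vector_derivative g (at x)) ^^ j"

definition in_C0 :: "nat \<Rightarrow> (real \<Rightarrow> complex) \<Rightarrow> bool" where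
  "in_C0 r f \<longleftrightarrow>
     (\<forall>j<r. \<forall>x. strong_deriv j f differentiable (at x)) \<and>
     continuous_on UNIV (strong_deriv r f) \<and>
     (\<forall>j\<le>r. (strong_deriv j f \<longlongrightarrow> 0) at_infinity)"

definition C0_norm :: "nat \<Rightarrow> (real \<Rightarrow> complex) \<Rightarrow> real" where
  "C0_norm r f = (\<Sum>j\<le>r. SUP x. norm (strong_deriv j f x))"

definition test_function :: "(real \<Rightarrow> real) \<Rightarrow> bool" where
  "test_function \<phi> \<longleftrightarrow>
     (\<forall>m x. (deriv ^^ m) \<phi> differentiable (at x)) \<and> (\<exists>R. \<forall>x. R < \<bar>x\<bar> \<longrightarrow> \<phi> x = 0)"

definition locally_integrable :: "(real \<Rightarrow> complex) \<Rightarrow> bool" where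
  "locally_integrable f \<longleftrightarrow> (\<forall>R. set_integrable lborel {-R..R} f)"

definition has_weak_deriv :: "nat \<Rightarrow> (real \<Rightarrow> complex) \<Rightarrow> (real \<Rightarrow> complex) \<Rightarrow> bool" where
  "has_weak_deriv j f g \<longleftrightarrow>
     locally_integrable f \<and> locally_integrable g \<and>
     (\<forall>\<phi>. test_function \<phi> \<longrightarrow>
        (LINT x|lborel. (deriv ^^ j) \<phi> x *\<^sub>R f x) = (-1) ^ j * (LINT x|lborel. \<phi> x *\<^sub>R g x))"

definition weak_deriv :: "nat \<Rightarrow> (real \<Rightarrow> complex) \<Rightarrow> real \<Rightarrow> complex" where
  "weak_deriv j f = (SOME g. has_weak_deriv j f g)"

definition deriv_in_L1 :: "nat \<Rightarrow> (real \<Rightarrow> complex) \<Rightarrow> bool" where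
  "deriv_in_L1 j f \<longleftrightarrow> (\<exists>g. has_weak_deriv j f g) \<and> integrable lborel (weak_deriv j f)"

definition L1_norm :: "(real \<Rightarrow> complex) \<Rightarrow> real" where
  "L1_norm g = (LINT x|lborel. norm (g x))"

definition has_pv_integral :: "(real \<Rightarrow> complex) \<Rightarrow> complex \<Rightarrow> bool" where
  "has_pv_integral g L \<longleftrightarrow> ((\<lambda>R::real. LINT x:{-R..R}|lborel. g x) \<longlongrightarrow> L) at_top"

section \<open>Rational interpolation\<close>

definition moebius :: "real \<Rightarrow> complex \<Rightarrow> complex" where
  "moebius \<beta> z = (z - \<i> * of_real \<beta>) / (z + \<i> * of_real \<beta>)"

definition moebius_inv :: "real \<Rightarrow> complex \<Rightarrow> complex" where
  "moebius_inv \<beta> z = of_real \<beta> / \<i> * ((z + 1) / (z - 1))"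

text \<open>For \<open>0 < \<theta> < 2\<pi>\<close> the value \<open>moebius_inv \<beta> (cis \<theta>)\<close> is real; see \<open>moebius_inv_cis\<close> below.\<close>

definition circle_to_line :: "real \<Rightarrow> real \<Rightarrow> real" where
  "circle_to_line \<beta> \<theta> = Re (moebius_inv \<beta> (cis \<theta>))"

definition pullback :: "real \<Rightarrow> (real \<Rightarrow> complex) \<Rightarrow> real \<Rightarrow> complex" where
  "pullback \<beta> f \<theta> = (if 0 < \<theta> \<and> \<theta> < 2 * pi then f (circle_to_line \<beta> \<theta>) else 0)"

definition node :: "nat \<Rightarrow> nat \<Rightarrow> real" where
  "node n l = 2 * pi * real l / real n"

definition discrete_fourier :: "nat \<Rightarrow> (real \<Rightarrow> complex) \<Rightarrow> int \<Rightarrow> complex" where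
  "discrete_fourier n F k = 1 / of_nat n * (\<Sum>l<n. cis (- (of_int k * node n l)) * F (node n l))"

definition trig_interpolant :: "nat \<Rightarrow> (real \<Rightarrow> complex) \<Rightarrow> real \<Rightarrow> complex" where
  "trig_interpolant n F \<theta> =
     (\<Sum>k = - int ((n - 1) div 2)..int (n div 2). cis (of_int k * \<theta>) * discrete_fourier n F k)"

definition rational_interpolant :: "real \<Rightarrow> nat \<Rightarrow> (real \<Rightarrow> complex) \<Rightarrow> real \<Rightarrow> complex" where
  "rational_interpolant \<beta> n f x =
     (\<Sum>k = - int ((n - 1) div 2)..int (n div 2).
        discrete_fourier n (pullback \<beta> f) k * moebius \<beta> (of_real x) powi k)"

lemma cis_neq_1:
  assumes "0 < \<theta>" "\<theta> < 2 * pi"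
  shows "cis \<theta> \<noteq> 1"
proof
  assume "cis \<theta> = 1"
  then have "cos \<theta> = 1"
    by (simp add: complex_eq_iff)
  then obtain n :: int where n: "\<theta> = of_int n * 2 * pi"
    using cos_one_2pi_int by blast
  have "0 < of_int n * (2 * pi)" "of_int n * (2 * pi) < 1 * (2 * pi)"
    using assms unfolding n by (simp_all add: mult.assoc)
  then have "0 < n" "n < 1"
    using pi_gt_zero by (simp_all add: zero_less_mult_iff)
  then show False
    by simp
qed

lemma moebius_inv_cis:
  assumes "0 < \<theta>" "\<theta> < 2 * pi"
  shows "moebius_inv \<beta> (cis \<theta>) = of_real (circle_to_line \<beta> \<theta>)"
proof -
  have z: "cis \<theta> \<noteq> 1" "cis \<theta> \<noteq> 0"
    using cis_neq_1[OF assms] by auto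
  have w: "cnj (cis \<theta>) = 1 / cis \<theta>"
    by (simp add: cis_cnj cis_inverse flip: inverse_eq_divide)
  have z': "1 - cis \<theta> \<noteq> 0" "cis \<theta> - 1 \<noteq> 0"
    using z by auto
  have "(1 / cis \<theta> + 1) / (1 / cis \<theta> - 1) = (1 + cis \<theta>) / (1 - cis \<theta>)"
    using z z' by (simp add: divide_simps)
  also have "\<dots> = - ((cis \<theta> + 1) / (cis \<theta> - 1))"
    using z' by (metis add.commute minus_diff_eq minus_divide_right)
  finally have "cnj (moebius_inv \<beta> (cis \<theta>)) = moebius_inv \<beta> (cis \<theta>)"
    unfolding moebius_inv_def by (simp add: w del: times_divide_eq_right flip: times_divide_eq_right)
  then show ?thesis
    unfolding circle_to_line_def by (simp add: complex_eq_iff)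
qed

lemma moebius_moebius_inv:
  assumes "\<beta> > 0" "z \<noteq> 1"
  shows "moebius \<beta> (moebius_inv \<beta> z) = z"
proof -
  define c where "c = - (\<i> * of_real \<beta>) / (z - 1)"
  have c: "c \<noteq> 0" and z: "z - 1 \<noteq> 0"
    using assms by (auto simp: c_def)
  have i: "\<i> * of_real \<beta> = - (c * (z - 1))"
    using z unfolding c_def by (simp add: field_simps)
  have m: "moebius_inv \<beta> z = c * (z + 1)"
    unfolding moebius_inv_def c_def by simp
  have "moebius \<beta> (moebius_inv \<beta> z) = (2 * c * z) / (2 * c)"
    unfolding moebius_def m i by (simp add: algebra_simps)
  then show ?thesis
    using c by simp
qed

lemma moebius_circle_to_line:
  assumes "\<beta> > 0" "0 < \<theta>" "\<theta> < 2 * pi"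
  shows "moebius \<beta> (of_real (circle_to_line \<beta> \<theta>)) = cis \<theta>"
  using moebius_moebius_inv[OF assms(1) cis_neq_1[OF assms(2,3)]]
    moebius_inv_cis[OF assms(2,3), of \<beta>] by simp

lemma rational_interpolant_eq_trig_interpolant:
  assumes "\<beta> > 0" "0 < \<theta>" "\<theta> < 2 * pi"
  shows "rational_interpolant \<beta> n f (circle_to_line \<beta> \<theta>) = trig_interpolant n (pullback \<beta> f) \<theta>"
  unfolding rational_interpolant_def trig_interpolant_def moebius_circle_to_line[OF assms]
  by (simp add: cis_power_int mult.commute)

end

theory Submission
  imports Defs "HOL-Computational_Algebra.Polynomial"
begin

text \<open>
  Write \<open>M(x) = exp (i \<tau>(x))\<close> with \<open>\<tau>' = 2 \<beta> / (x\<^sup>2 + \<beta>\<^sup>2)\<close>. Since \<open>F\<close> is the sum of its Fourier series,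
  the error is a series \<open>\<Sum> c\<^sub>k M\<^sup>k\<close> with \<open>\<Sum> c\<^sub>k = 0\<close>, where \<open>c\<^sub>k\<close> is an aliasing error at low
  frequencies and a Fourier coefficient of \<open>F\<close> at high ones; hence the weighted \<open>\<ell>\<^sup>2\<close> and \<open>\<ell>\<^sup>1\<close>
  norms of \<open>c\<close> are \<open>O(n\<^bsup>a-s\<^esup>)\<close> and \<open>O(n\<^bsup>1/2+a-s\<^esup>)\<close>.
  On powers of \<open>M\<close> differentiation is a banded operator with coefficients linear in \<open>k\<close>, and the
  powers of \<open>M\<close> are orthogonal for the weight \<open>\<tau>'\<close>; this bounds derivatives uniformly, in \<open>L\<^sup>1\<close>
  and in \<open>L\<^sup>2\<close>.
  For the principal value, \<open>Re M\<^sup>k - 1 = - |M\<^sup>k - 1|\<^sup>2 / 2\<close> is integrable with integral \<open>- 2 \<pi> \<beta> |k|\<close>.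
  For fractional Sobolev norms the error is cut into dyadic frequency blocks, on which the
  weight \<open>(1 + |\<xi>|)\<^bsup>2t\<^esup>\<close> is interpolated pointwise between integer powers. The exponents so obtained
  need no \<open>\<epsilon>\<close>, and the constants are made unbounded as \<open>\<epsilon> \<rightarrow> 0\<close> by adding \<open>1/\<epsilon>\<close>.
\<close>

section \<open>Fourier series of a continuous periodic function and aliasing\<close>

text \<open>The powers of \<open>M\<close> do not decay: each tends to 1 at infinity. Since the
  coefficients sum to zero, the error is also the series of \<open>c_k (M^k - 1)\<close>, whose
  terms do vanish at infinity, but only like 1/x: they are square-integrable without being
  integrable. This is the obstacle behind the principal value, behind the transform defined as a
  limit, and behind the detour by which the transform of the error is found: that of the derivative
  is an honest integral and is divided by i \<xi>.

  A second obstacle is that the powers of \<open>M\<close> are orthogonal for the weight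
  \<open>\<tau>'\<close> but not for Lebesgue measure. Derivatives carry a factor
  \<open>\<tau>'\<close>, so orthogonality controls them by a weighted l2 norm of the coefficients.
  The undifferentiated error lacks that factor: \<open>M^k - 1\<close> has squared L2 norm of order
  |k|, and a sum over frequencies up to K is bounded only by K times the l2 norm of its
  coefficients. Order 0 thus costs as much as order 1. The rate is \<open>n^(t-s)\<close> for t
  \<ge> 1 and stays at \<open>n^(1-s)\<close> below, which accounts for the two terms of the Sobolev
  estimate.\<close>

inductive_set trig_polys :: "(real \<Rightarrow> complex) set" where
  cis: "(\<lambda>\<theta>. cis (of_int k * \<theta>)) \<in> trig_polys"
| add: "f \<in> trig_polys \<Longrightarrow> g \<in> trig_polys \<Longrightarrow> (\<lambda>\<theta>. f \<theta> + g \<theta>) \<in> trig_polys"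
| scale: "f \<in> trig_polys \<Longrightarrow> (\<lambda>\<theta>. c * f \<theta>) \<in> trig_polys"

lemma trig_polys_const: "(\<lambda>\<theta>. c) \<in> trig_polys"
  using trig_polys.scale[OF trig_polys.cis[of 0], of c] by simp

lemma trig_polys_mult:
  assumes "f \<in> trig_polys" "g \<in> trig_polys" shows "(\<lambda>\<theta>. f \<theta> * g \<theta>) \<in> trig_polys"
  using assms(1)
proof induction
  case (cis k)
  show ?case using assms(2)
  proof induction
    case (cis l)
    show ?case using trig_polys.cis[of "k + l"] by (simp add: cis_mult algebra_simps)
  next
    case (add f g)
    then show ?case using trig_polys.add by (simp add: distrib_left)
  next
    case (scale f c)
    then show ?case using trig_polys.scale[OF scale.IH, of c] by (simp add: mult_ac)
  qed
next
  case (add f h)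
  then show ?case using trig_polys.add[OF add.IH] by (simp add: distrib_right)
next
  case (scale f c)
  then show ?case using trig_polys.scale[OF scale.IH, of c] by (simp add: mult_ac)
qed

lemma real_polynomial_cis_in_trig_polys:
  assumes "real_polynomial_function q" shows "(\<lambda>\<theta>. of_real (q (cis \<theta>))) \<in> trig_polys"
  using assms
proof induction
  case (linear f)
  interpret bounded_linear f by fact
  \<comment> \<open>A real-linear functional on the plane is cos \<theta> f(1) + sin \<theta> f(i)
    on the circle; Euler's formulas turn this into the frequencies 1 and -1.\<close>
  have e: "of_real (f (cis \<theta>)) = (of_real (f 1) / 2 - \<i> * of_real (f \<i>) / 2) * cis (of_int 1 * \<theta>)
     + (of_real (f 1) / 2 + \<i> * of_real (f \<i>) / 2) * cis (of_int (-1) * \<theta>)" for \<theta>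
  proof -
    have "cis \<theta> = cos \<theta> *\<^sub>R 1 + sin \<theta> *\<^sub>R \<i>" by (simp add: complex_eq_iff)
    then have "f (cis \<theta>) = cos \<theta> * f 1 + sin \<theta> * f \<i>" by (simp only: add scaleR) simp
    then show ?thesis by (simp add: complex_eq_iff field_simps)
  qed
  show ?case unfolding e by (intro trig_polys.add trig_polys.scale trig_polys.cis)
next
  case (const c)
  show ?case by (rule trig_polys_const)
next
  case (add f g)
  then show ?case using trig_polys.add by simp
next
  case (mult f g)
  then show ?case using trig_polys_mult by simp
qed

text \<open>Connects Stone-Weierstrass, which yields polynomials in the two real coordinates of the
  plane, with the exponentials against which Fourier coefficients are defined.\<close>

lemma polynomial_cis_in_trig_polys:
  fixes p :: "complex \<Rightarrow> complex"
  assumes "polynomial_function p" shows "(\<lambda>\<theta>. p (cis \<theta>)) \<in> trig_polys"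
proof -
  have "real_polynomial_function (Re \<circ> p)" "real_polynomial_function (Im \<circ> p)"
    using assms bounded_linear_Re bounded_linear_Im unfolding polynomial_function_def by blast+
  then have "(\<lambda>\<theta>. of_real ((Re \<circ> p) (cis \<theta>)) + \<i> * of_real ((Im \<circ> p) (cis \<theta>))) \<in> trig_polys"
    by (intro trig_polys.add trig_polys.scale real_polynomial_cis_in_trig_polys)
  then show ?thesis by (simp add: complex_eq[symmetric])
qed

lemma trig_polys_continuous: "f \<in> trig_polys \<Longrightarrow> continuous_on A f"
  by (induction rule: trig_polys.induct) (auto intro!: continuous_intros)

lemma trig_polys_orthogonal:
  assumes "continuous_on {0..2*pi} D" and z: "\<And>k. (LINT \<theta>:{0..2*pi}|lborel. cis (- (of_int k * \<theta>)) * D \<theta>) = 0"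
    and "f \<in> trig_polys"
  shows "(LINT \<theta>:{0..2*pi}|lborel. f \<theta> * D \<theta>) = 0"
  using assms(3)
proof induction
  case (cis k)
  show ?case using z[of "- k"] by simp
next
  case (add f g)
  have "set_integrable lborel {0..2*pi} (\<lambda>\<theta>. h \<theta> * D \<theta>)" if "h \<in> trig_polys" for h
    by (intro borel_integrable_atLeastAtMost' continuous_on_mult assms(1) trig_polys_continuous that)
  then show ?case using add by (simp add: distrib_right set_integral_add)
next
  case (scale f c)
  then show ?case by (simp add: mult.assoc)
qed

text \<open>\<open>D\<close> factors through the circle by \<open>Arg2pi\<close>, which jumps at 1;
  there the agreement \<open>D 0 = D (2*pi)\<close> enters. Continuity is that of a map on a
  quotient of a compact space: the preimage of a closed set under \<open>?H\<close> is the
  \<open>cis\<close>-image of a compact set.\<close>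

lemma continuous_periodic_on_circle:
  fixes D :: "real \<Rightarrow> complex"
  assumes D: "continuous_on {0..2*pi} D" "D 0 = D (2*pi)"
  obtains H where "continuous_on (sphere 0 1) H" "\<And>\<theta>. \<theta> \<in> {0..2*pi} \<Longrightarrow> H (cis \<theta>) = D \<theta>"
proof
  let ?H = "\<lambda>z. D (Arg2pi z)"
  show H: "?H (cis \<theta>) = D \<theta>" if "\<theta> \<in> {0..2*pi}" for \<theta>
  proof (cases "\<theta> = 2 * pi")
    case True
    moreover have "Arg2pi 1 = 0" by (intro Arg2pi_unique[of 1]) auto
    ultimately show ?thesis using D(2) by simp
  next
    case False
    then have "Arg2pi (cis \<theta>) = \<theta>" using that
      by (intro Arg2pi_unique[of 1]) (auto simp: cis_conv_exp)
    then show ?thesis by simp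
  qed
  have sph: "sphere 0 1 = cis ` {0..2*pi}"
  proof safe
    fix z :: complex assume "z \<in> sphere 0 1"
    then have "z = cis (Arg2pi z)" using Arg2pi_eq[of z] by (simp add: cis_conv_exp)
    then show "z \<in> cis ` {0..2*pi}" using Arg2pi_ge_0[of z] Arg2pi_lt_2pi[of z] by auto
  qed simp
  show "continuous_on (sphere 0 1) ?H"
    unfolding continuous_on_closed_vimage[OF closed_sphere]
  proof (intro allI impI)
    fix C :: "complex set" assume "closed C"
    have "?H -` C \<inter> sphere 0 1 = cis ` ({0..2*pi} \<inter> D -` C)"
    proof safe
      fix z assume z: "D (Arg2pi z) \<in> C" "z \<in> sphere 0 (1::real)"
      then have "z = cis (Arg2pi z)" using Arg2pi_eq[of z] by (simp add: cis_conv_exp)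
      then show "z \<in> cis ` ({0..2*pi} \<inter> D -` C)" using z Arg2pi_ge_0[of z] Arg2pi_lt_2pi[of z]
        by (intro image_eqI[of _ _ "Arg2pi z"]) auto
    qed (use H in auto)
    moreover have "compact (cis ` ({0..2*pi} \<inter> D -` C))"
    proof (intro compact_continuous_image continuous_intros)
      have "closed ({0..2*pi} \<inter> D -` C)"
        by (rule continuous_closed_preimage[OF D(1) closed_atLeastAtMost \<open>closed C\<close>])
      then have "compact ({0..2*pi} \<inter> ({0..2*pi} \<inter> D -` C))" by (intro compact_Int_closed) auto
      then show "compact ({0..2*pi} \<inter> D -` C)" by simp
    qed
    ultimately show "closed (?H -` C \<inter> sphere 0 1)" by (simp add: compact_imp_closed)
  qed
qed

text \<open>Vanishing coefficients make \<open>D\<close> orthogonal to every trigonometric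
  polynomial, in particular to one uniformly close to the conjugate of \<open>D\<close>. Hence the
  integral of |D|^2 is at most e times that of |D| for every e > 0, and a continuous function of
  zero L2 norm vanishes everywhere.\<close>

lemma fourier_coefficients_unique:
  fixes D :: "real \<Rightarrow> complex"
  assumes D: "continuous_on {0..2*pi} D" "D 0 = D (2*pi)"
    and z: "\<And>k. (LINT \<theta>:{0..2*pi}|lborel. cis (- (of_int k * \<theta>)) * D \<theta>) = 0"
    and \<theta>: "\<theta> \<in> {0..2*pi}"
  shows "D \<theta> = 0"
proof -
  obtain H where H: "continuous_on (sphere 0 1) H" "\<And>\<theta>. \<theta> \<in> {0..2*pi} \<Longrightarrow> H (cis \<theta>) = D \<theta>"
    using continuous_periodic_on_circle[OF D] by blast
  let ?I = "LINT \<theta>:{0..2*pi}|lborel. norm (D \<theta>)" and ?J = "LINT \<theta>:{0..2*pi}|lborel. (norm (D \<theta>))\<^sup>2"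
  have c2: "continuous_on {0..2*pi} (\<lambda>\<theta>. (norm (D \<theta>))\<^sup>2)" by (intro continuous_intros D)
  have le: "?J \<le> e * ?I" if "e > 0" for e
  proof -
    have "continuous_on (sphere 0 1) (\<lambda>z. cnj (H z))" by (intro continuous_intros H)
    from Stone_Weierstrass_polynomial_function[OF _ this that]
    obtain p :: "complex \<Rightarrow> complex" where p: "polynomial_function p" "\<And>z. z \<in> sphere 0 1 \<Longrightarrow> norm (cnj (H z) - p z) < e"
      by (metis compact_sphere)
    let ?g = "\<lambda>\<theta>. p (cis \<theta>)"
    have g: "?g \<in> trig_polys" by (rule polynomial_cis_in_trig_polys[OF p(1)])
    have gc: "continuous_on {0..2*pi} ?g" by (rule trig_polys_continuous[OF g])
    have i: "set_integrable lborel {0..2*pi} (\<lambda>\<theta>. (cnj (D \<theta>) - ?g \<theta>) * D \<theta>)" "set_integrable lborel {0..2*pi} (\<lambda>\<theta>. ?g \<theta> * D \<theta>)"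
      by (intro borel_integrable_atLeastAtMost' continuous_intros D gc)+
    have "of_real ((norm (D \<theta>))\<^sup>2) = (cnj (D \<theta>) - ?g \<theta>) * D \<theta> + ?g \<theta> * D \<theta>" for \<theta>
      unfolding complex_norm_square by (simp add: algebra_simps)
    then have "of_real ?J = (LINT \<theta>:{0..2*pi}|lborel. (cnj (D \<theta>) - ?g \<theta>) * D \<theta> + ?g \<theta> * D \<theta>)"
      unfolding set_integral_complex_of_real[symmetric] by simp
    also have "\<dots> = (LINT \<theta>:{0..2*pi}|lborel. (cnj (D \<theta>) - ?g \<theta>) * D \<theta>)"
      using trig_polys_orthogonal[OF D(1) z g] by (simp add: set_integral_add(2)[OF i])
    finally have "norm (complex_of_real ?J) = norm (LINT \<theta>:{0..2*pi}|lborel. (cnj (D \<theta>) - ?g \<theta>) * D \<theta>)" by simp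
    also have "\<dots> \<le> (LINT \<theta>:{0..2*pi}|lborel. norm ((cnj (D \<theta>) - ?g \<theta>) * D \<theta>))"
      by (rule set_integral_norm_bound[OF i(1)])
    also have "\<dots> \<le> (LINT \<theta>:{0..2*pi}|lborel. e * norm (D \<theta>))"
    proof (rule set_integral_mono)
      show "set_integrable lborel {0..2*pi} (\<lambda>\<theta>. norm ((cnj (D \<theta>) - ?g \<theta>) * D \<theta>))"
        "set_integrable lborel {0..2*pi} (\<lambda>\<theta>. e * norm (D \<theta>))"
        by (intro borel_integrable_atLeastAtMost' continuous_intros D gc)+
      fix \<theta> :: real assume "\<theta> \<in> {0..2*pi}"
      then show "norm ((cnj (D \<theta>) - ?g \<theta>) * D \<theta>) \<le> e * norm (D \<theta>)"
        using p(2)[of "cis \<theta>"] H(2)[of \<theta>] by (simp add: norm_mult mult_right_mono less_imp_le)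
    qed
    also have "\<dots> = e * ?I" by simp
    finally show ?thesis by simp
  qed
  have "?J \<le> 0"
  proof (rule field_le_epsilon)
    fix e :: real assume e: "e > 0"
    have I: "?I \<ge> 0" unfolding set_lebesgue_integral_def by (intro Bochner_Integration.integral_nonneg) simp
    \<comment> \<open>The \<open>+ 1\<close> keeps the denominator positive when \<open>?I\<close>
      is zero.\<close>
    have "?J \<le> e / (?I + 1) * ?I" using I e by (intro le) simp
    also have "\<dots> \<le> 0 + e" using I e by (simp add: field_simps)
    finally show "?J \<le> 0 + e" .
  qed
  moreover have "?J \<ge> 0" unfolding set_lebesgue_integral_def by (intro Bochner_Integration.integral_nonneg) simp
  ultimately have "?J = 0" by simp
  then have "integral {0..2*pi} (\<lambda>\<theta>. (norm (D \<theta>))\<^sup>2) = 0"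
    using set_borel_integral_eq_integral(2)[OF borel_integrable_atLeastAtMost'[OF c2]] by simp
  then have "(norm (D \<theta>))\<^sup>2 = 0" using \<theta> integral_eq_0_iff[OF c2] by simp
  then show ?thesis by simp
qed

section \<open>Sums over the integers and Fourier inversion\<close>

text \<open>Enumerating the integers by \<open>int_decode\<close> turns unordered sums into ordinary
  series, so that the Weierstrass test, Tannery's theorem and termwise integration apply.\<close>

lemma summable_on_int_imp_summable:
  fixes f :: "int \<Rightarrow> 'a :: banach"
  assumes "f summable_on UNIV" shows "summable (\<lambda>i. f (int_decode i))"
  using assms summable_on_reindex_bij_betw[OF bij_int_decode, of f] summable_on_imp_summable by blast

lemma infsum_int_eq_suminf:
  fixes f :: "int \<Rightarrow> 'a :: banach"
  assumes "f summable_on UNIV" shows "(\<lambda>i. f (int_decode i)) sums (\<Sum>\<^sub>\<infinity>k. f k)"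
  using has_sum_infsum[OF assms] has_sum_reindex_bij_betw[OF bij_int_decode, of f] has_sum_imp_sums by blast

lemma circle_cis_integral:
  "(LINT \<theta>:{0..2*pi}|lborel. cis (- (of_int m * \<theta>)) * cis (of_int k * \<theta>)) = (if k = m then 2 * pi else 0)"
proof -
  have e: "cis (- (of_int m * \<theta>)) * cis (of_int k * \<theta>) = cis (of_int (k - m) * \<theta>)" for \<theta>
    by (simp add: cis_mult algebra_simps)
  show ?thesis
  proof (cases "k = m")
    case True
    then show ?thesis unfolding e set_lebesgue_integral_def by (simp add: scaleR_conv_of_real)
  next
    case False
    let ?a = "of_int (k - m) :: real"
    have a: "?a \<noteq> 0" using False by simp
    have "(LINT \<theta>|lborel. indicator {0..2*pi} \<theta> *\<^sub>R cis (?a * \<theta>)) = cis (?a * (2 * pi)) / (\<i> * of_real ?a) - cis (?a * 0) / (\<i> * of_real ?a)"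
    proof (rule integral_FTC_atLeastAtMost)
      fix x :: real
      have "((\<lambda>x. exp (\<i> * of_real ?a * complex_of_real x) / (\<i> * of_real ?a)) has_vector_derivative exp (\<i> * of_real ?a * complex_of_real x)) (at x within {0..2*pi})"
        by (rule has_vector_derivative_real_field) (use a in \<open>auto intro!: derivative_eq_intros\<close>)
      then show "((\<lambda>x. cis (?a * x) / (\<i> * of_real ?a)) has_vector_derivative cis (?a * x)) (at x within {0..2*pi})"
        by (simp add: cis_conv_exp mult_ac)
    qed (auto intro!: continuous_intros)
    also have "cis (?a * (2 * pi)) = 1"
      using cis_multiple_2pi[of ?a] by (simp add: mult.commute mult.assoc)
    finally show ?thesis unfolding e set_lebesgue_integral_def using False by simp
  qed
qed

text \<open>The absolutely convergent series defines a continuous periodic \<open>G\<close> with the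
  same coefficients as \<open>F\<close>, and uniqueness identifies the two. The summable norms of
  the coefficients justify integrating \<open>G\<close> term by term.\<close>

lemma fourier_inversion:
  fixes F :: "real \<Rightarrow> complex"
  assumes F: "continuous_on {0..2*pi} F" "F 0 = F (2*pi)"
    and s: "(\<lambda>k. norm (circle_fourier F k)) summable_on UNIV"
    and \<theta>: "\<theta> \<in> {0..2*pi}"
  shows "((\<lambda>k. circle_fourier F k * cis (of_int k * \<theta>)) has_sum F \<theta>) UNIV"
proof -
  let ?a = "circle_fourier F"
  define t where "t i \<theta> = ?a (int_decode i) * cis (of_int (int_decode i) * \<theta>)" for i \<theta>
  define G where "G \<theta> = (\<Sum>i. t i \<theta>)" for \<theta>
  have ns: "summable (\<lambda>i. norm (?a (int_decode i)))"
    by (rule summable_on_int_imp_summable[OF s])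
  have nt: "norm (t i \<theta>) = norm (?a (int_decode i))" for i \<theta> by (simp add: t_def norm_mult)
  have "uniform_limit UNIV (\<lambda>n \<theta>. \<Sum>i<n. t i \<theta>) G sequentially"
    unfolding G_def by (rule Weierstrass_m_test[OF _ ns]) (simp add: nt)
  then have Gc: "continuous_on UNIV G"
    by (rule uniform_limit_theorem[rotated]) (auto simp: t_def intro!: always_eventually continuous_intros)
  have Gp: "G 0 = G (2 * pi)"
  proof -
    have "t i 0 = t i (2 * pi)" for i
      using cis_multiple_2pi[of "of_int (int_decode i)"] by (simp add: t_def mult.commute mult.assoc)
    then show ?thesis unfolding G_def by simp
  qed
  have Gm: "(LINT \<theta>:{0..2*pi}|lborel. cis (- (of_int m * \<theta>)) * G \<theta>) = 2 * pi * ?a m" for m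
  proof -
    let ?f = "\<lambda>i \<theta>. indicator {0..2*pi} \<theta> *\<^sub>R (cis (- (of_int m * \<theta>)) * t i \<theta>)"
    have fi: "integrable lborel (?f i)" for i
      using borel_integrable_atLeastAtMost'[of 0 "2*pi" "\<lambda>\<theta>. cis (- (of_int m * \<theta>)) * t i \<theta>"]
      unfolding set_integrable_def by (simp add: t_def continuous_intros)
    have nf: "norm (?f i \<theta>) = norm (?a (int_decode i)) * indicator {0..2*pi} \<theta>" for i \<theta>
      by (simp add: norm_mult nt)
    have sm: "summable (\<lambda>i. norm (?f i \<theta>))" for \<theta>
      unfolding nf by (intro summable_mult2 ns)
    have "(\<lambda>i. integral\<^sup>L lborel (?f i)) sums (LINT \<theta>|lborel. (\<Sum>i. ?f i \<theta>))"
    proof (rule sums_integral[OF fi])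
      have "(LINT \<theta>|lborel. norm (?f i \<theta>)) = norm (?a (int_decode i)) * (2 * pi)" for i
        unfolding nf by simp
      then show "summable (\<lambda>i. LINT \<theta>|lborel. norm (?f i \<theta>))"
        using summable_mult2[OF ns] by simp
    qed (use sm in simp)
    moreover have "(\<Sum>i. ?f i \<theta>) = indicator {0..2*pi} \<theta> *\<^sub>R (cis (- (of_int m * \<theta>)) * G \<theta>)" for \<theta>
    proof -
      have "summable (\<lambda>i. t i \<theta>)" by (rule summable_norm_cancel) (simp add: nt ns)
      then show ?thesis unfolding G_def
        by (simp add: suminf_mult suminf_scaleR_right[symmetric] summable_mult)
    qed
    moreover have "integral\<^sup>L lborel (?f i) = (if i = int_encode m then 2 * pi * ?a m else 0)" for i
    proof -
      have "integral\<^sup>L lborel (?f i) = (LINT \<theta>:{0..2*pi}|lborel. ?a (int_decode i) * (cis (- (of_int m * \<theta>)) * cis (of_int (int_decode i) * \<theta>)))"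
        unfolding set_lebesgue_integral_def t_def by (simp add: mult_ac)
      also have "\<dots> = ?a (int_decode i) * (if int_decode i = m then 2 * pi else 0)"
        unfolding set_integral_mult_right circle_cis_integral ..
      finally show ?thesis by (auto simp: int_encode_inverse)
    qed
    ultimately have "(\<lambda>i. if i = int_encode m then 2 * pi * ?a m else 0) sums (LINT \<theta>:{0..2*pi}|lborel. cis (- (of_int m * \<theta>)) * G \<theta>)"
      unfolding set_lebesgue_integral_def by simp
    moreover have "(\<lambda>i. if i = int_encode m then 2 * pi * ?a m else 0) sums (2 * pi * ?a m)"
      by (rule sums_single)
    ultimately show ?thesis by (rule sums_unique2)
  qed
  have "F \<theta> - G \<theta> = 0"
  proof (rule fourier_coefficients_unique[of "\<lambda>\<theta>. F \<theta> - G \<theta>"])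
    show "continuous_on {0..2*pi} (\<lambda>\<theta>. F \<theta> - G \<theta>)"
      by (intro continuous_intros F continuous_on_subset[OF Gc]) simp
    fix k :: int
    have i: "set_integrable lborel {0..2*pi} (\<lambda>\<theta>. cis (- (of_int k * \<theta>)) * F \<theta>)" "set_integrable lborel {0..2*pi} (\<lambda>\<theta>. cis (- (of_int k * \<theta>)) * G \<theta>)"
      by (intro borel_integrable_atLeastAtMost' continuous_intros F continuous_on_subset[OF Gc]; simp)+
    have "(LINT \<theta>:{0..2*pi}|lborel. cis (- (of_int k * \<theta>)) * F \<theta>) = 2 * pi * ?a k"
      unfolding circle_fourier_def by simp
    then show "(LINT \<theta>:{0..2*pi}|lborel. cis (- (of_int k * \<theta>)) * (F \<theta> - G \<theta>)) = 0"
      unfolding right_diff_distrib set_integral_diff(2)[OF i] Gm by simp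
  qed (use F Gp \<theta> in auto)
  then have "(\<lambda>i. t i \<theta>) sums F \<theta>"
    using summable_sums[OF summable_norm_cancel[of "\<lambda>i. t i \<theta>"]] ns by (simp add: nt G_def)
  then have "((\<lambda>i. t i \<theta>) has_sum F \<theta>) UNIV"
    by (intro norm_summable_imp_has_sum) (simp add: nt ns)
  then show ?thesis
    unfolding t_def using has_sum_reindex_bij_betw[OF bij_int_decode, of "\<lambda>k. ?a k * cis (of_int k * \<theta>)"] by simp
qed

section \<open>Discrete orthogonality and aliasing\<close>

text \<open>A geometric sum in the n-th root of unity \<open>z\<close>, which equals 1 exactly when
  n divides m - k.\<close>

lemma sum_cis_nodes:
  assumes n: "n > 0"
  shows "(\<Sum>l<n. cis (- (of_int k * node n l)) * cis (of_int m * node n l)) = (if int n dvd m - k then of_nat n else 0)"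
proof -
  define z where "z = cis (2 * pi * (of_int (m - k) / real n))"
  have e: "cis (- (of_int k * node n l)) * cis (of_int m * node n l) = z ^ l" for l
  proof -
    have "real l * (2 * pi * (of_int (m - k) / real n)) = - (of_int k * node n l) + of_int m * node n l"
      using n by (simp add: node_def field_simps)
    then show ?thesis unfolding z_def Complex.DeMoivre cis_mult by simp
  qed
  show ?thesis
  proof (cases "int n dvd m - k")
    case True
    then obtain q where q: "m - k = int n * q" by blast
    have "of_int (m - k) / real n = of_int q" using n unfolding q by simp
    then have "z = 1" unfolding z_def by (simp add: cis_multiple_2pi)
    then show ?thesis unfolding e using True by simp
  next
    case False
    have "z \<noteq> 1"
    proof
      assume "z = 1"
      then have "cos (2 * pi * (of_int (m - k) / real n)) = 1" unfolding z_def by (simp add: complex_eq_iff)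
      then obtain q :: int where "2 * pi * (of_int (m - k) / real n) = of_int q * 2 * pi"
        using cos_one_2pi_int by blast
      then have "2 * pi * (of_int (m - k) / real n) = 2 * pi * of_int q" by (simp only: mult_ac)
      then have "of_int (m - k) / real n = of_int q" using pi_gt_zero by (simp only: mult_cancel_left) simp
      then have "of_int (m - k) = real n * of_int q" using n by (simp add: divide_eq_eq mult.commute)
      then have "m - k = int n * q" by (metis of_int_eq_iff of_int_mult of_int_of_nat_eq)
      then show False using False by simp
    qed
    moreover have "z ^ n = 1"
    proof -
      have "real n * (2 * pi * (of_int (m - k) / real n)) = 2 * pi * of_int (m - k)" using n by simp
      then show ?thesis unfolding z_def Complex.DeMoivre by (simp only: cis_multiple_2pi Ints_of_int)
    qed
    ultimately show ?thesis unfolding e using False by (simp add: sum_gp_strict)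
  qed
qed

lemma has_sum_finite_sum:
  fixes f :: "'a \<Rightarrow> 'b \<Rightarrow> 'c :: topological_comm_monoid_add"
  assumes "finite I" "\<And>i. i \<in> I \<Longrightarrow> (f i has_sum s i) A"
  shows "((\<lambda>x. \<Sum>i\<in>I. f i x) has_sum (\<Sum>i\<in>I. s i)) A"
  using assms by (induction I rule: finite_induct) (auto intro!: has_sum_add)

text \<open>Sampling at the nodes cannot distinguish frequencies that agree modulo n. The finite sum
  over the nodes is exchanged with the Fourier series, and discrete orthogonality keeps only the
  residue class of k.\<close>

lemma discrete_fourier_aliasing:
  assumes n: "n > 0"
    and inv: "\<And>\<theta>. \<theta> \<in> {0..2*pi} \<Longrightarrow> ((\<lambda>k. a k * cis (of_int k * \<theta>)) has_sum F \<theta>) UNIV"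
  shows "(a has_sum discrete_fourier n F k) {m. int n dvd m - k}"
proof -
  have node: "node n l \<in> {0..2*pi}" if "l < n" for l
    using that n by (auto simp: node_def field_simps)
  have "((\<lambda>m. \<Sum>l<n. cis (- (of_int k * node n l)) * (a m * cis (of_int m * node n l))) has_sum
     (\<Sum>l<n. cis (- (of_int k * node n l)) * F (node n l))) UNIV"
    by (intro has_sum_finite_sum has_sum_cmult_right inv node) auto
  then have "((\<lambda>m. 1 / of_nat n * (\<Sum>l<n. cis (- (of_int k * node n l)) * (a m * cis (of_int m * node n l)))) has_sum discrete_fourier n F k) UNIV"
    unfolding discrete_fourier_def by (rule has_sum_cmult_right)
  moreover have "1 / of_nat n * (\<Sum>l<n. cis (- (of_int k * node n l)) * (a m * cis (of_int m * node n l))) = (if int n dvd m - k then a m else 0)" for m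
  proof -
    have "(\<Sum>l<n. cis (- (of_int k * node n l)) * (a m * cis (of_int m * node n l))) = a m * (\<Sum>l<n. cis (- (of_int k * node n l)) * cis (of_int m * node n l))"
      unfolding sum_distrib_left by (intro sum.cong refl) (simp add: mult_ac)
    then show ?thesis unfolding sum_cis_nodes[OF n] using n by simp
  qed
  ultimately have "((\<lambda>m. if int n dvd m - k then a m else 0) has_sum discrete_fourier n F k) UNIV" by simp
  then show ?thesis
    by (subst has_sum_cong_neutral[of UNIV _ "\<lambda>m. if int n dvd m - k then a m else 0" a]) auto
qed

section \<open>The coefficients of the interpolation error\<close>

definition wt :: "int \<Rightarrow> real" where "wt k = 1 + real_of_int \<bar>k\<bar>"

lemma wt_ge_1: "1 \<le> wt k" and wt_pos: "0 < wt k" and wt_nonneg: "0 \<le> wt k"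
  by (simp_all add: wt_def)

text \<open>The finite inequality bounds every partial sum by one constant, which gives summability
  and the estimate together.\<close>

lemma infsum_Cauchy_Schwarz:
  fixes f g :: "'a \<Rightarrow> real"
  assumes f: "(\<lambda>x. (f x)\<^sup>2) summable_on A" and g: "(\<lambda>x. (g x)\<^sup>2) summable_on A"
  shows "(\<lambda>x. \<bar>f x\<bar> * \<bar>g x\<bar>) summable_on A"
    "(\<Sum>\<^sub>\<infinity>x\<in>A. \<bar>f x\<bar> * \<bar>g x\<bar>) \<le> sqrt (\<Sum>\<^sub>\<infinity>x\<in>A. (f x)\<^sup>2) * sqrt (\<Sum>\<^sub>\<infinity>x\<in>A. (g x)\<^sup>2)"
proof -
  let ?B = "sqrt (\<Sum>\<^sub>\<infinity>x\<in>A. (f x)\<^sup>2) * sqrt (\<Sum>\<^sub>\<infinity>x\<in>A. (g x)\<^sup>2)"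
  have b: "(\<Sum>x\<in>X. \<bar>f x\<bar> * \<bar>g x\<bar>) \<le> ?B" if "finite X" "X \<subseteq> A" for X
  proof -
    have "(\<Sum>x\<in>X. \<bar>f x\<bar> * \<bar>g x\<bar>) \<le> L2_set f X * L2_set g X" by (rule L2_set_mult_ineq)
    also have "\<dots> \<le> ?B"
      unfolding L2_set_def using that f g
      by (intro mult_mono real_sqrt_le_mono finite_sum_le_infsum) (auto intro: sum_nonneg infsum_nonneg)
    finally show ?thesis .
  qed
  show "(\<lambda>x. \<bar>f x\<bar> * \<bar>g x\<bar>) summable_on A"
    by (rule nonneg_bdd_above_summable_on) (auto intro!: bdd_aboveI2[where M = ?B] b)
  then show "(\<Sum>\<^sub>\<infinity>x\<in>A. \<bar>f x\<bar> * \<bar>g x\<bar>) \<le> ?B"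
    by (rule infsum_le_finite_sums) (rule b)
qed

lemma summable_on_int_powr:
  assumes "p > 1" shows "(\<lambda>l::int. real_of_int \<bar>l\<bar> powr - p) summable_on - {0}"
proof -
  have "summable (\<lambda>n. real n powr - p)" using assms by (subst summable_real_powr_iff) simp
  then have s: "(\<lambda>n. real n powr - p) summable_on UNIV"
    by (subst summable_on_UNIV_nonneg_real_iff) auto
  have "(\<lambda>l::int. real_of_int \<bar>l\<bar> powr - p) summable_on range int"
    by (subst summable_on_reindex) (auto simp: o_def s)
  moreover have "(\<lambda>l::int. real_of_int \<bar>l\<bar> powr - p) summable_on range (\<lambda>n. - int n)"
    by (subst summable_on_reindex) (auto simp: o_def s inj_on_def)
  then have "(\<lambda>l::int. real_of_int \<bar>l\<bar> powr - p) summable_on {..<0}"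
    by (rule summable_on_subset_banach) (auto intro!: rangeI[of "\<lambda>n. - int n" "nat (- k)" for k, simplified] simp: image_iff, metis add.inverse_inverse less_imp_le neg_0_less_iff_less int_nat_eq)
  ultimately have "(\<lambda>l::int. real_of_int \<bar>l\<bar> powr - p) summable_on (range int \<union> {..<0})"
    by (rule summable_on_Un_disjoint) auto
  then show ?thesis by (rule summable_on_subset_banach) (metis Un_iff UNIV_I image_eqI int_nat_eq lessThan_iff linorder_not_less subsetI)
qed

section \<open>Frequencies modulo n\<close>

text \<open>One representative of every residue class modulo n: exactly the frequencies of the
  interpolant.\<close>

definition freqs :: "nat \<Rightarrow> int set" where
  "freqs n = {- int ((n - 1) div 2)..int (n div 2)}"

text \<open>The frequencies that the nodes confuse with m, without m itself.\<close>

definition aliases :: "nat \<Rightarrow> int \<Rightarrow> int set" where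
  "aliases n m = {k. int n dvd k - m} - {m}"

lemma finite_freqs [simp]: "finite (freqs n)" by (simp add: freqs_def)

lemma freqs_bound: "k \<in> freqs n \<Longrightarrow> 2 * \<bar>k\<bar> \<le> int n"
  unfolding freqs_def by auto

lemma freqs_width: "k \<in> freqs n \<Longrightarrow> m \<in> freqs n \<Longrightarrow> n > 0 \<Longrightarrow> \<bar>k - m\<bar> < int n"
  unfolding freqs_def by auto

lemma freqs_unique: "k \<in> freqs n \<Longrightarrow> m \<in> freqs n \<Longrightarrow> n > 0 \<Longrightarrow> int n dvd k - m \<Longrightarrow> k = m"
  using freqs_width[of k n m] zdvd_imp_le[of "int n" "\<bar>k - m\<bar>"] by fastforce

lemma card_freqs: "n > 0 \<Longrightarrow> card (freqs n) = n"
  unfolding freqs_def by simp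

lemma freqs_exists:
  assumes "n > 0" obtains m where "m \<in> freqs n" "int n dvd k - m"
proof
  let ?q = "int ((n - 1) div 2)"
  \<comment> \<open>Shifting by the lower end of the window before reducing modulo n places the
    remainder in \<open>freqs n\<close>, because n - 1 - \<open>?q\<close> equals n div 2.\<close>
  let ?m = "(k + ?q) mod int n - ?q"
  have "k - ?m = int n * ((k + ?q) div int n)"
    by (simp add: minus_mod_eq_mult_div[symmetric] algebra_simps)
  then show "int n dvd k - ?m" by simp
  have "0 \<le> (k + ?q) mod int n" "(k + ?q) mod int n < int n" using assms by simp_all
  then show "?m \<in> freqs n" unfolding freqs_def by simp
qed

lemma not_freqs_wt: "k \<notin> freqs n \<Longrightarrow> real n / 2 \<le> wt k"
proof -
  assume "k \<notin> freqs n"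
  then have "int n \<le> 2 * (1 + \<bar>k\<bar>)" unfolding freqs_def by simp linarith
  then have "real_of_int (int n) \<le> real_of_int (2 * (1 + \<bar>k\<bar>))" by (rule of_int_le_iff[THEN iffD2])
  then show ?thesis by (simp add: wt_def)
qed

lemma freqs_wt: assumes "k \<in> freqs n" "n > 1" shows "wt k \<le> real n"
proof -
  have "2 * (1 + \<bar>k\<bar>) \<le> 2 * int n" using freqs_bound[OF assms(1)] assms(2) by presburger
  then have "real_of_int (2 * (1 + \<bar>k\<bar>)) \<le> real_of_int (2 * int n)" by (rule of_int_le_iff[THEN iffD2])
  then show ?thesis by (simp add: wt_def)
qed

lemma aliases_eq: assumes "n > 0" shows "aliases n m = (\<lambda>l. m + l * int n) ` (- {0})"
proof safe
  fix k assume "k \<in> aliases n m"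
  then have "int n dvd k - m" "k \<noteq> m" unfolding aliases_def by auto
  then obtain l where "k - m = int n * l" by blast
  then have "k = m + l * int n" "l \<noteq> 0" using \<open>k \<noteq> m\<close> by (auto simp: algebra_simps)
  then show "k \<in> (\<lambda>l. m + l * int n) ` (- {0})" by blast
qed (use assms in \<open>auto simp: aliases_def\<close>)

text \<open>With \<open>aliases_disjoint\<close> this partitions the high frequencies into alias
  classes, so that a tail sum can be computed class by class.\<close>

lemma Un_aliases: assumes "n > 0" shows "(\<Union>m\<in>freqs n. aliases n m) = - freqs n"
proof safe
  fix k m assume "k \<in> aliases n m" "m \<in> freqs n" "k \<in> freqs n"
  then show False using freqs_unique[of k n m] assms unfolding aliases_def by auto
next
  fix k assume "k \<notin> freqs n"
  moreover obtain m where "m \<in> freqs n" "int n dvd k - m" using freqs_exists[OF assms] by blast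
  ultimately show "k \<in> (\<Union>m\<in>freqs n. aliases n m)" unfolding aliases_def by auto
qed

lemma aliases_disjoint:
  assumes "n > 0" "m \<in> freqs n" "m' \<in> freqs n" "m \<noteq> m'" shows "aliases n m \<inter> aliases n m' = {}"
proof (rule ccontr)
  assume "aliases n m \<inter> aliases n m' \<noteq> {}"
  then obtain k where "int n dvd k - m" "int n dvd k - m'" unfolding aliases_def by auto
  then have "int n dvd (k - m') - (k - m)" by (rule dvd_diff[rotated])
  then show False using freqs_unique[of m n m'] assms by (simp add: algebra_simps)
qed

text \<open>Because |m| \<le> n/2, the alias m + l n has size at least |l| n/2. The tail is thus
  dominated by a zeta sum scaled by \<open>n powr - p\<close>, and the constant is independent of n
  and m.\<close>

lemma aliases_tail:
  assumes p: "p > 1"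
  obtains C where "C \<ge> 0" "\<And>n m. n > 0 \<Longrightarrow> m \<in> freqs n \<Longrightarrow> (\<lambda>k. wt k powr - p) summable_on aliases n m"
    "\<And>n m. n > 0 \<Longrightarrow> m \<in> freqs n \<Longrightarrow> (\<Sum>\<^sub>\<infinity>k\<in>aliases n m. wt k powr - p) \<le> C * real n powr - p"
proof -
  let ?Z = "\<Sum>\<^sub>\<infinity>l\<in>-{0}. real_of_int \<bar>l\<bar> powr - p"
  have *: "(\<lambda>k. wt k powr - p) summable_on aliases n m \<and> (\<Sum>\<^sub>\<infinity>k\<in>aliases n m. wt k powr - p) \<le> (2 powr p * ?Z) * real n powr - p"
    if n: "n > 0" and m: "m \<in> freqs n" for n m
  proof -
    have le: "wt (m + l * int n) powr - p \<le> (2 powr p * real n powr - p) * real_of_int \<bar>l\<bar> powr - p" if "l \<noteq> 0" for l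
    proof -
      have "\<bar>l\<bar> * int n \<le> \<bar>m + l * int n\<bar> + \<bar>m\<bar>"
        using abs_triangle_ineq4[of "m + l * int n" m] by (simp add: abs_mult)
      moreover have "int n \<le> \<bar>l\<bar> * int n" using that by (simp add: mult_le_cancel_right1) linarith
      moreover have "Y \<le> 2 * (1 + X)" if "Y \<le> X + M" "N \<le> Y" "2 * M \<le> N" for X Y M N :: int
        using that by presburger
      ultimately have "\<bar>l\<bar> * int n \<le> 2 * (1 + \<bar>m + l * int n\<bar>)" using freqs_bound[OF m] by blast
      then have "real_of_int (\<bar>l\<bar> * int n) \<le> real_of_int (2 * (1 + \<bar>m + l * int n\<bar>))" by (rule of_int_le_iff[THEN iffD2])
      then have "real_of_int \<bar>l\<bar> * (real n / 2) \<le> wt (m + l * int n)" by (simp add: wt_def)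
      moreover have "0 < real_of_int \<bar>l\<bar> * (real n / 2)" using that n by simp
      ultimately have "wt (m + l * int n) powr - p \<le> (real_of_int \<bar>l\<bar> * (real n / 2)) powr - p"
        using p by (intro powr_mono2') auto
      also have "\<dots> = (2 powr p * real n powr - p) * real_of_int \<bar>l\<bar> powr - p"
        using n by (simp add: powr_mult powr_divide powr_minus field_simps)
      finally show ?thesis .
    qed
    have inj: "inj_on (\<lambda>l. m + l * int n) (- {0})" using n by (auto simp: inj_on_def)
    have s0: "(\<lambda>l. (2 powr p * real n powr - p) * real_of_int \<bar>l\<bar> powr - p) summable_on - {0}"
      by (intro summable_on_cmult_right summable_on_int_powr p)
    then have s: "(\<lambda>l. wt (m + l * int n) powr - p) summable_on - {0}"
      by (rule summable_on_comparison_test) (use le in auto)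
    have "(\<Sum>\<^sub>\<infinity>k\<in>aliases n m. wt k powr - p) = (\<Sum>\<^sub>\<infinity>l\<in>-{0}. wt (m + l * int n) powr - p)"
      unfolding aliases_eq[OF n] infsum_reindex[OF inj] by (simp add: o_def)
    also have "\<dots> \<le> (\<Sum>\<^sub>\<infinity>l\<in>-{0}. (2 powr p * real n powr - p) * real_of_int \<bar>l\<bar> powr - p)"
      by (rule infsum_mono[OF s s0]) (use le in auto)
    also have "\<dots> = (2 powr p * ?Z) * real n powr - p"
      by (simp add: infsum_cmult_right' mult_ac)
    finally show ?thesis using s unfolding aliases_eq[OF n] summable_on_reindex[OF inj] by (simp add: o_def)
  qed
  show ?thesis
    by (rule that[of "2 powr p * ?Z"]) (use * in \<open>auto intro!: mult_nonneg_nonneg infsum_nonneg\<close>)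
qed

section \<open>Weighted norms of the error coefficients\<close>

definition err_coeff :: "nat \<Rightarrow> (int \<Rightarrow> complex) \<Rightarrow> (int \<Rightarrow> complex) \<Rightarrow> int \<Rightarrow> complex" where
  "err_coeff n d a k = (if k \<in> freqs n then d k else 0) - a k"

text \<open>On the window the error is the sum of the folded coefficients. Cauchy-Schwarz against
  \<open>wt m powr - s\<close>, square-summable because s > 1/2, gains
  \<open>n powr (- 2 * s)\<close> in each class; as the classes are disjoint, the norm of
  \<open>a\<close> is counted only once.\<close>

lemma aliasing_error_L2:
  assumes s: "s > 1/2"
  obtains C where "C \<ge> 0" "\<And>n a d. n > 0 \<Longrightarrow> (\<lambda>k. wt k powr (2 * s) * (norm (a k))\<^sup>2) summable_on UNIV \<Longrightarrow>
     (\<And>k. (a has_sum d k) {m. int n dvd m - k}) \<Longrightarrow>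
     (\<Sum>k\<in>freqs n. (norm (err_coeff n d a k))\<^sup>2) \<le> C * real n powr (- 2 * s) * (\<Sum>\<^sub>\<infinity>k. wt k powr (2 * s) * (norm (a k))\<^sup>2)"
proof -
  obtain C where C: "C \<ge> 0" "\<And>n m. n > 0 \<Longrightarrow> m \<in> freqs n \<Longrightarrow> (\<lambda>k. wt k powr - (2 * s)) summable_on aliases n m"
    "\<And>n m. n > 0 \<Longrightarrow> m \<in> freqs n \<Longrightarrow> (\<Sum>\<^sub>\<infinity>k\<in>aliases n m. wt k powr - (2 * s)) \<le> C * real n powr - (2 * s)"
    using aliases_tail[of "2 * s"] s by auto
  show ?thesis
  proof (rule that[OF C(1)])
    fix n :: nat and a d :: "int \<Rightarrow> complex"
    assume n: "n > 0" and g: "(\<lambda>k. wt k powr (2 * s) * (norm (a k))\<^sup>2) summable_on UNIV"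
      and d: "\<And>k. (a has_sum d k) {m. int n dvd m - k}"
    let ?g = "\<lambda>k. wt k powr (2 * s) * (norm (a k))\<^sup>2"
    have gs: "?g summable_on A" for A by (rule summable_on_subset_banach[OF g]) simp
    have one: "(norm (err_coeff n d a k))\<^sup>2 \<le> C * real n powr - (2 * s) * (\<Sum>\<^sub>\<infinity>m\<in>aliases n k. ?g m)" if k: "k \<in> freqs n" for k
    proof -
      have hs: "(a has_sum err_coeff n d a k) (aliases n k)"
        unfolding aliases_def err_coeff_def using k has_sum_Diff[OF d[of k] has_sum_finite[of "{k}" a]] by simp
      let ?f = "\<lambda>m. wt m powr - s" and ?h = "\<lambda>m. wt m powr s * norm (a m)"
      have f2: "(?f m)\<^sup>2 = wt m powr - (2 * s)" for m
        by (simp add: power2_eq_square powr_add[symmetric])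
      have "(wt m powr s)\<^sup>2 = wt m powr (2 * s)" for m
        by (simp add: power2_eq_square powr_add[symmetric])
      then have h2: "(?h m)\<^sup>2 = ?g m" for m
        by (simp add: power_mult_distrib)
      have fh: "\<bar>?f m\<bar> * \<bar>?h m\<bar> = norm (a m)" for m
        using wt_pos[of m] by (simp add: abs_mult powr_minus field_simps)
      have cs: "(\<lambda>m. norm (a m)) summable_on aliases n k"
        "(\<Sum>\<^sub>\<infinity>m\<in>aliases n k. norm (a m)) \<le> sqrt (\<Sum>\<^sub>\<infinity>m\<in>aliases n k. wt m powr - (2 * s)) * sqrt (\<Sum>\<^sub>\<infinity>m\<in>aliases n k. ?g m)"
        using infsum_Cauchy_Schwarz[of ?f "aliases n k" ?h] C(2)[OF n k] gs unfolding fh f2 h2 by auto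
      have "norm (err_coeff n d a k) \<le> (\<Sum>\<^sub>\<infinity>m\<in>aliases n k. norm (a m))"
        using norm_infsum_le[OF hs has_sum_infsum[OF cs(1)]] by simp
      also note cs(2)
      also have "sqrt (\<Sum>\<^sub>\<infinity>m\<in>aliases n k. wt m powr - (2 * s)) * sqrt (\<Sum>\<^sub>\<infinity>m\<in>aliases n k. ?g m)
          \<le> sqrt (C * real n powr - (2 * s)) * sqrt (\<Sum>\<^sub>\<infinity>m\<in>aliases n k. ?g m)"
        by (intro mult_right_mono real_sqrt_le_mono C(3) n k real_sqrt_ge_zero infsum_nonneg) auto
      finally have "(norm (err_coeff n d a k))\<^sup>2 \<le> (sqrt (C * real n powr - (2 * s)) * sqrt (\<Sum>\<^sub>\<infinity>m\<in>aliases n k. ?g m))\<^sup>2"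
        by (intro power_mono) auto
      then show ?thesis using C(1) by (simp add: power_mult_distrib infsum_nonneg)
    qed
    have "(\<Sum>k\<in>freqs n. (norm (err_coeff n d a k))\<^sup>2) \<le> (\<Sum>k\<in>freqs n. C * real n powr - (2 * s) * (\<Sum>\<^sub>\<infinity>m\<in>aliases n k. ?g m))"
      by (intro sum_mono one)
    also have "\<dots> = C * real n powr - (2 * s) * (\<Sum>\<^sub>\<infinity>m\<in>- freqs n. ?g m)"
      unfolding sum_distrib_left[symmetric] Un_aliases[OF n, symmetric]
      by (subst sum_infsum[OF finite_freqs gs aliases_disjoint[OF n]]) simp_all
    also have "\<dots> \<le> C * real n powr - (2 * s) * (\<Sum>\<^sub>\<infinity>m. ?g m)"
      using C(1) by (intro mult_left_mono infsum_mono2 gs) auto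
    finally show "(\<Sum>k\<in>freqs n. (norm (err_coeff n d a k))\<^sup>2) \<le> C * real n powr (- 2 * s) * (\<Sum>\<^sub>\<infinity>k. ?g k)" by simp
  qed
qed

text \<open>On the window the weight is at most n, so the aliasing bound loses only
  \<open>n powr (2 * t)\<close>. Off the window |c_k| = |a_k|, and lowering the exponent from s to t
  gains \<open>n powr (2 * (t - s))\<close> because the frequencies there are at least of order
  n.\<close>

lemma err_coeff_weighted_L2:
  assumes s: "s > 1/2"
  obtains C where "C \<ge> 0"
   "\<And>n a d t. n > 1 \<Longrightarrow> 0 \<le> t \<Longrightarrow> t \<le> s \<Longrightarrow> (\<lambda>k. wt k powr (2 * s) * (norm (a k))\<^sup>2) summable_on UNIV \<Longrightarrow>
     (\<And>k. (a has_sum d k) {m. int n dvd m - k}) \<Longrightarrow>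
     (\<lambda>k. wt k powr (2 * t) * (norm (err_coeff n d a k))\<^sup>2) summable_on UNIV \<and>
     (\<Sum>\<^sub>\<infinity>k. wt k powr (2 * t) * (norm (err_coeff n d a k))\<^sup>2)
       \<le> C * real n powr (2 * (t - s)) * (\<Sum>\<^sub>\<infinity>k. wt k powr (2 * s) * (norm (a k))\<^sup>2)"
proof -
  obtain C where C: "C \<ge> 0" "\<And>n a d. n > 0 \<Longrightarrow> (\<lambda>k. wt k powr (2 * s) * (norm (a k))\<^sup>2) summable_on UNIV \<Longrightarrow>
     (\<And>k. (a has_sum d k) {m. int n dvd m - k}) \<Longrightarrow>
     (\<Sum>k\<in>freqs n. (norm (err_coeff n d a k))\<^sup>2) \<le> C * real n powr (- 2 * s) * (\<Sum>\<^sub>\<infinity>k. wt k powr (2 * s) * (norm (a k))\<^sup>2)"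
    using aliasing_error_L2[OF s] by blast
  show ?thesis
  proof (rule that[of "C + 2 powr (2 * s)"])
    show "0 \<le> C + 2 powr (2 * s)" using C by simp
    fix n :: nat and a d :: "int \<Rightarrow> complex" and t :: real
    assume n: "n > 1" and t: "0 \<le> t" "t \<le> s" and g: "(\<lambda>k. wt k powr (2 * s) * (norm (a k))\<^sup>2) summable_on UNIV"
      and d: "\<And>k. (a has_sum d k) {m. int n dvd m - k}"
    let ?g = "\<lambda>k. wt k powr (2 * s) * (norm (a k))\<^sup>2" and ?c = "err_coeff n d a"
    let ?h = "\<lambda>k. wt k powr (2 * t) * (norm (?c k))\<^sup>2" and ?N = "\<Sum>\<^sub>\<infinity>k. wt k powr (2 * s) * (norm (a k))\<^sup>2"
    let ?K = "2 powr (2 * s) * real n powr (2 * (t - s))"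
    have gs: "?g summable_on A" for A by (rule summable_on_subset_banach[OF g]) simp
    have hi: "?h k \<le> ?K * ?g k" if k: "k \<in> - freqs n" for k
    proof -
      have "wt k powr (2 * t) = wt k powr (2 * s) * wt k powr (2 * (t - s))"
        by (simp add: powr_add[symmetric] algebra_simps)
      also have "wt k powr (2 * (t - s)) \<le> (real n / 2) powr (2 * (t - s))"
        using n t k not_freqs_wt[of k n] by (intro powr_mono2') auto
      also have "(real n / 2) powr (2 * (t - s)) = 2 powr (2 * (s - t)) * real n powr (2 * (t - s))"
      proof -
        have "(real n / 2) powr (2 * (t - s)) = real n powr (2 * (t - s)) * (1 / 2 powr (2 * (t - s)))"
          by (simp add: powr_divide)
        also have "1 / (2::real) powr (2 * (t - s)) = 2 powr (2 * (s - t))"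
          by (simp add: powr_minus_divide[symmetric] algebra_simps)
        finally show ?thesis by simp
      qed
      \<comment> \<open>Dropping t from the exponent of 2 makes the constant independent of
        t.\<close>
      also have "\<dots> \<le> ?K" using t by (intro mult_right_mono powr_mono) auto
      finally have "wt k powr (2 * t) \<le> wt k powr (2 * s) * ?K" by (simp add: mult_left_mono)
      then have "wt k powr (2 * t) * (norm (a k))\<^sup>2 \<le> wt k powr (2 * s) * ?K * (norm (a k))\<^sup>2"
        by (rule mult_right_mono) simp
      then show ?thesis using k by (simp add: err_coeff_def mult_ac)
    qed
    have hs: "?h summable_on - freqs n"
      by (rule summable_on_comparison_test[OF summable_on_cmult_right[OF gs]]) (use hi in auto)
    have hi2: "infsum ?h (- freqs n) \<le> ?K * ?N"
    proof -
      have "infsum ?h (- freqs n) \<le> infsum (\<lambda>k. ?K * ?g k) (- freqs n)"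
        by (rule infsum_mono[OF hs summable_on_cmult_right[OF gs]]) (rule hi)
      also have "\<dots> = ?K * infsum ?g (- freqs n)" by (rule infsum_cmult_right')
      also have "\<dots> \<le> ?K * ?N" by (intro mult_left_mono infsum_mono2 gs) auto
      finally show ?thesis .
    qed
    have lo: "sum ?h (freqs n) \<le> C * real n powr (2 * (t - s)) * ?N"
    proof -
      have "sum ?h (freqs n) \<le> (\<Sum>k\<in>freqs n. real n powr (2 * t) * (norm (?c k))\<^sup>2)"
        using t n wt_nonneg freqs_wt by (intro sum_mono mult_right_mono powr_mono2) auto
      also have "\<dots> = real n powr (2 * t) * (\<Sum>k\<in>freqs n. (norm (?c k))\<^sup>2)" by (simp add: sum_distrib_left)
      also have "\<dots> \<le> real n powr (2 * t) * (C * real n powr (- 2 * s) * ?N)"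
        using n by (intro mult_left_mono C(2) g d) auto
      also have "\<dots> = C * (real n powr (2 * t) * real n powr (- 2 * s)) * ?N" by (simp add: mult_ac)
      also have "real n powr (2 * t) * real n powr (- 2 * s) = real n powr (2 * (t - s))"
        by (simp add: powr_add[symmetric] algebra_simps)
      finally show ?thesis .
    qed
    have hsum: "(?h has_sum (sum ?h (freqs n) + infsum ?h (- freqs n))) (freqs n \<union> - freqs n)"
      by (intro has_sum_Un_disjoint has_sum_infsum hs has_sum_finite) auto
    then have "(?h has_sum (sum ?h (freqs n) + infsum ?h (- freqs n))) UNIV" by simp
    moreover have "sum ?h (freqs n) + infsum ?h (- freqs n) \<le> (C + 2 powr (2 * s)) * real n powr (2 * (t - s)) * ?N"
      using lo hi2 by (simp add: algebra_simps)
    ultimately show "?h summable_on UNIV \<and> infsum ?h UNIV \<le> (C + 2 powr (2 * s)) * real n powr (2 * (t - s)) * ?N"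
      by (auto simp: has_sum_imp_summable dest: infsumI)
  qed
qed

text \<open>Cauchy-Schwarz on both parts. On the window, n equal weights cost a factor sqrt n over
  the l2 bound. Off it, \<open>wt k powr (t - s)\<close> is square-summable because t < s - 1/2, and
  its n alias classes contribute a multiple of \<open>n powr (1 - 2 * (s - t))\<close> in
  total.\<close>

lemma err_coeff_weighted_L1:
  assumes s: "s > 1/2" and t: "0 \<le> t" "t < s - 1/2"
  obtains C where "C \<ge> 0"
   "\<And>n a d. n > 1 \<Longrightarrow> (\<lambda>k. wt k powr (2 * s) * (norm (a k))\<^sup>2) summable_on UNIV \<Longrightarrow>
     (\<And>k. (a has_sum d k) {m. int n dvd m - k}) \<Longrightarrow>
     (\<lambda>k. wt k powr t * norm (err_coeff n d a k)) summable_on UNIV \<and>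
     (\<Sum>\<^sub>\<infinity>k. wt k powr t * norm (err_coeff n d a k))
       \<le> C * real n powr (1/2 + t - s) * sqrt (\<Sum>\<^sub>\<infinity>k. wt k powr (2 * s) * (norm (a k))\<^sup>2)"
proof -
  obtain C where C: "C \<ge> 0" "\<And>n a d. n > 0 \<Longrightarrow> (\<lambda>k. wt k powr (2 * s) * (norm (a k))\<^sup>2) summable_on UNIV \<Longrightarrow>
     (\<And>k. (a has_sum d k) {m. int n dvd m - k}) \<Longrightarrow>
     (\<Sum>k\<in>freqs n. (norm (err_coeff n d a k))\<^sup>2) \<le> C * real n powr (- 2 * s) * (\<Sum>\<^sub>\<infinity>k. wt k powr (2 * s) * (norm (a k))\<^sup>2)"
    using aliasing_error_L2[OF s] by blast
  let ?p = "2 * (s - t)"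
  obtain Z where Z: "Z \<ge> 0" "\<And>n m. n > 0 \<Longrightarrow> m \<in> freqs n \<Longrightarrow> (\<lambda>k. wt k powr - ?p) summable_on aliases n m"
    "\<And>n m. n > 0 \<Longrightarrow> m \<in> freqs n \<Longrightarrow> (\<Sum>\<^sub>\<infinity>k\<in>aliases n m. wt k powr - ?p) \<le> Z * real n powr - ?p"
    using aliases_tail[of ?p] t by auto
  show ?thesis
  proof (rule that[of "sqrt C + sqrt Z"])
    show "0 \<le> sqrt C + sqrt Z" using C Z by simp
    fix n :: nat and a d :: "int \<Rightarrow> complex"
    assume n: "n > 1" and g: "(\<lambda>k. wt k powr (2 * s) * (norm (a k))\<^sup>2) summable_on UNIV"
      and d: "\<And>k. (a has_sum d k) {m. int n dvd m - k}"
    let ?g = "\<lambda>k. wt k powr (2 * s) * (norm (a k))\<^sup>2" and ?c = "err_coeff n d a"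
    let ?h = "\<lambda>k. wt k powr t * norm (?c k)" and ?N = "\<Sum>\<^sub>\<infinity>k. wt k powr (2 * s) * (norm (a k))\<^sup>2"
    let ?K = "real n powr (1/2 + t - s)"
    have N: "?N \<ge> 0" by (intro infsum_nonneg) auto
    have gs: "?g summable_on A" for A by (rule summable_on_subset_banach[OF g]) simp
    have lo: "sum ?h (freqs n) \<le> sqrt C * ?K * sqrt ?N"
    proof -
      have "sum ?h (freqs n) \<le> (\<Sum>k\<in>freqs n. real n powr t * norm (?c k))"
        using t n wt_nonneg freqs_wt by (intro sum_mono mult_right_mono powr_mono2) auto
      also have "\<dots> = real n powr t * (\<Sum>k\<in>freqs n. \<bar>1\<bar> * \<bar>norm (?c k)\<bar>)" by (simp add: sum_distrib_left)
      also have "(\<Sum>k\<in>freqs n. \<bar>1\<bar> * \<bar>norm (?c k)\<bar>) \<le> L2_set (\<lambda>_. 1) (freqs n) * L2_set (\<lambda>k. norm (?c k)) (freqs n)"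
        by (rule L2_set_mult_ineq)
      also have "\<dots> = sqrt (real n) * sqrt (\<Sum>k\<in>freqs n. (norm (?c k))\<^sup>2)"
        using n by (simp add: L2_set_def card_freqs)
      also have "\<dots> \<le> sqrt (real n) * sqrt (C * real n powr (- 2 * s) * ?N)"
        using n by (intro mult_left_mono real_sqrt_le_mono C(2) g d) auto
      also have "\<dots> = real n powr (1/2) * (sqrt C * real n powr - s * sqrt ?N)"
      proof -
        have "sqrt (real n powr (- 2 * s)) = real n powr - s"
          by (rule real_sqrt_unique) (simp_all add: power2_eq_square powr_add[symmetric])
        then show ?thesis using n by (simp add: real_sqrt_mult powr_half_sqrt)
      qed
      finally have "sum ?h (freqs n) \<le> real n powr t * (real n powr (1/2) * (sqrt C * real n powr - s * sqrt ?N))"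
        by (simp add: mult_left_mono)
      also have "\<dots> = (real n powr t * real n powr (1/2) * real n powr - s) * (sqrt C * sqrt ?N)" by (simp add: mult_ac)
      also have "real n powr t * real n powr (1/2) * real n powr - s = ?K"
        by (simp add: powr_add[symmetric] algebra_simps)
      finally show ?thesis by (simp add: mult_ac)
    qed
    let ?f1 = "\<lambda>k. wt k powr (t - s)" and ?f2 = "\<lambda>k. wt k powr s * norm (a k)"
    have f1: "(?f1 k)\<^sup>2 = wt k powr - ?p" for k
      by (simp add: power2_eq_square powr_add[symmetric] algebra_simps)
    have f2: "(?f2 k)\<^sup>2 = ?g k" for k
    proof -
      have "(wt k powr s)\<^sup>2 = wt k powr (2 * s)" by (simp add: power2_eq_square powr_add[symmetric])
      then show ?thesis by (simp add: power_mult_distrib)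
    qed
    have f12: "\<bar>?f1 k\<bar> * \<bar>?f2 k\<bar> = ?h k" if "k \<in> - freqs n" for k
    proof -
      have "?f1 k * ?f2 k = wt k powr (t - s) * wt k powr s * norm (a k)" by simp
      also have "\<dots> = ?h k" using that by (simp add: powr_add[symmetric] err_coeff_def)
      finally show ?thesis by (simp add: abs_mult)
    qed
    have n0: "n > 0" using n by simp
    have w1: "(\<lambda>k. wt k powr - ?p) summable_on - freqs n" "infsum (\<lambda>k. wt k powr - ?p) (- freqs n) \<le> Z * real n powr (1 - ?p)"
    proof -
      show "(\<lambda>k. wt k powr - ?p) summable_on - freqs n"
        unfolding Un_aliases[OF n0, symmetric]
        by (rule summable_on_finite_union_disjoint[OF finite_freqs Z(2)[OF n0] aliases_disjoint[OF n0]])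
      have "infsum (\<lambda>k. wt k powr - ?p) (- freqs n) = (\<Sum>m\<in>freqs n. \<Sum>\<^sub>\<infinity>k\<in>aliases n m. wt k powr - ?p)"
        unfolding Un_aliases[OF n0, symmetric]
        by (rule sum_infsum[OF finite_freqs Z(2)[OF n0] aliases_disjoint[OF n0], symmetric])
      also have "\<dots> \<le> (\<Sum>m\<in>freqs n. Z * real n powr - ?p)" by (intro sum_mono Z n0)
      also have "\<dots> = Z * (real n powr 1 * real n powr - ?p)" using n by (simp add: card_freqs)
      also have "real n powr 1 * real n powr - ?p = real n powr (1 - ?p)" unfolding powr_add[symmetric] by (simp only: diff_conv_add_uminus)
      finally show "infsum (\<lambda>k. wt k powr - ?p) (- freqs n) \<le> Z * real n powr (1 - ?p)" .
    qed
    have cs: "(\<lambda>k. \<bar>?f1 k\<bar> * \<bar>?f2 k\<bar>) summable_on - freqs n"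
      "infsum (\<lambda>k. \<bar>?f1 k\<bar> * \<bar>?f2 k\<bar>) (- freqs n) \<le> sqrt (infsum (\<lambda>k. wt k powr - ?p) (- freqs n)) * sqrt (infsum ?g (- freqs n))"
      using infsum_Cauchy_Schwarz[of ?f1 "- freqs n" ?f2] w1(1) gs unfolding f1 f2 by auto
    have hs: "?h summable_on - freqs n" by (rule iffD1[OF summable_on_cong[OF f12] cs(1)])
    have hi: "infsum ?h (- freqs n) \<le> sqrt Z * ?K * sqrt ?N"
    proof -
      have "infsum ?h (- freqs n) = infsum (\<lambda>k. \<bar>?f1 k\<bar> * \<bar>?f2 k\<bar>) (- freqs n)"
        by (rule infsum_cong) (simp only: f12)
      also note cs(2)
      also have "sqrt (infsum (\<lambda>k. wt k powr - ?p) (- freqs n)) * sqrt (infsum ?g (- freqs n)) \<le> sqrt (Z * real n powr (1 - ?p)) * sqrt ?N"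
        using Z(1) by (intro mult_mono real_sqrt_le_mono w1(2) infsum_mono2 gs) (auto intro: infsum_nonneg)
      also have "sqrt (Z * real n powr (1 - ?p)) = sqrt Z * ?K"
      proof -
        have "sqrt (real n powr (1 - ?p)) = ?K"
          by (rule real_sqrt_unique) (simp_all add: power2_eq_square powr_add[symmetric] algebra_simps)
        then show ?thesis by (simp add: real_sqrt_mult)
      qed
      finally show ?thesis .
    qed
    have "(?h has_sum (sum ?h (freqs n) + infsum ?h (- freqs n))) (freqs n \<union> - freqs n)"
      by (intro has_sum_Un_disjoint has_sum_infsum hs has_sum_finite) auto
    then have "(?h has_sum (sum ?h (freqs n) + infsum ?h (- freqs n))) UNIV" by simp
    moreover have "sum ?h (freqs n) + infsum ?h (- freqs n) \<le> (sqrt C + sqrt Z) * ?K * sqrt ?N"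
      using lo hi by (simp add: algebra_simps)
    ultimately show "?h summable_on UNIV \<and> infsum ?h UNIV \<le> (sqrt C + sqrt Z) * ?K * sqrt ?N"
      by (auto simp: has_sum_imp_summable dest: infsumI)
  qed
qed

section \<open>Powers of the Moebius map on the line\<close>

text \<open>The argument of \<open>M\<close> on the line and the inverse of
  \<open>circle_to_line\<close>. The shift by pi puts its values in (0, 2 pi), so that both ends of
  the line approach the point 1 of the circle.\<close>

definition angle :: "real \<Rightarrow> real \<Rightarrow> real" where
  "angle \<beta> x = 2 * arctan (x / \<beta>) + pi"

text \<open>The density of the angle measure with respect to dx, a multiple of the Cauchy
  density.\<close>

definition angle_deriv :: "real \<Rightarrow> real \<Rightarrow> real" where
  "angle_deriv \<beta> x = 2 * \<beta> / (x\<^sup>2 + \<beta>\<^sup>2)"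

definition wave :: "real \<Rightarrow> int \<Rightarrow> real \<Rightarrow> complex" where
  "wave \<beta> k x = cis (of_int k * angle \<beta> x)"

lemma sum_squares_beta_pos: "\<beta> > 0 \<Longrightarrow> 0 < (x::real)\<^sup>2 + \<beta>\<^sup>2"
  by (simp add: add_nonneg_pos)

lemma angle_deriv_pos: "\<beta> > 0 \<Longrightarrow> 0 < angle_deriv \<beta> x"
  unfolding angle_deriv_def by (simp add: sum_squares_beta_pos)

lemma angle_deriv_le: "\<beta> > 0 \<Longrightarrow> angle_deriv \<beta> x \<le> 2 / \<beta>"
  unfolding angle_deriv_def using sum_squares_beta_pos[of \<beta> x]
  by (simp add: field_simps power2_eq_square)

lemma angle_bounds: "0 < angle \<beta> x" "angle \<beta> x < 2 * pi"
  using arctan_bounded[of "x / \<beta>"] unfolding angle_def by auto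

lemma has_real_derivative_angle:
  assumes "\<beta> > 0" shows "(angle \<beta> has_real_derivative angle_deriv \<beta> x) (at x)"
proof -
  have "((\<lambda>x. 2 * arctan (x / \<beta>) + pi) has_real_derivative
      2 * (inverse (1 + (x/\<beta>)\<^sup>2) * (1 / \<beta>)) + 0) (at x)"
    by (rule derivative_eq_intros refl | use assms in simp)+
  moreover have "2 * (inverse (1 + (x/\<beta>)\<^sup>2) * (1 / \<beta>)) + 0 = angle_deriv \<beta> x"
    unfolding angle_deriv_def using assms sum_squares_beta_pos[OF assms, of x]
    by (simp add: divide_simps power2_eq_square)
  ultimately show ?thesis unfolding angle_def by (simp add: fun_eq_iff)
qed

lemma norm_wave [simp]: "norm (wave \<beta> k x) = 1"
  by (simp add: wave_def)

lemma wave_0 [simp]: "wave \<beta> 0 x = 1"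
  by (simp add: wave_def)

lemma wave_add: "wave \<beta> (k + l) x = wave \<beta> k x * wave \<beta> l x"
  by (simp add: wave_def cis_mult algebra_simps)

lemma cnj_wave: "cnj (wave \<beta> k x) = wave \<beta> (- k) x"
  by (simp add: wave_def cis_cnj)

lemma cos_sin_double_arctan:
  fixes u :: real
  shows "cos (2 * arctan u) = (1 - u\<^sup>2) / (1 + u\<^sup>2)" "sin (2 * arctan u) = 2 * u / (1 + u\<^sup>2)"
  unfolding cos_double sin_double cos_arctan sin_arctan
  by (simp_all add: power_divide add_nonneg_nonneg diff_divide_distrib)

lemma cos_sin_double_arctan_divide:
  assumes "\<beta> > 0"
  shows "cos (2 * arctan (x/\<beta>)) = (\<beta>\<^sup>2 - x\<^sup>2) / (x\<^sup>2 + \<beta>\<^sup>2)"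
    "sin (2 * arctan (x/\<beta>)) = 2 * x * \<beta> / (x\<^sup>2 + \<beta>\<^sup>2)"
proof -
  have s: "x\<^sup>2 + \<beta>\<^sup>2 \<noteq> 0" "1 + (x / \<beta>)\<^sup>2 = (x\<^sup>2+\<beta>\<^sup>2)/\<beta>\<^sup>2"
    using sum_squares_beta_pos[OF assms, of x] assms by (auto simp: power_divide field_simps)
  show "cos (2 * arctan (x/\<beta>)) = (\<beta>\<^sup>2 - x\<^sup>2) / (x\<^sup>2 + \<beta>\<^sup>2)"
    "sin (2 * arctan (x/\<beta>)) = 2 * x * \<beta> / (x\<^sup>2 + \<beta>\<^sup>2)"
    unfolding cos_sin_double_arctan s(2) using assms s(1)
    by (simp_all add: power_divide divide_simps power2_eq_square)
qed

lemma moebius_of_real: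
  assumes "\<beta> > 0" shows "moebius \<beta> (of_real x) = wave \<beta> 1 x"
proof -
  have n0: "complex_of_real x + \<i> * of_real \<beta> \<noteq> 0"
    using assms by (auto simp: complex_eq_iff)
  have s: "x\<^sup>2 + \<beta>\<^sup>2 \<noteq> 0"
    using sum_squares_beta_pos[OF assms, of x] by (metis less_irrefl)
  note c = cos_sin_double_arctan_divide[OF assms, of x]
  have "moebius \<beta> (of_real x) = Complex ((x\<^sup>2 - \<beta>\<^sup>2) / (x\<^sup>2 + \<beta>\<^sup>2)) (- 2 * x * \<beta> / (x\<^sup>2 + \<beta>\<^sup>2))"
  proof -
    let ?S = "x\<^sup>2 + \<beta>\<^sup>2"
    have "(x\<^sup>2 - \<beta>\<^sup>2) / ?S * x - (- 2 * x * \<beta> / ?S) * \<beta> = x * ?S / ?S"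
      "(x\<^sup>2 - \<beta>\<^sup>2) / ?S * \<beta> + (- 2 * x * \<beta> / ?S) * x = - \<beta> * ?S / ?S"
      unfolding times_divide_eq_left diff_divide_distrib[symmetric] add_divide_distrib[symmetric]
      by (simp_all add: algebra_simps power2_eq_square)
    then have "Complex ((x\<^sup>2 - \<beta>\<^sup>2) / ?S) (- 2 * x * \<beta> / ?S) * (of_real x + \<i> * of_real \<beta>) = of_real x - \<i> * of_real \<beta>"
      using s by (simp add: complex_eq_iff)
    then show ?thesis unfolding moebius_def using n0 by (simp add: divide_eq_eq)
  qed
  also have "\<dots> = wave \<beta> 1 x"
  proof -
    have "(x\<^sup>2 - \<beta>\<^sup>2) / (x\<^sup>2 + \<beta>\<^sup>2) = - ((\<beta>\<^sup>2 - x\<^sup>2) / (x\<^sup>2 + \<beta>\<^sup>2))"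
      by (simp only: minus_divide_left minus_diff_eq)
    then show ?thesis unfolding wave_def angle_def complex_eq_iff by (simp add: c)
  qed
  finally show ?thesis .
qed

lemma moebius_powi: "\<beta> > 0 \<Longrightarrow> moebius \<beta> (of_real x) powi k = wave \<beta> k x"
  by (simp add: moebius_of_real) (simp add: wave_def cis_power_int)

lemma circle_to_line_angle:
  assumes "\<beta> > 0" shows "circle_to_line \<beta> (angle \<beta> x) = x"
proof -
  let ?y = "circle_to_line \<beta> (angle \<beta> x)"
  have "moebius \<beta> (of_real ?y) = moebius \<beta> (of_real x)"
    using moebius_circle_to_line[OF assms angle_bounds] moebius_of_real[OF assms]
    by (simp add: wave_def)
  moreover have "complex_of_real z + \<i> * of_real \<beta> \<noteq> 0" for z
    using assms by (auto simp: complex_eq_iff)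
  ultimately have "(of_real ?y - \<i> * of_real \<beta>) * (of_real x + \<i> * of_real \<beta>)
     = (of_real x - \<i> * of_real \<beta>) * (of_real ?y + \<i> * of_real \<beta> :: complex)"
    unfolding moebius_def by (simp add: frac_eq_eq)
  then have "\<beta> * ?y = \<beta> * x" by (auto simp: complex_eq_iff)
  then show ?thesis using assms by simp
qed

text \<open>The weight is itself a trigonometric polynomial of degree one in the angle.
  Differentiating a power of \<open>M\<close> therefore produces only that power and its two
  neighbours, and |M - 1|^2 is a multiple of the weight.\<close>

lemma one_minus_cos_angle:
  assumes "\<beta> > 0" shows "1 - cos (angle \<beta> x) = \<beta> * angle_deriv \<beta> x"
proof -
  have "x\<^sup>2 + \<beta>\<^sup>2 \<noteq> 0"
    using sum_squares_beta_pos[OF assms, of x] by (metis less_irrefl)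
  then show ?thesis unfolding angle_def angle_deriv_def using cos_sin_double_arctan_divide(1)[OF assms, of x]
    by (simp add: field_simps power2_eq_square)
qed

lemma angle_deriv_wave:
  assumes "\<beta> > 0"
  shows "of_real (angle_deriv \<beta> x) = (2 - wave \<beta> 1 x - wave \<beta> (-1) x) / (2 * of_real \<beta>)"
proof -
  have "(2 - wave \<beta> 1 x - wave \<beta> (-1) x) = of_real (2 * (1 - cos (angle \<beta> x)))"
    by (simp add: wave_def complex_eq_iff)
  then show ?thesis using assms unfolding one_minus_cos_angle[OF assms] by simp
qed

lemma has_vector_derivative_wave:
  assumes "\<beta> > 0"
  shows "(wave \<beta> k has_vector_derivative \<i> * of_int k * of_real (angle_deriv \<beta> x) * wave \<beta> k x) (at x)"
proof -
  have "((\<lambda>x. exp (\<i> * complex_of_real (of_int k * angle \<beta> x))) has_vector_derivative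
     (of_int k * angle_deriv \<beta> x) *\<^sub>R (exp (\<i> * complex_of_real (of_int k * angle \<beta> x)) * \<i>)) (at x)"
  proof (rule vector_diff_chain_at[where g = "\<lambda>t. exp (\<i> * complex_of_real t)" and f = "\<lambda>x. of_int k * angle \<beta> x", unfolded o_def])
    show "((\<lambda>x. of_int k * angle \<beta> x) has_vector_derivative of_int k * angle_deriv \<beta> x) (at x)"
      using has_real_derivative_angle[OF assms, of x]
      by (intro derivative_eq_intros) (auto simp: has_real_derivative_iff_has_vector_derivative[symmetric])
    show "((\<lambda>t. exp (\<i> * complex_of_real t)) has_vector_derivative
      exp (\<i> * complex_of_real (real_of_int k * angle \<beta> x)) * \<i>) (at (of_int k * angle \<beta> x))"
      by (rule has_vector_derivative_real_field) (auto intro!: derivative_eq_intros)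
  qed
  then show ?thesis
    unfolding wave_def[abs_def] cis_conv_exp by (simp add: scaleR_conv_of_real mult_ac)
qed

section \<open>Derivatives of the powers\<close>

text \<open>The derivative of order r + 1 is the derivative of order r of (M^k)' = i k
  \<open>\<tau>'\<close> M^k, with \<open>\<tau>'\<close> expanded into powers of \<open>M\<close>.
  As a recursion in the frequency it lets estimates for order r be reused at k - 1, k and k + 1
  without a product rule.\<close>

fun wave_deriv :: "real \<Rightarrow> nat \<Rightarrow> int \<Rightarrow> real \<Rightarrow> complex" where
  "wave_deriv \<beta> 0 k x = wave \<beta> k x"
| "wave_deriv \<beta> (Suc r) k x = \<i> * of_int k / (2 * of_real \<beta>) *
     (2 * wave_deriv \<beta> r k x - wave_deriv \<beta> r (k + 1) x - wave_deriv \<beta> r (k - 1) x)"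

declare wave_deriv.simps(2) [simp del]

lemma wave_deriv_1:
  assumes "\<beta> > 0"
  shows "wave_deriv \<beta> (Suc 0) k x = \<i> * of_int k * of_real (angle_deriv \<beta> x) * wave \<beta> k x"
  unfolding wave_deriv.simps angle_deriv_wave[OF assms] wave_add
  using wave_add[of \<beta> k "-1" x] by (simp add: algebra_simps diff_divide_distrib add_divide_distrib)

lemma has_vector_derivative_wave_deriv:
  assumes "\<beta> > 0"
  shows "(wave_deriv \<beta> r k has_vector_derivative wave_deriv \<beta> (Suc r) k x) (at x)"
proof (induction r arbitrary: k)
  case 0
  show ?case using has_vector_derivative_wave[OF assms, of k x]
    unfolding wave_deriv_1[OF assms] by (simp add: fun_eq_iff)
next
  case (Suc r)
  have "((\<lambda>x. \<i> * of_int k / (2 * of_real \<beta>) *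
     (2 * wave_deriv \<beta> r k x - wave_deriv \<beta> r (k + 1) x - wave_deriv \<beta> r (k - 1) x))
     has_vector_derivative wave_deriv \<beta> (Suc (Suc r)) k x) (at x)"
    unfolding wave_deriv.simps(2)[of _ "Suc r"]
    by (intro has_vector_derivative_mult_right has_vector_derivative_diff Suc)
  then show ?case by (simp add: fun_eq_iff wave_deriv.simps(2)[of \<beta> r, abs_def])
qed

lemma continuous_wave_deriv: "\<beta> > 0 \<Longrightarrow> isCont (wave_deriv \<beta> r k) x"
  using has_vector_derivative_wave_deriv has_vector_derivative_continuous by blast

text \<open>Every derivative of positive order retains a factor \<open>\<tau>'\<close>, since each
  of the three terms of the recursion does. This supplies decay at infinity and
  integrability.\<close>

lemma norm_wave_deriv_Suc_le:
  assumes "\<beta> > 0"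
  obtains C where "C \<ge> 0"
    "\<And>k x. norm (wave_deriv \<beta> (Suc r) k x) \<le> C * (1 + real_of_int \<bar>k\<bar>) ^ Suc r * angle_deriv \<beta> x"
proof (induction r arbitrary: thesis)
  case 0
  show ?case
  proof (rule 0[of 1])
    fix k x show "norm (wave_deriv \<beta> (Suc 0) k x) \<le> 1 * (1 + real_of_int \<bar>k\<bar>) ^ Suc 0 * angle_deriv \<beta> x"
      unfolding wave_deriv_1[OF assms] using angle_deriv_pos[OF assms, of x]
      by (simp add: norm_mult mult_right_mono del: wave_deriv.simps)
  qed simp
next
  case (Suc r)
  obtain C where C: "C \<ge> 0"
    "\<And>k x. norm (wave_deriv \<beta> (Suc r) k x) \<le> C * (1 + real_of_int \<bar>k\<bar>) ^ Suc r * angle_deriv \<beta> x"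
    using Suc.IH by blast
  show ?case
  \<comment> \<open>The three terms have total weight 4, divided by 2 \<beta>; the power of 2 pays
    for 1 + |m| \<le> 2 (1 + |k|) at a neighbour m of k.\<close>
  proof (rule Suc.prems[of "2 * 2 ^ Suc r * C / \<beta>"])
    show "0 \<le> 2 * 2 ^ Suc r * C / \<beta>" using C assms by simp
    fix k x
    let ?w = "wave_deriv \<beta> (Suc r)" and ?K = "1 + real_of_int \<bar>k\<bar>"
    let ?B = "2 ^ Suc r * C * ?K ^ Suc r * angle_deriv \<beta> x"
    have p: "angle_deriv \<beta> x \<ge> 0" using angle_deriv_pos[OF assms, of x] by simp
    have b: "norm (?w m x) \<le> ?B" if "\<bar>m\<bar> \<le> \<bar>k\<bar> + 1" for m
    proof -
      have "real_of_int \<bar>m\<bar> \<le> real_of_int (\<bar>k\<bar> + 1)" using that of_int_le_iff by blast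
      then have "(1 + real_of_int \<bar>m\<bar>) ^ Suc r \<le> (2 * ?K) ^ Suc r"
        by (intro power_mono) auto
      then have "C * (1 + real_of_int \<bar>m\<bar>) ^ Suc r * angle_deriv \<beta> x \<le> C * (2 * ?K) ^ Suc r * angle_deriv \<beta> x"
        using C p by (intro mult_right_mono mult_left_mono)
      then show ?thesis using C(2)[of m x] unfolding power_mult_distrib by (simp only: mult_ac)
    qed
    have "norm (2 * ?w k x - ?w (k + 1) x - ?w (k - 1) x) \<le> norm (2 * ?w k x) + norm (?w (k + 1) x) + norm (?w (k - 1) x)"
      by (meson add_mono norm_triangle_ineq4 order_refl order_trans)
    also have "\<dots> \<le> 2 * ?B + ?B + ?B"
      using b[of "k+1"] b[of "k-1"] mult_left_mono[OF b[of k], of 2]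
      by (intro add_mono) (auto simp only: norm_mult norm_numeral)
    also have "\<dots> = 4 * ?B" by algebra
    finally have 1: "norm (2 * ?w k x - ?w (k + 1) x - ?w (k - 1) x) \<le> 4 * ?B" .
    have "norm (wave_deriv \<beta> (Suc (Suc r)) k x) = \<bar>of_int k\<bar> / (2 * \<beta>) * norm (2 * ?w k x - ?w (k + 1) x - ?w (k - 1) x)"
      unfolding wave_deriv.simps(2)[of _ "Suc r"] norm_mult norm_divide using assms by simp
    also have "\<dots> \<le> ?K / (2 * \<beta>) * (4 * ?B)"
      by (intro mult_mono 1 divide_right_mono) (use assms in auto)
    also have "\<dots> = 2 * 2 ^ Suc r * C / \<beta> * ?K ^ Suc (Suc r) * angle_deriv \<beta> x"
      using assms by (simp add: field_simps)
    finally show "norm (wave_deriv \<beta> (Suc (Suc r)) k x) \<le> 2 * 2 ^ Suc r * C / \<beta> * ?K ^ Suc (Suc r) * angle_deriv \<beta> x" .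
  qed
qed

lemma norm_wave_deriv_le:
  assumes "\<beta> > 0"
  obtains C where "C \<ge> 0" "\<And>k x. norm (wave_deriv \<beta> r k x) \<le> C * (1 + real_of_int \<bar>k\<bar>) ^ r"
proof (cases r)
  case 0
  then show ?thesis by (intro that[of 1]) auto
next
  case (Suc q)
  obtain C where C: "C \<ge> 0"
    "\<And>k x. norm (wave_deriv \<beta> (Suc q) k x) \<le> C * (1 + real_of_int \<bar>k\<bar>) ^ Suc q * angle_deriv \<beta> x"
    using norm_wave_deriv_Suc_le[OF assms] by blast
  show ?thesis
  proof (rule that[of "C * (2 / \<beta>)"])
    show "0 \<le> C * (2 / \<beta>)" using C assms by simp
    fix k x
    have "C * (1 + real_of_int \<bar>k\<bar>) ^ Suc q * angle_deriv \<beta> x \<le> C * (1 + real_of_int \<bar>k\<bar>) ^ Suc q * (2 / \<beta>)"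
      using C by (intro mult_left_mono angle_deriv_le assms) auto
    then show "norm (wave_deriv \<beta> r k x) \<le> C * (2 / \<beta>) * (1 + real_of_int \<bar>k\<bar>) ^ r"
      using C(2)[of k x] Suc by (simp add: mult_ac del: wave_deriv.simps)
  qed
qed

lemma angle_limits:
  assumes "\<beta> > 0" shows "(angle \<beta> \<longlongrightarrow> 2 * pi) at_top" "(angle \<beta> \<longlongrightarrow> 0) at_bot"
proof -
  have p: "0 < 1 / \<beta>" using assms by simp
  have "LIM x at_top. (1 / \<beta>) * x :> at_top" "LIM x at_bot. (1 / \<beta>) * x :> at_bot"
    by (rule filterlim_tendsto_pos_mult_at_top[OF tendsto_const p filterlim_ident],
        rule filterlim_tendsto_pos_mult_at_bot[OF tendsto_const p filterlim_ident])
  then have "((\<lambda>x. arctan (x / \<beta>)) \<longlongrightarrow> pi / 2) at_top" "((\<lambda>x. arctan (x / \<beta>)) \<longlongrightarrow> - (pi / 2)) at_bot"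
    using filterlim_compose[OF tendsto_arctan_at_top, of "\<lambda>x. x / \<beta>" at_top]
      filterlim_compose[OF tendsto_arctan_at_bot, of "\<lambda>x. x / \<beta>" at_bot] by simp_all
  then have "((\<lambda>x. 2 * arctan (x / \<beta>) + pi) \<longlongrightarrow> 2 * (pi / 2) + pi) at_top"
     "((\<lambda>x. 2 * arctan (x / \<beta>) + pi) \<longlongrightarrow> 2 * (- (pi / 2)) + pi) at_bot"
    by (intro tendsto_intros; simp)+
  then show "(angle \<beta> \<longlongrightarrow> 2 * pi) at_top" "(angle \<beta> \<longlongrightarrow> 0) at_bot"
    by (simp_all add: angle_def[abs_def])
qed

lemma wave_tendsto_1:
  assumes "\<beta> > 0" shows "(wave \<beta> k \<longlongrightarrow> 1) at_infinity"
proof -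
  have "((\<lambda>x. cis (of_int k * angle \<beta> x)) \<longlongrightarrow> cis (of_int k * (2 * pi))) at_top"
       "((\<lambda>x. cis (of_int k * angle \<beta> x)) \<longlongrightarrow> cis (of_int k * 0)) at_bot"
    by (intro isCont_tendsto_compose[of _ cis] tendsto_intros angle_limits assms continuous_intros)+
  moreover have "cis (of_int k * (2 * pi)) = 1"
    by (simp add: complex_eq_iff) (metis Ints_of_int cos_int_2pin sin_int_2pin mult.assoc mult.commute)
  ultimately show ?thesis unfolding wave_def[abs_def] at_infinity_eq_at_top_bot by (simp add: filterlim_sup)
qed

lemma angle_deriv_tendsto_0:
  assumes "\<beta> > 0" shows "(angle_deriv \<beta> \<longlongrightarrow> 0) at_infinity"
proof -
  have "((\<lambda>x. (1 - cos (angle \<beta> x)) / \<beta>) \<longlongrightarrow> (1 - Re 1) / \<beta>) at_infinity"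
    using tendsto_Re[OF wave_tendsto_1[OF assms, of 1]] assms
    by (intro tendsto_intros) (auto simp: wave_def)
  then show ?thesis unfolding one_minus_cos_angle[OF assms] using assms by simp
qed

lemma wave_deriv_tendsto_0:
  assumes "\<beta> > 0" shows "(wave_deriv \<beta> (Suc r) k \<longlongrightarrow> 0) at_infinity"
proof -
  obtain C where C: "C \<ge> 0"
    "\<And>k x. norm (wave_deriv \<beta> (Suc r) k x) \<le> C * (1 + real_of_int \<bar>k\<bar>) ^ Suc r * angle_deriv \<beta> x"
    using norm_wave_deriv_Suc_le[OF assms] by blast
  have "((\<lambda>x. C * (1 + real_of_int \<bar>k\<bar>) ^ Suc r * angle_deriv \<beta> x) \<longlongrightarrow> C * (1 + real_of_int \<bar>k\<bar>) ^ Suc r * 0) at_infinity"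
    by (intro tendsto_intros angle_deriv_tendsto_0 assms)
  then have "((\<lambda>x. C * (1 + real_of_int \<bar>k\<bar>) ^ Suc r * angle_deriv \<beta> x) \<longlongrightarrow> 0) at_infinity"
    by (simp only: mult_zero_right)
  then show ?thesis
    by (rule Lim_null_comparison[OF always_eventually[OF allI[OF C(2)]]])
qed

lemma continuous_on_angle_deriv: "\<beta> > 0 \<Longrightarrow> continuous_on A (angle_deriv \<beta>)"
  unfolding angle_deriv_def[abs_def]
  by (intro continuous_intros) (metis sum_squares_beta_pos less_irrefl)

lemma borel_measurable_angle_deriv [measurable]: "angle_deriv \<beta> \<in> borel_measurable borel"
  unfolding angle_deriv_def[abs_def] by measurable

lemma borel_measurable_wave [measurable]: "wave \<beta> k \<in> borel_measurable borel"
  unfolding wave_def[abs_def] angle_def cis_conv_exp by measurable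

lemma borel_measurable_wave_deriv [measurable]: "wave_deriv \<beta> r k \<in> borel_measurable borel"
  proof (induction r arbitrary: k)
  case 0
  have "wave_deriv \<beta> 0 k = wave \<beta> k" by (simp add: fun_eq_iff)
  then show ?case by simp
next
  case (Suc r)
  note [measurable] = Suc
  show ?case unfolding wave_deriv.simps(2)[abs_def] by measurable
qed

section \<open>Orthogonality of the powers for the weight\<close>

lemma angle_deriv_integral:
  assumes "\<beta> > 0"
  shows "integrable lborel (angle_deriv \<beta>)" "(LINT x|lborel. angle_deriv \<beta> x) = 2 * pi"
proof -
  have c: "isCont (angle_deriv \<beta>) x" for x
    using continuous_on_angle_deriv[OF assms, of UNIV] by (simp add: continuous_on_eq_continuous_at)
  have l: "((angle \<beta> \<circ> real_of_ereal) \<longlongrightarrow> 0) (at_right (-\<infinity>))" "((angle \<beta> \<circ> real_of_ereal) \<longlongrightarrow> 2 * pi) (at_left \<infinity>)"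
    using angle_limits[OF assms] by (simp_all add: ereal_tendsto_simps)
  note FTC = interval_integral_FTC_nonneg[of "-\<infinity>" "\<infinity>" "angle \<beta>" "angle_deriv \<beta>" 0 "2*pi",
     OF _ has_real_derivative_angle[OF assms] c _ l]
  have e: "AE x in lborel. -\<infinity> < ereal x \<longrightarrow> ereal x < \<infinity> \<longrightarrow> 0 \<le> angle_deriv \<beta> x"
    using angle_deriv_pos[OF assms] by (simp add: less_imp_le)
  show "integrable lborel (angle_deriv \<beta>)" "(LINT x|lborel. angle_deriv \<beta> x) = 2 * pi"
    using FTC(1)[OF _ e] FTC(2)[OF _ e]
    by (simp_all add: set_integrable_def interval_lebesgue_integral_def set_lebesgue_integral_def)
qed

text \<open>For nonzero k the integrand is the derivative of M^k / (i k), whose limits at the two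
  ends of the line coincide.\<close>

lemma wave_integral:
  assumes "\<beta> > 0"
  shows "integrable lborel (\<lambda>x. of_real (angle_deriv \<beta> x) * wave \<beta> k x)"
    "(LINT x|lborel. of_real (angle_deriv \<beta> x) * wave \<beta> k x) = (if k = 0 then 2 * pi else 0)"
proof -
  show i: "integrable lborel (\<lambda>x. of_real (angle_deriv \<beta> x) * wave \<beta> k x)"
    by (rule Bochner_Integration.integrable_bound[OF angle_deriv_integral(1)[OF assms]]) (simp_all add: norm_mult)
  show "(LINT x|lborel. of_real (angle_deriv \<beta> x) * wave \<beta> k x) = (if k = 0 then 2 * pi else 0)"
  proof (cases "k = 0")
    case True
    then show ?thesis using angle_deriv_integral(2)[OF assms] by simp
  next
    case False
    have ca: "isCont (angle_deriv \<beta>) x" for x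
      using continuous_on_angle_deriv[OF assms, of UNIV] by (simp add: continuous_on_eq_continuous_at)
    have cw: "isCont (wave \<beta> k) x" for x
      using has_vector_derivative_wave[OF assms] has_vector_derivative_continuous by blast
    have c: "isCont (\<lambda>x. of_real (angle_deriv \<beta> x) * wave \<beta> k x) x" for x
      by (intro continuous_intros ca cw)
    have d: "((\<lambda>x. wave \<beta> k x / (\<i> * of_int k)) has_vector_derivative of_real (angle_deriv \<beta> x) * wave \<beta> k x) (at x)" for x
      using has_vector_derivative_divide[OF has_vector_derivative_wave[OF assms, of k x], of "\<i> * of_int k"] False
      by simp
    have wl: "(wave \<beta> k \<longlongrightarrow> 1) at_bot" "(wave \<beta> k \<longlongrightarrow> 1) at_top"
      using wave_tendsto_1[OF assms, of k] unfolding at_infinity_eq_at_top_bot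
      by (auto elim!: filterlim_mono)
    have l: "(((\<lambda>x. wave \<beta> k x / (\<i> * of_int k)) \<circ> real_of_ereal) \<longlongrightarrow> 1 / (\<i> * of_int k)) (at_right (-\<infinity>))"
      "(((\<lambda>x. wave \<beta> k x / (\<i> * of_int k)) \<circ> real_of_ereal) \<longlongrightarrow> 1 / (\<i> * of_int k)) (at_left \<infinity>)"
      unfolding ereal_tendsto_simps
      by (intro tendsto_divide wl tendsto_const; use False in simp)+
    have "(LBINT x=-\<infinity>..\<infinity>. of_real (angle_deriv \<beta> x) * wave \<beta> k x) = 1 / (\<i> * of_int k) - 1 / (\<i> * of_int k)"
      by (rule interval_integral_FTC_integrable[OF _ d c _ l]) (use i in \<open>simp_all add: set_integrable_def\<close>)
    then show ?thesis using False
      by (simp_all add: interval_lebesgue_integral_def set_lebesgue_integral_def)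
  qed
qed

text \<open>Expanding the square leaves differences of frequencies, whose weighted integrals vanish
  off the diagonal. As an identity of nonnegative integrals it can be applied without integrability
  conditions.\<close>

lemma wave_parseval:
  assumes "\<beta> > 0" "finite A"
  shows "(\<integral>\<^sup>+x. ennreal (angle_deriv \<beta> x * (norm (\<Sum>k\<in>A. a k * wave \<beta> k x))\<^sup>2) \<partial>lborel)
    = ennreal (2 * pi * (\<Sum>k\<in>A. (norm (a k))\<^sup>2))"
proof -
  let ?S = "\<lambda>x. \<Sum>k\<in>A. a k * wave \<beta> k x"
  let ?g = "\<lambda>x. \<Sum>k\<in>A. \<Sum>l\<in>A. (a k * cnj (a l)) * (of_real (angle_deriv \<beta> x) * wave \<beta> (k - l) x)"
  have e: "of_real (angle_deriv \<beta> x * (norm (?S x))\<^sup>2) = ?g x" for x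
    unfolding of_real_mult complex_norm_square cnj_sum complex_cnj_mult cnj_wave
    unfolding sum_product diff_conv_add_uminus wave_add unfolding sum_distrib_left
    by (intro sum.cong refl) (simp only: mult_ac)
  have bi: "has_bochner_integral lborel ?g (\<Sum>k\<in>A. \<Sum>l\<in>A. (a k * cnj (a l)) * (if k - l = 0 then 2 * pi else 0))"
  proof (intro has_bochner_integral_sum has_bochner_integral_mult_right)
    fix k l show "has_bochner_integral lborel (\<lambda>x. of_real (angle_deriv \<beta> x) * wave \<beta> (k - l) x)
       (if k - l = 0 then 2 * pi else 0)"
      using wave_integral[OF assms(1), of "k - l"] by (simp only: has_bochner_integral_iff)
  qed
  then have gi: "integrable lborel ?g" by (simp only: has_bochner_integral_iff)
  have "(LINT x|lborel. ?g x) = (\<Sum>k\<in>A. \<Sum>l\<in>A. (a k * cnj (a l)) * (if k - l = 0 then 2 * pi else 0))"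
    using bi by (simp only: has_bochner_integral_iff)
  also have "\<dots> = (\<Sum>k\<in>A. \<Sum>l\<in>A. if k = l then (a k * cnj (a l)) * (2 * pi) else 0)"
    by (intro sum.cong refl) auto
  also have "\<dots> = (\<Sum>k\<in>A. (a k * cnj (a k)) * (2 * pi))"
    using assms(2) by (intro sum.cong refl) (simp add: sum.delta)
  also have "\<dots> = of_real (2 * pi * (\<Sum>k\<in>A. (norm (a k))\<^sup>2))"
    by (simp only: of_real_mult of_real_sum complex_norm_square sum_distrib_left mult_ac)
  finally have 1: "(LINT x|lborel. ?g x) = of_real (2 * pi * (\<Sum>k\<in>A. (norm (a k))\<^sup>2))" .
  have ri: "integrable lborel (\<lambda>x. angle_deriv \<beta> x * (norm (?S x))\<^sup>2)"
    using integrable_Re[OF gi] unfolding e[symmetric] by (simp only: Re_complex_of_real)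
  have "(LINT x|lborel. angle_deriv \<beta> x * (norm (?S x))\<^sup>2) = 2 * pi * (\<Sum>k\<in>A. (norm (a k))\<^sup>2)"
    using 1 unfolding e[symmetric] integral_complex_of_real of_real_eq_iff .
  then show ?thesis
    using nn_integral_eq_integral[OF ri] angle_deriv_pos[OF assms(1)] by (simp add: less_imp_le)
qed

text \<open>Cauchy-Schwarz for three terms, 3 (4 |a|^2 + |b|^2 + |c|^2), shaped for the recursion of
  \<open>wave_deriv\<close>.\<close>

lemma norm_sum3_sq_le: "(norm (2 * a - b - c :: complex))\<^sup>2 \<le> 12 * (norm a)\<^sup>2 + 3 * (norm b)\<^sup>2 + 3 * (norm c)\<^sup>2"
proof -
  have "norm (2 * a - b - c) \<le> 2 * norm a + norm b + norm c"
    using norm_triangle_ineq4[of "2*a - b" c] norm_triangle_ineq4[of "2*a" b] by (simp add: norm_mult)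
  then have "(norm (2 * a - b - c))\<^sup>2 \<le> (2 * norm a + norm b + norm c)\<^sup>2"
    by (intro power_mono) auto
  also have "\<dots> \<le> 12 * (norm a)\<^sup>2 + 3 * (norm b)\<^sup>2 + 3 * (norm c)\<^sup>2"
    using sum_squares_ge_zero[of "2 * norm a - norm b" "2 * norm a - norm c"] zero_le_power2[of "norm b - norm c"]
    by (simp add: power2_eq_square algebra_simps)
  finally show ?thesis .
qed

lemma nn_integral_linear3:
  fixes f g h :: "'a \<Rightarrow> real"
  assumes [measurable]: "f \<in> borel_measurable M" "g \<in> borel_measurable M" "h \<in> borel_measurable M"
    and "\<And>x. 0 \<le> f x" "\<And>x. 0 \<le> g x" "\<And>x. 0 \<le> h x" "0 \<le> c"
  shows "(\<integral>\<^sup>+x. ennreal (c * (12 * f x + 3 * g x + 3 * h x)) \<partial>M) =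
    ennreal c * (12 * (\<integral>\<^sup>+x. ennreal (f x) \<partial>M) + 3 * (\<integral>\<^sup>+x. ennreal (g x) \<partial>M) + 3 * (\<integral>\<^sup>+x. ennreal (h x) \<partial>M))"
proof -
  have "ennreal (c * (12 * f x + 3 * g x + 3 * h x)) = ennreal c * (12 * ennreal (f x) + 3 * ennreal (g x) + 3 * ennreal (h x))" for x
    using assms(4-7) by (simp add: ennreal_mult')
  then show ?thesis by (simp add: nn_integral_cmult nn_integral_add)
qed

text \<open>Dividing by \<^term>\<open>angle_deriv \<beta>\<close> gives a weighted bound from which both the
  \<open>L\<^sup>1\<close> and the \<open>L\<^sup>2\<close> bound on the line follow.\<close>

lemma wave_deriv_sum_weighted_bound:
  assumes "\<beta> > 0"
  obtains C where "C \<ge> 0"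
    "\<And>A a. finite A \<Longrightarrow>
      (\<integral>\<^sup>+x. ennreal ((norm (\<Sum>k\<in>A. a k * wave_deriv \<beta> (Suc r) k x))\<^sup>2 / angle_deriv \<beta> x) \<partial>lborel)
      \<le> ennreal (C * (\<Sum>k\<in>A. (1 + real_of_int \<bar>k\<bar>) ^ (2 * Suc r) * (norm (a k))\<^sup>2))"
proof (induction r arbitrary: thesis)
  case 0
  show ?case
  proof (rule 0[of "2 * pi"])
    fix A :: "int set" and a :: "int \<Rightarrow> complex" assume A: "finite A"
    \<comment> \<open>The squared derivative carries two factors \<open>\<tau>'\<close>; dividing by
      one leaves the weight of Parseval's identity.\<close>
    have "(norm (\<Sum>k\<in>A. a k * wave_deriv \<beta> (Suc 0) k x))\<^sup>2 / angle_deriv \<beta> x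
       = angle_deriv \<beta> x * (norm (\<Sum>k\<in>A. (of_int k * a k) * wave \<beta> k x))\<^sup>2" for x
    proof -
      have "(\<Sum>k\<in>A. a k * wave_deriv \<beta> (Suc 0) k x) =
         \<i> * of_real (angle_deriv \<beta> x) * (\<Sum>k\<in>A. (of_int k * a k) * wave \<beta> k x)"
        unfolding wave_deriv_1[OF assms] sum_distrib_left by (intro sum.cong refl) (simp add: mult_ac)
      then have "norm (\<Sum>k\<in>A. a k * wave_deriv \<beta> (Suc 0) k x)
          = angle_deriv \<beta> x * norm (\<Sum>k\<in>A. (of_int k * a k) * wave \<beta> k x)"
        using angle_deriv_pos[OF assms, of x] by (simp add: norm_mult)
      then show ?thesis using angle_deriv_pos[OF assms, of x] by (simp add: power2_eq_square)
    qed
    then have "(\<integral>\<^sup>+x. ennreal ((norm (\<Sum>k\<in>A. a k * wave_deriv \<beta> (Suc 0) k x))\<^sup>2 / angle_deriv \<beta> x) \<partial>lborel)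
      = ennreal (2 * pi * (\<Sum>k\<in>A. (norm (of_int k * a k))\<^sup>2))"
      by (simp only: wave_parseval[OF assms A])
    also have "\<dots> \<le> ennreal (2 * pi * (\<Sum>k\<in>A. (1 + real_of_int \<bar>k\<bar>) ^ (2 * Suc 0) * (norm (a k))\<^sup>2))"
      by (intro ennreal_leI mult_left_mono sum_mono) (auto simp: norm_mult power_mult_distrib abs_le_square_iff[symmetric] simp flip: power2_eq_square intro!: mult_right_mono)
    finally show "(\<integral>\<^sup>+x. ennreal ((norm (\<Sum>k\<in>A. a k * wave_deriv \<beta> (Suc 0) k x))\<^sup>2 / angle_deriv \<beta> x) \<partial>lborel)
      \<le> ennreal (2 * pi * (\<Sum>k\<in>A. (1 + real_of_int \<bar>k\<bar>) ^ (2 * Suc 0) * (norm (a k))\<^sup>2))" .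
  qed simp
next
  case (Suc r)
  let ?W = "\<lambda>r A a x. \<Sum>k\<in>A. a k * wave_deriv \<beta> r k x"
  let ?N = "\<lambda>r A a. \<Sum>k\<in>A. (1 + real_of_int \<bar>k\<bar>) ^ (2 * r) * (norm (a k))\<^sup>2"
  let ?I = "\<lambda>r A a. \<integral>\<^sup>+x. ennreal ((norm (?W r A a x))\<^sup>2 / angle_deriv \<beta> x) \<partial>lborel"
  obtain C where C: "C \<ge> 0" "\<And>A a. finite A \<Longrightarrow> ?I (Suc r) A a \<le> ennreal (C * ?N (Suc r) A a)"
    using Suc.IH by blast
  \<comment> \<open>\<open>?c\<close> is the square of 1 / (2 \<beta>), and \<open>?d\<close> is the
    cost of replacing a neighbouring frequency by k in the weight. The 18 below is 12 + 3 + 3 from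
    \<open>norm_sum3_sq_le\<close>.\<close>
  let ?c = "1 / (4 * \<beta>\<^sup>2)" and ?d = "2 ^ (2 * Suc r) :: real"
  show ?case
  proof (rule Suc.prems[of "?c * (18 * (C * ?d))"])
    show "0 \<le> ?c * (18 * (C * ?d))" using C assms by simp
    fix A :: "int set" and a :: "int \<Rightarrow> complex" assume A: "finite A"
    \<comment> \<open>\<open>b\<close> absorbs the factor k of the recursion. Shifting the index
      turns the two neighbouring sums into sums of the same kind over \<open>?P\<close> and
      \<open>?M\<close>, to which the induction hypothesis applies.\<close>
    define b where "b k = of_int k * a k" for k
    let ?P = "(\<lambda>k. k + 1) ` A" and ?M = "(\<lambda>k. k - 1) ` A"
    let ?bp = "\<lambda>k. b (k - 1)" and ?bm = "\<lambda>k. b (k + 1)"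
    have P: "(\<Sum>k\<in>A. b k * wave_deriv \<beta> (Suc r) (k + 1) x) = ?W (Suc r) ?P ?bp x" for x
      by (subst sum.reindex) (auto simp: inj_on_def)
    have M: "(\<Sum>k\<in>A. b k * wave_deriv \<beta> (Suc r) (k - 1) x) = ?W (Suc r) ?M ?bm x" for x
      by (subst sum.reindex) (auto simp: inj_on_def)
    have e: "?W (Suc (Suc r)) A a x = \<i> / (2 * of_real \<beta>) *
       (2 * ?W (Suc r) A b x - ?W (Suc r) ?P ?bp x - ?W (Suc r) ?M ?bm x)" for x
    proof -
      have "?W (Suc (Suc r)) A a x = (\<Sum>k\<in>A. \<i> / (2 * of_real \<beta>) *
         (2 * (b k * wave_deriv \<beta> (Suc r) k x) - b k * wave_deriv \<beta> (Suc r) (k + 1) x - b k * wave_deriv \<beta> (Suc r) (k - 1) x))"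
        unfolding wave_deriv.simps(2)[of _ "Suc r"] b_def by (intro sum.cong refl) (simp add: algebra_simps)
      then show ?thesis unfolding P[symmetric] M[symmetric]
        by (simp only: sum_distrib_left[symmetric] sum_subtractf)
    qed
    have ne: "(norm (?W (Suc (Suc r)) A a x))\<^sup>2 = ?c * (norm (2 * ?W (Suc r) A b x - ?W (Suc r) ?P ?bp x - ?W (Suc r) ?M ?bm x))\<^sup>2" for x
      unfolding e norm_mult norm_divide using assms by (simp add: power_divide power_mult_distrib)
    have pt: "(norm (?W (Suc (Suc r)) A a x))\<^sup>2 / angle_deriv \<beta> x \<le>
       ?c * (12 * ((norm (?W (Suc r) A b x))\<^sup>2 / angle_deriv \<beta> x) + 3 * ((norm (?W (Suc r) ?P ?bp x))\<^sup>2 / angle_deriv \<beta> x)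
         + 3 * ((norm (?W (Suc r) ?M ?bm x))\<^sup>2 / angle_deriv \<beta> x))" for x
    proof -
      let ?X = "?W (Suc r) A b x" and ?Y = "?W (Suc r) ?P ?bp x" and ?Z = "?W (Suc r) ?M ?bm x"
      have "(norm (2 * ?X - ?Y - ?Z))\<^sup>2 / angle_deriv \<beta> x
        \<le> (12 * (norm ?X)\<^sup>2 + 3 * (norm ?Y)\<^sup>2 + 3 * (norm ?Z)\<^sup>2) / angle_deriv \<beta> x"
        using angle_deriv_pos[OF assms, of x] by (intro divide_right_mono norm_sum3_sq_le) simp
      then have "?c * ((norm (2 * ?X - ?Y - ?Z))\<^sup>2 / angle_deriv \<beta> x)
        \<le> ?c * ((12 * (norm ?X)\<^sup>2 + 3 * (norm ?Y)\<^sup>2 + 3 * (norm ?Z)\<^sup>2) / angle_deriv \<beta> x)"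
        by (rule mult_left_mono) simp
      then show ?thesis unfolding ne by (simp only: add_divide_distrib times_divide_eq_right)
    qed
    have nn: "0 \<le> (norm (?W r A a x))\<^sup>2 / angle_deriv \<beta> x" for r A a x
      using angle_deriv_pos[OF assms, of x] by simp
    have w: "(1 + real_of_int \<bar>m\<bar>) ^ (2 * Suc r) * (norm (b k))\<^sup>2 \<le>
       ?d * ((1 + real_of_int \<bar>k\<bar>) ^ (2 * Suc (Suc r)) * (norm (a k))\<^sup>2)" if "\<bar>m\<bar> \<le> \<bar>k\<bar> + 1" for m k
    proof -
      have "real_of_int \<bar>m\<bar> \<le> real_of_int (\<bar>k\<bar> + 1)" using that of_int_le_iff by blast
      then have "(1 + real_of_int \<bar>m\<bar>) ^ (2 * Suc r) \<le> (2 * (1 + real_of_int \<bar>k\<bar>)) ^ (2 * Suc r)"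
        by (intro power_mono) auto
      moreover have "(norm (b k))\<^sup>2 \<le> (1 + real_of_int \<bar>k\<bar>)\<^sup>2 * (norm (a k))\<^sup>2"
        unfolding b_def norm_mult power_mult_distrib by (intro mult_right_mono power_mono) auto
      ultimately have "(1 + real_of_int \<bar>m\<bar>) ^ (2 * Suc r) * (norm (b k))\<^sup>2 \<le>
         (2 * (1 + real_of_int \<bar>k\<bar>)) ^ (2 * Suc r) * ((1 + real_of_int \<bar>k\<bar>)\<^sup>2 * (norm (a k))\<^sup>2)"
        by (intro mult_mono) auto
      also have "\<dots> = ?d * ((1 + real_of_int \<bar>k\<bar>) ^ (2 * Suc (Suc r)) * (norm (a k))\<^sup>2)"
        unfolding power_mult_distrib by (simp add: power_add[symmetric] mult_ac power2_eq_square)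
      finally show ?thesis .
    qed
    have NP: "?N (Suc r) ?P ?bp = (\<Sum>k\<in>A. (1 + real_of_int \<bar>k + 1\<bar>) ^ (2 * Suc r) * (norm (b k))\<^sup>2)"
      by (subst sum.reindex) (auto simp: inj_on_def)
    have NM: "?N (Suc r) ?M ?bm = (\<Sum>k\<in>A. (1 + real_of_int \<bar>k - 1\<bar>) ^ (2 * Suc r) * (norm (b k))\<^sup>2)"
      by (subst sum.reindex) (auto simp: inj_on_def)
    have bN: "?N (Suc r) A b \<le> ?d * ?N (Suc (Suc r)) A a" "?N (Suc r) ?P ?bp \<le> ?d * ?N (Suc (Suc r)) A a"
      "?N (Suc r) ?M ?bm \<le> ?d * ?N (Suc (Suc r)) A a"
      unfolding NP NM sum_distrib_left by (intro sum_mono w; simp)+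
    have I: "?I (Suc r) A b \<le> ennreal (C * ?d * ?N (Suc (Suc r)) A a)"
       "?I (Suc r) ?P ?bp \<le> ennreal (C * ?d * ?N (Suc (Suc r)) A a)"
       "?I (Suc r) ?M ?bm \<le> ennreal (C * ?d * ?N (Suc (Suc r)) A a)"
      using A C(1) unfolding mult.assoc
      by (intro order_trans[OF C(2)] ennreal_leI mult_left_mono bN[unfolded mult.assoc]; simp)+
    have "?I (Suc (Suc r)) A a \<le> (\<integral>\<^sup>+x. ennreal (?c * (12 * ((norm (?W (Suc r) A b x))\<^sup>2 / angle_deriv \<beta> x) + 3 * ((norm (?W (Suc r) ?P ?bp x))\<^sup>2 / angle_deriv \<beta> x)
         + 3 * ((norm (?W (Suc r) ?M ?bm x))\<^sup>2 / angle_deriv \<beta> x))) \<partial>lborel)"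
      by (intro nn_integral_mono ennreal_leI pt)
    also have "\<dots> = ennreal ?c * (12 * ?I (Suc r) A b + 3 * ?I (Suc r) ?P ?bp + 3 * ?I (Suc r) ?M ?bm)"
      using nn by (intro nn_integral_linear3) (simp_all)
    also have "\<dots> \<le> ennreal ?c * (12 * ennreal (C * ?d * ?N (Suc (Suc r)) A a)
       + 3 * ennreal (C * ?d * ?N (Suc (Suc r)) A a) + 3 * ennreal (C * ?d * ?N (Suc (Suc r)) A a))"
      by (intro mult_left_mono add_mono I) auto
    also have "\<dots> = ennreal (?c * (18 * (C * ?d)) * ?N (Suc (Suc r)) A a)"
    proof -
      have "ennreal ?c * (12 * ennreal y + 3 * ennreal y + 3 * ennreal y) = ennreal (?c * (18 * y))" if "y \<ge> 0" for y
      proof -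
        have "12 * ennreal y + 3 * ennreal y + 3 * ennreal y = 18 * ennreal y" by (simp flip: distrib_right)
        also have "\<dots> = ennreal (18 * y)" using that by (simp add: ennreal_mult')
        finally show ?thesis using ennreal_mult'[of ?c "18 * y"] by simp
      qed
      from this[of "C * ?d * ?N (Suc (Suc r)) A a"] C(1) show ?thesis
        by (simp add: sum_nonneg mult_ac)
    qed
    finally show "?I (Suc (Suc r)) A a \<le> ennreal (?c * (18 * (C * ?d)) * ?N (Suc (Suc r)) A a)" .
  qed
qed

lemma wave_deriv_sum_L2_bound:
  assumes "\<beta> > 0"
  obtains C where "C \<ge> 0"
    "\<And>A a. finite A \<Longrightarrow>
      (\<integral>\<^sup>+x. ennreal ((norm (\<Sum>k\<in>A. a k * wave_deriv \<beta> (Suc r) k x))\<^sup>2) \<partial>lborel)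
      \<le> ennreal (C * (\<Sum>k\<in>A. (1 + real_of_int \<bar>k\<bar>) ^ (2 * Suc r) * (norm (a k))\<^sup>2))"
proof -
  obtain C where C: "C \<ge> 0"
    "\<And>A a. finite A \<Longrightarrow>
      (\<integral>\<^sup>+x. ennreal ((norm (\<Sum>k\<in>A. a k * wave_deriv \<beta> (Suc r) k x))\<^sup>2 / angle_deriv \<beta> x) \<partial>lborel)
      \<le> ennreal (C * (\<Sum>k\<in>A. (1 + real_of_int \<bar>k\<bar>) ^ (2 * Suc r) * (norm (a k))\<^sup>2))"
    using wave_deriv_sum_weighted_bound[OF assms] by blast
  show ?thesis
  proof (rule that[of "2 / \<beta> * C"])
    show "0 \<le> 2 / \<beta> * C" using C assms by simp
    fix A :: "int set" and a :: "int \<Rightarrow> complex" assume A: "finite A"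
    let ?W = "\<lambda>x. \<Sum>k\<in>A. a k * wave_deriv \<beta> (Suc r) k x"
    let ?N = "\<Sum>k\<in>A. (1 + real_of_int \<bar>k\<bar>) ^ (2 * Suc r) * (norm (a k))\<^sup>2"
    have pt: "(norm (?W x))\<^sup>2 \<le> 2 / \<beta> * ((norm (?W x))\<^sup>2 / angle_deriv \<beta> x)" for x
    proof -
      have "angle_deriv \<beta> x * ((norm (?W x))\<^sup>2 / angle_deriv \<beta> x) \<le> 2 / \<beta> * ((norm (?W x))\<^sup>2 / angle_deriv \<beta> x)"
        using angle_deriv_pos[OF assms, of x] by (intro mult_right_mono angle_deriv_le assms) simp
      then show ?thesis using angle_deriv_pos[OF assms, of x] by simp
    qed
    have "(\<integral>\<^sup>+x. ennreal ((norm (?W x))\<^sup>2) \<partial>lborel) \<le> (\<integral>\<^sup>+x. ennreal (2 / \<beta>) * ennreal ((norm (?W x))\<^sup>2 / angle_deriv \<beta> x) \<partial>lborel)"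
      using pt assms by (intro nn_integral_mono) (simp add: ennreal_leI flip: ennreal_mult')
    also have "\<dots> = ennreal (2 / \<beta>) * (\<integral>\<^sup>+x. ennreal ((norm (?W x))\<^sup>2 / angle_deriv \<beta> x) \<partial>lborel)"
      by (intro nn_integral_cmult) measurable
    also have "\<dots> \<le> ennreal (2 / \<beta>) * ennreal (C * ?N)"
      by (intro mult_left_mono C A) auto
    also have "\<dots> = ennreal (2 / \<beta> * C * ?N)"
      using assms by (simp add: mult.assoc flip: ennreal_mult')
    finally show "(\<integral>\<^sup>+x. ennreal ((norm (?W x))\<^sup>2) \<partial>lborel) \<le> ennreal (2 / \<beta> * C * ?N)" .
  qed
qed

lemma mult_le_sum_squares: "0 \<le> a \<Longrightarrow> 0 \<le> b \<Longrightarrow> a * b \<le> a\<^sup>2 + (b::real)\<^sup>2"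
  using sum_squares_bound[of a b] mult_nonneg_nonneg[of a b] by linarith

text \<open>Pointwise |W| \<le> |W|^2 / (X \<open>\<tau>'\<close>) + X \<open>\<tau>'\<close>;
  integrated, the first part is the weighted bound and the second is 2 pi X. The free scale X stands
  for the size of the coefficients and avoids division by a norm that may be zero.\<close>

lemma wave_deriv_sum_L1_bound:
  assumes "\<beta> > 0"
  obtains C where "C \<ge> 0"
    "\<And>A a X. finite A \<Longrightarrow> X > 0 \<Longrightarrow> (\<Sum>k\<in>A. (1 + real_of_int \<bar>k\<bar>) ^ (2 * Suc r) * (norm (a k))\<^sup>2) \<le> X\<^sup>2 \<Longrightarrow>
      (\<integral>\<^sup>+x. ennreal (norm (\<Sum>k\<in>A. a k * wave_deriv \<beta> (Suc r) k x)) \<partial>lborel) \<le> ennreal (C * X)"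
proof -
  obtain C where C: "C \<ge> 0"
    "\<And>A a. finite A \<Longrightarrow>
      (\<integral>\<^sup>+x. ennreal ((norm (\<Sum>k\<in>A. a k * wave_deriv \<beta> (Suc r) k x))\<^sup>2 / angle_deriv \<beta> x) \<partial>lborel)
      \<le> ennreal (C * (\<Sum>k\<in>A. (1 + real_of_int \<bar>k\<bar>) ^ (2 * Suc r) * (norm (a k))\<^sup>2))"
    using wave_deriv_sum_weighted_bound[OF assms] by blast
  show ?thesis
  proof (rule that[of "C + 2 * pi"])
    show "0 \<le> C + 2 * pi" using C by simp
    fix A :: "int set" and a :: "int \<Rightarrow> complex" and X :: real
    let ?W = "\<lambda>x. \<Sum>k\<in>A. a k * wave_deriv \<beta> (Suc r) k x"
    let ?N = "\<Sum>k\<in>A. (1 + real_of_int \<bar>k\<bar>) ^ (2 * Suc r) * (norm (a k))\<^sup>2"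
    assume A: "finite A" and X: "X > 0" "?N \<le> X\<^sup>2"
    have pt: "norm (?W x) \<le> (1 / X) * ((norm (?W x))\<^sup>2 / angle_deriv \<beta> x) + X * angle_deriv \<beta> x" for x
    proof -
      have p: "angle_deriv \<beta> x > 0" by (rule angle_deriv_pos[OF assms])
      let ?n = "norm (?W x)" and ?t = "angle_deriv \<beta> x * X"
      have t: "?t > 0" using p X by simp
      have "?n * ?t \<le> ?n\<^sup>2 + ?t\<^sup>2"
        by (rule mult_le_sum_squares) (use t in simp_all)
      then have "?n \<le> (?n\<^sup>2 + ?t\<^sup>2) / ?t" using t by (simp add: pos_le_divide_eq)
      also have "\<dots> = (1 / X) * (?n\<^sup>2 / angle_deriv \<beta> x) + X * angle_deriv \<beta> x"
        using p X by (simp add: add_divide_distrib power2_eq_square mult_ac)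
      finally show ?thesis .
    qed
    have "(\<integral>\<^sup>+x. ennreal (norm (?W x)) \<partial>lborel) \<le> (\<integral>\<^sup>+x. ennreal (1 / X) * ennreal ((norm (?W x))\<^sup>2 / angle_deriv \<beta> x)
        + ennreal X * ennreal (angle_deriv \<beta> x) \<partial>lborel)"
    proof (intro nn_integral_mono)
      fix x
      have p: "angle_deriv \<beta> x > 0" by (rule angle_deriv_pos[OF assms])
      show "ennreal (norm (?W x)) \<le> ennreal (1 / X) * ennreal ((norm (?W x))\<^sup>2 / angle_deriv \<beta> x)
        + ennreal X * ennreal (angle_deriv \<beta> x)"
        using pt[of x] p X(1) by (simp add: ennreal_leI flip: ennreal_mult' ennreal_plus)
    qed
    also have "\<dots> = ennreal (1 / X) * (\<integral>\<^sup>+x. ennreal ((norm (?W x))\<^sup>2 / angle_deriv \<beta> x) \<partial>lborel)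
        + ennreal X * (\<integral>\<^sup>+x. ennreal (angle_deriv \<beta> x) \<partial>lborel)"
      by (simp add: nn_integral_add nn_integral_cmult)
    also have "(\<integral>\<^sup>+x. ennreal (angle_deriv \<beta> x) \<partial>lborel) = ennreal (2 * pi)"
      using angle_deriv_integral[OF assms] angle_deriv_pos[OF assms] by (simp add: nn_integral_eq_integral less_imp_le)
    also have "ennreal (1 / X) * (\<integral>\<^sup>+x. ennreal ((norm (?W x))\<^sup>2 / angle_deriv \<beta> x) \<partial>lborel) + ennreal X * ennreal (2 * pi)
       \<le> ennreal (1 / X) * ennreal (C * X\<^sup>2) + ennreal X * ennreal (2 * pi)"
      using X(2) C(1) by (intro add_right_mono mult_left_mono order_trans[OF C(2)[OF A]] ennreal_leI) auto
    also have "\<dots> = ennreal ((C + 2 * pi) * X)"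
      using X(1) C(1) by (simp add: power2_eq_square algebra_simps flip: ennreal_mult' ennreal_plus)
    finally show "(\<integral>\<^sup>+x. ennreal (norm (?W x)) \<partial>lborel) \<le> ennreal ((C + 2 * pi) * X)" .
  qed
qed

section \<open>The square norm of a power minus one\<close>

lemma wave_minus_one_eq:
  "wave \<beta> (int m) x - 1 = (wave \<beta> 1 x - 1) * (\<Sum>k\<in>{0..<int m}. 1 * wave \<beta> k x)"
proof (induction m)
  case (Suc m)
  have "{0..<int (Suc m)} = insert (int m) {0..<int m}" by auto
  then have "(wave \<beta> 1 x - 1) * (\<Sum>k\<in>{0..<int (Suc m)}. 1 * wave \<beta> k x)
     = (wave \<beta> 1 x - 1) * wave \<beta> (int m) x + (wave \<beta> (int m) x - 1)"
    using Suc by (simp add: distrib_left)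
  then show ?case using wave_add[of \<beta> "int m" 1 x] by (simp add: algebra_simps)
qed simp

text \<open>Factoring M^k - 1 as (M - 1)(1 + ... + M^(k-1)) turns Lebesgue measure into the weight,
  as |M - 1|^2 = 2 \<beta> \<open>\<tau>'\<close>. Parseval then counts |k| coefficients equal to 1;
  negative k follow by conjugation.\<close>

lemma wave_minus_one_sq_integral:
  assumes "\<beta> > 0"
  shows "integrable lborel (\<lambda>x. (norm (wave \<beta> k x - 1))\<^sup>2)"
    "(LINT x|lborel. (norm (wave \<beta> k x - 1))\<^sup>2) = 4 * pi * \<beta> * real_of_int \<bar>k\<bar>"
proof -
  define m where "m = nat \<bar>k\<bar>"
  have n1: "(norm (wave \<beta> 1 x - 1))\<^sup>2 = 2 * \<beta> * angle_deriv \<beta> x" for x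
  proof -
    have "(norm (wave \<beta> 1 x - 1))\<^sup>2 = 2 * (1 - cos (angle \<beta> x))"
      using sin_cos_squared_add[of "angle \<beta> x"]
      by (simp add: wave_def cmod_power2 power2_diff)
    then show ?thesis unfolding one_minus_cos_angle[OF assms] by simp
  qed
  have "norm (wave \<beta> k x - 1) = norm (wave \<beta> (int m) x - 1)" for x
  proof (cases "k \<ge> 0")
    case False
    then have "k = - int m" unfolding m_def by auto
    then have "wave \<beta> k x - 1 = cnj (wave \<beta> (int m) x - 1)" by (simp add: cnj_wave)
    then show ?thesis by (simp only: complex_mod_cnj)
  qed (simp add: m_def)
  then have e: "(norm (wave \<beta> k x - 1))\<^sup>2 = 2 * \<beta> * (angle_deriv \<beta> x * (norm (\<Sum>k\<in>{0..<int m}. 1 * wave \<beta> k x))\<^sup>2)" for x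
    by (simp only: wave_minus_one_eq norm_mult power_mult_distrib n1 mult.assoc)
  have "(\<integral>\<^sup>+x. ennreal ((norm (wave \<beta> k x - 1))\<^sup>2) \<partial>lborel) = ennreal (2 * \<beta>) * ennreal (2 * pi * (\<Sum>k\<in>{0..<int m}. (norm (1::complex))\<^sup>2))"
    unfolding e using assms by (simp add: ennreal_mult' nn_integral_cmult wave_parseval[OF assms, of "{0..<int m}" "\<lambda>_. 1", simplified])
  also have "\<dots> = ennreal (4 * pi * \<beta> * real_of_int \<bar>k\<bar>)"
    using assms unfolding m_def by (simp flip: ennreal_mult')
  finally have nn: "(\<integral>\<^sup>+x. ennreal ((norm (wave \<beta> k x - 1))\<^sup>2) \<partial>lborel) = ennreal (4 * pi * \<beta> * real_of_int \<bar>k\<bar>)" .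
  show "integrable lborel (\<lambda>x. (norm (wave \<beta> k x - 1))\<^sup>2)"
    by (rule integrableI_nonneg) (use nn in simp_all)
  show "(LINT x|lborel. (norm (wave \<beta> k x - 1))\<^sup>2) = 4 * pi * \<beta> * real_of_int \<bar>k\<bar>"
    using nn assms by (subst integral_eq_nn_integral) auto
qed

section \<open>Plancherel's inequality and the Fourier transform of a square-integrable function\<close>

lemma borel_measurable_cis [measurable]: "cis \<in> borel_measurable borel"
  by (intro borel_measurable_continuous_onI continuous_intros)

text \<open>The transform as a plain integral, meaningful for integrable functions; the
  square-integrable case is reached from it by truncation.\<close>

definition ft :: "(real \<Rightarrow> complex) \<Rightarrow> real \<Rightarrow> complex" where
  "ft h \<xi> = (LINT x|lborel. cis (- (\<xi> * x)) * h x)"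

definition truncate :: "real \<Rightarrow> (real \<Rightarrow> complex) \<Rightarrow> real \<Rightarrow> complex" where
  "truncate R u x = indicator {-R..R} x *\<^sub>R u x"

lemma borel_measurable_truncate [measurable]:
  assumes [measurable]: "u \<in> borel_measurable borel" shows "truncate R u \<in> borel_measurable borel"
  unfolding truncate_def[abs_def] by measurable

lemma borel_measurable_ft [measurable]:
  assumes [measurable]: "h \<in> borel_measurable borel" shows "ft h \<in> borel_measurable borel"
  unfolding ft_def[abs_def] by measurable

lemma integrable_cis_mult:
  assumes "integrable lborel h" shows "integrable lborel (\<lambda>x. cis (- (\<xi> * x)) * h x)"
proof -
  have [measurable]: "h \<in> borel_measurable borel" using assms by auto
  show ?thesis by (rule Bochner_Integration.integrable_bound[OF assms]) (auto simp: norm_mult)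
qed

lemma ft_truncate: "ft (truncate R u) \<xi> = (LINT x:{-R..R}|lborel. cis (- (\<xi> * x)) * u x)"
  unfolding ft_def truncate_def set_lebesgue_integral_def by simp

lemma norm_ft_le:
  assumes "integrable lborel h" shows "norm (ft h \<xi>) \<le> (LINT x|lborel. norm (h x))"
proof -
  have "norm (ft h \<xi>) \<le> (LINT x|lborel. norm (cis (- (\<xi> * x)) * h x))"
    unfolding ft_def by (rule integral_norm_bound)
  then show ?thesis by (simp add: norm_mult)
qed

lemma norm_diff_sq: "(norm (a - b :: complex))\<^sup>2 = (norm a)\<^sup>2 - 2 * Re (cnj b * a) + (norm b)\<^sup>2"
  unfolding cmod_power2 by (simp add: power2_eq_square algebra_simps)

section \<open>Bessel's inequality and functions of bounded support\<close>

text \<open>Integrates |h - S|^2 \<ge> 0 for the orthogonal projection \<open>S\<close> of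
  \<open>h\<close>. All members of the family have the same squared norm c, as exponentials on an
  interval do.\<close>

lemma finite_bessel:
  fixes h :: "'a \<Rightarrow> complex" and \<phi> :: "'b \<Rightarrow> 'a \<Rightarrow> complex"
  assumes "finite A" "c > 0"
    and h2: "integrable M (\<lambda>x. (norm (h x))\<^sup>2)"
    and h\<phi>: "\<And>k. k \<in> A \<Longrightarrow> integrable M (\<lambda>x. cnj (\<phi> k x) * h x)"
    and orth: "\<And>k l. k \<in> A \<Longrightarrow> l \<in> A \<Longrightarrow>
       has_bochner_integral M (\<lambda>x. \<phi> k x * cnj (\<phi> l x)) (if k = l then of_real c else 0)"
  shows "(\<Sum>k\<in>A. (norm (LINT x|M. cnj (\<phi> k x) * h x))\<^sup>2) \<le> c * (LINT x|M. (norm (h x))\<^sup>2)"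
proof -
  define b where "b k = (LINT x|M. cnj (\<phi> k x) * h x)" for k
  define S where "S x = (\<Sum>k\<in>A. (b k / of_real c) * \<phi> k x)" for x
  let ?B = "\<Sum>k\<in>A. (norm (b k))\<^sup>2"
  have 1: "has_bochner_integral M (\<lambda>x. cnj (S x) * h x) (of_real (?B / c))"
  proof -
    have e: "cnj (S x) * h x = (\<Sum>k\<in>A. (cnj (b k) / of_real c) * (cnj (\<phi> k x) * h x))" for x
      unfolding S_def cnj_sum sum_distrib_right by (intro sum.cong refl) (simp add: mult_ac)
    have "has_bochner_integral M (\<lambda>x. cnj (S x) * h x) (\<Sum>k\<in>A. (cnj (b k) / of_real c) * b k)"
      unfolding e by (intro has_bochner_integral_sum has_bochner_integral_mult_right)
        (simp add: has_bochner_integral_iff h\<phi> b_def)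
    also have "(\<Sum>k\<in>A. (cnj (b k) / of_real c) * b k) = of_real (?B / c)"
      by (simp add: sum_divide_distrib complex_norm_square[symmetric] mult.commute)
    finally show ?thesis .
  qed
  have 2: "has_bochner_integral M (\<lambda>x. of_real ((norm (S x))\<^sup>2)) (of_real (?B / c) :: complex)"
  proof -
    have e: "of_real ((norm (S x))\<^sup>2) = (\<Sum>k\<in>A. \<Sum>l\<in>A. (b k * cnj (b l) / (of_real c)\<^sup>2) * (\<phi> k x * cnj (\<phi> l x)))" for x
      unfolding S_def complex_norm_square cnj_sum sum_product
      by (intro sum.cong refl) (simp add: power2_eq_square mult_ac)
    have "has_bochner_integral M (\<lambda>x. of_real ((norm (S x))\<^sup>2))
       (\<Sum>k\<in>A. \<Sum>l\<in>A. (b k * cnj (b l) / (of_real c)\<^sup>2) * (if k = l then of_real c else 0))"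
      unfolding e by (intro has_bochner_integral_sum has_bochner_integral_mult_right orth)
    also have "(\<Sum>k\<in>A. \<Sum>l\<in>A. (b k * cnj (b l) / (of_real c)\<^sup>2) * (if k = l then of_real c else 0)) =
       (\<Sum>k\<in>A. \<Sum>l\<in>A. if k = l then b k * cnj (b l) / of_real c else 0)"
      using \<open>c > 0\<close> by (intro sum.cong refl) (auto simp: power2_eq_square)
    also have "\<dots> = (\<Sum>k\<in>A. b k * cnj (b k) / of_real c)"
      using \<open>finite A\<close> by (intro sum.cong refl) (simp add: sum.delta)
    also have "\<dots> = of_real (?B / c)"
      by (simp add: sum_divide_distrib complex_norm_square[symmetric] mult.commute)
    finally show ?thesis .
  qed
  have 3: "has_bochner_integral M (\<lambda>x. (norm (S x))\<^sup>2) (?B / c)"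
    using has_bochner_integral_Re[OF 2] by (simp only: Re_complex_of_real)
  have 4: "has_bochner_integral M (\<lambda>x. Re (cnj (S x) * h x)) (?B / c)"
    using has_bochner_integral_Re[OF 1] by (simp only: Re_complex_of_real)
  have 5: "has_bochner_integral M (\<lambda>x. (norm (h x))\<^sup>2) (LINT x|M. (norm (h x))\<^sup>2)"
    using h2 by (simp add: has_bochner_integral_iff)
  have "has_bochner_integral M (\<lambda>x. (norm (h x))\<^sup>2 - 2 * Re (cnj (S x) * h x) + (norm (S x))\<^sup>2)
      ((LINT x|M. (norm (h x))\<^sup>2) - 2 * (?B / c) + ?B / c)"
    by (intro has_bochner_integral_add has_bochner_integral_diff has_bochner_integral_mult_right 3 4 5)
  then have "has_bochner_integral M (\<lambda>x. (norm (h x - S x))\<^sup>2) ((LINT x|M. (norm (h x))\<^sup>2) - ?B / c)"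
    unfolding norm_diff_sq by simp
  then have "(LINT x|M. (norm (h x - S x))\<^sup>2) = (LINT x|M. (norm (h x))\<^sup>2) - ?B / c"
    by (rule has_bochner_integral_integral_eq)
  moreover have "0 \<le> (LINT x|M. (norm (h x - S x))\<^sup>2)" by simp
  ultimately have "0 \<le> (LINT x|M. (norm (h x))\<^sup>2) - ?B / c" by linarith
  then show ?thesis using \<open>c > 0\<close> unfolding b_def by (simp add: field_simps)
qed

lemma has_vector_derivative_cis_mult:
  "((\<lambda>x. cis (a * x)) has_vector_derivative \<i> * of_real a * cis (a * x)) (at x within S)"
proof -
  have "((\<lambda>x. exp (\<i> * of_real a * complex_of_real x)) has_vector_derivative
      exp (\<i> * of_real a * of_real x) * (\<i> * of_real a)) (at x within S)"
    by (rule has_vector_derivative_real_field) (auto intro!: derivative_eq_intros)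
  then show ?thesis by (simp add: cis_conv_exp mult_ac)
qed

lemma cis_integral_period:
  assumes "L > 0"
  shows "has_bochner_integral lborel (\<lambda>x. indicator {-L..L} x *\<^sub>R cis (pi * of_int m / L * x)) (if m = 0 then of_real (2 * L) else 0)"
proof -
  let ?a = "pi * of_int m / L"
  have c: "continuous_on {-L..L} (\<lambda>x. cis (?a * x))" by (intro continuous_intros)
  have i: "integrable lborel (\<lambda>x. indicator {-L..L} x *\<^sub>R cis (?a * x))"
    using borel_integrable_atLeastAtMost'[OF c] by (simp add: set_integrable_def)
  moreover have "(LINT x|lborel. indicator {-L..L} x *\<^sub>R cis (?a * x)) = (if m = 0 then of_real (2 * L) else 0)"
  proof (cases "m = 0")
    case True
    have "(LINT x|lborel. indicator {-L..L} x *\<^sub>R (1::complex)) = complex_of_real L - complex_of_real (-L)"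
      by (rule integral_FTC_atLeastAtMost) (use assms in \<open>auto intro!: derivative_eq_intros\<close>)
    then show ?thesis using True by simp
  next
    case False
    then have a: "?a \<noteq> 0" using assms by simp
    have "(LINT x|lborel. indicator {-L..L} x *\<^sub>R cis (?a * x)) = cis (?a * L) / (\<i> * of_real ?a) - cis (?a * (-L)) / (\<i> * of_real ?a)"
    proof (rule integral_FTC_atLeastAtMost[OF _ _ c])
      show "((\<lambda>x. cis (?a * x) / (\<i> * of_real ?a)) has_vector_derivative cis (?a * x)) (at x within {-L..L})" for x
        using has_vector_derivative_divide[OF has_vector_derivative_cis_mult[of ?a x "{-L..L}"], of "\<i> * of_real ?a"] a
        by simp
    qed (use assms in simp)
    moreover have "cis (?a * L) = cis (?a * (-L))"
    proof -
      have "cis (?a * L) = cis (?a * (-L)) * cis (2 * pi * of_int m)"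
        using assms by (simp add: cis_mult field_simps)
      then show ?thesis by (simp add: cis_multiple_2pi)
    qed
    ultimately show ?thesis using False by simp
  qed
  ultimately show ?thesis by (simp add: has_bochner_integral_iff)
qed

text \<open>Values of the transform on a lattice of step pi / L are, up to a factor, Fourier
  coefficients of \<open>h\<close> on its supporting interval, twisted by the shift \<eta>. Bessel's
  inequality bounds them uniformly in \<eta>.\<close>

lemma bessel_ft_shift:
  assumes L: "L > 0" and [measurable]: "h \<in> borel_measurable borel"
    and supp: "\<And>x. x \<notin> {-L..L} \<Longrightarrow> h x = 0"
    and h1: "integrable lborel h" and h2: "integrable lborel (\<lambda>x. (norm (h x))\<^sup>2)" and "finite A"
  shows "(\<Sum>m\<in>A. (norm (ft h (\<eta> + of_int m * (pi / L))))\<^sup>2) \<le> 2 * L * (LINT x|lborel. (norm (h x))\<^sup>2)"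
proof -
  define \<phi> where "\<phi> m x = indicator {-L..L} x *\<^sub>R cis ((\<eta> + of_int m * (pi / L)) * x)" for m x
  have e: "cnj (\<phi> m x) * h x = cis (- ((\<eta> + of_int m * (pi / L)) * x)) * h x" for m x
    using supp[of x] by (cases "x \<in> {-L..L}") (auto simp: \<phi>_def cis_cnj)
  have "(\<Sum>m\<in>A. (norm (LINT x|lborel. cnj (\<phi> m x) * h x))\<^sup>2) \<le> (2 * L) * (LINT x|lborel. (norm (h x))\<^sup>2)"
  proof (rule finite_bessel[OF \<open>finite A\<close> _ h2])
    fix k l :: int
    show "integrable lborel (\<lambda>x. cnj (\<phi> k x) * h x)" unfolding e by (rule integrable_cis_mult[OF h1])
    have e': "\<phi> k x * cnj (\<phi> l x) = indicator {-L..L} x *\<^sub>R cis (pi * of_int (k - l) / L * x)" for x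
      by (simp add: \<phi>_def cis_cnj cis_mult algebra_simps diff_divide_distrib split: split_indicator)
    show "has_bochner_integral lborel (\<lambda>x. \<phi> k x * cnj (\<phi> l x)) (if k = l then of_real (2 * L) else 0)"
      unfolding e' using cis_integral_period[OF L, of "k - l"] by simp
  qed (use L in simp)
  then show ?thesis unfolding e ft_def .
qed

text \<open>The line is cut into cells of length \<delta>, indexed by the floor of \<xi> / \<delta>,
  and all cells are translated onto the first; the bound on the translated sums is integrated over
  that one cell. The bound concerns finite sums, so Fatou's lemma closes the argument.\<close>

lemma nn_integral_le_periodised:
  fixes u :: "real \<Rightarrow> ennreal"
  assumes [measurable]: "u \<in> borel_measurable borel" and \<delta>: "\<delta> > 0"
    and b: "\<And>\<eta> (N::nat). (\<Sum>m\<in>{-int N..int N}. u (\<eta> + of_int m * \<delta>)) \<le> B"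
  shows "(\<integral>\<^sup>+\<xi>. u \<xi> \<partial>lborel) \<le> ennreal \<delta> * B"
proof -
  let ?i = "\<lambda>m \<xi>. indicator {x. \<lfloor>x / \<delta>\<rfloor> = m} \<xi> :: ennreal"
  define S where "S N \<xi> = (\<Sum>m\<in>{-int N..int N}. u \<xi> * ?i m \<xi>)" for N \<xi>
  have Seq: "S N \<xi> = (if \<lfloor>\<xi> / \<delta>\<rfloor> \<in> {-int N..int N} then u \<xi> else 0)" for N \<xi>
  proof -
    have "S N \<xi> = (\<Sum>m\<in>{-int N..int N}. if m = \<lfloor>\<xi> / \<delta>\<rfloor> then u \<xi> else 0)"
      unfolding S_def by (intro sum.cong refl) (auto split: split_indicator)
    then show ?thesis by simp
  qed
  have [measurable]: "S N \<in> borel_measurable borel" for N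
    unfolding S_def[abs_def] by measurable
  have "(\<lambda>N. S N \<xi>) \<longlonglongrightarrow> u \<xi>" for \<xi>
  proof (rule tendsto_eventually)
    show "\<forall>\<^sub>F N in sequentially. S N \<xi> = u \<xi>"
      using eventually_ge_at_top[of "nat \<bar>\<lfloor>\<xi> / \<delta>\<rfloor>\<bar>"] by eventually_elim (auto simp: Seq)
  qed
  then have "liminf (\<lambda>N. S N \<xi>) = u \<xi>" for \<xi>
    by (intro lim_imp_Liminf) auto
  then have "(\<integral>\<^sup>+\<xi>. u \<xi> \<partial>lborel) = (\<integral>\<^sup>+\<xi>. liminf (\<lambda>N. S N \<xi>) \<partial>lborel)" by simp
  also have "\<dots> \<le> liminf (\<lambda>N. \<integral>\<^sup>+\<xi>. S N \<xi> \<partial>lborel)"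
    by (rule nn_integral_liminf) simp
  also have "\<dots> \<le> ennreal \<delta> * B"
  proof (rule Liminf_le[OF _ always_eventually], simp, rule allI)
    fix N
    have "(\<integral>\<^sup>+\<xi>. S N \<xi> \<partial>lborel) = (\<Sum>m\<in>{-int N..int N}. \<integral>\<^sup>+\<xi>. u \<xi> * ?i m \<xi> \<partial>lborel)"
      unfolding S_def by (rule nn_integral_sum) measurable
    also have "\<dots> = (\<Sum>m\<in>{-int N..int N}. \<integral>\<^sup>+\<eta>. u (\<eta> + of_int m * \<delta>) * ?i 0 \<eta> \<partial>lborel)"
    proof (intro sum.cong refl)
      fix m :: int
      have "(\<integral>\<^sup>+\<xi>. u \<xi> * ?i m \<xi> \<partial>lborel) = (\<integral>\<^sup>+\<eta>. u (of_int m * \<delta> + 1 * \<eta>) * ?i m (of_int m * \<delta> + 1 * \<eta>) \<partial>lborel)"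
        using nn_integral_real_affine[of "\<lambda>\<xi>. u \<xi> * ?i m \<xi>" 1 "of_int m * \<delta>"] by simp
      also have "\<dots> = (\<integral>\<^sup>+\<eta>. u (\<eta> + of_int m * \<delta>) * ?i 0 \<eta> \<partial>lborel)"
      proof (intro nn_integral_cong)
        fix \<eta> :: real
        have "\<lfloor>(of_int m * \<delta> + 1 * \<eta>) / \<delta>\<rfloor> = m + \<lfloor>\<eta> / \<delta>\<rfloor>"
          using \<delta> by (simp add: add_divide_distrib floor_add_int[symmetric] add.commute)
        then show "u (of_int m * \<delta> + 1 * \<eta>) * ?i m (of_int m * \<delta> + 1 * \<eta>) = u (\<eta> + of_int m * \<delta>) * ?i 0 \<eta>"
          by (auto simp: add.commute split: split_indicator)
      qed
      finally show "(\<integral>\<^sup>+\<xi>. u \<xi> * ?i m \<xi> \<partial>lborel) = (\<integral>\<^sup>+\<eta>. u (\<eta> + of_int m * \<delta>) * ?i 0 \<eta> \<partial>lborel)" .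
    qed
    also have "\<dots> = (\<integral>\<^sup>+\<eta>. (\<Sum>m\<in>{-int N..int N}. u (\<eta> + of_int m * \<delta>)) * ?i 0 \<eta> \<partial>lborel)"
      unfolding sum_distrib_right by (rule nn_integral_sum[symmetric]) measurable
    also have "\<dots> \<le> (\<integral>\<^sup>+\<eta>. B * ?i 0 \<eta> \<partial>lborel)"
      by (intro nn_integral_mono mult_right_mono b) simp
    also have "\<dots> = B * emeasure lborel {x. \<lfloor>x / \<delta>\<rfloor> = 0}"
      by (subst nn_integral_cmult_indicator) auto
    also have "{x. \<lfloor>x / \<delta>\<rfloor> = 0} = {0..<\<delta>}"
      using \<delta> by (auto simp: floor_eq_iff field_simps)
    also have "B * emeasure lborel {0..<\<delta>} = ennreal \<delta> * B"
      using \<delta> by (simp add: mult.commute)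
    finally show "(\<integral>\<^sup>+\<xi>. S N \<xi> \<partial>lborel) \<le> ennreal \<delta> * B" .
  qed
  finally show ?thesis .
qed

text \<open>The cell length pi / L times Bessel's constant 2 L is 2 pi: the size of the support
  drops out, so the support may later be let grow.\<close>

lemma ft_L2_le_compact:
  assumes L: "L > 0" and [measurable]: "h \<in> borel_measurable borel"
    and supp: "\<And>x. x \<notin> {-L..L} \<Longrightarrow> h x = 0"
  shows "(\<integral>\<^sup>+\<xi>. ennreal ((norm (ft h \<xi>))\<^sup>2) \<partial>lborel) \<le> ennreal (2 * pi) * (\<integral>\<^sup>+x. ennreal ((norm (h x))\<^sup>2) \<partial>lborel)"
proof (cases "(\<integral>\<^sup>+x. ennreal ((norm (h x))\<^sup>2) \<partial>lborel) = \<infinity>")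
  case True
  then show ?thesis by (simp add: ennreal_mult_top)
next
  case False
  then have h2: "integrable lborel (\<lambda>x. (norm (h x))\<^sup>2)"
    by (intro integrableI_nonneg) (auto simp: less_top)
  have h1: "integrable lborel h"
  proof (rule Bochner_Integration.integrable_bound)
    \<comment> \<open>On the support |h| \<le> 1 + |h|^2, so a square-integrable \<open>h\<close> is
      integrable.\<close>
    show "integrable lborel (\<lambda>x. indicator {-L..L} x + (norm (h x))\<^sup>2 :: real)"
      by (intro Bochner_Integration.integrable_add h2 integrable_real_indicator) (use L in \<open>simp_all add: emeasure_lborel_Icc_eq\<close>)
    have "norm (h x) \<le> indicator {-L..L} x + (norm (h x))\<^sup>2" for x
    proof (cases "x \<in> {-L..L}")
      case True
      then show ?thesis using sum_squares_bound[of "norm (h x)" 1] by (simp, smt (verit) norm_ge_zero)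
    qed (use supp in auto)
    then show "AE x in lborel. norm (h x) \<le> norm (indicator {-L..L} x + (norm (h x))\<^sup>2 :: real)"
      by (intro AE_I2) (smt (verit) real_norm_def)
  qed simp
  let ?I = "LINT x|lborel. (norm (h x))\<^sup>2"
  have I: "0 \<le> ?I" by simp
  have "(\<integral>\<^sup>+\<xi>. ennreal ((norm (ft h \<xi>))\<^sup>2) \<partial>lborel) \<le> ennreal (pi / L) * ennreal (2 * L * ?I)"
  proof (rule nn_integral_le_periodised)
    fix \<eta> :: real and N :: nat
    show "(\<Sum>m\<in>{-int N..int N}. ennreal ((norm (ft h (\<eta> + of_int m * (pi / L))))\<^sup>2)) \<le> ennreal (2 * L * ?I)"
      using bessel_ft_shift[OF L _ supp h1 h2, of "{-int N..int N}" \<eta>] by (simp add: sum_ennreal ennreal_leI)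
  qed (use L in auto)
  also have "\<dots> = ennreal (2 * pi * ?I)"
    using L by (simp add: mult_ac flip: ennreal_mult')
  also have "\<dots> = ennreal (2 * pi) * (\<integral>\<^sup>+x. ennreal ((norm (h x))\<^sup>2) \<partial>lborel)"
    using h2 I by (simp add: nn_integral_eq_integral ennreal_mult)
  finally show ?thesis .
qed

section \<open>Truncation and the square-integrable transform\<close>

lemma truncate_tendsto: "((\<lambda>R. truncate R u x) \<longlongrightarrow> u x) at_top"
proof (rule tendsto_eventually)
  show "\<forall>\<^sub>F R in at_top. truncate R u x = u x"
    using eventually_ge_at_top[of "\<bar>x\<bar>"] by eventually_elim (simp add: truncate_def indicator_def, linarith)
qed

lemma norm_truncate_le: "norm (truncate R u x) \<le> norm (u x)"
  by (auto simp: truncate_def split: split_indicator)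

lemma integral_truncate_tendsto:
  assumes "integrable lborel u" shows "((\<lambda>R. LINT x|lborel. truncate R u x) \<longlongrightarrow> (LINT x|lborel. u x)) at_top"
proof -
  have [measurable]: "u \<in> borel_measurable borel" using assms by auto
  show ?thesis
    by (rule integral_dominated_convergence_at_top[where w = "\<lambda>x. norm (u x)"])
      (use assms in \<open>auto intro!: truncate_tendsto norm_truncate_le always_eventually\<close>)
qed

lemma ft_truncate_tendsto:
  assumes "integrable lborel u" shows "((\<lambda>R. ft (truncate R u) \<xi>) \<longlongrightarrow> ft u \<xi>) at_top"
proof -
  have "ft (truncate R u) \<xi> = (LINT x|lborel. truncate R (\<lambda>x. cis (- (\<xi> * x)) * u x) x)" for R
    by (simp add: ft_def truncate_def)
  then show ?thesis
    using integral_truncate_tendsto[OF integrable_cis_mult[OF assms, of \<xi>]] by (simp add: ft_def)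
qed

lemma nn_integral_fatou_le:
  fixes g :: "'a \<Rightarrow> complex"
  assumes [measurable]: "\<And>n. G n \<in> borel_measurable M" and [measurable]: "g \<in> borel_measurable M"
    and lim: "AE x in M. (\<lambda>n. G n x) \<longlonglongrightarrow> g x"
    and b: "\<And>n. (\<integral>\<^sup>+x. ennreal ((norm (G n x))\<^sup>2) \<partial>M) \<le> B"
  shows "(\<integral>\<^sup>+x. ennreal ((norm (g x))\<^sup>2) \<partial>M) \<le> B"
proof -
  have "(\<integral>\<^sup>+x. ennreal ((norm (g x))\<^sup>2) \<partial>M) = (\<integral>\<^sup>+x. liminf (\<lambda>n. ennreal ((norm (G n x))\<^sup>2)) \<partial>M)"
  proof (rule nn_integral_cong_AE, use lim in eventually_elim)
    fix x assume "(\<lambda>n. G n x) \<longlonglongrightarrow> g x"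
    then have "(\<lambda>n. ennreal ((norm (G n x))\<^sup>2)) \<longlonglongrightarrow> ennreal ((norm (g x))\<^sup>2)"
      by (intro tendsto_ennrealI tendsto_intros)
    then show "ennreal ((norm (g x))\<^sup>2) = liminf (\<lambda>n. ennreal ((norm (G n x))\<^sup>2))"
      by (intro lim_imp_Liminf[symmetric]) auto
  qed
  also have "\<dots> \<le> liminf (\<lambda>n. \<integral>\<^sup>+x. ennreal ((norm (G n x))\<^sup>2) \<partial>M)"
    by (rule nn_integral_liminf) simp
  also have "\<dots> \<le> B" by (rule Liminf_le[OF _ always_eventually]) (auto intro: b)
  finally show ?thesis .
qed

text \<open>Truncations fall under the case of bounded support, and Fatou's lemma lets the interval
  grow.\<close>

lemma ft_L2_le:
  assumes h1: "integrable lborel h"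
  shows "(\<integral>\<^sup>+\<xi>. ennreal ((norm (ft h \<xi>))\<^sup>2) \<partial>lborel) \<le> ennreal (2 * pi) * (\<integral>\<^sup>+x. ennreal ((norm (h x))\<^sup>2) \<partial>lborel)"
proof (rule nn_integral_fatou_le)
  have [measurable]: "h \<in> borel_measurable borel" using h1 by auto
  let ?G = "\<lambda>n::nat. ft (truncate (1 + real n) h)"
  show "?G n \<in> borel_measurable lborel" "ft h \<in> borel_measurable lborel" for n by simp_all
  have "filterlim (\<lambda>n. 1 + real n) at_top sequentially"
    by (intro filterlim_tendsto_add_at_top[OF tendsto_const] filterlim_real_sequentially)
  from filterlim_compose[OF ft_truncate_tendsto[OF h1] this]
  show "AE \<xi> in lborel. (\<lambda>n. ?G n \<xi>) \<longlonglongrightarrow> ft h \<xi>" by simp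
  fix n
  have "(\<integral>\<^sup>+\<xi>. ennreal ((norm (?G n \<xi>))\<^sup>2) \<partial>lborel) \<le> ennreal (2 * pi) * (\<integral>\<^sup>+x. ennreal ((norm (truncate (1 + real n) h x))\<^sup>2) \<partial>lborel)"
    by (rule ft_L2_le_compact[of "1 + real n"]) (auto simp: truncate_def)
  also have "\<dots> \<le> ennreal (2 * pi) * (\<integral>\<^sup>+x. ennreal ((norm (h x))\<^sup>2) \<partial>lborel)"
    by (intro mult_left_mono nn_integral_mono ennreal_leI power_mono norm_truncate_le) auto
  finally show "(\<integral>\<^sup>+\<xi>. ennreal ((norm (?G n \<xi>))\<^sup>2) \<partial>lborel) \<le> ennreal (2 * pi) * (\<integral>\<^sup>+x. ennreal ((norm (h x))\<^sup>2) \<partial>lborel)" .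
qed

text \<open>The difference of two truncations is integrable, so Plancherel's inequality bounds its
  transform. Letting the larger radius grow, Fatou's lemma bounds the squared distance from
  \<open>g\<close> to the transform at radius R by 2 pi times a squared tail of \<open>u\<close>,
  which tends to 0.\<close>

lemma has_L2_fourier_limit:
  assumes [measurable]: "u \<in> borel_measurable borel" "g \<in> borel_measurable borel"
    and loc: "\<And>R. integrable lborel (truncate R u)"
    and u2: "integrable lborel (\<lambda>x. (norm (u x))\<^sup>2)"
    and lim: "AE \<xi> in lborel. ((\<lambda>R. ft (truncate R u) \<xi>) \<longlongrightarrow> g \<xi>) at_top"
  shows "has_L2_fourier u g" "(\<integral>\<^sup>+\<xi>. ennreal ((norm (g \<xi>))\<^sup>2) \<partial>lborel) \<le> ennreal (2 * pi) * (\<integral>\<^sup>+x. ennreal ((norm (u x))\<^sup>2) \<partial>lborel)"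
proof -
  define tail where "tail R = (LINT x|lborel. (norm (u x - truncate R u x))\<^sup>2)" for R
  have tri: "norm (u x - truncate R u x) \<le> norm (u x)" for R x
    by (auto simp: truncate_def split: split_indicator)
  have tail_int: "integrable lborel (\<lambda>x. (norm (u x - truncate R u x))\<^sup>2)" for R
    by (rule Bochner_Integration.integrable_bound[OF u2]) (auto intro!: power_mono tri)
  have tail: "(tail \<longlongrightarrow> (LINT x|lborel. (norm (u x - u x))\<^sup>2)) at_top"
    unfolding tail_def
  proof (rule integral_dominated_convergence_at_top[OF _ _ u2])
    show "\<forall>\<^sub>F R in at_top. AE x in lborel. norm ((norm (u x - truncate R u x))\<^sup>2) \<le> (norm (u x))\<^sup>2"
      by (auto intro!: power_mono tri always_eventually)
    show "AE x in lborel. ((\<lambda>R. (norm (u x - truncate R u x))\<^sup>2) \<longlongrightarrow> (norm (u x - u x))\<^sup>2) at_top"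
      by (intro AE_I2 tendsto_intros truncate_tendsto)
  qed simp_all
  then have tail0: "(tail \<longlongrightarrow> 0) at_top" by simp
  have seq: "filterlim (\<lambda>n. R + real n) at_top sequentially" for R
    by (intro filterlim_tendsto_add_at_top[OF tendsto_const] filterlim_real_sequentially)
  have step: "(\<integral>\<^sup>+\<xi>. ennreal ((norm (g \<xi> - ft (truncate R u) \<xi>))\<^sup>2) \<partial>lborel) \<le> ennreal (2 * pi * tail R)" for R
  proof (rule nn_integral_fatou_le)
    let ?G = "\<lambda>n \<xi>. ft (truncate (R + real n) u) \<xi> - ft (truncate R u) \<xi>"
    show "?G n \<in> borel_measurable lborel" "(\<lambda>\<xi>. g \<xi> - ft (truncate R u) \<xi>) \<in> borel_measurable lborel" for n by simp_all
    show "AE \<xi> in lborel. (\<lambda>n. ?G n \<xi>) \<longlonglongrightarrow> g \<xi> - ft (truncate R u) \<xi>"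
      using lim by eventually_elim (intro tendsto_diff tendsto_const, erule filterlim_compose[OF _ seq])
    fix n
    let ?d = "\<lambda>x. truncate (R + real n) u x - truncate R u x"
    have "?G n \<xi> = ft ?d \<xi>" for \<xi>
      unfolding ft_def right_diff_distrib
      by (intro Bochner_Integration.integral_diff[symmetric] integrable_cis_mult loc)
    then have "(\<integral>\<^sup>+\<xi>. ennreal ((norm (?G n \<xi>))\<^sup>2) \<partial>lborel) = (\<integral>\<^sup>+\<xi>. ennreal ((norm (ft ?d \<xi>))\<^sup>2) \<partial>lborel)" by simp
    also have "\<dots> \<le> ennreal (2 * pi) * (\<integral>\<^sup>+x. ennreal ((norm (?d x))\<^sup>2) \<partial>lborel)"
      by (intro ft_L2_le Bochner_Integration.integrable_diff loc)
    also have "\<dots> \<le> ennreal (2 * pi) * (\<integral>\<^sup>+x. ennreal ((norm (u x - truncate R u x))\<^sup>2) \<partial>lborel)"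
      by (intro mult_left_mono nn_integral_mono ennreal_leI power_mono) (auto simp: truncate_def split: split_indicator)
    also have "\<dots> = ennreal (2 * pi * tail R)"
      using tail_int[of R] unfolding tail_def by (simp add: nn_integral_eq_integral ennreal_mult')
    finally show "(\<integral>\<^sup>+\<xi>. ennreal ((norm (?G n \<xi>))\<^sup>2) \<partial>lborel) \<le> ennreal (2 * pi * tail R)" .
  qed
  show b: "(\<integral>\<^sup>+\<xi>. ennreal ((norm (g \<xi>))\<^sup>2) \<partial>lborel) \<le> ennreal (2 * pi) * (\<integral>\<^sup>+x. ennreal ((norm (u x))\<^sup>2) \<partial>lborel)"
  proof (rule nn_integral_fatou_le)
    let ?G = "\<lambda>n::nat. ft (truncate (0 + real n) u)"
    show "?G n \<in> borel_measurable lborel" "g \<in> borel_measurable lborel" for n by simp_all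
    show "AE \<xi> in lborel. (\<lambda>n. ?G n \<xi>) \<longlonglongrightarrow> g \<xi>"
      using lim by eventually_elim (erule filterlim_compose[OF _ seq])
    fix n
    have "(\<integral>\<^sup>+\<xi>. ennreal ((norm (?G n \<xi>))\<^sup>2) \<partial>lborel) \<le> ennreal (2 * pi) * (\<integral>\<^sup>+x. ennreal ((norm (truncate (0 + real n) u x))\<^sup>2) \<partial>lborel)"
      by (intro ft_L2_le loc)
    also have "\<dots> \<le> ennreal (2 * pi) * (\<integral>\<^sup>+x. ennreal ((norm (u x))\<^sup>2) \<partial>lborel)"
      by (intro mult_left_mono nn_integral_mono ennreal_leI power_mono norm_truncate_le) auto
    finally show "(\<integral>\<^sup>+\<xi>. ennreal ((norm (?G n \<xi>))\<^sup>2) \<partial>lborel) \<le> ennreal (2 * pi) * (\<integral>\<^sup>+x. ennreal ((norm (u x))\<^sup>2) \<partial>lborel)" .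
  qed
  have "(\<integral>\<^sup>+\<xi>. ennreal ((norm (g \<xi>))\<^sup>2) \<partial>lborel) \<le> ennreal (2 * pi * (LINT x|lborel. (norm (u x))\<^sup>2))"
    using b u2 by (simp add: nn_integral_eq_integral flip: ennreal_mult')
  from le_less_trans[OF this ennreal_less_top] have "integrable lborel (\<lambda>\<xi>. (norm (g \<xi>))\<^sup>2)"
    by (intro integrableI_nonneg) auto
  moreover have "((\<lambda>R. \<integral>\<^sup>+\<xi>. ennreal ((norm (g \<xi> - ft (truncate R u) \<xi>))\<^sup>2) \<partial>lborel) \<longlongrightarrow> 0) at_top"
  proof (rule tendsto_sandwich[where f = "\<lambda>_. 0" and h = "\<lambda>R. ennreal (2 * pi * tail R)"])
    have "((\<lambda>R. ennreal (2 * pi * tail R)) \<longlongrightarrow> ennreal (2 * pi * 0)) at_top"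
      by (intro tendsto_ennrealI tendsto_intros tail0)
    then show "((\<lambda>R. ennreal (2 * pi * tail R)) \<longlongrightarrow> 0) at_top" by simp
  qed (simp_all add: always_eventually step)
  ultimately show "has_L2_fourier u g"
    unfolding has_L2_fourier_def in_L2_real_def ft_truncate by simp
qed

text \<open>\<open>fourier\<close> is an arbitrary choice among the functions with the defining
  property; this makes Sobolev norms independent of that choice.\<close>

lemma has_L2_fourier_unique:
  assumes [measurable]: "u \<in> borel_measurable borel"
    and g: "has_L2_fourier u g1" "has_L2_fourier u g2"
  shows "AE \<xi> in lborel. g1 \<xi> = g2 \<xi>"
proof -
  have [measurable]: "g1 \<in> borel_measurable borel" "g2 \<in> borel_measurable borel"
    using g unfolding has_L2_fourier_def in_L2_real_def by auto
  let ?I = "\<lambda>g R. \<integral>\<^sup>+\<xi>. ennreal ((norm (g \<xi> - ft (truncate R u) \<xi>))\<^sup>2) \<partial>lborel"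
  have lim: "(?I g1 \<longlongrightarrow> 0) at_top" "(?I g2 \<longlongrightarrow> 0) at_top"
    using g unfolding has_L2_fourier_def ft_truncate by auto
  have le: "(\<integral>\<^sup>+\<xi>. ennreal ((norm (g1 \<xi> - g2 \<xi>))\<^sup>2) \<partial>lborel) \<le> 2 * ?I g1 R + 2 * ?I g2 R" for R
  proof -
    have "(norm (a - b :: complex))\<^sup>2 \<le> 2 * (norm (a - c))\<^sup>2 + 2 * (norm (b - c))\<^sup>2" for a b c
    proof -
      have "norm (a - b) \<le> norm (a - c) + norm (b - c)"
        using norm_triangle_ineq4[of "a - c" "b - c"] by simp
      then have "(norm (a - b))\<^sup>2 \<le> (norm (a - c) + norm (b - c))\<^sup>2" by (intro power_mono) auto
      then show ?thesis using sum_squares_bound[of "norm (a - c)" "norm (b - c)"] unfolding power2_sum by linarith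
    qed
    then have "(\<integral>\<^sup>+\<xi>. ennreal ((norm (g1 \<xi> - g2 \<xi>))\<^sup>2) \<partial>lborel) \<le>
       (\<integral>\<^sup>+\<xi>. ennreal (2 * (norm (g1 \<xi> - ft (truncate R u) \<xi>))\<^sup>2 + 2 * (norm (g2 \<xi> - ft (truncate R u) \<xi>))\<^sup>2) \<partial>lborel)"
      by (intro nn_integral_mono ennreal_leI)
    also have "\<dots> = 2 * ?I g1 R + 2 * ?I g2 R"
      by (simp add: ennreal_mult' nn_integral_add nn_integral_cmult)
    finally show ?thesis .
  qed
  have "((\<lambda>R. 2 * ?I g1 R + 2 * ?I g2 R) \<longlongrightarrow> 2 * 0 + 2 * 0) at_top"
    by (intro tendsto_add ennreal_tendsto_cmult lim) auto
  then have "((\<lambda>R. 2 * ?I g1 R + 2 * ?I g2 R) \<longlongrightarrow> 0) at_top" by simp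
  from tendsto_lowerbound[OF this always_eventually[OF allI[OF le]]]
  have "(\<integral>\<^sup>+\<xi>. ennreal ((norm (g1 \<xi> - g2 \<xi>))\<^sup>2) \<partial>lborel) = 0" by simp
  then have "AE \<xi> in lborel. ennreal ((norm (g1 \<xi> - g2 \<xi>))\<^sup>2) = 0"
    by (subst (asm) nn_integral_0_iff_AE) auto
  then show ?thesis by eventually_elim (auto simp: ennreal_eq_0_iff)
qed

section \<open>The transform of a derivative\<close>

lemma ft_truncate_by_parts:
  assumes "R \<ge> 0" and d: "\<And>x. (u has_vector_derivative u' x) (at x)" and c: "continuous_on UNIV u'"
  shows "ft (truncate R u') \<xi> = cis (- (\<xi> * R)) * u R - cis (\<xi> * R) * u (- R) + \<i> * of_real \<xi> * ft (truncate R u) \<xi>"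
proof -
  have cu: "continuous_on UNIV u"
    using has_vector_derivative_continuous[OF d] by (simp add: continuous_on_eq_continuous_at)
  have cc: "continuous_on A (\<lambda>x. cis (- (\<xi> * x)) * u x)" "continuous_on A (\<lambda>x. cis (- (\<xi> * x)) * u' x)" for A
    by (intro continuous_intros continuous_on_subset[OF cu] continuous_on_subset[OF c]; simp)+
  have i: "set_integrable lborel {-R..R} (\<lambda>x. cis (- (\<xi> * x)) * u x)" "set_integrable lborel {-R..R} (\<lambda>x. cis (- (\<xi> * x)) * u' x)"
    by (intro borel_integrable_atLeastAtMost' cc)+
  have "(LINT x|lborel. indicator {-R..R} x *\<^sub>R (cis (- (\<xi> * x)) * u' x - \<i> * of_real \<xi> * (cis (- (\<xi> * x)) * u x)))
    = cis (- (\<xi> * R)) * u R - cis (- (\<xi> * (- R))) * u (- R)"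
  proof (rule integral_FTC_atLeastAtMost)
    show "((\<lambda>x. cis (- (\<xi> * x)) * u x) has_vector_derivative
       cis (- (\<xi> * x)) * u' x - \<i> * of_real \<xi> * (cis (- (\<xi> * x)) * u x)) (at x within {-R..R})" for x
      using has_vector_derivative_mult[OF has_vector_derivative_cis_mult[of "-\<xi>" x "{-R..R}"] has_vector_derivative_at_within[OF d[of x]]]
      by (simp add: algebra_simps)
    show "continuous_on {-R..R} (\<lambda>x. cis (- (\<xi> * x)) * u' x - \<i> * of_real \<xi> * (cis (- (\<xi> * x)) * u x))"
      by (intro continuous_intros cc)
  qed (use assms in simp)
  note A = this
  have B: "(LINT x|lborel. indicator {-R..R} x *\<^sub>R (cis (- (\<xi> * x)) * u' x - \<i> * of_real \<xi> * (cis (- (\<xi> * x)) * u x)))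
    = ft (truncate R u') \<xi> - \<i> * of_real \<xi> * ft (truncate R u) \<xi>"
    unfolding ft_truncate set_lebesgue_integral_def[symmetric]
    using i by (subst set_integral_diff) (simp_all add: set_integral_mult_right)
  show ?thesis using trans[OF B[symmetric] A] by (simp add: algebra_simps)
qed

lemma ft_deriv:
  assumes d: "\<And>x. (u has_vector_derivative u' x) (at x)" and c: "continuous_on UNIV u'"
    and i: "integrable lborel u" "integrable lborel u'" and l: "(u \<longlongrightarrow> 0) at_infinity"
  shows "ft u' \<xi> = \<i> * of_real \<xi> * ft u \<xi>"
proof -
  have l': "(u \<longlongrightarrow> 0) at_top" "(u \<longlongrightarrow> 0) at_bot"
    using l unfolding at_infinity_eq_at_top_bot by (auto elim!: filterlim_mono)
  have "((\<lambda>R. cis (- (\<xi> * R)) * u R - cis (\<xi> * R) * u (- R) + \<i> * of_real \<xi> * ft (truncate R u) \<xi>) \<longlongrightarrow>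
     0 - 0 + \<i> * of_real \<xi> * ft u \<xi>) at_top"
  proof (intro tendsto_add tendsto_diff tendsto_mult tendsto_const ft_truncate_tendsto i)
    show "((\<lambda>R. cis (- (\<xi> * R)) * u R) \<longlongrightarrow> 0) at_top"
      using l'(1) by (intro tendsto_norm_zero_cancel[where f = "\<lambda>R. cis (- (\<xi> * R)) * u R"]) (simp add: norm_mult tendsto_norm_zero)
    have "((\<lambda>R. u (- R)) \<longlongrightarrow> 0) at_top"
      by (rule filterlim_compose[OF l'(2) filterlim_uminus_at_bot_at_top])
    then show "((\<lambda>R. cis (\<xi> * R) * u (- R)) \<longlongrightarrow> 0) at_top"
      by (intro tendsto_norm_zero_cancel[where f = "\<lambda>R. cis (\<xi> * R) * u (-R)"]) (simp add: norm_mult tendsto_norm_zero)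
  qed
  moreover have "\<forall>\<^sub>F R in at_top. cis (- (\<xi> * R)) * u R - cis (\<xi> * R) * u (- R) + \<i> * of_real \<xi> * ft (truncate R u) \<xi> = ft (truncate R u') \<xi>"
    using eventually_ge_at_top[of 0] by eventually_elim (simp add: ft_truncate_by_parts[OF _ d c])
  ultimately have "((\<lambda>R. ft (truncate R u') \<xi>) \<longlongrightarrow> \<i> * of_real \<xi> * ft u \<xi>) at_top"
    by (simp add: filterlim_cong)
  from tendsto_unique[OF _ this ft_truncate_tendsto[OF i(2)]] show ?thesis by simp
qed

section \<open>Test functions and weak derivatives\<close>

lemma deriv_eqI: "(\<And>x. (f has_real_derivative f' x) (at x)) \<Longrightarrow> deriv f = f'"
  by (rule ext) (rule DERIV_imp_deriv)

text \<open>Smoothness is read off a set of functions closed under differentiation, which avoids any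
  formula for the higher derivatives.\<close>

lemma smooth_coinduct:
  fixes f :: "real \<Rightarrow> real"
  assumes "f \<in> S" and S: "\<And>g. g \<in> S \<Longrightarrow> \<exists>g'\<in>S. \<forall>x. (g has_real_derivative g' x) (at x)"
  shows "(deriv ^^ m) f differentiable (at x)"
proof -
  have "(deriv ^^ m) f \<in> S"
  proof (induction m)
    case (Suc m)
    obtain g' where g': "g' \<in> S" "\<forall>x. ((deriv ^^ m) f has_real_derivative g' x) (at x)"
      using S[OF Suc] by blast
    then have "deriv ((deriv ^^ m) f) = g'" by (intro deriv_eqI) auto
    then show ?case using g' by simp
  qed (use assms in simp)
  then obtain g' where "\<forall>x. ((deriv ^^ m) f has_real_derivative g' x) (at x)" using S by blast
  then show ?thesis using real_differentiable_def by blast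
qed

section \<open>Smooth bump functions\<close>

text \<open>The classical exp (-1/x), multiplied by a polynomial in y = 1/x so that the class is
  closed under differentiation: p becomes (p - p') y^2.\<close>

definition flat :: "real poly \<Rightarrow> real \<Rightarrow> real" where
  "flat p x = (if x > 0 then poly p (1 / x) * exp (- (1 / x)) else 0)"

text \<open>This is the difference quotient at 0, where the two formulas meet. From the right, y =
  1/x turns it into a polynomial times exp (-y), with one extra factor y from the division by x;
  from the left it is zero.\<close>

lemma flat_over_tendsto_0: "((\<lambda>x. flat p x / x) \<longlongrightarrow> 0) (at 0)"
proof -
  have "((\<lambda>y. poly q y * exp (- y)) \<longlongrightarrow> 0) at_top" for q :: "real poly"
  proof -
    have "((\<lambda>y. \<Sum>i\<le>degree q. coeff q i * (y ^ i / exp y)) \<longlongrightarrow> (\<Sum>i\<le>degree q. coeff q i * 0)) at_top"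
      by (intro tendsto_intros tendsto_power_div_exp_0)
    then show ?thesis
      by (simp add: poly_altdef exp_minus sum_distrib_right divide_inverse mult.assoc)
  qed
  from this[of "p * [:0, 1:]"]
have r: "((\<lambda>x. poly (p * [:0, 1:]) (1 / x) * exp (- (1 / x))) \<longlongrightarrow> 0) (at_right 0)"
    by (rule filterlim_compose) (simp add: inverse_eq_divide[symmetric] filterlim_inverse_at_top_right)
  have "((\<lambda>x. flat p x / x) \<longlongrightarrow> 0) (at_right 0)"
    by (rule Lim_transform_eventually[OF r], rule eventually_at_rightI[of 0 1]) (auto simp: flat_def divide_inverse)
  moreover have "((\<lambda>x. flat p x / x) \<longlongrightarrow> 0) (at_left 0)"
    by (rule tendsto_eventually, rule eventually_at_leftI[of "-1"]) (auto simp: flat_def)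
  ultimately show ?thesis by (simp add: filterlim_split_at)
qed

lemma flat_derivative:
  "(flat p has_real_derivative flat ((p - pderiv p) * [:0, 0, 1:]) x) (at x)"
proof (cases x "0::real" rule: linorder_cases)
  case less
  have "\<forall>\<^sub>F y in nhds x. y \<in> {..<0}" using less by (intro eventually_nhds_in_open) auto
  then have ev: "\<forall>\<^sub>F y in nhds x. flat p y = 0" by eventually_elim (simp add: flat_def)
  have "(flat p has_real_derivative 0) (at x)"
    using DERIV_cong_ev[OF refl ev refl, of 0] by simp
  then show ?thesis using less by (simp add: flat_def)
next
  case equal
  have "((\<lambda>h. (flat p (0 + h) - flat p 0) / h) \<longlongrightarrow> 0) (at 0)"
    using flat_over_tendsto_0[of p] by (simp add: flat_def[of p 0])
  then show ?thesis using equal by (simp add: DERIV_def flat_def[of _ 0])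
next
  case greater
  have "((\<lambda>x. poly p (1 / x) * exp (- (1 / x))) has_real_derivative
      poly (pderiv p) (1 / x) * (- 1 / x\<^sup>2) * exp (- (1 / x)) + poly p (1 / x) * (exp (- (1 / x)) * (1 / x\<^sup>2))) (at x)"
  proof -
    have i: "((\<lambda>x. 1 / x) has_real_derivative - 1 / x\<^sup>2) (at x)"
      using greater by (auto intro!: derivative_eq_intros simp: power2_eq_square)
    have "((\<lambda>x. exp (- (1 / x))) has_real_derivative exp (- (1 / x)) * (1 / x\<^sup>2)) (at x)"
      using DERIV_chain'[OF DERIV_minus[OF i] DERIV_exp] by (simp add: o_def)
    from DERIV_mult[OF DERIV_chain'[OF i poly_DERIV] this]
    show ?thesis by (simp add: algebra_simps)
  qed
  moreover have "poly (pderiv p) (1 / x) * (- 1 / x\<^sup>2) * exp (- (1 / x)) + poly p (1 / x) * (exp (- (1 / x)) * (1 / x\<^sup>2))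
     = flat ((p - pderiv p) * [:0, 0, 1:]) x"
    using greater by (simp add: flat_def power2_eq_square divide_inverse algebra_simps)
  ultimately have "((\<lambda>x. poly p (1 / x) * exp (- (1 / x))) has_real_derivative flat ((p - pderiv p) * [:0, 0, 1:]) x) (at x)" by simp
  moreover have "\<forall>\<^sub>F y in nhds x. y \<in> {0<..}" using greater by (intro eventually_nhds_in_open) auto
  then have ev: "\<forall>\<^sub>F y in nhds x. flat p y = poly p (1 / y) * exp (- (1 / y))"
    by eventually_elim (simp add: flat_def)
  ultimately show ?thesis using DERIV_cong_ev[OF refl ev refl] by blast
qed

text \<open>For M > 0 the products vanish outside (a, b). Closing under sums and multiples keeps the
  product rule inside the set, as \<open>smooth_coinduct\<close> demands.\<close>

inductive_set bumps :: "real \<Rightarrow> real \<Rightarrow> real \<Rightarrow> (real \<Rightarrow> real) set" for M a b where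
  base: "(\<lambda>x. flat p (M * (x - a)) * flat q (M * (b - x))) \<in> bumps M a b"
| add: "f \<in> bumps M a b \<Longrightarrow> g \<in> bumps M a b \<Longrightarrow> (\<lambda>x. f x + g x) \<in> bumps M a b"
| scale: "f \<in> bumps M a b \<Longrightarrow> (\<lambda>x. c * f x) \<in> bumps M a b"

lemma bumps_deriv: "f \<in> bumps M a b \<Longrightarrow> \<exists>f'\<in>bumps M a b. \<forall>x. (f has_real_derivative f' x) (at x)"
proof (induction rule: bumps.induct)
  case (base p q)
  let ?p = "(p - pderiv p) * [:0, 0, 1:]" and ?q = "(q - pderiv q) * [:0, 0, 1:]"
  have 1: "((\<lambda>x. flat p (M * (x - a))) has_real_derivative flat ?p (M * (x - a)) * M) (at x)" for x
    by (rule DERIV_chain'[OF _ flat_derivative]) (auto intro!: derivative_eq_intros)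
  have 2: "((\<lambda>x. flat q (M * (b - x))) has_real_derivative flat ?q (M * (b - x)) * (- M)) (at x)" for x
    by (rule DERIV_chain'[OF _ flat_derivative]) (auto intro!: derivative_eq_intros)
  let ?f' = "\<lambda>x. M * (flat ?p (M * (x - a)) * flat q (M * (b - x))) + (- M) * (flat p (M * (x - a)) * flat ?q (M * (b - x)))"
  have "?f' \<in> bumps M a b" by (intro bumps.intros)
  moreover have "((\<lambda>x. flat p (M * (x - a)) * flat q (M * (b - x))) has_real_derivative ?f' x) (at x)" for x
    using DERIV_mult[OF 1 2, of x] by (simp add: algebra_simps)
  ultimately show ?case by (intro bexI[of _ ?f'] allI)
next
  case (add f g)
  then obtain f' g' where "f' \<in> bumps M a b" "g' \<in> bumps M a b"
    "\<forall>x. (f has_real_derivative f' x) (at x)" "\<forall>x. (g has_real_derivative g' x) (at x)" by blast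
  then show ?case by (intro bexI[of _ "\<lambda>x. f' x + g' x"]) (auto intro: bumps.add DERIV_add)
next
  case (scale f c)
  then obtain f' where "f' \<in> bumps M a b" "\<forall>x. (f has_real_derivative f' x) (at x)" by blast
  then show ?case by (intro bexI[of _ "\<lambda>x. c * f' x"]) (auto intro: bumps.scale DERIV_cmult)
qed

text \<open>Scaling by n + 1 steepens the flanks: exp (-1 / ((n + 1) y)) tends to 1 for every y > 0,
  so these functions approximate the indicator of the open interval and stay between 0 and
  1.\<close>

definition bump :: "real \<Rightarrow> real \<Rightarrow> nat \<Rightarrow> real \<Rightarrow> real" where
  "bump a b n x = flat 1 (real (Suc n) * (x - a)) * flat 1 (real (Suc n) * (b - x))"

lemma bump_outside: "x \<notin> {a<..<b} \<Longrightarrow> bump a b n x = 0"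
  by (auto simp: bump_def flat_def zero_less_mult_iff)

lemma bump_bounds: "0 \<le> bump a b n x" "bump a b n x \<le> 1"
proof -
  have "0 \<le> flat 1 y" "flat 1 y \<le> 1" for y :: real by (auto simp: flat_def)
  then show "0 \<le> bump a b n x" "bump a b n x \<le> 1"
    unfolding bump_def by (auto intro: mult_le_one)
qed

lemma bump_tendsto: "(\<lambda>n. bump a b n x) \<longlonglongrightarrow> indicator {a<..<b} x"
proof (cases "x \<in> {a<..<b}")
  case True
  have f: "(\<lambda>n. flat 1 (real (Suc n) * y)) \<longlonglongrightarrow> 1" if "y > 0" for y
  proof -
    have "(\<lambda>n. exp (- ((1 / y) * inverse (real (Suc n))))) \<longlonglongrightarrow> exp (- ((1 / y) * 0))"
      by (intro tendsto_intros LIMSEQ_inverse_real_of_nat)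
    then show ?thesis using that by (simp add: flat_def divide_inverse mult.commute)
  qed
  have "(\<lambda>n. bump a b n x) \<longlonglongrightarrow> 1 * 1"
    unfolding bump_def using True by (intro tendsto_mult f) auto
  then show ?thesis using True by simp
qed (simp add: bump_outside)

lemma test_function_bump: "test_function (bump a b n)"
  unfolding test_function_def
proof
  have "bump a b n \<in> bumps (real (Suc n)) a b"
    unfolding bump_def[abs_def] by (rule bumps.base)
  then show "\<forall>m x. (deriv ^^ m) (bump a b n) differentiable (at x)"
    using smooth_coinduct[of "bump a b n" "bumps (real (Suc n)) a b"] bumps_deriv by blast
  show "\<exists>R. \<forall>x. R < \<bar>x\<bar> \<longrightarrow> bump a b n x = 0"
    by (intro exI[of _ "\<bar>a\<bar> + \<bar>b\<bar>"] allI impI bump_outside) auto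
qed

section \<open>Uniqueness of weak derivatives\<close>

lemma borel_measurable_locally_integrable:
  assumes "locally_integrable f" shows "f \<in> borel_measurable borel"
proof (rule borel_measurable_LIMSEQ_metric)
  fix n
  have "integrable lborel (\<lambda>x. indicator {- real n..real n} x *\<^sub>R f x)"
    using assms unfolding locally_integrable_def set_integrable_def by simp
  from borel_measurable_integrable[OF this]
  show "(\<lambda>x. indicator {- real n..real n} x *\<^sub>R f x) \<in> borel_measurable borel" by simp
next
  fix x
  have "\<forall>\<^sub>F n in sequentially. indicator {- real n..real n} x *\<^sub>R f x = f x"
    using eventually_ge_at_top[of "nat \<lceil>\<bar>x\<bar>\<rceil>"] by eventually_elim (simp add: indicator_def, linarith)
  then show "(\<lambda>n. indicator {- real n..real n} x *\<^sub>R f x) \<longlonglongrightarrow> f x"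
    by (rule tendsto_eventually)
qed

text \<open>Open intervals form an intersection-stable generator of the Borel sets, and the sets
  over which \<open>d\<close> integrates to zero are closed under complements and disjoint countable
  unions. A density whose integrals over all Borel sets vanish is zero almost everywhere.\<close>

lemma AE_zero_of_intervals:
  fixes d :: "real \<Rightarrow> complex"
  assumes i: "integrable lborel d" and z: "\<And>a b. (LINT x|lborel. indicator {a<..<b} x *\<^sub>R d x) = 0"
  shows "AE x in lborel. d x = 0"
proof (rule sigma_finite_measure.density_zero[OF lborel.sigma_finite_measure_axioms i])
  let ?G = "range (\<lambda>(a, b). {a<..<b::real})"
  have sb: "sigma_sets UNIV ?G = sets borel"
  proof -
    have e: "(\<lambda>(a, b). {a<..<b::real}) = (\<lambda>(a, b). box a b)" by (auto simp: fun_eq_iff)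
    have "sets borel = sets (sigma UNIV (range (\<lambda>(a, b). box a b :: real set)))"
      by (rule arg_cong[OF borel_eq_box])
    then show ?thesis unfolding e by (simp only: sets_measure_of_conv Pow_UNIV subset_UNIV if_True)
  qed
  fix A :: "real set" assume "A \<in> sets lborel"
  then have A: "A \<in> sigma_sets UNIV ?G" by (simp add: sb)
  have [measurable]: "d \<in> borel_measurable borel" using i by auto
  have si: "integrable lborel (\<lambda>x. indicator A x *\<^sub>R d x)" if "A \<in> sets borel" for A
    using that by (intro integrable_mult_indicator i) simp
  \<comment> \<open>Complements require the integral over the whole line, which is a limit of
    integrals over intervals.\<close>
  have all: "(LINT x|lborel. d x) = 0"
  proof -
    have "(\<lambda>n. LINT x|lborel. indicator {- real n<..<real n} x *\<^sub>R d x) \<longlonglongrightarrow> (LINT x|lborel. d x)"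
    proof (rule integral_dominated_convergence[where w = "\<lambda>x. norm (d x)"])
      have "(\<lambda>n. indicator {- real n<..<real n} x *\<^sub>R d x) \<longlonglongrightarrow> d x" for x
      proof (rule tendsto_eventually)
        show "\<forall>\<^sub>F n in sequentially. indicator {- real n<..<real n} x *\<^sub>R d x = d x"
          using eventually_gt_at_top[of "nat \<lceil>\<bar>x\<bar>\<rceil>"] by eventually_elim (simp add: indicator_def, linarith)
      qed
      then show "AE x in lborel. (\<lambda>n. indicator {- real n<..<real n} x *\<^sub>R d x) \<longlonglongrightarrow> d x" by simp
    qed (use i in \<open>auto simp: indicator_def\<close>)
    then show ?thesis unfolding z using LIMSEQ_unique tendsto_const by blast
  qed
  have "Int_stable ?G"
  proof (rule Int_stableI)
    fix X Y assume "X \<in> ?G" "Y \<in> ?G"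
    then obtain a b c e where "X = {a<..<b}" "Y = {c<..<e}" by auto
    then have "X \<inter> Y = (\<lambda>(a, b). {a<..<b}) (max a c, min b e)" by auto
    then show "X \<inter> Y \<in> ?G" by blast
  qed
  moreover have "?G \<subseteq> Pow UNIV" by simp
  ultimately have "(LINT x|lborel. indicator A x *\<^sub>R d x) = 0"
    using A
  proof (induction rule: sigma_sets_induct_disjoint)
    case (basic A)
    then show ?case using z by auto
  next
    case empty
    show ?case by simp
  next
    case (compl A)
    have "indicator (UNIV - A) x *\<^sub>R d x = d x - indicator A x *\<^sub>R d x" for x
      by (simp split: split_indicator)
    then show ?case using compl all i si[of A] by (simp add: sb)
  next
    case (union A)
    have m: "A i \<in> sets lborel" for i using union(2) unfolding sb by auto
    have "(\<Union>i. A i) \<in> sets borel" using m by (intro sets.countable_UN) auto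
    then have "set_integrable lborel (\<Union>i. A i) d"
      unfolding set_integrable_def by (rule si)
    from lebesgue_integral_countable_add[OF m disjoint_family_onD[OF union(1)] this]
    have "(LINT x:(\<Union>i. A i)|lborel. d x) = (\<Sum>i. (LINT x:(A i)|lborel. d x))" by simp
    then show ?case using union(3) by (simp add: set_lebesgue_integral_def)
  qed
  then show "set_lebesgue_integral lborel A d = 0" by (simp add: set_lebesgue_integral_def)
qed

lemma locally_integrable_subset:
  assumes "locally_integrable f" "A \<in> sets borel" "A \<subseteq> {-R..R}"
  shows "set_integrable lborel A f"
proof (rule set_integrable_subset)
  show "set_integrable lborel {-R..R} f" using assms(1) unfolding locally_integrable_def by blast
qed (use assms in simp_all)

text \<open>\<open>weak_deriv\<close> is a choice, and this makes its L1 norm independent of it.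
  Testing with bump functions equates the integrals over every open interval; cutting down to (-n,
  n) makes the difference integrable.\<close>

lemma has_weak_deriv_unique:
  assumes "has_weak_deriv j f g1" "has_weak_deriv j f g2"
  shows "AE x in lborel. g1 x = g2 x"
proof -
  have li: "locally_integrable g1" "locally_integrable g2"
    using assms unfolding has_weak_deriv_def by auto
  have [measurable]: "g1 \<in> borel_measurable borel" "g2 \<in> borel_measurable borel"
    using li by (auto intro: borel_measurable_locally_integrable)
  have oi: "integrable lborel (\<lambda>x. indicator {a<..<b} x *\<^sub>R g x)" if "locally_integrable g" for a b :: real and g
  proof -
    have "{a<..<b} \<subseteq> {- (\<bar>a\<bar> + \<bar>b\<bar>)..\<bar>a\<bar> + \<bar>b\<bar>}"
      by (intro subsetI) (simp, linarith)
    from locally_integrable_subset[OF that _ this] show ?thesis unfolding set_integrable_def by simp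
  qed
  have lim: "(\<lambda>n. LINT x|lborel. bump a b n x *\<^sub>R g x) \<longlonglongrightarrow> (LINT x|lborel. indicator {a<..<b} x *\<^sub>R g x)"
    if "locally_integrable g" for a b and g
  proof (rule integral_dominated_convergence[where w = "\<lambda>x. norm (indicator {a<..<b} x *\<^sub>R g x)"])
    have [measurable]: "g \<in> borel_measurable borel" by (rule borel_measurable_locally_integrable[OF that])
    show "(\<lambda>x. indicator {a<..<b} x *\<^sub>R g x) \<in> borel_measurable lborel" by simp
    have "isCont (bump a b n) x" for n x
      using test_function_bump[of a b n] unfolding test_function_def
      by (metis differentiable_imp_continuous_within funpow_0)
    then have [measurable]: "bump a b n \<in> borel_measurable borel" for n
      by (intro borel_measurable_continuous_onI) (simp add: continuous_on_eq_continuous_at)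
    show "(\<lambda>x. bump a b n x *\<^sub>R g x) \<in> borel_measurable lborel" for n by simp
    show "integrable lborel (\<lambda>x. norm (indicator {a<..<b} x *\<^sub>R g x))"
      by (intro integrable_norm oi that)
    show "AE x in lborel. (\<lambda>n. bump a b n x *\<^sub>R g x) \<longlonglongrightarrow> indicator {a<..<b} x *\<^sub>R g x"
      by (intro AE_I2 tendsto_intros bump_tendsto)
    have "norm (bump a b n x *\<^sub>R g x) \<le> norm (indicator {a<..<b} x *\<^sub>R g x)" for n x
      using bump_outside[of x a b n] bump_bounds[of a b n x]
      by (cases "x \<in> {a<..<b}") (auto intro: mult_left_le_one_le)
    then show "AE x in lborel. norm (bump a b n x *\<^sub>R g x) \<le> norm (indicator {a<..<b} x *\<^sub>R g x)" for n by simp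
  qed
  have eq: "(LINT x|lborel. indicator {a<..<b} x *\<^sub>R g1 x) = (LINT x|lborel. indicator {a<..<b} x *\<^sub>R g2 x)" for a b
  proof -
    have "(LINT x|lborel. bump a b n x *\<^sub>R g1 x) = (LINT x|lborel. bump a b n x *\<^sub>R g2 x)" for n
    proof -
      have "(-1) ^ j * (LINT x|lborel. bump a b n x *\<^sub>R g1 x) = (-1) ^ j * (LINT x|lborel. bump a b n x *\<^sub>R g2 x)"
        using assms test_function_bump[of a b n] unfolding has_weak_deriv_def by metis
      then show ?thesis by simp
    qed
    with lim[OF li(1), of a b] lim[OF li(2), of a b] show ?thesis by (simp add: LIMSEQ_unique)
  qed
  have "AE x in lborel. indicator {- real n<..<real n} x *\<^sub>R (g1 x - g2 x) = 0" for n
  proof (rule AE_zero_of_intervals)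
    have e: "indicator {a<..<b} x *\<^sub>R (indicator {- real n<..<real n} x *\<^sub>R (g1 x - g2 x)) =
       indicator {max a (- real n)<..<min b (real n)} x *\<^sub>R g1 x - indicator {max a (- real n)<..<min b (real n)} x *\<^sub>R g2 x" for a b x
      by (auto simp: indicator_def)
    show "integrable lborel (\<lambda>x. indicator {- real n<..<real n} x *\<^sub>R (g1 x - g2 x))"
      unfolding scaleR_diff_right by (intro Bochner_Integration.integrable_diff oi li)
    show "(LINT x|lborel. indicator {a<..<b} x *\<^sub>R (indicator {- real n<..<real n} x *\<^sub>R (g1 x - g2 x))) = 0" for a b
      unfolding e using eq oi li by (subst Bochner_Integration.integral_diff) auto
  qed
  then have "AE x in lborel. \<forall>n. indicator {- real n<..<real n} x *\<^sub>R (g1 x - g2 x) = 0"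
    unfolding AE_all_countable by (rule allI)
  then show ?thesis
  proof eventually_elim
    case (elim x)
    obtain n where "\<bar>x\<bar> < real n" using reals_Archimedean2 by blast
    then show ?case using elim[rule_format, of n] by (auto simp: indicator_def split: if_splits)
  qed
qed

section \<open>Weak derivatives as limits of strong ones\<close>

lemma deriv_funpow_outside:
  assumes "\<And>x. R < \<bar>x\<bar> \<Longrightarrow> \<phi> x = (0::real)" "R < \<bar>x\<bar>" shows "(deriv ^^ m) \<phi> x = 0"
  using assms(2)
proof (induction m arbitrary: x)
  case (Suc m)
  have "open {x. R < \<bar>x::real\<bar>}" by (intro open_Collect_less continuous_intros)
  then have "\<forall>\<^sub>F y in nhds x. R < \<bar>y\<bar>" using eventually_nhds_in_open Suc.prems by fastforce
  then have ev: "\<forall>\<^sub>F y in nhds x. (deriv ^^ m) \<phi> y = 0" by eventually_elim (rule Suc.IH)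
  have "((deriv ^^ m) \<phi> has_real_derivative 0) (at x)"
    using DERIV_cong_ev[OF refl ev refl, of 0] by simp
  then show ?case by (simp add: DERIV_imp_deriv)
qed (use assms(1) in simp)

text \<open>\<open>U\<close> is a chain of successive derivatives, so repeated integration by parts
  is an induction on j with r left free. The boundary terms vanish because the interval ends where
  the test function and all its derivatives are zero.\<close>

lemma integral_by_parts_test_function:
  assumes \<phi>: "test_function \<phi>" and U: "\<And>r x. (U r has_vector_derivative U (Suc r) x) (at x)"
  shows "(LINT x|lborel. (deriv ^^ j) \<phi> x *\<^sub>R U r x) = (-1) ^ j * (LINT x|lborel. \<phi> x *\<^sub>R (U (r + j) x :: complex))"
proof (induction j arbitrary: r)
  case (Suc j)
  obtain R0 where R0: "\<And>x. R0 < \<bar>x\<bar> \<Longrightarrow> \<phi> x = 0" using \<phi> unfolding test_function_def by auto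
  define R where "R = \<bar>R0\<bar> + 1"
  have R: "R0 < \<bar>x\<bar>" if "\<not> \<bar>x\<bar> < R" for x using that unfolding R_def by linarith
  have out: "(deriv ^^ m) \<phi> x = 0" if "\<not> \<bar>x\<bar> < R" for m x
    by (rule deriv_funpow_outside[OF R0 R[OF that]])
  have d: "((deriv ^^ m) \<phi> has_real_derivative (deriv ^^ Suc m) \<phi> x) (at x)" for m x
    using \<phi> unfolding test_function_def by (metis DERIV_deriv_iff_real_differentiable comp_apply funpow.simps(2))
  have c: "isCont ((deriv ^^ m) \<phi>) x" for m x using d DERIV_isCont by blast
  have cU: "isCont (U r) x" for r x using U has_vector_derivative_continuous by blast
  have con: "continuous_on A (\<lambda>x. (deriv ^^ m) \<phi> x *\<^sub>R U r x)" for A m r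
    by (intro continuous_at_imp_continuous_on ballI continuous_intros c cU)
  have ind: "indicator {-R..R} x *\<^sub>R ((deriv ^^ m) \<phi> x *\<^sub>R U r x) = (deriv ^^ m) \<phi> x *\<^sub>R U r x" for m r x
    using out[of x m] by (cases "\<bar>x\<bar> < R") (auto simp: indicator_def abs_less_iff)
  have int: "integrable lborel (\<lambda>x. (deriv ^^ m) \<phi> x *\<^sub>R U r x)" for m r
    using borel_integrable_atLeastAtMost'[OF con[of "{-R..R}" m r]] unfolding set_integrable_def ind .
  have "(LINT x|lborel. indicator {-R..R} x *\<^sub>R ((deriv ^^ j) \<phi> x *\<^sub>R U (Suc r) x + (deriv ^^ Suc j) \<phi> x *\<^sub>R U r x))
     = (deriv ^^ j) \<phi> R *\<^sub>R U r R - (deriv ^^ j) \<phi> (-R) *\<^sub>R U r (-R)"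
  proof (rule integral_FTC_atLeastAtMost)
    show "((\<lambda>x. (deriv ^^ j) \<phi> x *\<^sub>R U r x) has_vector_derivative
         (deriv ^^ j) \<phi> x *\<^sub>R U (Suc r) x + (deriv ^^ Suc j) \<phi> x *\<^sub>R U r x) (at x within {-R..R})" for x
      by (rule has_vector_derivative_scaleR[OF has_field_derivative_at_within[OF d] has_vector_derivative_at_within[OF U]])
    show "continuous_on {-R..R} (\<lambda>x. (deriv ^^ j) \<phi> x *\<^sub>R U (Suc r) x + (deriv ^^ Suc j) \<phi> x *\<^sub>R U r x)"
      by (intro continuous_on_add con)
  qed (simp add: R_def)
  also have "\<dots> = 0" using out[of R j] out[of "-R" j] by simp
  finally have "(LINT x|lborel. (deriv ^^ j) \<phi> x *\<^sub>R U (Suc r) x) + (LINT x|lborel. (deriv ^^ Suc j) \<phi> x *\<^sub>R U r x) = 0"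
    unfolding scaleR_add_right[of "indicator _ _"] ind using int by (subst (asm) Bochner_Integration.integral_add) blast+
  then have "(LINT x|lborel. (deriv ^^ Suc j) \<phi> x *\<^sub>R U r x) = - (LINT x|lborel. (deriv ^^ j) \<phi> x *\<^sub>R U (Suc r) x)"
    by (simp add: eq_neg_iff_add_eq_0 add.commute)
  then show ?case unfolding Suc.IH by simp
qed simp

text \<open>A test function and its derivatives are bounded with bounded support, so uniform
  convergence of the functions and L1 convergence of the j-th derivatives suffice to pass to the
  limit on both sides of the integration by parts.\<close>

lemma has_weak_deriv_limit:
  fixes U :: "nat \<Rightarrow> nat \<Rightarrow> real \<Rightarrow> complex"
  assumes U: "\<And>i r x. (U i r has_vector_derivative U i (Suc r) x) (at x)"
    and f: "continuous_on UNIV f" and g: "integrable lborel g"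
    and lim: "uniform_limit UNIV (\<lambda>i. U i 0) f sequentially"
    and Ui: "\<And>i. integrable lborel (U i j)"
    and lim1: "(\<lambda>i. LINT x|lborel. norm (U i j x - g x)) \<longlonglongrightarrow> 0"
  shows "has_weak_deriv j f g"
  unfolding has_weak_deriv_def
proof (intro conjI allI impI)
  have [measurable]: "f \<in> borel_measurable borel" by (rule borel_measurable_continuous_onI[OF f])
  have [measurable]: "g \<in> borel_measurable borel" using g by auto
  show "locally_integrable f"
    unfolding locally_integrable_def by (intro allI borel_integrable_atLeastAtMost' continuous_on_subset[OF f]) simp
  show "locally_integrable g"
    unfolding locally_integrable_def set_integrable_def by (intro allI integrable_mult_indicator g) simp
  fix \<phi> assume \<phi>: "test_function \<phi>"
  obtain R0 where R0: "\<And>x. R0 < \<bar>x\<bar> \<Longrightarrow> \<phi> x = 0" using \<phi> unfolding test_function_def by auto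
  define R where "R = \<bar>R0\<bar> + 1"
  have R: "R0 < \<bar>x\<bar>" if "\<not> \<bar>x\<bar> < R" for x using that unfolding R_def by linarith
  have out: "(deriv ^^ m) \<phi> x = 0" if "\<not> \<bar>x\<bar> < R" for m x
    by (rule deriv_funpow_outside[OF R0 R[OF that]])
  have c: "isCont ((deriv ^^ m) \<phi>) x" for m x
    using \<phi> unfolding test_function_def by (metis differentiable_imp_continuous_within)
  then have con: "continuous_on A ((deriv ^^ m) \<phi>)" for A m
    by (simp add: continuous_at_imp_continuous_on)
  have [measurable]: "(deriv ^^ m) \<phi> \<in> borel_measurable borel" for m
    by (rule borel_measurable_continuous_onI[OF con])
  have "\<exists>B. \<forall>x. \<bar>(deriv ^^ m) \<phi> x\<bar> \<le> B" for m
  proof -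
    have "compact ((deriv ^^ m) \<phi> ` {-R..R})" by (intro compact_continuous_image con) simp
    then obtain B where B: "\<And>x. x \<in> {-R..R} \<Longrightarrow> norm ((deriv ^^ m) \<phi> x) \<le> B"
      by (meson bounded_iff compact_imp_bounded imageI)
    have "\<bar>(deriv ^^ m) \<phi> x\<bar> \<le> max 0 B" for x
      using B[of x] out[of x m] by (cases "\<bar>x\<bar> < R") (auto simp: max_def abs_le_iff abs_less_iff)
    then show ?thesis by blast
  qed
  then obtain B where B: "\<And>m x. \<bar>(deriv ^^ m) \<phi> x\<bar> \<le> B m" by metis
  have Um [measurable]: "U i r \<in> borel_measurable borel" for i r
    using U has_vector_derivative_continuous by (intro borel_measurable_continuous_onI continuous_at_imp_continuous_on) blast
  have 1: "(\<lambda>i. LINT x|lborel. (deriv ^^ j) \<phi> x *\<^sub>R U i 0 x) \<longlonglongrightarrow> (LINT x|lborel. (deriv ^^ j) \<phi> x *\<^sub>R f x)"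
  proof -
    \<comment> \<open>From the index N on, |U i 0| \<le> |f| + 1, which gives a dominating function
      on the support.\<close>
    have "\<forall>\<^sub>F i in sequentially. \<forall>x. dist (U i 0 x) (f x) < 1"
      using uniform_limitD[OF lim, of 1] by simp
    then obtain N where N: "\<And>i x. i \<ge> N \<Longrightarrow> dist (U i 0 x) (f x) < 1" unfolding eventually_sequentially by blast
    have "(\<lambda>i. LINT x|lborel. (deriv ^^ j) \<phi> x *\<^sub>R U (i + N) 0 x) \<longlonglongrightarrow> (LINT x|lborel. (deriv ^^ j) \<phi> x *\<^sub>R f x)"
    proof (rule integral_dominated_convergence[where w = "\<lambda>x. indicator {-R..R} x *\<^sub>R (\<bar>(deriv ^^ j) \<phi> x\<bar> * (norm (f x) + 1))"])
      show "integrable lborel (\<lambda>x. indicator {-R..R} x *\<^sub>R (\<bar>(deriv ^^ j) \<phi> x\<bar> * (norm (f x) + 1)))"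
        by (rule borel_integrable_atLeastAtMost'[unfolded set_integrable_def])
          (intro continuous_intros con continuous_on_subset[OF f] subset_UNIV)
      have "(\<lambda>i. U i 0 x) \<longlonglongrightarrow> f x" for x
        using tendsto_uniform_limitI[OF lim] by simp
      then have "(\<lambda>i. U (i + N) 0 x) \<longlonglongrightarrow> f x" for x using LIMSEQ_ignore_initial_segment by blast
      then show "AE x in lborel. (\<lambda>i. (deriv ^^ j) \<phi> x *\<^sub>R U (i + N) 0 x) \<longlonglongrightarrow> (deriv ^^ j) \<phi> x *\<^sub>R f x"
        by (intro AE_I2 tendsto_intros)
      have "norm (U (i + N) 0 x) \<le> norm (f x) + 1" for i x
        using N[of "i + N" x] norm_triangle_ineq2[of "U (i + N) 0 x" "f x"] by (simp add: dist_norm)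
      then have "norm ((deriv ^^ j) \<phi> x *\<^sub>R U (i + N) 0 x) \<le> indicator {-R..R} x *\<^sub>R (\<bar>(deriv ^^ j) \<phi> x\<bar> * (norm (f x) + 1))" for i x
        using out[of x j] by (cases "\<bar>x\<bar> < R") (auto simp: indicator_def intro!: mult_left_mono)
      then show "AE x in lborel. norm ((deriv ^^ j) \<phi> x *\<^sub>R U (i + N) 0 x) \<le> indicator {-R..R} x *\<^sub>R (\<bar>(deriv ^^ j) \<phi> x\<bar> * (norm (f x) + 1))" for i
        by simp
    qed simp_all
    then show ?thesis by (rule LIMSEQ_offset)
  qed
  have 2: "(\<lambda>i. LINT x|lborel. \<phi> x *\<^sub>R U i j x) \<longlonglongrightarrow> (LINT x|lborel. \<phi> x *\<^sub>R g x)"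
  proof (rule Lim_transform2[OF tendsto_const], rule Lim_null_comparison[OF always_eventually, OF allI])
    fix i
    have m: "\<phi> \<in> borel_measurable borel" using \<open>\<And>m. (deriv ^^ m) \<phi> \<in> borel_measurable borel\<close>[of 0] by simp
    have b: "\<bar>\<phi> x\<bar> \<le> B 0" for x using B[of 0 x] by simp
    have pint: "integrable lborel (\<lambda>x. \<phi> x *\<^sub>R h x)" if "integrable lborel h" for h :: "real \<Rightarrow> complex"
    proof (rule Bochner_Integration.integrable_bound)
      show "integrable lborel (\<lambda>x. B 0 * norm (h x))" using that by simp
      show "(\<lambda>x. \<phi> x *\<^sub>R h x) \<in> borel_measurable lborel" using m that by simp
      show "AE x in lborel. norm (\<phi> x *\<^sub>R h x) \<le> norm (B 0 * norm (h x))"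
        using b by (intro AE_I2) (auto simp: abs_mult intro!: mult_right_mono order_trans[OF b])
    qed
    have "norm ((LINT x|lborel. \<phi> x *\<^sub>R g x) - (LINT x|lborel. \<phi> x *\<^sub>R U i j x)) = norm (LINT x|lborel. \<phi> x *\<^sub>R (g x - U i j x))"
      unfolding scaleR_diff_right by (subst Bochner_Integration.integral_diff) (auto intro: pint g Ui)
    also have "\<dots> \<le> (LINT x|lborel. norm (\<phi> x *\<^sub>R (g x - U i j x)))" by (rule integral_norm_bound)
    also have "\<dots> \<le> (LINT x|lborel. B 0 * norm (U i j x - g x))"
    proof (rule integral_mono)
      show "integrable lborel (\<lambda>x. norm (\<phi> x *\<^sub>R (g x - U i j x)))" "integrable lborel (\<lambda>x. B 0 * norm (U i j x - g x))"
        by (intro integrable_norm pint integrable_mult_right Bochner_Integration.integrable_diff g Ui)+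
      show "norm (\<phi> x *\<^sub>R (g x - U i j x)) \<le> B 0 * norm (U i j x - g x)" for x
        by (simp add: norm_minus_commute mult_right_mono b)
    qed
    finally show "norm ((LINT x|lborel. \<phi> x *\<^sub>R g x) - (LINT x|lborel. \<phi> x *\<^sub>R U i j x)) \<le> B 0 * (LINT x|lborel. norm (U i j x - g x))"
      by simp
  next
    show "(\<lambda>i. B 0 * (LINT x|lborel. norm (U i j x - g x))) \<longlonglongrightarrow> 0"
      using tendsto_mult_left[OF lim1, of "B 0"] by simp
  qed
  have "(LINT x|lborel. (deriv ^^ j) \<phi> x *\<^sub>R U i 0 x) = (-1) ^ j * (LINT x|lborel. \<phi> x *\<^sub>R U i j x)" for i
    using integral_by_parts_test_function[where U = "U i" and r = 0 and j = j, OF \<phi> U] by simp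
  then have "(\<lambda>i. (-1) ^ j * (LINT x|lborel. \<phi> x *\<^sub>R U i j x)) \<longlonglongrightarrow> (LINT x|lborel. (deriv ^^ j) \<phi> x *\<^sub>R f x)"
    using 1 by simp
  moreover have "(\<lambda>i. (-1) ^ j * (LINT x|lborel. \<phi> x *\<^sub>R U i j x)) \<longlonglongrightarrow> (-1) ^ j * (LINT x|lborel. \<phi> x *\<^sub>R g x)"
    by (intro tendsto_intros 2)
  ultimately show "(LINT x|lborel. (deriv ^^ j) \<phi> x *\<^sub>R f x) = (-1) ^ j * (LINT x|lborel. \<phi> x *\<^sub>R g x)"
    by (rule LIMSEQ_unique)
qed

section \<open>Uniform and principal value bounds\<close>

lemma has_vector_derivative_series:
  fixes f :: "nat \<Rightarrow> real \<Rightarrow> 'a :: banach"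
  assumes "\<And>n x. (f n has_vector_derivative f' n x) (at x)"
    and "uniform_limit UNIV (\<lambda>n x. \<Sum>i<n. f' i x) g' sequentially"
    and "\<And>x. (\<lambda>n. f n x) sums g x"
  shows "(g has_vector_derivative g' x) (at x)"
proof -
  have "\<exists>h. \<forall>x\<in>UNIV. (\<lambda>n. f n x) sums (h x) \<and> (h has_derivative (\<lambda>y. y *\<^sub>R g' x)) (at x within UNIV)"
  proof (rule has_derivative_series)
    fix e :: real assume "e > 0"
    from uniform_limitD[OF assms(2) this]
    show "\<forall>\<^sub>F n in sequentially. \<forall>x\<in>UNIV. \<forall>h. norm ((\<Sum>i<n. h *\<^sub>R f' i x) - h *\<^sub>R g' x) \<le> e * norm h"
    proof eventually_elim
      case (elim n)
      show ?case
      proof (intro ballI allI)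
        fix x h :: real
        have "norm ((\<Sum>i<n. h *\<^sub>R f' i x) - h *\<^sub>R g' x) = \<bar>h\<bar> * norm ((\<Sum>i<n. f' i x) - g' x)"
          by (simp add: scaleR_sum_right[symmetric] scaleR_diff_right[symmetric])
        also have "\<dots> \<le> \<bar>h\<bar> * e" using elim by (intro mult_left_mono) (auto simp: dist_norm less_imp_le)
        finally show "norm ((\<Sum>i<n. h *\<^sub>R f' i x) - h *\<^sub>R g' x) \<le> e * norm h" by (simp add: mult.commute)
      qed
    qed
  qed (use assms(1,3) in \<open>auto simp: has_vector_derivative_def\<close>)
  then obtain h where h: "\<And>x. (\<lambda>n. f n x) sums (h x)" "\<And>x. (h has_derivative (\<lambda>y. y *\<^sub>R g' x)) (at x)" by auto
  have "h = g" using h(1) assms(3) sums_unique2 by blast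
  then show ?thesis using h(2) by (simp add: has_vector_derivative_def)
qed

section \<open>Uniform bounds\<close>

text \<open>Derivatives of the terms up to order r are dominated by a multiple of
  \<open>wt k ^ r * norm (c k)\<close>. The Weierstrass test then gives termwise differentiation,
  and Tannery's theorem the limits at infinity.\<close>

lemma wave_series_C0:
  assumes \<beta>: "\<beta> > 0"
  obtains K where "K \<ge> 0" "\<And>c u B. (\<lambda>k. wt k ^ r * norm (c k)) summable_on UNIV \<Longrightarrow>
     (\<Sum>\<^sub>\<infinity>k. wt k ^ r * norm (c k)) \<le> B \<Longrightarrow> (c has_sum 0) UNIV \<Longrightarrow>
     (\<And>x. ((\<lambda>k. c k * wave \<beta> k x) has_sum u x) UNIV) \<Longrightarrow> in_C0 r u \<and> C0_norm r u \<le> K * B"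
proof -
  have "\<exists>C. C \<ge> 0 \<and> (\<forall>k x. norm (wave_deriv \<beta> j k x) \<le> C * wt k ^ j)" for j
    using norm_wave_deriv_le[OF \<beta>, of j] unfolding wt_def by metis
  then obtain C where C: "\<And>j. C j \<ge> 0" "\<And>j k x. norm (wave_deriv \<beta> j k x) \<le> C j * wt k ^ j" by metis
  show ?thesis
  proof (rule that[of "\<Sum>j\<le>r. C j"])
    show "0 \<le> (\<Sum>j\<le>r. C j)" by (intro sum_nonneg C)
    fix c :: "int \<Rightarrow> complex" and u :: "real \<Rightarrow> complex" and B
    assume s: "(\<lambda>k. wt k ^ r * norm (c k)) summable_on UNIV" and B: "(\<Sum>\<^sub>\<infinity>k. wt k ^ r * norm (c k)) \<le> B"
      and c0: "(c has_sum 0) UNIV" and u: "\<And>x. ((\<lambda>k. c k * wave \<beta> k x) has_sum u x) UNIV"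
    define \<kappa> where "\<kappa> = int_decode"
    let ?m = "\<lambda>i. wt (\<kappa> i) ^ r * norm (c (\<kappa> i))"
    define D where "D j x = (\<Sum>i. c (\<kappa> i) * wave_deriv \<beta> j (\<kappa> i) x)" for j x
    have sm: "summable ?m" unfolding \<kappa>_def by (rule summable_on_int_imp_summable[OF s])
    have smB: "suminf ?m \<le> B" using infsum_int_eq_suminf[OF s] B unfolding \<kappa>_def by (simp add: sums_iff)
    have tb: "norm (c (\<kappa> i) * wave_deriv \<beta> j (\<kappa> i) x) \<le> C j * ?m i" if "j \<le> r" for i j x
    proof -
      have "norm (c (\<kappa> i) * wave_deriv \<beta> j (\<kappa> i) x) \<le> norm (c (\<kappa> i)) * (C j * wt (\<kappa> i) ^ j)"
        unfolding norm_mult by (intro mult_left_mono C) auto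
      also have "\<dots> \<le> norm (c (\<kappa> i)) * (C j * wt (\<kappa> i) ^ r)"
        using that by (intro mult_left_mono power_increasing wt_ge_1 C) auto
      finally show ?thesis by (simp add: mult_ac)
    qed
    have smC: "summable (\<lambda>i. C j * ?m i)" for j by (intro summable_mult sm)
    have ul: "uniform_limit UNIV (\<lambda>n x. \<Sum>i<n. c (\<kappa> i) * wave_deriv \<beta> j (\<kappa> i) x) (D j) sequentially" if "j \<le> r" for j
      unfolding D_def by (rule Weierstrass_m_test[OF _ smC]) (use tb that in auto)
    have sums: "(\<lambda>i. c (\<kappa> i) * wave_deriv \<beta> j (\<kappa> i) x) sums D j x" if "j \<le> r" for j x
      using tendsto_uniform_limitI[OF ul[OF that], of x] by (simp add: sums_def)
    have der: "(D j has_vector_derivative D (Suc j) x) (at x)" if "j < r" for j x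
      by (rule has_vector_derivative_series[OF _ ul sums])
        (use that in \<open>auto intro!: has_vector_derivative_mult_right has_vector_derivative_wave_deriv \<beta> simp del: wave_deriv.simps\<close>)
    have D0: "D 0 = u"
    proof
      fix x
      have "(\<lambda>i. c (\<kappa> i) * wave \<beta> (\<kappa> i) x) sums u x"
        using u[of x] has_sum_reindex_bij_betw[OF bij_int_decode, of "\<lambda>k. c k * wave \<beta> k x"] has_sum_imp_sums unfolding \<kappa>_def by blast
      then show "D 0 x = u x" unfolding D_def by (simp add: sums_iff)
    qed
    have sd: "strong_deriv j u = D j" if "j \<le> r" for j using that
    proof (induction j)
      case 0
      then show ?case by (simp add: strong_deriv_def D0)
    next
      case (Suc j)
      then have "strong_deriv j u = D j" by simp
      moreover have "strong_deriv (Suc j) u = (\<lambda>x. vector_derivative (strong_deriv j u) (at x))"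
        by (simp add: strong_deriv_def)
      ultimately show ?case using der[of j] Suc.prems by (auto simp: vector_derivative_at)
    qed
    have cont: "continuous_on UNIV (D r)"
      by (rule uniform_limit_theorem[OF always_eventually ul])
        (auto intro!: continuous_intros continuous_at_imp_continuous_on continuous_wave_deriv \<beta>)
    have lim: "(D j \<longlongrightarrow> 0) at_infinity" if "j \<le> r" for j
    proof (cases j)
      case 0
      \<comment> \<open>The undifferentiated powers tend to 1 rather than 0; subtracting the
        vanishing sum of the coefficients repairs this.\<close>
      have e: "D 0 x = (\<Sum>i. c (\<kappa> i) * (wave \<beta> (\<kappa> i) x - 1))" for x
      proof -
        have "(\<lambda>i. c (\<kappa> i)) sums 0"
          using c0 has_sum_reindex_bij_betw[OF bij_int_decode, of c] has_sum_imp_sums unfolding \<kappa>_def by blast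
        from sums_diff[OF sums[of 0 x] this] show ?thesis by (simp add: sums_iff right_diff_distrib)
      qed
      have "((\<lambda>x. \<Sum>i. c (\<kappa> i) * (wave \<beta> (\<kappa> i) x - 1)) \<longlongrightarrow> (\<Sum>i::nat. 0)) at_infinity"
      proof (rule tannerys_theorem[THEN conjunct2, THEN conjunct2])
        have "((\<lambda>x. c (\<kappa> i) * (wave \<beta> (\<kappa> i) x - 1)) \<longlongrightarrow> c (\<kappa> i) * (1 - 1)) at_infinity" for i
          by (intro tendsto_intros wave_tendsto_1 \<beta>)
        then show "((\<lambda>x. c (\<kappa> i) * (wave \<beta> (\<kappa> i) x - 1)) \<longlongrightarrow> 0) at_infinity" for i by simp
        have "norm (c (\<kappa> i) * (wave \<beta> (\<kappa> i) x - 1)) \<le> 2 * ?m i" for i x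
        proof -
          have "norm (wave \<beta> (\<kappa> i) x - 1) \<le> 2" using norm_triangle_ineq4[of "wave \<beta> (\<kappa> i) x" 1] by simp
          then have "norm (c (\<kappa> i) * (wave \<beta> (\<kappa> i) x - 1)) \<le> norm (c (\<kappa> i)) * 2"
            unfolding norm_mult by (intro mult_left_mono) auto
          also have "norm (c (\<kappa> i)) \<le> wt (\<kappa> i) ^ r * norm (c (\<kappa> i))"
            using mult_right_mono[of 1 "wt (\<kappa> i) ^ r" "norm (c (\<kappa> i))"] one_le_power[OF wt_ge_1] by simp
          finally show ?thesis by simp
        qed
        then show "\<forall>\<^sub>F (i, x) in at_top \<times>\<^sub>F at_infinity. norm (c (\<kappa> i) * (wave \<beta> (\<kappa> i) x - 1)) \<le> 2 * ?m i"
          by (intro always_eventually) auto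
        show "summable (\<lambda>i. 2 * ?m i)" by (intro summable_mult sm)
      qed (rule trivial_limit_at_infinity)
      then show ?thesis unfolding 0 e[abs_def] by simp
    next
      case (Suc q)
      have "((\<lambda>x. \<Sum>i. c (\<kappa> i) * wave_deriv \<beta> j (\<kappa> i) x) \<longlongrightarrow> (\<Sum>i::nat. 0)) at_infinity"
      proof (rule tannerys_theorem[THEN conjunct2, THEN conjunct2])
        have "((\<lambda>x. c (\<kappa> i) * wave_deriv \<beta> j (\<kappa> i) x) \<longlongrightarrow> c (\<kappa> i) * 0) at_infinity" for i
          unfolding Suc by (intro tendsto_intros wave_deriv_tendsto_0 \<beta>)
        then show "((\<lambda>x. c (\<kappa> i) * wave_deriv \<beta> j (\<kappa> i) x) \<longlongrightarrow> 0) at_infinity" for i by simp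
        show "\<forall>\<^sub>F (i, x) in at_top \<times>\<^sub>F at_infinity. norm (c (\<kappa> i) * wave_deriv \<beta> j (\<kappa> i) x) \<le> C j * ?m i"
          using tb[OF that] by (intro always_eventually) auto
      qed (rule smC trivial_limit_at_infinity)+
      then show ?thesis unfolding D_def[abs_def] by simp
    qed
    have bound: "norm (D j x) \<le> C j * B" if "j \<le> r" for j x
    proof -
      have "norm (D j x) \<le> (\<Sum>i. norm (c (\<kappa> i) * wave_deriv \<beta> j (\<kappa> i) x))"
        unfolding D_def by (rule summable_norm) (rule summable_comparison_test'[OF smC, of 0 _ j], use tb[OF that] in simp)
      also have "\<dots> \<le> (\<Sum>i. C j * ?m i)"
        by (intro suminf_le tb that smC summable_comparison_test'[OF smC, of 0 _ j]) (use tb[OF that] in simp)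
      also have "\<dots> = C j * suminf ?m" by (rule suminf_mult[OF sm])
      also have "\<dots> \<le> C j * B" by (intro mult_left_mono smB C)
      finally show ?thesis .
    qed
    show "in_C0 r u \<and> C0_norm r u \<le> (\<Sum>j\<le>r. C j) * B"
    proof
      show "in_C0 r u"
        unfolding in_C0_def
      proof (intro conjI allI impI)
        fix j x assume "j < r"
        then show "strong_deriv j u differentiable (at x)"
          using der[of j x] sd[of j] differentiableI_vector by auto
      qed (use sd cont lim in auto)
      have "C0_norm r u \<le> (\<Sum>j\<le>r. C j * B)"
        unfolding C0_norm_def by (intro sum_mono cSUP_least) (use sd bound in auto)
      then show "C0_norm r u \<le> (\<Sum>j\<le>r. C j) * B" by (simp add: sum_distrib_right)
    qed
  qed
qed

section \<open>The principal value integral\<close>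

lemma continuous_on_wave: "\<beta> > 0 \<Longrightarrow> continuous_on A (wave \<beta> k)"
  using has_vector_derivative_continuous[OF has_vector_derivative_wave] by (intro continuous_at_imp_continuous_on) blast

lemma wave_minus: "\<beta> > 0 \<Longrightarrow> wave \<beta> k (- x) = cnj (wave \<beta> k x)"
proof -
  assume "\<beta> > 0"
  have "wave \<beta> k (- x) = cis (of_int k * (2 * pi)) * cis (- (of_int k * angle \<beta> x))"
    by (simp add: wave_def cis_mult angle_def arctan_minus algebra_simps)
  also have "cis (of_int k * (2 * pi)) = 1"
    using cis_multiple_2pi[of "of_int k"] by (simp add: mult.commute mult.assoc)
  finally show ?thesis by (simp add: wave_def cis_cnj)
qed

lemma norm_wave_minus_one_sq: "(norm (wave \<beta> k x - 1))\<^sup>2 = 2 - 2 * Re (wave \<beta> k x)"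
proof -
  have "(Re (wave \<beta> k x))\<^sup>2 + (Im (wave \<beta> k x))\<^sup>2 = 1"
    using norm_wave[of \<beta> k x] by (simp add: cmod_power2[symmetric])
  then show ?thesis unfolding cmod_power2 by (simp add: power2_diff)
qed

text \<open>By the symmetry of the interval only the real part of the integrand survives, and
  \<open>Re z - 1 = - |z - 1|\<^sup>2 / 2\<close> on the unit circle.\<close>

lemma wave_minus_one_truncated_integral:
  assumes \<beta>: "\<beta> > 0"
  shows "(LINT x:{-R..R}|lborel. wave \<beta> k x - 1) = of_real (- (1/2) * (LINT x|lborel. indicator {-R..R} x * (norm (wave \<beta> k x - 1))\<^sup>2))"
proof -
  let ?g = "\<lambda>x. indicator {-R..R} x *\<^sub>R (wave \<beta> k x - 1)"
  have gc: "continuous_on A (\<lambda>x. wave \<beta> k x - 1)" for A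
    by (intro continuous_intros continuous_on_wave \<beta>)
  have gi: "integrable lborel ?g"
    using borel_integrable_atLeastAtMost'[OF gc, of "-R" R] unfolding set_integrable_def .
  have refl: "?g (- x) = cnj (?g x)" for x
    using wave_minus[OF \<beta>, of k x] by (auto simp: indicator_def)
  have "integral\<^sup>L lborel ?g = integral\<^sup>L lborel (\<lambda>x. ?g (- x))"
    using lborel_integral_real_affine[of "-1" ?g 0] by simp
  also have "\<dots> = cnj (integral\<^sup>L lborel ?g)"
    unfolding refl by (rule integral_bounded_linear[OF bounded_linear_cnj gi])
  finally have "Im (integral\<^sup>L lborel ?g) = - Im (integral\<^sup>L lborel ?g)" by (metis cnj.sel(2))
  then have "Im (integral\<^sup>L lborel ?g) = 0" by simp
  moreover have "Re (integral\<^sup>L lborel ?g) = (LINT x|lborel. Re (?g x))"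
    using integral_Re[OF gi] by simp
  moreover have "Re (?g x) = - (1/2) * (indicator {-R..R} x * (norm (wave \<beta> k x - 1))\<^sup>2)" for x
    unfolding norm_wave_minus_one_sq by (simp add: algebra_simps)
  ultimately show ?thesis unfolding set_lebesgue_integral_def by (simp add: complex_eq_iff)
qed

text \<open>The truncated integrals of M^k - 1 are bounded by \<open>2 * pi * \<beta> * wt k\<close>
  uniformly in the radius, and each converges. Summability of \<open>wt k * norm (c k)\<close>
  therefore lets the radius tend to infinity under the sum, by Tannery's theorem.\<close>

lemma wave_series_pv:
  assumes \<beta>: "\<beta> > 0" and s: "(\<lambda>k. wt k * norm (c k)) summable_on UNIV" and B: "(\<Sum>\<^sub>\<infinity>k. wt k * norm (c k)) \<le> B"
    and c0: "(c has_sum 0) UNIV" and u: "\<And>x. ((\<lambda>k. c k * wave \<beta> k x) has_sum u x) UNIV"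
  shows "\<exists>L. has_pv_integral u L \<and> norm L \<le> 2 * pi * \<beta> * B"
proof -
  define \<kappa> where "\<kappa> = int_decode"
  let ?m = "\<lambda>i. wt (\<kappa> i) * norm (c (\<kappa> i))"
  have sm: "summable ?m" unfolding \<kappa>_def by (rule summable_on_int_imp_summable[OF s])
  have smB: "suminf ?m \<le> B" using infsum_int_eq_suminf[OF s] B unfolding \<kappa>_def by (simp add: sums_iff)
  have cm: "norm (c (\<kappa> i)) \<le> ?m i" for i
    using mult_right_mono[OF wt_ge_1[of "\<kappa> i"], of "norm (c (\<kappa> i))"] by simp
  \<comment> \<open>The vanishing sum of the coefficients enters here: the differences have bounded
    truncated integrals, the powers themselves do not.\<close>
  have su: "(\<lambda>i. c (\<kappa> i) * (wave \<beta> (\<kappa> i) x - 1)) sums u x" for x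
  proof -
    have "(\<lambda>i. c (\<kappa> i) * wave \<beta> (\<kappa> i) x) sums u x" "(\<lambda>i. c (\<kappa> i)) sums 0"
      using u[of x] c0 has_sum_reindex_bij_betw[OF bij_int_decode, of "\<lambda>k. c k * wave \<beta> k x"]
        has_sum_reindex_bij_betw[OF bij_int_decode, of c] has_sum_imp_sums unfolding \<kappa>_def by blast+
    from sums_diff[OF this] show ?thesis by (simp add: right_diff_distrib)
  qed
  define I where "I k R = - (1/2) * (LINT x|lborel. indicator {-R..R} x * (norm (wave \<beta> k x - 1))\<^sup>2)" for k R
  have Ib: "\<bar>I k R\<bar> \<le> 2 * pi * \<beta> * wt k" for k R
  proof -
    have "(LINT x|lborel. indicator {-R..R} x * (norm (wave \<beta> k x - 1))\<^sup>2) \<le> (LINT x|lborel. (norm (wave \<beta> k x - 1))\<^sup>2)"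
    proof (rule integral_mono)
      show "integrable lborel (\<lambda>x. indicator {-R..R} x * (norm (wave \<beta> k x - 1))\<^sup>2)"
        using integrable_mult_indicator[OF _ wave_minus_one_sq_integral(1)[OF \<beta>], of "{-R..R}" k] by simp
    qed (auto simp: indicator_def intro!: wave_minus_one_sq_integral(1)[OF \<beta>])
    moreover have "0 \<le> (LINT x|lborel. indicator {-R..R} x * (norm (wave \<beta> k x - 1))\<^sup>2)"
      by (intro Bochner_Integration.integral_nonneg) simp
    moreover have "4 * pi * \<beta> * real_of_int \<bar>k\<bar> \<le> 4 * pi * \<beta> * wt k"
      using \<beta> by (intro mult_left_mono) (auto simp: wt_def)
    ultimately have "\<bar>I k R\<bar> \<le> (1/2) * (4 * pi * \<beta> * wt k)"
      unfolding I_def wave_minus_one_sq_integral(2)[OF \<beta>] by (simp only: abs_mult)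
    then show ?thesis by simp
  qed
  have Il: "((\<lambda>R. I k R) \<longlongrightarrow> - (1/2) * (4 * pi * \<beta> * real_of_int \<bar>k\<bar>)) at_top" for k
    unfolding I_def wave_minus_one_sq_integral(2)[OF \<beta>, symmetric]
  proof (intro tendsto_mult tendsto_const, rule integral_dominated_convergence_at_top[where w = "\<lambda>x. (norm (wave \<beta> k x - 1))\<^sup>2"])
    show "AE x in lborel. ((\<lambda>R. indicator {-R..R} x * (norm (wave \<beta> k x - 1))\<^sup>2) \<longlongrightarrow> (norm (wave \<beta> k x - 1))\<^sup>2) at_top"
    proof (intro AE_I2 tendsto_eventually)
      fix x show "\<forall>\<^sub>F R in at_top. indicator {-R..R} x * (norm (wave \<beta> k x - 1))\<^sup>2 = (norm (wave \<beta> k x - 1))\<^sup>2"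
        using eventually_ge_at_top[of "\<bar>x\<bar>"] by eventually_elim (simp add: indicator_def, linarith)
    qed
    show "\<forall>\<^sub>F R in at_top. AE x in lborel. norm (indicator {-R..R} x * (norm (wave \<beta> k x - 1))\<^sup>2) \<le> (norm (wave \<beta> k x - 1))\<^sup>2"
      by (intro always_eventually allI AE_I2) (simp add: indicator_def)
  qed (use wave_minus_one_sq_integral(1)[OF \<beta>] in simp_all)
  have int: "(LINT x:{-R..R}|lborel. u x) = (\<Sum>i. c (\<kappa> i) * of_real (I (\<kappa> i) R))" for R
  proof -
    let ?f = "\<lambda>i x. indicator {-R..R} x *\<^sub>R (c (\<kappa> i) * (wave \<beta> (\<kappa> i) x - 1))"
    have fi: "integrable lborel (?f i)" for i
      using borel_integrable_atLeastAtMost'[of "-R" R "\<lambda>x. c (\<kappa> i) * (wave \<beta> (\<kappa> i) x - 1)"]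
      unfolding set_integrable_def by (simp add: continuous_intros continuous_on_wave \<beta>)
    have fb: "norm (?f i x) \<le> indicator {-R..R} x * (2 * ?m i)" for i x
    proof -
      have "norm (wave \<beta> (\<kappa> i) x - 1) \<le> 2" using norm_triangle_ineq4[of "wave \<beta> (\<kappa> i) x" 1] by simp
      then have "norm (c (\<kappa> i)) * norm (wave \<beta> (\<kappa> i) x - 1) \<le> ?m i * 2" by (intro mult_mono cm) (auto simp: wt_nonneg)
      then show ?thesis by (simp add: norm_mult indicator_def)
    qed
    have ssum: "summable (\<lambda>i. norm (?f i x))" for x
      by (rule summable_comparison_test'[of "\<lambda>i. indicator {-R..R} x * (2 * ?m i)" 0])
        (auto intro!: summable_mult sm simp: fb[simplified])
    have "(\<lambda>i. integral\<^sup>L lborel (?f i)) sums (LINT x|lborel. (\<Sum>i. ?f i x))"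
    proof (rule sums_integral[OF fi])
      show "AE x in lborel. summable (\<lambda>i. norm (?f i x))" using ssum by simp
      show "summable (\<lambda>i. LINT x|lborel. norm (?f i x))"
      proof (rule summable_comparison_test'[of "\<lambda>i. measure lborel {-R..R} * (2 * ?m i)" 0])
        show "summable (\<lambda>i. measure lborel {-R..R} * (2 * ?m i))" by (intro summable_mult sm)
        fix i :: nat
        have ii: "integrable lborel (\<lambda>x. indicator {-R..R} x * (2 * ?m i))"
          by (intro integrable_mult_left integrable_real_indicator) (simp_all add: emeasure_lborel_Icc_eq)
        have "(LINT x|lborel. norm (?f i x)) \<le> (LINT x|lborel. indicator {-R..R} x * (2 * ?m i))"
          by (intro integral_mono integrable_norm fi ii fb)
        then show "norm (LINT x|lborel. norm (?f i x)) \<le> measure lborel {-R..R} * (2 * ?m i)"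
          by simp
      qed
    qed
    moreover have "(\<Sum>i. ?f i x) = indicator {-R..R} x *\<^sub>R u x" for x
      using sums_scaleR_right[OF su[of x], of "indicator {-R..R} x"] by (simp add: sums_iff)
    moreover have "integral\<^sup>L lborel (?f i) = c (\<kappa> i) * of_real (I (\<kappa> i) R)" for i
    proof -
      have "integral\<^sup>L lborel (?f i) = (LINT x:{-R..R}|lborel. c (\<kappa> i) * (wave \<beta> (\<kappa> i) x - 1))"
        unfolding set_lebesgue_integral_def ..
      then show ?thesis unfolding set_integral_mult_right wave_minus_one_truncated_integral[OF \<beta>] I_def .
    qed
    ultimately show ?thesis unfolding set_lebesgue_integral_def by (simp add: sums_iff)
  qed
  define J where "J k = - (1/2) * (4 * pi * \<beta> * real_of_int \<bar>k\<bar>)" for k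
  define L where "L = (\<Sum>i. c (\<kappa> i) * of_real (J (\<kappa> i)))"
  have tb: "norm (c (\<kappa> i) * of_real (I (\<kappa> i) R)) \<le> 2 * pi * \<beta> * ?m i" for i R
    using mult_left_mono[OF Ib[of "\<kappa> i" R], of "norm (c (\<kappa> i))"] by (simp add: norm_mult mult_ac)
  have "((\<lambda>R. \<Sum>i. c (\<kappa> i) * of_real (I (\<kappa> i) R)) \<longlongrightarrow> L) at_top"
    unfolding L_def
  proof (rule tannerys_theorem[THEN conjunct2, THEN conjunct2])
    show "((\<lambda>R. c (\<kappa> i) * of_real (I (\<kappa> i) R)) \<longlongrightarrow> c (\<kappa> i) * of_real (J (\<kappa> i))) at_top" for i
      unfolding J_def by (intro tendsto_intros Il)
    show "\<forall>\<^sub>F (i, R) in at_top \<times>\<^sub>F at_top. norm (c (\<kappa> i) * complex_of_real (I (\<kappa> i) R)) \<le> 2 * pi * \<beta> * ?m i"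
      by (intro always_eventually) (use tb in auto)
    show "summable (\<lambda>i. 2 * pi * \<beta> * ?m i)" by (intro summable_mult sm)
  qed simp
  then have "has_pv_integral u L" unfolding has_pv_integral_def int .
  moreover have "norm L \<le> 2 * pi * \<beta> * B"
  proof -
    have jb: "norm (c (\<kappa> i) * of_real (J (\<kappa> i))) \<le> 2 * pi * \<beta> * ?m i" for i
    proof -
      have "\<bar>J (\<kappa> i)\<bar> \<le> 2 * pi * \<beta> * wt (\<kappa> i)" unfolding J_def wt_def using \<beta> by (simp add: abs_mult)
      from mult_left_mono[OF this, of "norm (c (\<kappa> i))"] show ?thesis by (simp add: norm_mult mult_ac)
    qed
    have sj: "summable (\<lambda>i. norm (c (\<kappa> i) * of_real (J (\<kappa> i))))"
      by (rule summable_comparison_test'[OF summable_mult[OF sm, of "2 * pi * \<beta>"], of 0]) (use jb in simp)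
    have "norm L \<le> (\<Sum>i. norm (c (\<kappa> i) * of_real (J (\<kappa> i))))" unfolding L_def by (rule summable_norm[OF sj])
    also have "\<dots> \<le> (\<Sum>i. 2 * pi * \<beta> * ?m i)" by (intro suminf_le jb sj summable_mult sm)
    also have "\<dots> = 2 * pi * \<beta> * suminf ?m" by (rule suminf_mult[OF sm])
    also have "\<dots> \<le> 2 * pi * \<beta> * B" using \<beta> by (intro mult_left_mono smB) auto
    finally show ?thesis .
  qed
  ultimately show ?thesis by blast
qed

section \<open>Weak derivatives in \<open>L\<^sup>1\<close>\<close>

text \<open>The partial sums of the derivatives are made to converge in L1 by grouping them into
  blocks with summable norms, which also gives convergence almost everywhere. The limit is a weak
  derivative because the undifferentiated sums converge uniformly.\<close>

lemma wave_series_L1: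
  assumes \<beta>: "\<beta> > 0"
  obtains K where "K \<ge> 0" "\<And>c u X. X > 0 \<Longrightarrow> (\<lambda>k. wt k ^ (2 * Suc r) * (norm (c k))\<^sup>2) summable_on UNIV \<Longrightarrow>
     (\<Sum>\<^sub>\<infinity>k. wt k ^ (2 * Suc r) * (norm (c k))\<^sup>2) \<le> X\<^sup>2 \<Longrightarrow> (\<lambda>k. norm (c k)) summable_on UNIV \<Longrightarrow>
     (\<And>x. ((\<lambda>k. c k * wave \<beta> k x) has_sum u x) UNIV) \<Longrightarrow>
     deriv_in_L1 (Suc r) u \<and> L1_norm (weak_deriv (Suc r) u) \<le> K * X"
proof -
  obtain C where C: "C \<ge> 0"
    "\<And>A a X. finite A \<Longrightarrow> X > 0 \<Longrightarrow> (\<Sum>k\<in>A. wt k ^ (2 * Suc r) * (norm (a k))\<^sup>2) \<le> X\<^sup>2 \<Longrightarrow>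
      (\<integral>\<^sup>+x. ennreal (norm (\<Sum>k\<in>A. a k * wave_deriv \<beta> (Suc r) k x)) \<partial>lborel) \<le> ennreal (C * X)"
    using wave_deriv_sum_L1_bound[OF \<beta>, of r] unfolding wt_def by blast
  show ?thesis
  proof (rule that[OF C(1)])
    fix c :: "int \<Rightarrow> complex" and u :: "real \<Rightarrow> complex" and X :: real
    assume X: "X > 0" and s: "(\<lambda>k. wt k ^ (2 * Suc r) * (norm (c k))\<^sup>2) summable_on UNIV"
      and sX: "(\<Sum>\<^sub>\<infinity>k. wt k ^ (2 * Suc r) * (norm (c k))\<^sup>2) \<le> X\<^sup>2" and s1: "(\<lambda>k. norm (c k)) summable_on UNIV"
      and u: "\<And>x. ((\<lambda>k. c k * wave \<beta> k x) has_sum u x) UNIV"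
    define \<kappa> where "\<kappa> = int_decode"
    define q where "q k = wt k ^ (2 * Suc r) * (norm (c k))\<^sup>2" for k
    have q0: "q k \<ge> 0" for k unfolding q_def by (intro mult_nonneg_nonneg zero_le_power wt_nonneg) simp
    have inj: "inj \<kappa>" unfolding \<kappa>_def by (rule inj_int_decode)
    have qsum: "summable (\<lambda>i. q (\<kappa> i))" unfolding \<kappa>_def q_def by (rule summable_on_int_imp_summable[OF s])
    \<comment> \<open>The L1 bound takes a square root, so tails of size (1/4)^l lead to blocks of
      L1 norm of order (1/2)^l.\<close>
    have "\<exists>N. \<forall>m\<ge>N. norm (\<Sum>i. q (\<kappa> (i + m))) < (1/4) ^ l" for l :: nat
      by (rule suminf_exist_split[OF _ qsum]) simp
    then obtain N where N: "\<And>l m. m \<ge> N l \<Longrightarrow> norm (\<Sum>i. q (\<kappa> (i + m))) < (1/4) ^ l" by metis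
    \<comment> \<open>At least \<open>N l\<close>, increasing in l, and unbounded because of the
      summand l.\<close>
    define M where "M l = l + (\<Sum>i\<le>l. N i)" for l
    have MN: "M l \<ge> N l" for l unfolding M_def using member_le_sum[of l "{..l}" N] by simp
    have Mmono: "M l \<le> M (Suc l)" for l unfolding M_def by simp
    define A where "A l = \<kappa> ` {..<M l}" for l
    have finA: "finite (A l)" for l unfolding A_def by simp
    have Asub: "A l \<subseteq> A (Suc l)" for l unfolding A_def using Mmono[of l] by (intro image_mono) auto
    define U where "U l j x = (\<Sum>k\<in>A l. c k * wave_deriv \<beta> j k x)" for l j x
    define p where "p l x = (\<Sum>k\<in>A (Suc l) - A l. c k * wave_deriv \<beta> (Suc r) k x)" for l x
    have Um [measurable]: "U l j \<in> borel_measurable borel" for l j unfolding U_def[abs_def] by measurable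
    have pm [measurable]: "p l \<in> borel_measurable borel" for l unfolding p_def[abs_def] by measurable
    have Ustep: "U (Suc l) (Suc r) x = U l (Suc r) x + p l x" for l x
      unfolding U_def p_def using sum.subset_diff[OF Asub finA] by (simp add: add.commute)
    have Usum: "U l (Suc r) x = U 0 (Suc r) x + (\<Sum>i<l. p i x)" for l x
      by (induction l) (simp_all add: Ustep)
    have UX: "(\<integral>\<^sup>+x. ennreal (norm (U l (Suc r) x)) \<partial>lborel) \<le> ennreal (C * X)" for l
      unfolding U_def
    proof (rule C(2)[OF finA X])
      have "(\<Sum>k\<in>A l. q k) \<le> infsum q UNIV"
        by (rule finite_sum_le_infsum) (use s finA q0 in \<open>auto simp: q_def[abs_def]\<close>)
      then show "(\<Sum>k\<in>A l. wt k ^ (2 * Suc r) * (norm (c k))\<^sup>2) \<le> X\<^sup>2" using sX unfolding q_def by simp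
    qed
    have pX: "(\<integral>\<^sup>+x. ennreal (norm (p l x)) \<partial>lborel) \<le> ennreal (C * (1/2) ^ l)" for l
      unfolding p_def
    proof (rule C(2))
      have "A (Suc l) - A l = \<kappa> ` {M l..<M (Suc l)}"
        unfolding A_def image_set_diff[OF inj, symmetric] by (rule arg_cong[of _ _ "image \<kappa>"]) auto
      then have "(\<Sum>k\<in>A (Suc l) - A l. q k) = (\<Sum>i\<in>{M l..<M (Suc l)}. q (\<kappa> i))"
        using inj by (simp add: sum.reindex inj_on_subset)
      also have "\<dots> = (\<Sum>i\<in>{..<M (Suc l) - M l}. q (\<kappa> (i + M l)))"
        by (rule sum.reindex_bij_witness[of _ "\<lambda>i. i + M l" "\<lambda>i. i - M l"]) auto
      also have "\<dots> \<le> (\<Sum>i. q (\<kappa> (i + M l)))"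
        by (rule sum_le_suminf) (use qsum q0 summable_iff_shift[of "\<lambda>i. q (\<kappa> i)"] in auto)
      also have "\<dots> \<le> (1/4) ^ l" using N[OF MN[of l]] by simp
      also have "(1/4 :: real) ^ l = ((1/2) ^ l)\<^sup>2"
      proof -
        have "(1/4 :: real) = (1/2)\<^sup>2" by (simp add: power2_eq_square)
        then show ?thesis by (simp only: power_mult[symmetric] mult.commute)
      qed
      finally show "(\<Sum>k\<in>A (Suc l) - A l. wt k ^ (2 * Suc r) * (norm (c k))\<^sup>2) \<le> ((1/2) ^ l)\<^sup>2" unfolding q_def .
    qed (use finA in simp_all)
    have "(\<integral>\<^sup>+x. (\<Sum>l. ennreal (norm (p l x))) \<partial>lborel) = (\<Sum>l. \<integral>\<^sup>+x. ennreal (norm (p l x)) \<partial>lborel)"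
      by (rule nn_integral_suminf) simp
    also have "\<dots> \<le> (\<Sum>l. ennreal (C * (1/2) ^ l))" by (intro suminf_le pX) auto
    also have "\<dots> = ennreal (\<Sum>l. C * (1/2) ^ l)"
      using C(1) by (intro suminf_ennreal2 summable_mult summable_geometric) auto
    finally have pint: "(\<integral>\<^sup>+x. (\<Sum>l. ennreal (norm (p l x))) \<partial>lborel) \<le> ennreal (\<Sum>l. C * (1/2) ^ l)" .
    then have pint': "(\<integral>\<^sup>+x. (\<Sum>l. ennreal (norm (p l x))) \<partial>lborel) \<noteq> \<infinity>" by (auto simp: top_unique)
    have "AE x in lborel. (\<Sum>l. ennreal (norm (p l x))) \<noteq> \<infinity>"
      by (rule nn_integral_PInf_AE[OF _ pint']) simp
    then have AEs: "AE x in lborel. summable (\<lambda>l. norm (p l x))"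
      by eventually_elim (rule summable_suminf_not_top, auto)
    \<comment> \<open>One dominating function for all partial sums, used for the integrability of
      \<open>g\<close> and for convergence in L1.\<close>
    define h where "h x = norm (U 0 (Suc r) x) + (\<Sum>l. norm (p l x))" for x
    define g where "g x = U 0 (Suc r) x + (\<Sum>l. p l x)" for x
    have Uint: "integrable lborel (U l (Suc r))" for l
      by (rule integrableI_bounded) (use UX[of l] in \<open>auto simp: order_le_less_trans\<close>)
    have sumint: "integrable lborel (\<lambda>x. \<Sum>l. norm (p l x))"
    proof (rule integrableI_nonneg)
      show "AE x in lborel. 0 \<le> (\<Sum>l. norm (p l x))" using AEs by eventually_elim (rule suminf_nonneg, auto)
      have "(\<integral>\<^sup>+x. ennreal (\<Sum>l. norm (p l x)) \<partial>lborel) = (\<integral>\<^sup>+x. (\<Sum>l. ennreal (norm (p l x))) \<partial>lborel)"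
        by (rule nn_integral_cong_AE) (use AEs in eventually_elim, rule suminf_ennreal2[symmetric], auto)
      then show "(\<integral>\<^sup>+x. ennreal (\<Sum>l. norm (p l x)) \<partial>lborel) < \<infinity>" using pint' by (simp add: less_top)
    qed simp
    have hint: "integrable lborel h" unfolding h_def by (intro Bochner_Integration.integrable_add integrable_norm Uint sumint)
    have gm [measurable]: "g \<in> borel_measurable borel" unfolding g_def[abs_def] by simp
    have lim: "AE x in lborel. (\<lambda>l. U l (Suc r) x) \<longlonglongrightarrow> g x"
      using AEs
    proof eventually_elim
      case (elim x)
      then have "(\<lambda>l. \<Sum>i<l. p i x) \<longlonglongrightarrow> (\<Sum>l. p l x)" by (rule summable_LIMSEQ[OF summable_norm_cancel])
      then have "(\<lambda>l. U 0 (Suc r) x + (\<Sum>i<l. p i x)) \<longlonglongrightarrow> g x"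
        unfolding g_def by (intro tendsto_intros)
      then show ?case by (simp only: Usum[symmetric])
    qed
    have bound: "AE x in lborel. norm (U l (Suc r) x) \<le> h x" for l
      using AEs
    proof eventually_elim
      case (elim x)
      have "norm (U l (Suc r) x) \<le> norm (U 0 (Suc r) x) + norm (\<Sum>i<l. p i x)" unfolding Usum[of l x] by (rule norm_triangle_ineq)
      also have "norm (\<Sum>i<l. p i x) \<le> (\<Sum>i<l. norm (p i x))" by (rule norm_sum)
      also have "\<dots> \<le> (\<Sum>i. norm (p i x))" by (rule sum_le_suminf[OF elim]) auto
      finally show ?case unfolding h_def by simp
    qed
    have gint: "integrable lborel g"
      by (rule integrable_dominated_convergence[OF _ _ hint lim bound]) simp_all
    have gbound: "AE x in lborel. norm (g x) \<le> h x"
    proof -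
      have "AE x in lborel. \<forall>l. norm (U l (Suc r) x) \<le> h x" using bound by (simp add: AE_all_countable)
      with lim show ?thesis
      proof eventually_elim
        case (elim x)
        show ?case by (rule LIMSEQ_le_const2[OF tendsto_norm[OF elim(1)]]) (use elim(2) in auto)
      qed
    qed
    have diff0: "(\<lambda>l. LINT x|lborel. norm (U l (Suc r) x - g x)) \<longlonglongrightarrow> 0"
    proof -
      have "(\<lambda>l. LINT x|lborel. norm (U l (Suc r) x - g x)) \<longlonglongrightarrow> (LINT x::real|lborel. 0 :: real)"
      proof (rule integral_dominated_convergence[where w = "\<lambda>x. 2 * h x"])
        show "integrable lborel (\<lambda>x. 2 * h x)" using hint by simp
        show "AE x in lborel. (\<lambda>l. norm (U l (Suc r) x - g x)) \<longlonglongrightarrow> 0"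
          using lim by eventually_elim (simp add: LIM_zero tendsto_norm_zero)
        show "AE x in lborel. norm (norm (U l (Suc r) x - g x)) \<le> 2 * h x" for l
          using bound[of l] gbound
        proof eventually_elim
          case (elim x)
          then show ?case using norm_triangle_ineq4[of "U l (Suc r) x" "g x"] by simp
        qed
      qed simp_all
      then show ?thesis by simp
    qed
    have g1: "(LINT x|lborel. norm (g x)) \<le> C * X"
    proof (rule LIMSEQ_le_const2)
      show "(\<lambda>l. LINT x|lborel. norm (U l (Suc r) x)) \<longlonglongrightarrow> (LINT x|lborel. norm (g x))"
      proof (rule integral_dominated_convergence[OF _ _ hint])
        show "AE x in lborel. (\<lambda>l. norm (U l (Suc r) x)) \<longlonglongrightarrow> norm (g x)"
          using lim by eventually_elim (rule tendsto_norm)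
      qed (use bound in simp_all)
      have "(LINT x|lborel. norm (U l (Suc r) x)) \<le> C * X" for l
        using UX[of l] Uint[of l] C(1) X by (simp add: nn_integral_eq_integral)
      then show "\<exists>N. \<forall>l\<ge>N. (LINT x|lborel. norm (U l (Suc r) x)) \<le> C * X" by blast
    qed
    have ulim: "uniform_limit UNIV (\<lambda>l. U l 0) u sequentially"
    proof -
      have "uniform_limit UNIV (\<lambda>m x. \<Sum>i<m. c (\<kappa> i) * wave \<beta> (\<kappa> i) x) (\<lambda>x. \<Sum>i. c (\<kappa> i) * wave \<beta> (\<kappa> i) x) sequentially"
        by (rule Weierstrass_m_test[where M = "\<lambda>i. norm (c (\<kappa> i))"])
          (use summable_on_int_imp_summable[OF s1] in \<open>auto simp: norm_mult \<kappa>_def\<close>)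
      moreover have "(\<Sum>i. c (\<kappa> i) * wave \<beta> (\<kappa> i) x) = u x" for x
        using u[of x] has_sum_reindex_bij_betw[OF bij_int_decode, of "\<lambda>k. c k * wave \<beta> k x"] has_sum_imp_sums
        unfolding \<kappa>_def by (blast intro: sums_unique[symmetric])
      ultimately have "uniform_limit UNIV (\<lambda>m x. \<Sum>i<m. c (\<kappa> i) * wave \<beta> (\<kappa> i) x) u sequentially" by simp
      moreover have "filterlim M at_top sequentially"
        by (rule filterlim_at_top_mono[OF filterlim_ident]) (simp add: M_def)
      ultimately have "uniform_limit UNIV (\<lambda>l x. \<Sum>i<M l. c (\<kappa> i) * wave \<beta> (\<kappa> i) x) u sequentially"
        by (rule filterlim_compose)
      moreover have "(\<Sum>i<M l. c (\<kappa> i) * wave \<beta> (\<kappa> i) x) = U l 0 x" for l x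
        unfolding U_def A_def using inj by (simp add: sum.reindex inj_on_subset)
      ultimately show ?thesis by simp
    qed
    have wd: "has_weak_deriv (Suc r) u g"
    proof (rule has_weak_deriv_limit[where U = U])
      show "(U l j has_vector_derivative U l (Suc j) x) (at x)" for l j x
        unfolding U_def
        by (intro has_vector_derivative_sum has_vector_derivative_mult_right has_vector_derivative_wave_deriv \<beta>)
      have "continuous_on UNIV (U l 0)" for l
        unfolding U_def by (intro continuous_intros continuous_at_imp_continuous_on continuous_wave_deriv \<beta> ballI)
      then show "continuous_on UNIV u" by (intro uniform_limit_theorem[OF always_eventually ulim]) auto
    qed (use gint ulim Uint diff0 in auto)
    \<comment> \<open>The chosen weak derivative agrees with \<open>g\<close> almost everywhere and
      so shares its norm.\<close>
    then have wd': "has_weak_deriv (Suc r) u (weak_deriv (Suc r) u)"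
      unfolding weak_deriv_def by (rule someI[of "has_weak_deriv (Suc r) u"])
    have ae: "AE x in lborel. g x = weak_deriv (Suc r) u x" by (rule has_weak_deriv_unique[OF wd wd'])
    have [measurable]: "weak_deriv (Suc r) u \<in> borel_measurable borel"
      using wd' unfolding has_weak_deriv_def by (auto intro: borel_measurable_locally_integrable)
    have "integrable lborel (weak_deriv (Suc r) u)"
      by (rule integrable_cong_AE_imp[OF gint]) (use ae in auto)
    moreover have "L1_norm (weak_deriv (Suc r) u) = (LINT x|lborel. norm (g x))"
      unfolding L1_norm_def by (rule integral_cong_AE) (use ae in auto)
    ultimately show "deriv_in_L1 (Suc r) u \<and> L1_norm (weak_deriv (Suc r) u) \<le> C * X"
      unfolding deriv_in_L1_def using wd g1 by auto
  qed
qed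

section \<open>Sobolev bounds\<close>

lemma norm_sum_sq_le_weighted:
  fixes f :: "'b \<Rightarrow> complex"
  assumes "finite I" "\<And>i. i \<in> I \<Longrightarrow> a i > 0"
  shows "(norm (\<Sum>i\<in>I. f i))\<^sup>2 \<le> (\<Sum>i\<in>I. a i) * (\<Sum>i\<in>I. (norm (f i))\<^sup>2 / a i)"
proof -
  have "norm (\<Sum>i\<in>I. f i) \<le> (\<Sum>i\<in>I. \<bar>sqrt (a i)\<bar> * \<bar>norm (f i) / sqrt (a i)\<bar>)"
  proof (rule sum_norm_le)
    fix i assume "i \<in> I"
    then have "0 < a i" by (rule assms(2))
    then show "norm (f i) \<le> \<bar>sqrt (a i)\<bar> * \<bar>norm (f i) / sqrt (a i)\<bar>" by simp
  qed
  also have "\<dots> \<le> L2_set (\<lambda>i. sqrt (a i)) I * L2_set (\<lambda>i. norm (f i) / sqrt (a i)) I" by (rule L2_set_mult_ineq)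
  finally have "(norm (\<Sum>i\<in>I. f i))\<^sup>2 \<le> (L2_set (\<lambda>i. sqrt (a i)) I * L2_set (\<lambda>i. norm (f i) / sqrt (a i)) I)\<^sup>2"
    by (rule power_mono) simp
  also have "\<dots> = (\<Sum>i\<in>I. (sqrt (a i))\<^sup>2) * (\<Sum>i\<in>I. (norm (f i) / sqrt (a i))\<^sup>2)"
    by (simp add: power_mult_distrib L2_set_def sum_nonneg)
  also have "\<dots> = (\<Sum>i\<in>I. a i) * (\<Sum>i\<in>I. (norm (f i))\<^sup>2 / a i)"
    using assms(2) by (intro arg_cong2[of _ _ _ _ "(*)"] sum.cong) (auto simp: power_divide less_imp_le)
  finally show ?thesis .
qed

text \<open>Cauchy-Schwarz with the \<open>a j\<close> themselves as weights bounds the partial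
  sums, and Fatou's lemma passes to the limit: a form of Minkowski's inequality for series.\<close>

lemma nn_integral_series_L2:
  fixes v :: "nat \<Rightarrow> real \<Rightarrow> complex" and W :: "real \<Rightarrow> real"
  assumes [measurable]: "\<And>j. v j \<in> borel_measurable borel" "w \<in> borel_measurable borel" "W \<in> borel_measurable borel"
    and W: "\<And>x. W x \<ge> 0"
    and sums: "AE x in lborel. (\<lambda>j. v j x) sums w x"
    and a: "\<And>j. a j > 0" "summable a"
    and b: "\<And>j. (\<integral>\<^sup>+x. ennreal (W x * (norm (v j x))\<^sup>2) \<partial>lborel) \<le> ennreal ((a j)\<^sup>2)"
  shows "(\<integral>\<^sup>+x. ennreal (W x * (norm (w x))\<^sup>2) \<partial>lborel) \<le> ennreal ((suminf a)\<^sup>2)"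
proof -
  have S: "(\<Sum>j<J. a j) \<le> suminf a" for J by (rule sum_le_suminf[OF a(2)]) (use a(1) in \<open>auto intro: less_imp_le\<close>)
  have "(\<integral>\<^sup>+x. ennreal ((norm (of_real (sqrt (W x)) * w x))\<^sup>2) \<partial>lborel) \<le> ennreal ((suminf a)\<^sup>2)"
  proof (rule nn_integral_fatou_le)
    let ?G = "\<lambda>J x. of_real (sqrt (W x)) * (\<Sum>j<J. v j x)"
    show "?G J \<in> borel_measurable lborel" "(\<lambda>x. of_real (sqrt (W x)) * w x) \<in> borel_measurable lborel" for J by simp_all
    show "AE x in lborel. (\<lambda>J. ?G J x) \<longlonglongrightarrow> of_real (sqrt (W x)) * w x"
      using sums by eventually_elim (intro tendsto_intros, simp add: sums_def)
    fix J
    have pt: "(norm (?G J x))\<^sup>2 \<le> (\<Sum>j<J. a j) * (\<Sum>j<J. (1 / a j) * (W x * (norm (v j x))\<^sup>2))" for x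
    proof -
      have "(norm (?G J x))\<^sup>2 = W x * (norm (\<Sum>j<J. v j x))\<^sup>2" using W[of x] by (simp add: norm_mult power_mult_distrib)
      also have "\<dots> \<le> W x * ((\<Sum>j<J. a j) * (\<Sum>j<J. (norm (v j x))\<^sup>2 / a j))"
        by (intro mult_left_mono norm_sum_sq_le_weighted W) (use a in auto)
      also have "\<dots> = (\<Sum>j<J. a j) * (\<Sum>j<J. (1 / a j) * (W x * (norm (v j x))\<^sup>2))"
        by (simp add: sum_distrib_left mult_ac)
      finally show ?thesis .
    qed
    have a0: "(\<Sum>j<J. a j) \<ge> 0" using a(1) by (intro sum_nonneg) (auto intro: less_imp_le)
    have "(\<integral>\<^sup>+x. ennreal ((norm (?G J x))\<^sup>2) \<partial>lborel) \<le> (\<integral>\<^sup>+x. ennreal (\<Sum>j<J. a j) * (\<Sum>j<J. ennreal (1 / a j) * ennreal (W x * (norm (v j x))\<^sup>2)) \<partial>lborel)"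
    proof (rule nn_integral_mono)
      fix x
      have nn: "0 \<le> (1 / a j) * (W x * (norm (v j x))\<^sup>2)" for j using a(1)[of j] W[of x] by simp
      have "ennreal (\<Sum>j<J. a j) * (\<Sum>j<J. ennreal (1 / a j) * ennreal (W x * (norm (v j x))\<^sup>2))
          = ennreal ((\<Sum>j<J. a j) * (\<Sum>j<J. (1 / a j) * (W x * (norm (v j x))\<^sup>2)))"
      proof -
        have "(\<Sum>j<J. ennreal (1 / a j) * ennreal (W x * (norm (v j x))\<^sup>2)) = (\<Sum>j<J. ennreal ((1 / a j) * (W x * (norm (v j x))\<^sup>2)))"
          using a(1) by (intro sum.cong refl ennreal_mult'[symmetric]) (simp add: less_imp_le)
        also have "\<dots> = ennreal (\<Sum>j<J. (1 / a j) * (W x * (norm (v j x))\<^sup>2))"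
          by (rule sum_ennreal[OF nn])
        finally show ?thesis by (simp only: ennreal_mult'[OF a0])
      qed
      then show "ennreal ((norm (?G J x))\<^sup>2) \<le> ennreal (\<Sum>j<J. a j) * (\<Sum>j<J. ennreal (1 / a j) * ennreal (W x * (norm (v j x))\<^sup>2))"
        using pt[of x] by (simp only: ennreal_leI)
    qed
    also have "\<dots> = ennreal (\<Sum>j<J. a j) * (\<Sum>j<J. ennreal (1 / a j) * (\<integral>\<^sup>+x. ennreal (W x * (norm (v j x))\<^sup>2) \<partial>lborel))"
      by (simp add: nn_integral_cmult nn_integral_sum)
    also have "\<dots> \<le> ennreal (\<Sum>j<J. a j) * (\<Sum>j<J. ennreal (1 / a j) * ennreal ((a j)\<^sup>2))"
      by (intro mult_left_mono sum_mono b) auto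
    also have "\<dots> = ennreal ((\<Sum>j<J. a j) * (\<Sum>j<J. a j))"
    proof -
      have "ennreal (1 / a j) * ennreal ((a j)\<^sup>2) = ennreal (a j)" for j
        using a(1)[of j] by (simp add: power2_eq_square flip: ennreal_mult')
      then have "(\<Sum>j<J. ennreal (1 / a j) * ennreal ((a j)\<^sup>2)) = ennreal (\<Sum>j<J. a j)"
        using a(1) by (simp only: sum_ennreal less_imp_le)
      then show ?thesis by (simp only: ennreal_mult'[OF a0])
    qed
    also have "\<dots> \<le> ennreal ((suminf a)\<^sup>2)"
      unfolding power2_eq_square by (intro ennreal_leI mult_mono S a0 order_trans[OF a0 S])
    finally show "(\<integral>\<^sup>+x. ennreal ((norm (?G J x))\<^sup>2) \<partial>lborel) \<le> ennreal ((suminf a)\<^sup>2)" .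
  qed
  then show ?thesis using W by (simp add: norm_mult power_mult_distrib)
qed

section \<open>Finite sums of powers and their transforms\<close>

text \<open>The constant is subtracted at order 0 only, so that the sum vanishes at infinity without
  disturbing the chain of derivatives.\<close>

definition wave_sum :: "real \<Rightarrow> int set \<Rightarrow> (int \<Rightarrow> complex) \<Rightarrow> nat \<Rightarrow> real \<Rightarrow> complex" where
  "wave_sum \<beta> A c r x = (\<Sum>k\<in>A. c k * (wave_deriv \<beta> r k x - (if r = 0 then 1 else 0)))"

text \<open>The transform of the sum of order 0, which need not be integrable. Its derivative is,
  and division by i \<xi> undoes the differentiation; the point \<xi> = 0 is a null set.\<close>

definition wave_sum_ft :: "real \<Rightarrow> int set \<Rightarrow> (int \<Rightarrow> complex) \<Rightarrow> real \<Rightarrow> complex" where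
  "wave_sum_ft \<beta> A c \<xi> = ft (wave_sum \<beta> A c (Suc 0)) \<xi> / (\<i> * of_real \<xi>)"

lemma wave_sum_Suc: "wave_sum \<beta> A c (Suc r) x = (\<Sum>k\<in>A. c k * wave_deriv \<beta> (Suc r) k x)"
  by (simp add: wave_sum_def)

lemma borel_measurable_wave_sum [measurable]: "wave_sum \<beta> A c r \<in> borel_measurable borel"
  unfolding wave_sum_def[abs_def] by measurable

lemma borel_measurable_wave_sum_ft [measurable]: "wave_sum_ft \<beta> A c \<in> borel_measurable borel"
  unfolding wave_sum_ft_def[abs_def] by measurable

lemma has_vector_derivative_wave_sum:
  assumes "\<beta> > 0"
  shows "(wave_sum \<beta> A c r has_vector_derivative wave_sum \<beta> A c (Suc r) x) (at x)"
proof -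
  have "((\<lambda>x. \<Sum>k\<in>A. c k * (wave_deriv \<beta> r k x - (if r = 0 then 1 else 0))) has_vector_derivative
    (\<Sum>k\<in>A. c k * (wave_deriv \<beta> (Suc r) k x - 0))) (at x)"
    by (intro has_vector_derivative_sum has_vector_derivative_mult_right has_vector_derivative_diff
       has_vector_derivative_wave_deriv assms has_vector_derivative_const)
  then show ?thesis by (simp add: wave_sum_def[abs_def])
qed

lemma continuous_on_wave_sum: "\<beta> > 0 \<Longrightarrow> continuous_on S (wave_sum \<beta> A c r)"
  using has_vector_derivative_continuous[OF has_vector_derivative_wave_sum] by (intro continuous_at_imp_continuous_on) blast

lemma wave_sum_tendsto_0:
  assumes "\<beta> > 0" shows "(wave_sum \<beta> A c r \<longlongrightarrow> 0) at_infinity"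
proof -
  have "((\<lambda>x. c k * (wave_deriv \<beta> r k x - (if r = 0 then 1 else 0))) \<longlongrightarrow> c k * 0) at_infinity" for k
  proof (intro tendsto_mult tendsto_const, cases r)
    case 0
    then show "((\<lambda>x. wave_deriv \<beta> r k x - (if r = 0 then 1 else 0)) \<longlongrightarrow> 0) at_infinity"
      using wave_tendsto_1[OF assms, of k] by (simp add: LIM_zero)
  next
    case (Suc q)
    then show "((\<lambda>x. wave_deriv \<beta> r k x - (if r = 0 then 1 else 0)) \<longlongrightarrow> 0) at_infinity"
      using wave_deriv_tendsto_0[OF assms, of q k] by simp
  qed
  then have "((\<lambda>x. \<Sum>k\<in>A. c k * (wave_deriv \<beta> r k x - (if r = 0 then 1 else 0))) \<longlongrightarrow> (\<Sum>k\<in>A. c k * 0)) at_infinity"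
    by (rule tendsto_sum)
  then show ?thesis by (simp add: wave_sum_def[abs_def])
qed

lemma integrable_wave_sum_Suc:
  assumes "\<beta> > 0" shows "integrable lborel (wave_sum \<beta> A c (Suc r))"
proof -
  obtain C where C: "C \<ge> 0"
    "\<And>k x. norm (wave_deriv \<beta> (Suc r) k x) \<le> C * (1 + real_of_int \<bar>k\<bar>) ^ Suc r * angle_deriv \<beta> x"
    using norm_wave_deriv_Suc_le[OF assms] by blast
  have "integrable lborel (wave_deriv \<beta> (Suc r) k)" for k
  proof (rule Bochner_Integration.integrable_bound)
    show "integrable lborel (\<lambda>x. C * (1 + real_of_int \<bar>k\<bar>) ^ Suc r * angle_deriv \<beta> x)"
      by (intro integrable_mult_right angle_deriv_integral assms)
    show "AE x in lborel. norm (wave_deriv \<beta> (Suc r) k x) \<le> norm (C * (1 + real_of_int \<bar>k\<bar>) ^ Suc r * angle_deriv \<beta> x)"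
      by (intro AE_I2 order_trans[OF C(2)]) simp
  qed simp
  then show ?thesis unfolding wave_sum_Suc[abs_def] by (intro Bochner_Integration.integrable_sum integrable_mult_right)
qed

lemma ft_wave_sum:
  assumes "\<beta> > 0"
  shows "ft (wave_sum \<beta> A c (Suc r)) \<xi> = (\<i> * of_real \<xi>) ^ r * ft (wave_sum \<beta> A c (Suc 0)) \<xi>"
proof (induction r)
  case (Suc r)
  have "ft (wave_sum \<beta> A c (Suc (Suc r))) \<xi> = \<i> * of_real \<xi> * ft (wave_sum \<beta> A c (Suc r)) \<xi>"
    by (intro ft_deriv has_vector_derivative_wave_sum continuous_on_wave_sum integrable_wave_sum_Suc wave_sum_tendsto_0 assms)
  then show ?case unfolding Suc by simp
qed simp

text \<open>Orthogonality fails without the weight, so Cauchy-Schwarz is applied to the whole sum.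
  For |k| \<le> K this costs a factor of order K^2 over the squared l2 norm of the coefficients, as
  much as one derivative.\<close>

lemma wave_sum_0_L2:
  assumes "\<beta> > 0" "finite A"
  shows "integrable lborel (\<lambda>x. (norm (wave_sum \<beta> A c 0 x))\<^sup>2)"
    "(LINT x|lborel. (norm (wave_sum \<beta> A c 0 x))\<^sup>2) \<le> (\<Sum>k\<in>A. (norm (c k))\<^sup>2) * (\<Sum>k\<in>A. 4 * pi * \<beta> * real_of_int \<bar>k\<bar>)"
proof -
  have pt: "(norm (wave_sum \<beta> A c 0 x))\<^sup>2 \<le> (\<Sum>k\<in>A. (norm (c k))\<^sup>2) * (\<Sum>k\<in>A. (norm (wave \<beta> k x - 1))\<^sup>2)" for x
  proof -
    have "norm (wave_sum \<beta> A c 0 x) \<le> (\<Sum>k\<in>A. \<bar>norm (c k)\<bar> * \<bar>norm (wave \<beta> k x - 1)\<bar>)"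
      unfolding wave_sum_def by (rule sum_norm_le) (simp add: norm_mult)
    also have "\<dots> \<le> L2_set (\<lambda>k. norm (c k)) A * L2_set (\<lambda>k. norm (wave \<beta> k x - 1)) A" by (rule L2_set_mult_ineq)
    finally have "(norm (wave_sum \<beta> A c 0 x))\<^sup>2 \<le> (L2_set (\<lambda>k. norm (c k)) A * L2_set (\<lambda>k. norm (wave \<beta> k x - 1)) A)\<^sup>2"
      by (rule power_mono) simp
    then show ?thesis by (simp add: power_mult_distrib L2_set_def sum_nonneg)
  qed
  have bi: "has_bochner_integral lborel (\<lambda>x. (\<Sum>k\<in>A. (norm (c k))\<^sup>2) * (\<Sum>k\<in>A. (norm (wave \<beta> k x - 1))\<^sup>2))
     ((\<Sum>k\<in>A. (norm (c k))\<^sup>2) * (\<Sum>k\<in>A. 4 * pi * \<beta> * real_of_int \<bar>k\<bar>))"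
    using wave_minus_one_sq_integral[OF assms(1)]
    by (intro has_bochner_integral_mult_right has_bochner_integral_sum) (simp add: has_bochner_integral_iff)
  show i: "integrable lborel (\<lambda>x. (norm (wave_sum \<beta> A c 0 x))\<^sup>2)"
    by (rule Bochner_Integration.integrable_bound[OF bi[unfolded has_bochner_integral_iff, THEN conjunct1]])
      (auto intro!: AE_I2 order_trans[OF pt])
  have "(LINT x|lborel. (norm (wave_sum \<beta> A c 0 x))\<^sup>2) \<le> (LINT x|lborel. (\<Sum>k\<in>A. (norm (c k))\<^sup>2) * (\<Sum>k\<in>A. (norm (wave \<beta> k x - 1))\<^sup>2))"
    by (rule integral_mono[OF i bi[unfolded has_bochner_integral_iff, THEN conjunct1] pt])
  then show "(LINT x|lborel. (norm (wave_sum \<beta> A c 0 x))\<^sup>2) \<le> (\<Sum>k\<in>A. (norm (c k))\<^sup>2) * (\<Sum>k\<in>A. 4 * pi * \<beta> * real_of_int \<bar>k\<bar>)"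
    unfolding has_bochner_integral_integral_eq[OF bi] .
qed

lemma integrable_truncate:
  assumes "continuous_on UNIV v" shows "integrable lborel (truncate R v)"
  using borel_integrable_atLeastAtMost'[OF continuous_on_subset[OF assms subset_UNIV], of "-R" R]
  unfolding set_integrable_def truncate_def[abs_def] .

text \<open>Integration by parts on the truncation interval; the boundary terms vanish in the limit
  because the sum of order 0 tends to 0 at infinity.\<close>

lemma ft_truncate_wave_sum_limit:
  assumes \<beta>: "\<beta> > 0" and \<xi>: "\<xi> \<noteq> 0"
  shows "((\<lambda>R. ft (truncate R (wave_sum \<beta> A c 0)) \<xi>) \<longlongrightarrow> wave_sum_ft \<beta> A c \<xi>) at_top"
proof -
  let ?p = "wave_sum \<beta> A c"
  have l: "(?p 0 \<longlongrightarrow> 0) at_top" "(?p 0 \<longlongrightarrow> 0) at_bot"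
    using wave_sum_tendsto_0[OF \<beta>, of A c 0] unfolding at_infinity_eq_at_top_bot by (auto elim!: filterlim_mono)
  have "((\<lambda>R. (ft (truncate R (?p (Suc 0))) \<xi> - (cis (- (\<xi> * R)) * ?p 0 R - cis (\<xi> * R) * ?p 0 (- R))) / (\<i> * of_real \<xi>)) \<longlongrightarrow>
     (ft (?p (Suc 0)) \<xi> - (0 - 0)) / (\<i> * of_real \<xi>)) at_top"
  proof (intro tendsto_divide tendsto_diff tendsto_const ft_truncate_tendsto integrable_wave_sum_Suc \<beta>)
    show "((\<lambda>R. cis (- (\<xi> * R)) * ?p 0 R) \<longlongrightarrow> 0) at_top"
      using l(1) by (intro tendsto_norm_zero_cancel[where f = "\<lambda>R. cis (- (\<xi> * R)) * ?p 0 R"]) (simp add: norm_mult tendsto_norm_zero)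
    have "((\<lambda>R. ?p 0 (- R)) \<longlongrightarrow> 0) at_top"
      by (rule filterlim_compose[OF l(2) filterlim_uminus_at_bot_at_top])
    then show "((\<lambda>R. cis (\<xi> * R) * ?p 0 (- R)) \<longlongrightarrow> 0) at_top"
      by (intro tendsto_norm_zero_cancel[where f = "\<lambda>R. cis (\<xi> * R) * ?p 0 (-R)"]) (simp add: norm_mult tendsto_norm_zero)
  qed (use \<xi> in simp)
  moreover have "\<forall>\<^sub>F R in at_top. (ft (truncate R (?p (Suc 0))) \<xi> - (cis (- (\<xi> * R)) * ?p 0 R - cis (\<xi> * R) * ?p 0 (- R))) / (\<i> * of_real \<xi>)
      = ft (truncate R (?p 0)) \<xi>"
    using eventually_ge_at_top[of 0]
  proof eventually_elim
    case (elim R)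
    show ?case
      unfolding ft_truncate_by_parts[OF elim has_vector_derivative_wave_sum[OF \<beta>] continuous_on_wave_sum[OF \<beta>]]
      using \<xi> by simp
  qed
  ultimately show ?thesis unfolding wave_sum_ft_def by (simp add: filterlim_cong)
qed

text \<open>The bound is independent of the radius and, over dyadic blocks, summable: the dominating
  sequence for taking the limit under the sum of block transforms.\<close>

lemma norm_ft_truncate_wave_sum_le:
  assumes \<beta>: "\<beta> > 0" and \<xi>: "\<xi> \<noteq> 0" and R: "R \<ge> 0"
  shows "norm (ft (truncate R (wave_sum \<beta> A c 0)) \<xi>) \<le>
    (4 * (\<Sum>k\<in>A. norm (c k)) + (LINT x|lborel. norm (wave_sum \<beta> A c (Suc 0) x))) / \<bar>\<xi>\<bar>"
proof -
  let ?p = "wave_sum \<beta> A c" and ?S = "\<Sum>k\<in>A. norm (c k)"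
  have pb: "norm (?p 0 x) \<le> 2 * ?S" for x
  proof -
    have "norm (?p 0 x) \<le> (\<Sum>k\<in>A. 2 * norm (c k))"
      unfolding wave_sum_def
    proof (rule sum_norm_le)
      fix k
      have "norm (wave \<beta> k x - 1) \<le> 2" using norm_triangle_ineq4[of "wave \<beta> k x" 1] by simp
      from mult_right_mono[OF this, of "norm (c k)"]
      show "norm (c k * (wave_deriv \<beta> 0 k x - (if (0::nat) = 0 then 1 else 0))) \<le> 2 * norm (c k)"
        by (simp add: norm_mult mult.commute)
    qed
    then show ?thesis by (simp add: sum_distrib_left)
  qed
  have t: "norm (ft (truncate R (?p (Suc 0))) \<xi>) \<le> (LINT x|lborel. norm (?p (Suc 0) x))"
  proof -
    have "norm (ft (truncate R (?p (Suc 0))) \<xi>) \<le> (LINT x|lborel. norm (truncate R (?p (Suc 0)) x))"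
      by (intro norm_ft_le integrable_truncate continuous_on_wave_sum \<beta>)
    also have "\<dots> \<le> (LINT x|lborel. norm (?p (Suc 0) x))"
      by (intro integral_mono integrable_norm integrable_truncate continuous_on_wave_sum integrable_wave_sum_Suc \<beta> norm_truncate_le)
    finally show ?thesis .
  qed
  have "\<i> * of_real \<xi> * ft (truncate R (?p 0)) \<xi> = ft (truncate R (?p (Suc 0))) \<xi> - (cis (- (\<xi> * R)) * ?p 0 R - cis (\<xi> * R) * ?p 0 (- R))"
    unfolding ft_truncate_by_parts[OF R has_vector_derivative_wave_sum[OF \<beta>] continuous_on_wave_sum[OF \<beta>]] by simp
  note e = this
  have "\<bar>\<xi>\<bar> * norm (ft (truncate R (?p 0)) \<xi>) = norm (\<i> * of_real \<xi> * ft (truncate R (?p 0)) \<xi>)"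
    by (simp add: norm_mult)
  also have "\<dots> = norm (ft (truncate R (?p (Suc 0))) \<xi> - (cis (- (\<xi> * R)) * ?p 0 R - cis (\<xi> * R) * ?p 0 (- R)))"
    by (simp only: e)
  also have "\<dots> \<le> norm (ft (truncate R (?p (Suc 0))) \<xi>) + (norm (cis (- (\<xi> * R)) * ?p 0 R) + norm (cis (\<xi> * R) * ?p 0 (- R)))"
    by (intro order_trans[OF norm_triangle_ineq4] add_left_mono norm_triangle_ineq4)
  also have "\<dots> \<le> (LINT x|lborel. norm (?p (Suc 0) x)) + (2 * ?S + 2 * ?S)"
    using t pb[of R] pb[of "-R"] by (simp add: norm_mult)
  finally show ?thesis using \<xi> by (simp add: pos_le_divide_eq mult.commute)
qed

lemma wave_sum_ft_L2:
  assumes \<beta>: "\<beta> > 0" and A: "finite A"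
  shows "(\<integral>\<^sup>+\<xi>. ennreal ((norm (wave_sum_ft \<beta> A c \<xi>))\<^sup>2) \<partial>lborel) \<le> ennreal (2 * pi) * (\<integral>\<^sup>+x. ennreal ((norm (wave_sum \<beta> A c 0 x))\<^sup>2) \<partial>lborel)"
proof (rule has_L2_fourier_limit(2))
  have "AE \<xi> in lborel. \<xi> \<noteq> (0::real)" by (rule AE_lborel_singleton)
  then show "AE \<xi> in lborel. ((\<lambda>R. ft (truncate R (wave_sum \<beta> A c 0)) \<xi>) \<longlongrightarrow> wave_sum_ft \<beta> A c \<xi>) at_top"
    by eventually_elim (rule ft_truncate_wave_sum_limit[OF \<beta>])
qed (use wave_sum_0_L2[OF \<beta> A] in \<open>auto intro!: integrable_truncate continuous_on_wave_sum \<beta>\<close>)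

lemma wave_sum_ft_power_L2:
  assumes \<beta>: "\<beta> > 0"
  shows "(\<integral>\<^sup>+\<xi>. ennreal (\<bar>\<xi>\<bar> ^ (2 * Suc r) * (norm (wave_sum_ft \<beta> A c \<xi>))\<^sup>2) \<partial>lborel) \<le> ennreal (2 * pi) * (\<integral>\<^sup>+x. ennreal ((norm (wave_sum \<beta> A c (Suc r) x))\<^sup>2) \<partial>lborel)"
proof -
  have "AE \<xi> in lborel. \<xi> \<noteq> (0::real)" by (rule AE_lborel_singleton)
  then have ae: "AE \<xi> in lborel. ennreal (\<bar>\<xi>\<bar> ^ (2 * Suc r) * (norm (wave_sum_ft \<beta> A c \<xi>))\<^sup>2) = ennreal ((norm (ft (wave_sum \<beta> A c (Suc r)) \<xi>))\<^sup>2)"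
  proof eventually_elim
    case (elim \<xi>)
    have e: "norm (ft (wave_sum \<beta> A c (Suc r)) \<xi>) = \<bar>\<xi>\<bar> ^ Suc r * norm (wave_sum_ft \<beta> A c \<xi>)"
      unfolding ft_wave_sum[OF \<beta>, of A c r \<xi>] wave_sum_ft_def using elim by (simp add: norm_mult norm_power norm_divide)
    show ?case by (simp only: e power_mult_distrib power_even_eq)
  qed
  have "(\<integral>\<^sup>+\<xi>. ennreal (\<bar>\<xi>\<bar> ^ (2 * Suc r) * (norm (wave_sum_ft \<beta> A c \<xi>))\<^sup>2) \<partial>lborel) = (\<integral>\<^sup>+\<xi>. ennreal ((norm (ft (wave_sum \<beta> A c (Suc r)) \<xi>))\<^sup>2) \<partial>lborel)"
    by (rule nn_integral_cong_AE[OF ae])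
  also have "\<dots> \<le> ennreal (2 * pi) * (\<integral>\<^sup>+x. ennreal ((norm (wave_sum \<beta> A c (Suc r) x))\<^sup>2) \<partial>lborel)"
    by (intro ft_L2_le integrable_wave_sum_Suc \<beta>)
  finally show ?thesis .
qed

section \<open>Dyadic blocks\<close>

text \<open>Block 0 contains every frequency of the interpolant, where the coefficients are
  controlled by \<open>n powr - s\<close> alone; the other blocks are dyadic annuli, on which the
  weighted norm yields decay.\<close>

definition block :: "nat \<Rightarrow> nat \<Rightarrow> int set" where
  "block n j = {k. \<bar>k\<bar> \<le> 2 ^ j * int n \<and> (j > 0 \<longrightarrow> 2 ^ (j - 1) * int n < \<bar>k\<bar>)}"

lemma finite_block [simp]: "finite (block n j)"
  by (rule finite_subset[of _ "{- (2 ^ j * int n)..2 ^ j * int n}"]) (auto simp: block_def)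

lemma Un_block: "(\<Union>j<J. block n j) \<union> block n J = {k. \<bar>k\<bar> \<le> 2 ^ J * int n}"
proof (induction J)
  case (Suc J)
  have le: "2 ^ J * int n \<le> 2 ^ Suc J * int n" by simp
  have "(\<Union>j<Suc J. block n j) = {k. \<bar>k\<bar> \<le> 2 ^ J * int n}" unfolding Suc[symmetric] by (auto simp: less_Suc_eq)
  then show ?case using le by (auto simp: block_def)
qed (auto simp: block_def)

lemma block_disjoint_aux: "i < j \<Longrightarrow> block n i \<inter> block n j = {}"
proof -
  assume "i < j"
  then have "(2::int) ^ i * int n \<le> 2 ^ (j - 1) * int n" by (intro mult_right_mono power_increasing) auto
  then show ?thesis using \<open>i < j\<close> by (auto simp: block_def)
qed

lemma block_disjoint: "i \<noteq> j \<Longrightarrow> block n i \<inter> block n j = {}"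
  using block_disjoint_aux[of i j n] block_disjoint_aux[of j i n] by (cases i j rule: linorder_cases) auto

lemma sum_blocks: "(\<Sum>j<Suc J. \<Sum>k\<in>block n j. f k) = (\<Sum>k\<in>{k. \<bar>k\<bar> \<le> 2 ^ J * int n}. f k)"
proof -
  have "(\<Sum>j<Suc J. \<Sum>k\<in>block n j. f k) = sum f (\<Union>j\<in>{..<Suc J}. block n j)"
    by (rule sum.UNION_disjoint[symmetric]) (auto simp: block_disjoint)
  also have "(\<Union>j\<in>{..<Suc J}. block n j) = {k. \<bar>k\<bar> \<le> 2 ^ J * int n}"
    unfolding Un_block[symmetric] by (auto simp: less_Suc_eq)
  finally show ?thesis .
qed

text \<open>The unions of the first blocks are intervals that eventually contain every finite set of
  frequencies, so the partial block sums form a subnet of the unordered sum.\<close>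

lemma has_sum_blocks:
  fixes f :: "int \<Rightarrow> 'a :: {topological_comm_monoid_add, t2_space}"
  assumes "(f has_sum S) UNIV" and n: "n > 0"
  shows "(\<lambda>j. \<Sum>k\<in>block n j. f k) sums S"
proof -
  have "filterlim (\<lambda>J. {k. \<bar>k\<bar> \<le> 2 ^ J * int n}) (finite_subsets_at_top UNIV) sequentially"
    unfolding filterlim_finite_subsets_at_top
  proof (intro allI impI)
    fix X :: "int set" assume "finite X \<and> X \<subseteq> UNIV"
    then have fin: "finite X" by simp
    define m where "m = (\<Sum>k\<in>X. nat \<bar>k\<bar>)"
    have "X \<subseteq> {k. \<bar>k\<bar> \<le> 2 ^ J * int n}" if "J \<ge> m" for J
    proof
      fix k assume "k \<in> X"
      then have "nat \<bar>k\<bar> \<le> m" unfolding m_def using fin by (intro member_le_sum) auto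
      also have "m \<le> J" by (rule that)
      also have "J \<le> 2 ^ J" by (simp add: less_exp less_imp_le)
      also have "(2::nat) ^ J \<le> 2 ^ J * n" using n by simp
      finally have "int (nat \<bar>k\<bar>) \<le> int (2 ^ J * n)" by (rule of_nat_mono)
      then show "k \<in> {k. \<bar>k\<bar> \<le> 2 ^ J * int n}" by simp
    qed
    moreover have "finite {k. \<bar>k\<bar> \<le> 2 ^ J * int n}" for J
      by (rule finite_subset[of _ "{- (2 ^ J * int n)..2 ^ J * int n}"]) auto
    ultimately show "\<forall>\<^sub>F J in sequentially. finite {k. \<bar>k\<bar> \<le> 2 ^ J * int n} \<and> X \<subseteq> {k. \<bar>k\<bar> \<le> 2 ^ J * int n} \<and> {k. \<bar>k\<bar> \<le> 2 ^ J * int n} \<subseteq> UNIV"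
      unfolding eventually_sequentially by blast
  qed
  from filterlim_compose[OF assms(1)[unfolded has_sum_def] this]
  have "(\<lambda>J. \<Sum>j<Suc J. \<Sum>k\<in>block n j. f k) \<longlonglongrightarrow> S" unfolding sum_blocks .
  then show ?thesis unfolding sums_def by (subst (asm) filterlim_sequentially_Suc)
qed

text \<open>With z = (1 + y) / K, z^(2 t) \<le> z^2 + z^(2 b) whether z is below or above 1, because
  1 \<le> t \<le> b. Normalising by the block size K makes the integer orders 1 and b each
  contribute K^(2 t), which replaces interpolation between spaces.\<close>

lemma weight_interpolation:
  fixes K y t :: real
  assumes "K \<ge> 1" "y \<ge> 0" "1 \<le> t" "t \<le> real b"
  shows "(1 + y) powr (2 * t) \<le> K powr (2 * t) * (4 / K ^ 2 * (1 + y ^ 2) + 4 ^ b / K ^ (2 * b) * (1 + y ^ (2 * b)))"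
proof -
  have bound: "(1 + y) ^ (2 * m) \<le> 4 ^ m * (1 + y ^ (2 * m))" for m
  proof -
    have "(1 + y) ^ (2 * m) \<le> (2 * max 1 y) ^ (2 * m)" using assms by (intro power_mono) auto
    also have "\<dots> = 4 ^ m * (max 1 y) ^ (2 * m)" by (simp add: power_mult_distrib power_mult)
    also have "(max 1 y) ^ (2 * m) \<le> 1 + y ^ (2 * m)" using assms by (auto simp: max_def)
    finally show ?thesis by simp
  qed
  define z where "z = (1 + y) / K"
  have z: "z > 0" unfolding z_def using assms by simp
  have e: "(1 + y) powr (2 * t) = K powr (2 * t) * z powr (2 * t)"
    unfolding z_def using assms by (simp add: powr_divide)
  have "z powr (2 * t) \<le> z ^ 2 + z ^ (2 * b)"
  proof (cases "z \<le> 1")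
    case True
    then have "z powr (2 * t) \<le> z powr 2" using z assms by (intro powr_mono') auto
    also have "\<dots> = z ^ 2" using z by (simp add: powr_numeral)
    finally show ?thesis using z by (simp add: add_increasing2)
  next
    case False
    then have "z powr (2 * t) \<le> z powr real (2 * b)" using z assms by (intro powr_mono) auto
    also have "\<dots> = z ^ (2 * b)" using z by (rule powr_realpow)
    finally show ?thesis using z by (simp add: add_increasing)
  qed
  also have "\<dots> \<le> 4 / K ^ 2 * (1 + y ^ 2) + 4 ^ b / K ^ (2 * b) * (1 + y ^ (2 * b))"
  proof (rule add_mono)
    show "z ^ 2 \<le> 4 / K ^ 2 * (1 + y ^ 2)"
      using bound[of 1] assms unfolding z_def power_divide by (simp add: divide_right_mono)
    show "z ^ (2 * b) \<le> 4 ^ b / K ^ (2 * b) * (1 + y ^ (2 * b))"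
      using bound[of b] assms unfolding z_def power_divide by (simp add: divide_right_mono)
  qed
  finally show ?thesis unfolding e by (intro mult_left_mono) auto
qed

text \<open>The three bounds serve different ends: the first places the series in L2, the second
  dominates the truncated transforms, the third is the Sobolev estimate of one block. The first two
  cost a factor K, the third K^t.\<close>

lemma wave_sum_norm_bounds:
  assumes \<beta>: "\<beta> > 0" and t: "1 \<le> t"
  obtains C where "C > 0" "\<And>A c K a. finite A \<Longrightarrow> (1::nat) \<le> K \<Longrightarrow> a > 0 \<Longrightarrow> (\<And>k. k \<in> A \<Longrightarrow> \<bar>k\<bar> \<le> int K) \<Longrightarrow> (\<Sum>k\<in>A. (norm (c k))\<^sup>2) \<le> a\<^sup>2 \<Longrightarrow>
      (\<integral>\<^sup>+x. ennreal ((norm (wave_sum \<beta> A c 0 x))\<^sup>2) \<partial>lborel) \<le> ennreal ((C * real K * a)\<^sup>2) \<and>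
      (LINT x|lborel. norm (wave_sum \<beta> A c (Suc 0) x)) \<le> C * real K * a \<and>
      (\<integral>\<^sup>+\<xi>. ennreal ((1 + \<bar>\<xi>\<bar>) powr (2 * t) * (norm (wave_sum_ft \<beta> A c \<xi>))\<^sup>2) \<partial>lborel) \<le> ennreal ((C * real K powr t * a)\<^sup>2)"
proof -
  \<comment> \<open>The integer order above t. The lower one is 1 because the bound for order 0 on a
    block is no better.\<close>
  define b where "b = nat \<lceil>t\<rceil>"
  have b: "t \<le> real b" "b \<ge> 1" unfolding b_def using t by linarith+
  obtain q where q: "b = Suc q" using b(2) by (cases b) auto
  obtain C1 where C1: "C1 \<ge> 0" "\<And>A a. finite A \<Longrightarrow>
      (\<integral>\<^sup>+x. ennreal ((norm (\<Sum>k\<in>A. a k * wave_deriv \<beta> (Suc 0) k x))\<^sup>2) \<partial>lborel)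
      \<le> ennreal (C1 * (\<Sum>k\<in>A. (1 + real_of_int \<bar>k\<bar>) ^ (2 * Suc 0) * (norm (a k))\<^sup>2))"
    using wave_deriv_sum_L2_bound[OF \<beta>, of 0] by blast
  obtain C2 where C2: "C2 \<ge> 0" "\<And>A a. finite A \<Longrightarrow>
      (\<integral>\<^sup>+x. ennreal ((norm (\<Sum>k\<in>A. a k * wave_deriv \<beta> (Suc q) k x))\<^sup>2) \<partial>lborel)
      \<le> ennreal (C2 * (\<Sum>k\<in>A. (1 + real_of_int \<bar>k\<bar>) ^ (2 * Suc q) * (norm (a k))\<^sup>2))"
    using wave_deriv_sum_L2_bound[OF \<beta>, of q] by blast
  obtain C3 where C3: "C3 \<ge> 0"
    "\<And>A a X. finite A \<Longrightarrow> X > 0 \<Longrightarrow> (\<Sum>k\<in>A. (1 + real_of_int \<bar>k\<bar>) ^ (2 * Suc 0) * (norm (a k))\<^sup>2) \<le> X\<^sup>2 \<Longrightarrow>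
      (\<integral>\<^sup>+x. ennreal (norm (\<Sum>k\<in>A. a k * wave_deriv \<beta> (Suc 0) k x)) \<partial>lborel) \<le> ennreal (C3 * X)"
    using wave_deriv_sum_L1_bound[OF \<beta>, of 0] by blast
  \<comment> \<open>4 pi \<beta> from the norm of M^k - 1, and 3 from \<open>card A\<close> \<le> 2
    K + 1 \<le> 3 K.\<close>
  define P where "P = 12 * pi * \<beta>"
  \<comment> \<open>Plancherel's 2 pi times one summand for each of the orders 1 and b. The outer
    powers of 4 come from \<open>weight_interpolation\<close>, the inner ones from 1 + |k| \<le> 2
    K; P is the order 0 part of the weight 1 + y^(2 m).\<close>
  define Q where "Q = 2 * pi * (4 * (P + C1 * 4) + 4 ^ b * (P + C2 * 4 ^ b))"
  have P0: "P > 0" unfolding P_def using \<beta> by simp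
  have Q0: "Q > 0" unfolding Q_def using P0 C1(1) C2(1)
    by (intro mult_pos_pos add_pos_nonneg mult_nonneg_nonneg add_nonneg_nonneg add_pos_nonneg) (auto intro: less_imp_le)
  define C where "C = sqrt P + 2 * C3 + sqrt Q"
  have CP: "P \<le> C\<^sup>2" and CQ: "Q \<le> C\<^sup>2" and C0: "C > 0" and CC3: "2 * C3 \<le> C"
  proof -
    have s: "sqrt P \<ge> 0" "sqrt Q > 0" using P0 Q0 by auto
    have "sqrt P \<le> C" "sqrt Q \<le> C" unfolding C_def using s C3(1) by auto
    from power_mono[OF this(1), of 2] power_mono[OF this(2), of 2]
    show "P \<le> C\<^sup>2" "Q \<le> C\<^sup>2" using s P0 Q0 by simp_all
    show "C > 0" "2 * C3 \<le> C" unfolding C_def using s C3(1) by linarith+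
  qed
  show ?thesis
  proof (rule that[OF C0], intro conjI)
    fix A :: "int set" and c :: "int \<Rightarrow> complex" and K :: nat and a :: real
    assume A: "finite A" and K: "(1::nat) \<le> K" and a: "a > 0" and AK: "\<And>k. k \<in> A \<Longrightarrow> \<bar>k\<bar> \<le> int K"
      and c: "(\<Sum>k\<in>A. (norm (c k))\<^sup>2) \<le> a\<^sup>2"
    let ?K = "real K"
    have K1: "?K \<ge> 1" using K by simp
    have AK': "real_of_int \<bar>k\<bar> \<le> ?K" if "k \<in> A" for k
      using AK[OF that] by (metis of_int_le_iff of_int_of_nat_eq)
    have card: "real (card A) \<le> 3 * ?K"
    proof -
      have "A \<subseteq> {- int K..int K}" using AK by (auto simp: abs_le_iff) (metis minus_le_iff)
      then have "card A \<le> card {- int K..int K}" by (intro card_mono) auto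
      then show ?thesis using K by simp
    qed
    have w: "(\<Sum>k\<in>A. (1 + real_of_int \<bar>k\<bar>) ^ (2 * m) * (norm (c k))\<^sup>2) \<le> 4 ^ m * ?K ^ (2 * m) * a\<^sup>2" for m
    proof -
      have "(\<Sum>k\<in>A. (1 + real_of_int \<bar>k\<bar>) ^ (2 * m) * (norm (c k))\<^sup>2) \<le> (\<Sum>k\<in>A. (2 * ?K) ^ (2 * m) * (norm (c k))\<^sup>2)"
        using K1 AK' by (intro sum_mono mult_right_mono power_mono) force+
      also have "\<dots> = (2 * ?K) ^ (2 * m) * (\<Sum>k\<in>A. (norm (c k))\<^sup>2)" by (simp add: sum_distrib_left)
      also have "\<dots> \<le> (2 * ?K) ^ (2 * m) * a\<^sup>2" by (intro mult_left_mono c) simp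
      finally show ?thesis by (simp add: power_mult_distrib power_mult)
    qed
    have p0: "(\<integral>\<^sup>+x. ennreal ((norm (wave_sum \<beta> A c 0 x))\<^sup>2) \<partial>lborel) \<le> ennreal (P * (?K * a)\<^sup>2)"
    proof -
      have "(\<integral>\<^sup>+x. ennreal ((norm (wave_sum \<beta> A c 0 x))\<^sup>2) \<partial>lborel) = ennreal (LINT x|lborel. (norm (wave_sum \<beta> A c 0 x))\<^sup>2)"
        by (intro nn_integral_eq_integral wave_sum_0_L2 \<beta> A) simp
      also have "\<dots> \<le> ennreal ((\<Sum>k\<in>A. (norm (c k))\<^sup>2) * (\<Sum>k\<in>A. 4 * pi * \<beta> * real_of_int \<bar>k\<bar>))"
        by (intro ennreal_leI wave_sum_0_L2 \<beta> A)
      also have "\<dots> \<le> ennreal (a\<^sup>2 * (\<Sum>k\<in>A. 4 * pi * \<beta> * ?K))"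
        using \<beta> by (intro ennreal_leI mult_mono c sum_mono mult_left_mono AK' sum_nonneg) auto
      also have "(\<Sum>k\<in>A. 4 * pi * \<beta> * ?K) = 4 * pi * \<beta> * ?K * real (card A)" by simp
      also have "a\<^sup>2 * (4 * pi * \<beta> * ?K * real (card A)) \<le> a\<^sup>2 * (4 * pi * \<beta> * ?K * (3 * ?K))"
        using \<beta> card by (intro mult_left_mono) auto
      also have "a\<^sup>2 * (4 * pi * \<beta> * ?K * (3 * ?K)) = P * (?K * a)\<^sup>2"
        unfolding P_def by (simp add: power2_eq_square mult_ac)
      finally show ?thesis by (simp add: ennreal_leI)
    qed
    also have "ennreal (P * (?K * a)\<^sup>2) \<le> ennreal ((C * ?K * a)\<^sup>2)"
      using CP by (intro ennreal_leI) (simp add: power_mult_distrib mult.assoc mult_right_mono)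
    finally show "(\<integral>\<^sup>+x. ennreal ((norm (wave_sum \<beta> A c 0 x))\<^sup>2) \<partial>lborel) \<le> ennreal ((C * ?K * a)\<^sup>2)" .
    have "(\<integral>\<^sup>+x. ennreal (norm (wave_sum \<beta> A c (Suc 0) x)) \<partial>lborel) \<le> ennreal (C3 * (2 * ?K * a))"
      unfolding wave_sum_Suc
      by (rule C3(2)[OF A]) (use K1 a w[of 1] in \<open>auto simp: power_mult_distrib\<close>)
    also have "\<dots> \<le> ennreal (C * ?K * a)"
      using CC3 K1 a by (intro ennreal_leI) (simp add: mult.assoc[symmetric] mult_right_mono mult.commute[of _ 2])
    finally show "(LINT x|lborel. norm (wave_sum \<beta> A c (Suc 0) x)) \<le> C * ?K * a"
      using integrable_wave_sum_Suc[OF \<beta>, of A c 0] C0 K1 a by (simp add: nn_integral_eq_integral)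
    let ?g = "wave_sum_ft \<beta> A c"
    have g0: "(\<integral>\<^sup>+\<xi>. ennreal ((norm (?g \<xi>))\<^sup>2) \<partial>lborel) \<le> ennreal (2 * pi) * ennreal (P * (?K * a)\<^sup>2)"
      by (rule order_trans[OF wave_sum_ft_L2[OF \<beta> A]]) (intro mult_left_mono p0, simp)
    have g1: "(\<integral>\<^sup>+\<xi>. ennreal (\<bar>\<xi>\<bar> ^ 2 * (norm (?g \<xi>))\<^sup>2) \<partial>lborel) \<le> ennreal (2 * pi) * ennreal (C1 * (4 ^ 1 * ?K ^ (2 * 1) * a\<^sup>2))"
    proof -
      have "(\<integral>\<^sup>+\<xi>. ennreal (\<bar>\<xi>\<bar> ^ (2 * Suc 0) * (norm (?g \<xi>))\<^sup>2) \<partial>lborel) \<le> ennreal (2 * pi) * (\<integral>\<^sup>+x. ennreal ((norm (wave_sum \<beta> A c (Suc 0) x))\<^sup>2) \<partial>lborel)"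
        by (rule wave_sum_ft_power_L2[OF \<beta>])
      also have "\<dots> \<le> ennreal (2 * pi) * ennreal (C1 * (4 ^ 1 * ?K ^ (2 * 1) * a\<^sup>2))"
        unfolding wave_sum_Suc using w[of 1] C1(1)
        by (intro mult_left_mono order_trans[OF C1(2)[OF A]] ennreal_leI) auto
      finally show ?thesis by simp
    qed
    have g2: "(\<integral>\<^sup>+\<xi>. ennreal (\<bar>\<xi>\<bar> ^ (2 * b) * (norm (?g \<xi>))\<^sup>2) \<partial>lborel) \<le> ennreal (2 * pi) * ennreal (C2 * (4 ^ b * ?K ^ (2 * b) * a\<^sup>2))"
    proof -
      have "(\<integral>\<^sup>+\<xi>. ennreal (\<bar>\<xi>\<bar> ^ (2 * Suc q) * (norm (?g \<xi>))\<^sup>2) \<partial>lborel) \<le> ennreal (2 * pi) * (\<integral>\<^sup>+x. ennreal ((norm (wave_sum \<beta> A c (Suc q) x))\<^sup>2) \<partial>lborel)"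
        by (rule wave_sum_ft_power_L2[OF \<beta>])
      also have "\<dots> \<le> ennreal (2 * pi) * ennreal (C2 * (4 ^ b * ?K ^ (2 * b) * a\<^sup>2))"
        unfolding wave_sum_Suc using w[of "Suc q"] C2(1) q
        by (intro mult_left_mono order_trans[OF C2(2)[OF A]] ennreal_leI) auto
      finally show ?thesis unfolding q .
    qed
    let ?T = "?K powr (2 * t)"
    define A1 where "A1 = ?T * (4 / ?K ^ 2)"
    define A2 where "A2 = ?T * (4 ^ b / ?K ^ (2 * b))"
    have A12: "A1 \<ge> 0" "A2 \<ge> 0" unfolding A1_def A2_def using K1 by auto
    have "(\<integral>\<^sup>+\<xi>. ennreal ((1 + \<bar>\<xi>\<bar>) powr (2 * t) * (norm (?g \<xi>))\<^sup>2) \<partial>lborel) \<le>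
      (\<integral>\<^sup>+\<xi>. ennreal A1 * (ennreal ((norm (?g \<xi>))\<^sup>2) + ennreal (\<bar>\<xi>\<bar> ^ 2 * (norm (?g \<xi>))\<^sup>2))
          + ennreal A2 * (ennreal ((norm (?g \<xi>))\<^sup>2) + ennreal (\<bar>\<xi>\<bar> ^ (2 * b) * (norm (?g \<xi>))\<^sup>2)) \<partial>lborel)"
    proof (rule nn_integral_mono)
      fix \<xi> :: real
      let ?n = "(norm (?g \<xi>))\<^sup>2"
      have n0: "?n \<ge> 0" by simp
      have "(1 + \<bar>\<xi>\<bar>) powr (2 * t) * ?n \<le> ?T * (4 / ?K ^ 2 * (1 + \<bar>\<xi>\<bar> ^ 2) + 4 ^ b / ?K ^ (2 * b) * (1 + \<bar>\<xi>\<bar> ^ (2 * b))) * ?n"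
        by (intro mult_right_mono weight_interpolation K1 t b(1) n0) simp
      also have "\<dots> = A1 * (?n + \<bar>\<xi>\<bar> ^ 2 * ?n) + A2 * (?n + \<bar>\<xi>\<bar> ^ (2 * b) * ?n)"
        unfolding A1_def A2_def by (simp only: distrib_left distrib_right mult_1 mult.assoc mult.left_commute)
      finally have "ennreal ((1 + \<bar>\<xi>\<bar>) powr (2 * t) * ?n) \<le> ennreal (A1 * (?n + \<bar>\<xi>\<bar> ^ 2 * ?n) + A2 * (?n + \<bar>\<xi>\<bar> ^ (2 * b) * ?n))"
        by (rule ennreal_leI)
      also have "\<dots> = ennreal A1 * (ennreal ?n + ennreal (\<bar>\<xi>\<bar> ^ 2 * ?n)) + ennreal A2 * (ennreal ?n + ennreal (\<bar>\<xi>\<bar> ^ (2 * b) * ?n))"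
        using A12 by (simp only: ennreal_plus ennreal_mult' n0 add_nonneg_nonneg mult_nonneg_nonneg zero_le_power abs_ge_zero)
      finally show "ennreal ((1 + \<bar>\<xi>\<bar>) powr (2 * t) * ?n) \<le> ennreal A1 * (ennreal ?n + ennreal (\<bar>\<xi>\<bar> ^ 2 * ?n)) + ennreal A2 * (ennreal ?n + ennreal (\<bar>\<xi>\<bar> ^ (2 * b) * ?n))" .
    qed
    also have "\<dots> = ennreal A1 * ((\<integral>\<^sup>+\<xi>. ennreal ((norm (?g \<xi>))\<^sup>2) \<partial>lborel) + (\<integral>\<^sup>+\<xi>. ennreal (\<bar>\<xi>\<bar> ^ 2 * (norm (?g \<xi>))\<^sup>2) \<partial>lborel))
          + ennreal A2 * ((\<integral>\<^sup>+\<xi>. ennreal ((norm (?g \<xi>))\<^sup>2) \<partial>lborel) + (\<integral>\<^sup>+\<xi>. ennreal (\<bar>\<xi>\<bar> ^ (2 * b) * (norm (?g \<xi>))\<^sup>2) \<partial>lborel))"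
      by (simp add: nn_integral_add nn_integral_cmult)
    also have "\<dots> \<le> ennreal A1 * (ennreal (2 * pi) * ennreal (P * (?K * a)\<^sup>2) + ennreal (2 * pi) * ennreal (C1 * (4 ^ 1 * ?K ^ (2 * 1) * a\<^sup>2)))
          + ennreal A2 * (ennreal (2 * pi) * ennreal (P * (?K * a)\<^sup>2) + ennreal (2 * pi) * ennreal (C2 * (4 ^ b * ?K ^ (2 * b) * a\<^sup>2)))"
      by (intro add_mono mult_left_mono g0 g1 g2) auto
    also have "\<dots> = ennreal (A1 * (2 * pi * (P * (?K * a)\<^sup>2) + 2 * pi * (C1 * (4 ^ 1 * ?K ^ (2 * 1) * a\<^sup>2)))
          + A2 * (2 * pi * (P * (?K * a)\<^sup>2) + 2 * pi * (C2 * (4 ^ b * ?K ^ (2 * b) * a\<^sup>2))))"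
    proof -
      have nn: "0 \<le> P * (?K * a)\<^sup>2" "0 \<le> C1 * (4 ^ 1 * ?K ^ (2 * 1) * a\<^sup>2)" "0 \<le> C2 * (4 ^ b * ?K ^ (2 * b) * a\<^sup>2)" "0 \<le> 2 * pi"
        using P0 C1(1) C2(1) by simp_all
      show ?thesis using A12 nn by (simp only: ennreal_plus ennreal_mult' add_nonneg_nonneg mult_nonneg_nonneg)
    qed
    also have "\<dots> \<le> ennreal (Q * (?T * a\<^sup>2))"
    proof (rule ennreal_leI)
      \<comment> \<open>The order 0 part contributes P K^2 also under the normalisation by K^(2 b);
        b \<ge> 1 absorbs it.\<close>
      have Kb: "?K ^ 2 / ?K ^ (2 * b) \<le> 1"
        using K1 b(2) by (simp add: power_increasing)
      have "A1 * (2 * pi * (P * (?K * a)\<^sup>2) + 2 * pi * (C1 * (4 ^ 1 * ?K ^ (2 * 1) * a\<^sup>2))) = 2 * pi * (4 * (P + C1 * 4)) * (?T * a\<^sup>2)"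
        unfolding A1_def using K1 by (simp add: power_mult_distrib divide_simps power2_eq_square) (simp add: algebra_simps)
      moreover have "A2 * (2 * pi * (P * (?K * a)\<^sup>2) + 2 * pi * (C2 * (4 ^ b * ?K ^ (2 * b) * a\<^sup>2)))
         = 2 * pi * 4 ^ b * (P * (?K ^ 2 / ?K ^ (2 * b)) + C2 * 4 ^ b) * (?T * a\<^sup>2)"
        unfolding A2_def using K1 by (simp add: power_mult_distrib divide_simps) (simp add: algebra_simps)
      moreover have "2 * pi * 4 ^ b * (P * (?K ^ 2 / ?K ^ (2 * b)) + C2 * 4 ^ b) * (?T * a\<^sup>2) \<le> 2 * pi * 4 ^ b * (P * 1 + C2 * 4 ^ b) * (?T * a\<^sup>2)"
        using P0 by (intro mult_right_mono mult_left_mono add_right_mono Kb) auto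
      ultimately show "A1 * (2 * pi * (P * (?K * a)\<^sup>2) + 2 * pi * (C1 * (4 ^ 1 * ?K ^ (2 * 1) * a\<^sup>2)))
          + A2 * (2 * pi * (P * (?K * a)\<^sup>2) + 2 * pi * (C2 * (4 ^ b * ?K ^ (2 * b) * a\<^sup>2))) \<le> Q * (?T * a\<^sup>2)"
        unfolding Q_def by (simp only: distrib_left distrib_right mult.assoc mult_1_right)
    qed
    also have "\<dots> \<le> ennreal ((C * ?K powr t * a)\<^sup>2)"
    proof (rule ennreal_leI)
      have "?T = (?K powr t)\<^sup>2" by (simp add: power2_eq_square powr_add[symmetric])
      then show "Q * (?T * a\<^sup>2) \<le> (C * ?K powr t * a)\<^sup>2"
        using CQ by (simp add: power_mult_distrib mult.assoc mult_right_mono)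
    qed
    finally show "(\<integral>\<^sup>+\<xi>. ennreal ((1 + \<bar>\<xi>\<bar>) powr (2 * t) * (norm (?g \<xi>))\<^sup>2) \<partial>lborel) \<le> ennreal ((C * ?K powr t * a)\<^sup>2)" .
  qed
qed

lemma powr_two_power: "(x::real) > 0 \<Longrightarrow> (2 ^ j * x) powr p = (2 powr p) ^ j * x powr p"
proof -
  assume "x > 0"
  have "((2::real) ^ j) powr p = (2 powr p) ^ j"
    by (simp add: powr_realpow[symmetric] powr_powr powr_power mult.commute)
  then show ?thesis using \<open>x > 0\<close> by (simp add: powr_mult)
qed

text \<open>On block j the coefficients have l2 norm at most a multiple of \<open>K j\<close> to the
  power -s, and order t costs the power t, so the blocks form a geometric series of ratio 2^(t - s).
  The same with exponent 1, below s by 1 \<le> t < s, makes the L2 norms and the dominating bounds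
  of the transforms summable.\<close>

lemma wave_series_Sobolev:
  assumes \<beta>: "\<beta> > 0" and t: "1 \<le> t" "t < s"
  obtains M where "M \<ge> 0" "\<And>c u n E. (n::nat) > 0 \<Longrightarrow> E > 0 \<Longrightarrow>
     (\<lambda>k. (norm (c k))\<^sup>2) summable_on UNIV \<Longrightarrow> (\<Sum>\<^sub>\<infinity>k. (norm (c k))\<^sup>2) \<le> (real n powr - s * E)\<^sup>2 \<Longrightarrow>
     (\<lambda>k. wt k powr (2 * s) * (norm (c k))\<^sup>2) summable_on UNIV \<Longrightarrow> (\<Sum>\<^sub>\<infinity>k. wt k powr (2 * s) * (norm (c k))\<^sup>2) \<le> E\<^sup>2 \<Longrightarrow>
     (\<lambda>k. norm (c k)) summable_on UNIV \<Longrightarrow> (c has_sum 0) UNIV \<Longrightarrow>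
     (\<And>x. ((\<lambda>k. c k * wave \<beta> k x) has_sum u x) UNIV) \<Longrightarrow>
     in_H_real t u \<and> H_real_norm t u \<le> M * real n powr (t - s) * E"
proof -
  obtain C where C: "C > 0" "\<And>A c K a. finite A \<Longrightarrow> (1::nat) \<le> K \<Longrightarrow> a > 0 \<Longrightarrow> (\<And>k. k \<in> A \<Longrightarrow> \<bar>k\<bar> \<le> int K) \<Longrightarrow> (\<Sum>k\<in>A. (norm (c k))\<^sup>2) \<le> a\<^sup>2 \<Longrightarrow>
      (\<integral>\<^sup>+x. ennreal ((norm (wave_sum \<beta> A c 0 x))\<^sup>2) \<partial>lborel) \<le> ennreal ((C * real K * a)\<^sup>2) \<and>
      (LINT x|lborel. norm (wave_sum \<beta> A c (Suc 0) x)) \<le> C * real K * a \<and>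
      (\<integral>\<^sup>+\<xi>. ennreal ((1 + \<bar>\<xi>\<bar>) powr (2 * t) * (norm (wave_sum_ft \<beta> A c \<xi>))\<^sup>2) \<partial>lborel) \<le> ennreal ((C * real K powr t * a)\<^sup>2)"
    using wave_sum_norm_bounds[OF \<beta> t(1)] by blast
  define \<rho> where "\<rho> = (2::real) powr (t - s)"
  have \<rho>: "0 < \<rho>" "\<rho> < 1" unfolding \<rho>_def using t by (auto intro: powr_less_one)
  show ?thesis
  proof (rule that[of "C * 2 powr s / (1 - \<rho>)"])
    show "0 \<le> C * 2 powr s / (1 - \<rho>)" using C(1) \<rho> by simp
    fix c :: "int \<Rightarrow> complex" and u :: "real \<Rightarrow> complex" and n :: nat and E :: real
    assume n: "n > 0" and E: "E > 0" and c2: "(\<lambda>k. (norm (c k))\<^sup>2) summable_on UNIV"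
      and c2E: "(\<Sum>\<^sub>\<infinity>k. (norm (c k))\<^sup>2) \<le> (real n powr - s * E)\<^sup>2"
      and cs: "(\<lambda>k. wt k powr (2 * s) * (norm (c k))\<^sup>2) summable_on UNIV" and csE: "(\<Sum>\<^sub>\<infinity>k. wt k powr (2 * s) * (norm (c k))\<^sup>2) \<le> E\<^sup>2"
      and c1: "(\<lambda>k. norm (c k)) summable_on UNIV" and c0: "(c has_sum 0) UNIV"
      and u: "\<And>x. ((\<lambda>k. c k * wave \<beta> k x) has_sum u x) UNIV"
    let ?B = "block n"
    define K where "K j = 2 ^ j * n" for j
    \<comment> \<open>The annulus j starts at half of \<open>K j\<close>, whence the factor
      \<open>2 powr s\<close>.\<close>
    define a where "a j = 2 powr s * real (K j) powr - s * E" for j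
    have K1: "1 \<le> K j" for j unfolding K_def using n by simp
    have Kp: "0 < real (K j)" for j using K1[of j] by simp
    have a0: "a j > 0" for j unfolding a_def using E Kp[of j] by simp
    have BK: "\<bar>k\<bar> \<le> int (K j)" if "k \<in> ?B j" for k j using that unfolding block_def K_def by simp
    have s0: "s > 0" using t by simp
    have coef: "(\<Sum>k\<in>?B j. (norm (c k))\<^sup>2) \<le> (a j)\<^sup>2" for j
    proof (cases j)
      \<comment> \<open>The weight gives no decay at low frequencies, so the bound on the unweighted
        norm is used for this block.\<close>
      case 0
      have "(\<Sum>k\<in>?B j. (norm (c k))\<^sup>2) \<le> (\<Sum>\<^sub>\<infinity>k. (norm (c k))\<^sup>2)" by (rule finite_sum_le_infsum[OF c2]) auto
      also note c2E
      also have "(real n powr - s * E)\<^sup>2 \<le> (a j)\<^sup>2"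
      proof (rule power_mono)
        have "1 * (real n powr - s * E) \<le> 2 powr s * (real n powr - s * E)"
          using E s0 by (intro mult_right_mono) (auto intro: ge_one_powr_ge_zero)
        then show "real n powr - s * E \<le> a j" unfolding a_def K_def 0 by (simp add: mult.assoc)
      qed (use E in simp)
      finally show ?thesis .
    next
      case (Suc i)
      have w: "(norm (c k))\<^sup>2 \<le> (2 powr s * real (K j) powr - s)\<^sup>2 * (wt k powr (2 * s) * (norm (c k))\<^sup>2)" if k: "k \<in> ?B j" for k
      proof -
        have "2 ^ i * int n < \<bar>k\<bar>" using k unfolding block_def Suc by simp
        then have "real_of_int (2 ^ i * int n) \<le> real_of_int \<bar>k\<bar>" by (intro of_int_le_iff[THEN iffD2]) simp
        then have kw: "real (K j) / 2 \<le> wt k" unfolding K_def Suc wt_def by simp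
        have "1 = (2 powr s * real (K j) powr - s)\<^sup>2 * (real (K j) / 2) powr (2 * s)"
        proof -
          have "2 powr s * real (K j) powr - s * (real (K j) / 2) powr s = 1"
            using Kp[of j] by (simp add: powr_divide powr_minus)
          moreover have "(real (K j) / 2) powr (2 * s) = ((real (K j) / 2) powr s)\<^sup>2"
            by (simp add: power2_eq_square powr_add[symmetric])
          ultimately show ?thesis by (simp add: power_mult_distrib[symmetric])
        qed
        also have "\<dots> \<le> (2 powr s * real (K j) powr - s)\<^sup>2 * wt k powr (2 * s)"
          using kw s0 Kp[of j] by (intro mult_left_mono powr_mono2) auto
        finally have "1 * (norm (c k))\<^sup>2 \<le> (2 powr s * real (K j) powr - s)\<^sup>2 * wt k powr (2 * s) * (norm (c k))\<^sup>2"
          by (intro mult_right_mono) auto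
        then show ?thesis by (simp add: mult.assoc)
      qed
      have "(\<Sum>k\<in>?B j. (norm (c k))\<^sup>2) \<le> (2 powr s * real (K j) powr - s)\<^sup>2 * (\<Sum>k\<in>?B j. wt k powr (2 * s) * (norm (c k))\<^sup>2)"
        unfolding sum_distrib_left by (intro sum_mono w)
      also have "\<dots> \<le> (2 powr s * real (K j) powr - s)\<^sup>2 * E\<^sup>2"
        by (intro mult_left_mono order_trans[OF finite_sum_le_infsum[OF cs] csE]) auto
      finally show ?thesis unfolding a_def by (simp add: power_mult_distrib)
    qed
    note bounds = C(2)[OF finite_block K1 a0 BK coef]
    define v where "v j = wave_sum \<beta> (?B j) c 0" for j
    define G where "G j = wave_sum_ft \<beta> (?B j) c" for j
    define S where "S j = (\<Sum>k\<in>?B j. norm (c k))" for j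
    define L where "L j = (LINT x|lborel. norm (wave_sum \<beta> (?B j) c (Suc 0) x))" for j
    have Ka: "real (K j) powr p * a j = 2 powr s * real n powr (p - s) * E * (2 powr (p - s)) ^ j" for j p
    proof -
      have "real (K j) powr p * a j = 2 powr s * E * (real (K j) powr p * real (K j) powr - s)" unfolding a_def by simp
      also have "real (K j) powr p * real (K j) powr - s = real (K j) powr (p - s)" by (simp add: powr_add[symmetric])
      also have "real (K j) powr (p - s) = (2 powr (p - s)) ^ j * real n powr (p - s)"
        using powr_two_power[of "real n" j "p - s"] n by (simp add: K_def)
      finally show ?thesis by (simp add: mult_ac)
    qed
    have geo: "(\<lambda>j. C * real (K j) powr p * a j) sums (C * 2 powr s * real n powr (p - s) * E * (1 / (1 - 2 powr (p - s))))" if "p < s" for p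
    proof -
      have "norm ((2::real) powr (p - s)) < 1" using that by (simp add: powr_less_one)
      from sums_mult[OF geometric_sums[OF this], of "C * 2 powr s * real n powr (p - s) * E"]
      show ?thesis unfolding mult.assoc[of C "real _ powr _"] Ka by (simp add: mult_ac)
    qed
    define a1 where "a1 j = C * real (K j) * a j" for j
    define bt where "bt j = C * real (K j) powr t * a j" for j
    have a1s: "summable a1" unfolding a1_def using geo[of 1] t Kp by (simp add: sums_iff less_imp_le)
    have ats: "bt sums (C * 2 powr s * real n powr (t - s) * E * (1 / (1 - \<rho>)))" unfolding bt_def \<rho>_def using geo[OF t(2)] .
    have a1p: "a1 j > 0" and atp: "bt j > 0" for j unfolding a1_def bt_def using C(1) a0[of j] Kp[of j] by simp_all
    have Ss: "summable S"
      unfolding S_def using has_sum_blocks[OF has_sum_infsum[OF c1] n] by (simp add: sums_iff)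
    have vu: "(\<lambda>j. v j x) sums u x" for x
    proof -
      have "((\<lambda>k. c k * wave \<beta> k x + (- 1) * c k) has_sum (u x + (- 1) * 0)) UNIV"
        by (intro has_sum_add has_sum_cmult_right u c0)
      then have "((\<lambda>k. c k * (wave \<beta> k x - 1)) has_sum u x) UNIV" by (simp add: algebra_simps)
      from has_sum_blocks[OF this n] show ?thesis unfolding v_def wave_sum_def by simp
    qed
    have vb: "norm (v j x) \<le> 2 * S j" for j x
    proof -
      have "norm (v j x) \<le> (\<Sum>k\<in>?B j. 2 * norm (c k))"
        unfolding v_def wave_sum_def
      proof (rule sum_norm_le)
        fix k
        have "norm (wave \<beta> k x - 1) \<le> 2" using norm_triangle_ineq4[of "wave \<beta> k x" 1] by simp
        from mult_right_mono[OF this, of "norm (c k)"]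
        show "norm (c k * (wave_deriv \<beta> 0 k x - (if (0::nat) = 0 then 1 else 0))) \<le> 2 * norm (c k)"
          by (simp add: norm_mult mult.commute)
      qed
      then show ?thesis unfolding S_def by (simp add: sum_distrib_left)
    qed
    have vc: "continuous_on A (v j)" for A j unfolding v_def by (rule continuous_on_wave_sum[OF \<beta>])
    have [measurable]: "v j \<in> borel_measurable borel" "G j \<in> borel_measurable borel" for j unfolding v_def G_def by simp_all
    have uc: "continuous_on UNIV u"
    proof (rule uniform_limit_theorem[OF always_eventually])
      have "uniform_limit UNIV (\<lambda>J x. \<Sum>j<J. v j x) (\<lambda>x. \<Sum>j. v j x) sequentially"
        by (rule Weierstrass_m_test[OF vb summable_mult[OF Ss]])
      moreover have "(\<Sum>j. v j x) = u x" for x using vu[of x] by (simp add: sums_iff)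
      ultimately show "uniform_limit UNIV (\<lambda>J x. \<Sum>j<J. v j x) u sequentially" by simp
    qed (auto intro!: continuous_on_sum vc)
    have [measurable]: "u \<in> borel_measurable borel" by (rule borel_measurable_continuous_onI[OF uc])
    have uL2: "(\<integral>\<^sup>+x. ennreal (1 * (norm (u x))\<^sup>2) \<partial>lborel) \<le> ennreal ((suminf a1)\<^sup>2)"
      by (rule nn_integral_series_L2[where v = v]) (use vu a1p a1s bounds in \<open>auto simp: a1_def v_def\<close>)
    have u2: "integrable lborel (\<lambda>x. (norm (u x))\<^sup>2)"
      by (rule integrableI_nonneg) (use uL2 in \<open>auto simp: order_le_less_trans\<close>)
    have ftu: "ft (truncate R u) \<xi> = (\<Sum>j. ft (truncate R (v j)) \<xi>)" for R \<xi>
    proof -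
      let ?f = "\<lambda>j x. cis (- (\<xi> * x)) * truncate R (v j) x"
      have fi: "integrable lborel (?f j)" for j by (intro integrable_cis_mult integrable_truncate vc)
      have fb: "norm (?f j x) \<le> indicator {-R..R} x * (2 * S j)" for j x
        using vb[of j x] by (simp add: norm_mult truncate_def indicator_def)
      have "(\<lambda>j. integral\<^sup>L lborel (?f j)) sums (LINT x|lborel. (\<Sum>j. ?f j x))"
      proof (rule sums_integral[OF fi])
        have "summable (\<lambda>j. norm (?f j x))" for x
          by (rule summable_comparison_test'[of "\<lambda>j. indicator {-R..R} x * (2 * S j)" 0])
            (intro summable_mult Ss, use fb[of x] in simp)
        then show "AE x in lborel. summable (\<lambda>j. norm (?f j x))" by simp
        show "summable (\<lambda>j. LINT x|lborel. norm (?f j x))"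
        proof (rule summable_comparison_test'[of "\<lambda>j. measure lborel {-R..R} * (2 * S j)" 0])
          show "summable (\<lambda>j. measure lborel {-R..R} * (2 * S j))" by (intro summable_mult Ss)
          fix j :: nat
          have ii: "integrable lborel (\<lambda>x. indicator {-R..R} x * (2 * S j))"
            by (intro integrable_mult_left integrable_real_indicator) (simp_all add: emeasure_lborel_Icc_eq)
          have "(LINT x|lborel. norm (?f j x)) \<le> (LINT x|lborel. indicator {-R..R} x * (2 * S j))"
            by (intro integral_mono integrable_norm fi ii fb)
          then show "norm (LINT x|lborel. norm (?f j x)) \<le> measure lborel {-R..R} * (2 * S j)" by simp
        qed
      qed
      moreover have "(\<Sum>j. ?f j x) = cis (- (\<xi> * x)) * truncate R u x" for x
      proof -
        have "(\<lambda>j. ?f j x) sums (cis (- (\<xi> * x)) * truncate R u x)"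
          unfolding truncate_def by (intro sums_mult sums_scaleR_right vu)
        then show ?thesis by (simp add: sums_iff)
      qed
      ultimately show ?thesis unfolding ft_def by (simp add: sums_iff)
    qed
    \<comment> \<open>The candidate for the transform of \<open>u\<close>; away from \<xi> = 0 it is
      the limit of the transforms of the truncations, by Tannery's theorem.\<close>
    define g where "g \<xi> = (\<Sum>j. G j \<xi>)" for \<xi>
    have [measurable]: "g \<in> borel_measurable borel" unfolding g_def[abs_def] by measurable
    have lim: "(\<lambda>j. G j \<xi>) sums g \<xi> \<and> ((\<lambda>R. ft (truncate R u) \<xi>) \<longlongrightarrow> g \<xi>) at_top" if \<xi>: "\<xi> \<noteq> 0" for \<xi>
    proof -
      have Ls: "summable L"
        by (rule summable_comparison_test'[OF a1s, of 0]) (use bounds in \<open>auto simp: L_def a1_def\<close>)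
      have 1: "summable (\<lambda>j. norm (G j \<xi>)) \<and> ((\<lambda>R. \<Sum>j. ft (truncate R (v j)) \<xi>) \<longlongrightarrow> (\<Sum>j. G j \<xi>)) at_top"
      proof (rule tannerys_theorem[THEN conjunct2])
        show "((\<lambda>R. ft (truncate R (v j)) \<xi>) \<longlongrightarrow> G j \<xi>) at_top" for j
          unfolding v_def G_def by (rule ft_truncate_wave_sum_limit[OF \<beta> \<xi>])
        have "\<forall>\<^sub>F R in at_top. R \<ge> (0::real)" by (rule eventually_ge_at_top)
        then have "\<forall>\<^sub>F (j::nat, R) in at_top \<times>\<^sub>F at_top. R \<ge> (0::real)"
          using eventually_prod2[of "at_top :: nat filter" "\<lambda>R. R \<ge> (0::real)" at_top] by simp
        then show "\<forall>\<^sub>F (j, R) in at_top \<times>\<^sub>F at_top. norm (ft (truncate R (v j)) \<xi>) \<le> (4 * S j + L j) / \<bar>\<xi>\<bar>"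
          by eventually_elim (auto simp: v_def S_def L_def intro: norm_ft_truncate_wave_sum_le[OF \<beta> \<xi>])
        show "summable (\<lambda>j. (4 * S j + L j) / \<bar>\<xi>\<bar>)" by (intro summable_divide summable_add summable_mult Ss Ls)
      qed simp
      have "(\<lambda>j. G j \<xi>) sums g \<xi>"
        unfolding g_def by (rule summable_sums[OF summable_norm_cancel[OF conjunct1[OF 1]]])
      moreover have "((\<lambda>R. ft (truncate R u) \<xi>) \<longlongrightarrow> g \<xi>) at_top"
        unfolding ftu g_def by (rule conjunct2[OF 1])
      ultimately show ?thesis ..
    qed
    have ae0: "AE \<xi> in lborel. \<xi> \<noteq> (0::real)" by (rule AE_lborel_singleton)
    have hL: "has_L2_fourier u g"
    proof (rule has_L2_fourier_limit(1))
      show "AE \<xi> in lborel. ((\<lambda>R. ft (truncate R u) \<xi>) \<longlongrightarrow> g \<xi>) at_top"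
        using ae0 by eventually_elim (use lim in blast)
    qed (use u2 integrable_truncate[OF uc] in auto)
    \<comment> \<open>Existence makes the choice behind \<open>fourier u\<close> valid, and
      uniqueness then identifies it with \<open>g\<close> almost everywhere.\<close>
    then have hL': "has_L2_fourier u (fourier u)" unfolding fourier_def by (rule someI[of "has_L2_fourier u"])
    have ae: "AE \<xi> in lborel. fourier u \<xi> = g \<xi>" by (rule has_L2_fourier_unique[OF _ hL' hL]) simp
    have [measurable]: "fourier u \<in> borel_measurable borel"
      using hL' unfolding has_L2_fourier_def in_L2_real_def by auto
    have gb: "(\<integral>\<^sup>+\<xi>. ennreal ((1 + \<bar>\<xi>\<bar>) powr (2 * t) * (norm (g \<xi>))\<^sup>2) \<partial>lborel) \<le> ennreal ((suminf bt)\<^sup>2)"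
    proof (rule nn_integral_series_L2[where v = G])
      show "AE \<xi> in lborel. (\<lambda>j. G j \<xi>) sums g \<xi>" using ae0 by eventually_elim (use lim in blast)
      show "summable bt" using ats by (simp add: sums_iff)
    qed (use atp bounds in \<open>auto simp: bt_def G_def\<close>)
    have "(\<integral>\<^sup>+\<xi>. ennreal ((1 + \<bar>\<xi>\<bar>) powr (2 * t) * (norm (fourier u \<xi>))\<^sup>2) \<partial>lborel) = (\<integral>\<^sup>+\<xi>. ennreal ((1 + \<bar>\<xi>\<bar>) powr (2 * t) * (norm (g \<xi>))\<^sup>2) \<partial>lborel)"
      by (rule nn_integral_cong_AE) (use ae in eventually_elim, simp)
    with gb have fb: "(\<integral>\<^sup>+\<xi>. ennreal ((1 + \<bar>\<xi>\<bar>) powr (2 * t) * (norm (fourier u \<xi>))\<^sup>2) \<partial>lborel) \<le> ennreal ((suminf bt)\<^sup>2)" by simp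
    have fint: "integrable lborel (\<lambda>\<xi>. (1 + \<bar>\<xi>\<bar>) powr (2 * t) * (norm (fourier u \<xi>))\<^sup>2)"
      by (rule integrableI_nonneg) (use fb in \<open>auto simp: order_le_less_trans\<close>)
    show "in_H_real t u \<and> H_real_norm t u \<le> C * 2 powr s / (1 - \<rho>) * real n powr (t - s) * E"
    proof
      show "in_H_real t u" unfolding in_H_real_def in_L2_real_def using u2 fint by simp
      have "(LINT \<xi>|lborel. (1 + \<bar>\<xi>\<bar>) powr (2 * t) * (norm (fourier u \<xi>))\<^sup>2) \<le> (suminf bt)\<^sup>2"
        using fb fint by (simp add: nn_integral_eq_integral)
      then have "H_real_norm t u \<le> sqrt ((suminf bt)\<^sup>2)" unfolding H_real_norm_def by (rule real_sqrt_le_mono)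
      also have "\<dots> = suminf bt"
        by (intro real_sqrt_unique suminf_nonneg sums_summable[OF ats] less_imp_le[OF atp]) simp
      also have "\<dots> = C * 2 powr s / (1 - \<rho>) * real n powr (t - s) * E" using ats by (simp add: sums_iff)
      finally show "H_real_norm t u \<le> C * 2 powr s / (1 - \<rho>) * real n powr (t - s) * E" .
    qed
  qed
qed

section \<open>The interpolation error\<close>

lemma circle_to_line_eq_tan:
  assumes "\<beta> > 0" "0 < \<theta>" "\<theta> < 2 * pi"
  shows "circle_to_line \<beta> \<theta> = \<beta> * tan ((\<theta> - pi) / 2)"
proof -
  have "angle \<beta> (\<beta> * tan ((\<theta> - pi) / 2)) = \<theta>"
  proof -
    have "arctan (tan ((\<theta> - pi) / 2)) = (\<theta> - pi) / 2" using assms by (intro arctan_tan) auto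
    then show ?thesis unfolding angle_def using assms by simp
  qed
  then show ?thesis using circle_to_line_angle[OF assms(1), of "\<beta> * tan ((\<theta> - pi) / 2)"] by simp
qed

lemma pullback_angle: "\<beta> > 0 \<Longrightarrow> pullback \<beta> f (angle \<beta> x) = f x"
  unfolding pullback_def using angle_bounds circle_to_line_angle by simp

text \<open>In the interior this is a composition of continuous functions. At the endpoints the
  tangent tends to minus or plus infinity and \<open>f\<close> tends to 0, the value assigned
  there.\<close>

lemma continuous_on_pullback:
  assumes \<beta>: "\<beta> > 0" and f: "continuous_on UNIV f" and f0: "(f \<longlongrightarrow> 0) at_infinity"
  shows "continuous_on {0..2*pi} (pullback \<beta> f)"
  unfolding continuous_on_def
proof
  let ?t = "\<lambda>\<theta>. \<beta> * tan ((\<theta> - pi) / 2)"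
  have fl: "(f \<longlongrightarrow> 0) at_top" "(f \<longlongrightarrow> 0) at_bot"
    using f0 unfolding at_infinity_eq_at_top_bot by (auto elim!: filterlim_mono)
  fix \<theta> :: real assume "\<theta> \<in> {0..2*pi}"
  then consider "\<theta> = 0" | "\<theta> = 2 * pi" | "0 < \<theta>" "\<theta> < 2 * pi" by fastforce
  then show "(pullback \<beta> f \<longlongrightarrow> pullback \<beta> f \<theta>) (at \<theta> within {0..2*pi})"
  proof cases
    case 1
    have "filterlim (\<lambda>\<theta>. (\<theta> - pi) / 2) (at_right (- (pi / 2))) (at_right 0)"
    proof (rule filterlim_at_withinI)
      have "((\<lambda>\<theta>. (\<theta> - pi) / 2) \<longlongrightarrow> (0 - pi) / 2) (at_right 0)" by (intro tendsto_intros) auto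
      then show "((\<lambda>\<theta>. (\<theta> - pi) / 2) \<longlongrightarrow> - (pi / 2)) (at_right 0)" by simp
      show "\<forall>\<^sub>F x in at_right 0. (x - pi) / 2 \<in> {- (pi / 2)<..} - {- (pi / 2)}"
        using eventually_at_right_less[of 0] by eventually_elim auto
    qed
    then have "filterlim (\<lambda>\<theta>. tan ((\<theta> - pi) / 2)) at_bot (at_right 0)"
      by (rule filterlim_compose[OF filterlim_tan_at_right])
    then have "filterlim ?t at_bot (at_right 0)"
      by (rule filterlim_tendsto_pos_mult_at_bot[OF tendsto_const \<beta>])
    then have l: "((\<lambda>\<theta>. f (?t \<theta>)) \<longlongrightarrow> 0) (at_right 0)" by (rule filterlim_compose[OF fl(2)])
    have "(pullback \<beta> f \<longlongrightarrow> 0) (at_right 0)"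
    proof (rule Lim_transform_eventually[OF l])
      show "\<forall>\<^sub>F \<theta> in at_right 0. f (?t \<theta>) = pullback \<beta> f \<theta>"
        using eventually_at_right_real[of 0 "2 * pi"]
        by (auto elim!: eventually_mono simp: pullback_def circle_to_line_eq_tan[OF \<beta>])
    qed
    moreover have "at (0::real) within {0..2*pi} = at_right 0"
      by (rule at_within_Icc_at_right) simp
    ultimately show ?thesis using 1 by (simp add: pullback_def)
  next
    case 2
    have "filterlim (\<lambda>\<theta>. (\<theta> - pi) / 2) (at_left (pi / 2)) (at_left (2 * pi))"
    proof (rule filterlim_at_withinI)
      have "((\<lambda>\<theta>. (\<theta> - pi) / 2) \<longlongrightarrow> (2 * pi - pi) / 2) (at_left (2 * pi))" by (intro tendsto_intros) auto
      then show "((\<lambda>\<theta>. (\<theta> - pi) / 2) \<longlongrightarrow> pi / 2) (at_left (2 * pi))" by simp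
      have "\<forall>\<^sub>F x in at_left (2 * pi). x < 2 * pi" by (simp add: eventually_at_filter)
      then show "\<forall>\<^sub>F x in at_left (2 * pi). (x - pi) / 2 \<in> {..<pi / 2} - {pi / 2}"
        by eventually_elim auto
    qed
    then have "filterlim (\<lambda>\<theta>. tan ((\<theta> - pi) / 2)) at_top (at_left (2 * pi))"
      by (rule filterlim_compose[OF filterlim_tan_at_left])
    then have "filterlim ?t at_top (at_left (2 * pi))"
      by (rule filterlim_tendsto_pos_mult_at_top[OF tendsto_const \<beta>])
    then have l: "((\<lambda>\<theta>. f (?t \<theta>)) \<longlongrightarrow> 0) (at_left (2 * pi))" by (rule filterlim_compose[OF fl(1)])
    have "(pullback \<beta> f \<longlongrightarrow> 0) (at_left (2 * pi))"
    proof (rule Lim_transform_eventually[OF l])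
      show "\<forall>\<^sub>F \<theta> in at_left (2 * pi). f (?t \<theta>) = pullback \<beta> f \<theta>"
        using eventually_at_left_real[of 0 "2 * pi"]
        by (auto elim!: eventually_mono simp: pullback_def circle_to_line_eq_tan[OF \<beta>])
    qed
    moreover have "at (2 * pi) within {0..2*pi} = at_left (2 * pi)"
      by (rule at_within_Icc_at_left) simp
    ultimately show ?thesis using 2 by (simp add: pullback_def)
  next
    case 3
    have "cos ((\<theta> - pi) / 2) \<noteq> 0" using 3 by (intro cos_gt_zero_pi[THEN less_imp_neq, symmetric]) auto
    then have "isCont ?t \<theta>" by (intro continuous_intros) auto
    moreover have "isCont f (?t \<theta>)" using f by (simp add: continuous_on_eq_continuous_at)
    ultimately have "isCont (\<lambda>\<theta>. f (?t \<theta>)) \<theta>" by (rule isCont_o2)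
    then have l: "((\<lambda>\<theta>. f (?t \<theta>)) \<longlongrightarrow> f (?t \<theta>)) (at \<theta> within {0..2*pi})"
      unfolding isCont_def by (rule tendsto_within_subset) simp
    have "\<forall>\<^sub>F y in at \<theta> within {0..2*pi}. y \<in> {0<..<2*pi}"
      using eventually_nhds_in_open[of "{0<..<2*pi}" \<theta>] 3 by (auto simp: eventually_at_filter elim: eventually_mono)
    then have "\<forall>\<^sub>F y in at \<theta> within {0..2*pi}. f (?t y) = pullback \<beta> f y"
      by eventually_elim (simp add: pullback_def circle_to_line_eq_tan[OF \<beta>])
    moreover have "pullback \<beta> f \<theta> = f (?t \<theta>)" using 3 by (simp add: pullback_def circle_to_line_eq_tan[OF \<beta>])
    ultimately show ?thesis using Lim_transform_eventually[OF l] by (simp only:)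
  qed
qed

section \<open>Expansion of the error\<close>

lemma H_circle_norm_wt: "H_circle_norm s F = sqrt (\<Sum>\<^sub>\<infinity>k. wt k powr (2 * s) * (norm (circle_fourier F k))\<^sup>2)"
  unfolding H_circle_norm_def wt_def ..

lemma wt_powr_summable:
  assumes "p > 1" shows "(\<lambda>k. wt k powr - p) summable_on UNIV"
proof -
  obtain C where C: "\<And>n m. (n::nat) > 0 \<Longrightarrow> m \<in> freqs n \<Longrightarrow> (\<lambda>k. wt k powr - p) summable_on aliases n m"
    using aliases_tail[OF assms] by metis
  \<comment> \<open>For n = 1 the window is {0} and its aliases are all nonzero integers.\<close>
  have "(\<lambda>k. wt k powr - p) summable_on ((UNIV - {0}) \<union> {0})"
    using C[of 1 0] by (intro summable_on_Un_disjoint) (auto simp: freqs_def aliases_def)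
  then show ?thesis by simp
qed

lemma weighted_L2_imp_abs_summable:
  assumes s: "s > 1/2" and g: "(\<lambda>k. wt k powr (2 * s) * (norm (a k))\<^sup>2) summable_on UNIV"
  shows "(\<lambda>k. norm (a k :: complex)) summable_on UNIV"
proof -
  let ?f = "\<lambda>m. wt m powr - s" and ?h = "\<lambda>m. wt m powr s * norm (a m)"
  have f2: "(?f m)\<^sup>2 = wt m powr - (2 * s)" for m
    by (simp add: power2_eq_square powr_add[symmetric])
  have h2: "(?h m)\<^sup>2 = wt m powr (2 * s) * (norm (a m))\<^sup>2" for m
  proof -
    have "(wt m powr s)\<^sup>2 = wt m powr (2 * s)" by (simp add: power2_eq_square powr_add[symmetric])
    then show ?thesis by (simp add: power_mult_distrib)
  qed
  have fh: "\<bar>?f m\<bar> * \<bar>?h m\<bar> = norm (a m)" for m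
    using wt_pos[of m] by (simp add: abs_mult powr_minus field_simps)
  show ?thesis
    using infsum_Cauchy_Schwarz(1)[of ?f UNIV ?h] wt_powr_summable[of "2 * s"] s g unfolding fh f2 h2 by simp
qed

text \<open>The coefficients of the error sum to zero because both \<open>F\<close> and its interpolant vanish at
  \<open>\<theta> = 0\<close>, the image of the point at infinity.\<close>

lemma interpolation_error_expansion:
  assumes \<beta>: "\<beta> > 0" and s: "s > 1/2" and f: "continuous_on UNIV f" and f0: "(f \<longlongrightarrow> 0) at_infinity"
    and H: "in_H_circle s (pullback \<beta> f)" and n: "n > 1"
  defines "a \<equiv> circle_fourier (pullback \<beta> f)" and "d \<equiv> discrete_fourier n (pullback \<beta> f)"
  shows "(\<lambda>k. wt k powr (2 * s) * (norm (a k))\<^sup>2) summable_on UNIV"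
    "\<And>k. (a has_sum d k) {m. int n dvd m - k}"
    "(err_coeff n d a has_sum 0) UNIV"
    "\<And>x. ((\<lambda>k. err_coeff n d a k * wave \<beta> k x) has_sum (rational_interpolant \<beta> n f x - f x)) UNIV"
proof -
  let ?F = "pullback \<beta> f"
  have n0: "n > 0" using n by simp
  show g: "(\<lambda>k. wt k powr (2 * s) * (norm (a k))\<^sup>2) summable_on UNIV"
    using H unfolding in_H_circle_def a_def wt_def by simp
  have inv: "((\<lambda>k. a k * cis (of_int k * \<theta>)) has_sum ?F \<theta>) UNIV" if "\<theta> \<in> {0..2*pi}" for \<theta>
    unfolding a_def
  proof (rule fourier_inversion[OF continuous_on_pullback[OF \<beta> f f0] _ _ that])
    show "(\<lambda>k. norm (circle_fourier ?F k)) summable_on UNIV"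
      using weighted_L2_imp_abs_summable[OF s g] unfolding a_def .
  qed (simp add: pullback_def)
  show d: "(a has_sum d k) {m. int n dvd m - k}" for k
    unfolding d_def by (rule discrete_fourier_aliasing[OF n0 inv])
  have a0: "(a has_sum 0) UNIV" using inv[of 0] by (simp add: pullback_def)
  \<comment> \<open>The residue classes of the window partition all frequencies, so the coefficients
    of the interpolant have the same sum as all \<open>a k\<close>, namely the value of
    \<open>?F\<close> at 0.\<close>
  have "(a has_sum (\<Sum>k\<in>freqs n. d k)) (\<Union>k\<in>freqs n. {m. int n dvd m - k})"
  proof (rule sum_has_sum[OF finite_freqs d])
    fix k k' assume k: "k \<in> freqs n" "k' \<in> freqs n" "k \<noteq> k'"
    show "{m. int n dvd m - k} \<inter> {m. int n dvd m - k'} = {}"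
    proof (rule ccontr)
      assume "{m. int n dvd m - k} \<inter> {m. int n dvd m - k'} \<noteq> {}"
      then obtain m where "int n dvd m - k" "int n dvd m - k'" by auto
      then have "int n dvd (m - k') - (m - k)" by (rule dvd_diff[rotated])
      then show False using freqs_unique[of k n k'] k n0 by (simp add: algebra_simps)
    qed
  qed
  moreover have "(\<Union>k\<in>freqs n. {m. int n dvd m - k}) = UNIV" using freqs_exists[OF n0] by blast
  ultimately have "(\<Sum>k\<in>freqs n. d k) = 0" using infsumI[OF a0] infsumI by fastforce
  have fin: "((\<lambda>k. if k \<in> freqs n then h k else 0) has_sum (\<Sum>k\<in>freqs n. h k)) UNIV" for h :: "int \<Rightarrow> complex"
    using has_sum_finite[OF finite_freqs[of n], of h] by (subst has_sum_cong_neutral[where S = UNIV and T = "freqs n" and g = h]) auto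
  have "((\<lambda>k. (if k \<in> freqs n then d k else 0) + (- 1) * a k) has_sum ((\<Sum>k\<in>freqs n. d k) + (- 1) * 0)) UNIV"
    by (intro has_sum_add has_sum_cmult_right fin a0)
  then show "(err_coeff n d a has_sum 0) UNIV"
    using \<open>(\<Sum>k\<in>freqs n. d k) = 0\<close> unfolding err_coeff_def[abs_def] by simp
  fix x
  have "((\<lambda>k. a k * wave \<beta> k x) has_sum f x) UNIV"
    using inv[of "angle \<beta> x"] angle_bounds[of \<beta> x] by (simp add: pullback_angle[OF \<beta>] wave_def)
  then have "((\<lambda>k. (if k \<in> freqs n then d k * wave \<beta> k x else 0) + (- 1) * (a k * wave \<beta> k x)) has_sum ((\<Sum>k\<in>freqs n. d k * wave \<beta> k x) + (- 1) * f x)) UNIV"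
    by (intro has_sum_add has_sum_cmult_right fin)
  moreover have "(if k \<in> freqs n then d k * wave \<beta> k x else 0) + (- 1) * (a k * wave \<beta> k x) = err_coeff n d a k * wave \<beta> k x" for k
    by (simp add: err_coeff_def algebra_simps)
  moreover have "rational_interpolant \<beta> n f x = (\<Sum>k\<in>freqs n. d k * wave \<beta> k x)"
    unfolding rational_interpolant_def freqs_def d_def moebius_powi[OF \<beta>] ..
  ultimately show "((\<lambda>k. err_coeff n d a k * wave \<beta> k x) has_sum (rational_interpolant \<beta> n f x - f x)) UNIV" by simp
qed

section \<open>The four estimates for the error\<close>

definition admissible :: "real \<Rightarrow> real \<Rightarrow> (real \<Rightarrow> complex) \<Rightarrow> nat \<Rightarrow> bool" where
  "admissible \<beta> s f n \<longleftrightarrow> continuous_on UNIV f \<and> (f \<longlongrightarrow> 0) at_infinity \<and> in_H_circle s (pullback \<beta> f) \<and> n > 1"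

definition interpolation_error :: "real \<Rightarrow> nat \<Rightarrow> (real \<Rightarrow> complex) \<Rightarrow> real \<Rightarrow> complex" where
  "interpolation_error \<beta> n f = (\<lambda>x. rational_interpolant \<beta> n f x - f x)"

lemma admissible_expansion:
  assumes \<beta>: "\<beta> > 0" and s: "s > 1/2" and adm: "admissible \<beta> s f n"
  obtains a d where "n > 1" "(\<lambda>k. wt k powr (2 * s) * (norm (a k))\<^sup>2) summable_on UNIV"
    "\<And>k. (a has_sum d k) {m. int n dvd m - k}" "(err_coeff n d a has_sum 0) UNIV"
    "\<And>x. ((\<lambda>k. err_coeff n d a k * wave \<beta> k x) has_sum interpolation_error \<beta> n f x) UNIV"
    "H_circle_norm s (pullback \<beta> f) = sqrt (\<Sum>\<^sub>\<infinity>k. wt k powr (2 * s) * (norm (a k))\<^sup>2)"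
  using interpolation_error_expansion[OF \<beta> s, of f n] adm H_circle_norm_wt unfolding admissible_def interpolation_error_def by blast

lemma H_circle_norm_nonneg: "0 \<le> H_circle_norm s F"
  unfolding H_circle_norm_def by (intro real_sqrt_ge_zero infsum_nonneg) auto

lemma error_C0_bound:
  assumes \<beta>: "\<beta> > 0" and s: "s > 1/2" and r: "real r < s - 1/2"
  shows "\<exists>C. \<forall>f n. admissible \<beta> s f n \<longrightarrow> in_C0 r (interpolation_error \<beta> n f) \<and>
    C0_norm r (interpolation_error \<beta> n f) \<le> C * real n powr (1/2 + real r - s) * H_circle_norm s (pullback \<beta> f)"
proof -
  obtain C where C: "C \<ge> 0" "\<And>n a d. n > 1 \<Longrightarrow> (\<lambda>k. wt k powr (2 * s) * (norm (a k))\<^sup>2) summable_on UNIV \<Longrightarrow>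
     (\<And>k. (a has_sum d k) {m. int n dvd m - k}) \<Longrightarrow>
     (\<lambda>k. wt k powr real r * norm (err_coeff n d a k)) summable_on UNIV \<and>
     (\<Sum>\<^sub>\<infinity>k. wt k powr real r * norm (err_coeff n d a k))
       \<le> C * real n powr (1/2 + real r - s) * sqrt (\<Sum>\<^sub>\<infinity>k. wt k powr (2 * s) * (norm (a k))\<^sup>2)"
    using err_coeff_weighted_L1[OF s _ r] by auto
  obtain K where K: "K \<ge> 0" "\<And>c u B. (\<lambda>k. wt k ^ r * norm (c k)) summable_on UNIV \<Longrightarrow>
     (\<Sum>\<^sub>\<infinity>k. wt k ^ r * norm (c k)) \<le> B \<Longrightarrow> (c has_sum 0) UNIV \<Longrightarrow>
     (\<And>x. ((\<lambda>k. c k * wave \<beta> k x) has_sum u x) UNIV) \<Longrightarrow> in_C0 r u \<and> C0_norm r u \<le> K * B"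
    using wave_series_C0[OF \<beta>, of r] by blast
  show ?thesis
  proof (intro exI[of _ "K * C"] allI impI)
    fix f n assume adm: "admissible \<beta> s f n"
    obtain a d where e: "n > 1" "(\<lambda>k. wt k powr (2 * s) * (norm (a k))\<^sup>2) summable_on UNIV"
      "\<And>k. (a has_sum d k) {m. int n dvd m - k}" "(err_coeff n d a has_sum 0) UNIV"
      "\<And>x. ((\<lambda>k. err_coeff n d a k * wave \<beta> k x) has_sum interpolation_error \<beta> n f x) UNIV"
      "H_circle_norm s (pullback \<beta> f) = sqrt (\<Sum>\<^sub>\<infinity>k. wt k powr (2 * s) * (norm (a k))\<^sup>2)"
      using admissible_expansion[OF \<beta> s adm] by blast
    have "wt k powr real r = wt k ^ r" for k by (rule powr_realpow[OF wt_pos])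
    with C(2)[OF e(1-3)] have "(\<lambda>k. wt k ^ r * norm (err_coeff n d a k)) summable_on UNIV"
      "(\<Sum>\<^sub>\<infinity>k. wt k ^ r * norm (err_coeff n d a k)) \<le> C * real n powr (1/2 + real r - s) * H_circle_norm s (pullback \<beta> f)"
      unfolding e(6) by simp_all
    from K(2)[OF this e(4,5)] show "in_C0 r (interpolation_error \<beta> n f) \<and>
      C0_norm r (interpolation_error \<beta> n f) \<le> K * C * real n powr (1/2 + real r - s) * H_circle_norm s (pullback \<beta> f)"
      by (simp add: mult.assoc)
  qed
qed

lemma error_pv_bound:
  assumes \<beta>: "\<beta> > 0" and s: "s > 3/2"
  shows "\<exists>C. \<forall>f n. admissible \<beta> s f n \<longrightarrow> (\<exists>L. has_pv_integral (interpolation_error \<beta> n f) L \<and>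
    norm L \<le> C * real n powr (3/2 - s) * H_circle_norm s (pullback \<beta> f))"
proof -
  have s': "s > 1/2" using s by simp
  obtain C where C: "C \<ge> 0" "\<And>n a d. n > 1 \<Longrightarrow> (\<lambda>k. wt k powr (2 * s) * (norm (a k))\<^sup>2) summable_on UNIV \<Longrightarrow>
     (\<And>k. (a has_sum d k) {m. int n dvd m - k}) \<Longrightarrow>
     (\<lambda>k. wt k powr 1 * norm (err_coeff n d a k)) summable_on UNIV \<and>
     (\<Sum>\<^sub>\<infinity>k. wt k powr 1 * norm (err_coeff n d a k))
       \<le> C * real n powr (1/2 + 1 - s) * sqrt (\<Sum>\<^sub>\<infinity>k. wt k powr (2 * s) * (norm (a k))\<^sup>2)"
    using err_coeff_weighted_L1[OF s', of 1] s by auto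
  show ?thesis
  proof (intro exI[of _ "2 * pi * \<beta> * C"] allI impI)
    fix f n assume adm: "admissible \<beta> s f n"
    obtain a d where e: "n > 1" "(\<lambda>k. wt k powr (2 * s) * (norm (a k))\<^sup>2) summable_on UNIV"
      "\<And>k. (a has_sum d k) {m. int n dvd m - k}" "(err_coeff n d a has_sum 0) UNIV"
      "\<And>x. ((\<lambda>k. err_coeff n d a k * wave \<beta> k x) has_sum interpolation_error \<beta> n f x) UNIV"
      "H_circle_norm s (pullback \<beta> f) = sqrt (\<Sum>\<^sub>\<infinity>k. wt k powr (2 * s) * (norm (a k))\<^sup>2)"
      using admissible_expansion[OF \<beta> s' adm] by blast
    have "wt k powr 1 = wt k" for k using wt_pos[of k] by simp
    with C(2)[OF e(1-3)] have "(\<lambda>k. wt k * norm (err_coeff n d a k)) summable_on UNIV"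
      "(\<Sum>\<^sub>\<infinity>k. wt k * norm (err_coeff n d a k)) \<le> C * real n powr (3/2 - s) * H_circle_norm s (pullback \<beta> f)"
      unfolding e(6) by simp_all
    from wave_series_pv[OF \<beta> this e(4,5)] show "\<exists>L. has_pv_integral (interpolation_error \<beta> n f) L \<and>
      norm L \<le> 2 * pi * \<beta> * C * real n powr (3/2 - s) * H_circle_norm s (pullback \<beta> f)"
      by (simp add: mult.assoc)
  qed
qed

text \<open>The L1 norm of a derivative is controlled by an l2 norm of the coefficients, not an l1
  norm, so the rate carries no extra 1/2 in the exponent.\<close>

lemma error_L1_bound:
  assumes \<beta>: "\<beta> > 0" and s: "s > 1/2" and j: "j > 0" "real j \<le> s"
  shows "\<exists>C. \<forall>f n. admissible \<beta> s f n \<longrightarrow> deriv_in_L1 j (interpolation_error \<beta> n f) \<and>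
    L1_norm (weak_deriv j (interpolation_error \<beta> n f)) \<le> C * real n powr (real j - s) * H_circle_norm s (pullback \<beta> f)"
proof -
  obtain r where r: "j = Suc r" using j(1) by (cases j) auto
  obtain C where C: "C \<ge> 0" "\<And>n a d t. n > 1 \<Longrightarrow> 0 \<le> t \<Longrightarrow> t \<le> s \<Longrightarrow> (\<lambda>k. wt k powr (2 * s) * (norm (a k))\<^sup>2) summable_on UNIV \<Longrightarrow>
     (\<And>k. (a has_sum d k) {m. int n dvd m - k}) \<Longrightarrow>
     (\<lambda>k. wt k powr (2 * t) * (norm (err_coeff n d a k))\<^sup>2) summable_on UNIV \<and>
     (\<Sum>\<^sub>\<infinity>k. wt k powr (2 * t) * (norm (err_coeff n d a k))\<^sup>2)
       \<le> C * real n powr (2 * (t - s)) * (\<Sum>\<^sub>\<infinity>k. wt k powr (2 * s) * (norm (a k))\<^sup>2)"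
    using err_coeff_weighted_L2[OF s] by blast
  obtain K where K: "K \<ge> 0" "\<And>c u X. X > 0 \<Longrightarrow> (\<lambda>k. wt k ^ (2 * Suc r) * (norm (c k))\<^sup>2) summable_on UNIV \<Longrightarrow>
     (\<Sum>\<^sub>\<infinity>k. wt k ^ (2 * Suc r) * (norm (c k))\<^sup>2) \<le> X\<^sup>2 \<Longrightarrow> (\<lambda>k. norm (c k)) summable_on UNIV \<Longrightarrow>
     (\<And>x. ((\<lambda>k. c k * wave \<beta> k x) has_sum u x) UNIV) \<Longrightarrow>
     deriv_in_L1 (Suc r) u \<and> L1_norm (weak_deriv (Suc r) u) \<le> K * X"
    using wave_series_L1[OF \<beta>, of r] by blast
  show ?thesis
  proof (intro exI[of _ "K * sqrt C"] allI impI)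
    fix f n assume adm: "admissible \<beta> s f n"
    obtain a d where e: "n > 1" "(\<lambda>k. wt k powr (2 * s) * (norm (a k))\<^sup>2) summable_on UNIV"
      "\<And>k. (a has_sum d k) {m. int n dvd m - k}" "(err_coeff n d a has_sum 0) UNIV"
      "\<And>x. ((\<lambda>k. err_coeff n d a k * wave \<beta> k x) has_sum interpolation_error \<beta> n f x) UNIV"
      "H_circle_norm s (pullback \<beta> f) = sqrt (\<Sum>\<^sub>\<infinity>k. wt k powr (2 * s) * (norm (a k))\<^sup>2)"
      using admissible_expansion[OF \<beta> s adm] by blast
    let ?c = "err_coeff n d a" and ?H = "H_circle_norm s (pullback \<beta> f)"
    have c1: "(\<lambda>k. norm (?c k)) summable_on UNIV"
      using C(2)[OF e(1) _ _ e(2,3), of s] s by (intro weighted_L2_imp_abs_summable[OF s]) auto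
    have pw: "wt k powr (2 * real j) = wt k ^ (2 * Suc r)" for k
      using powr_realpow[OF wt_pos[of k], of "2 * Suc r"] unfolding r by simp
    have H2: "(\<Sum>\<^sub>\<infinity>k. wt k powr (2 * s) * (norm (a k))\<^sup>2) = ?H\<^sup>2"
      unfolding e(6) by (simp add: infsum_nonneg)
    define X0 where "X0 = sqrt C * real n powr (real j - s) * ?H"
    have X00: "X0 \<ge> 0" unfolding X0_def using C(1) H_circle_norm_nonneg by simp
    have X02: "X0\<^sup>2 = C * real n powr (2 * (real j - s)) * ?H\<^sup>2"
    proof -
      have "(real n powr (real j - s))\<^sup>2 = real n powr (2 * (real j - s))" by (simp add: power2_eq_square powr_add[symmetric])
      then show ?thesis unfolding X0_def using C(1) by (simp add: power_mult_distrib)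
    qed
    have cs: "(\<lambda>k. wt k ^ (2 * Suc r) * (norm (?c k))\<^sup>2) summable_on UNIV"
      "(\<Sum>\<^sub>\<infinity>k. wt k ^ (2 * Suc r) * (norm (?c k))\<^sup>2) \<le> X0\<^sup>2"
      using C(2)[OF e(1) _ j(2) e(2,3)] unfolding pw H2 X02 by auto
    have step: "deriv_in_L1 j (interpolation_error \<beta> n f) \<and> L1_norm (weak_deriv j (interpolation_error \<beta> n f)) \<le> K * X" if "X > X0" for X
    proof -
      have "X0\<^sup>2 \<le> X\<^sup>2" using that X00 by (intro power_mono) auto
      note le = order_trans[OF cs(2) this]
      have "X > 0" using that X00 by simp
      from K(2)[OF this cs(1) le c1 e(5)] show ?thesis unfolding r .
    qed
    \<comment> \<open>\<open>wave_series_L1\<close> asks for a positive bound, while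
      \<open>X0\<close> may be zero; letting X decrease to \<open>X0\<close> covers that
      case.\<close>
    have "L1_norm (weak_deriv j (interpolation_error \<beta> n f)) \<le> K * X0"
    proof (rule tendsto_lowerbound)
      show "((\<lambda>X. K * X) \<longlongrightarrow> K * X0) (at_right X0)" by (intro tendsto_intros)
      show "\<forall>\<^sub>F X in at_right X0. L1_norm (weak_deriv j (interpolation_error \<beta> n f)) \<le> K * X"
        using eventually_at_right_less[of X0] by eventually_elim (use step in blast)
    qed simp
    then show "deriv_in_L1 j (interpolation_error \<beta> n f) \<and> L1_norm (weak_deriv j (interpolation_error \<beta> n f)) \<le> K * sqrt C * real n powr (real j - s) * ?H"
      using step[of "X0 + 1"] unfolding X0_def by (simp add: mult.assoc)
  qed
qed

lemma error_Sobolev_bound_ge_1: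
  assumes \<beta>: "\<beta> > 0" and t: "1 \<le> t" "t < s"
  shows "\<exists>C. \<forall>f n. admissible \<beta> s f n \<longrightarrow> in_H_real t (interpolation_error \<beta> n f) \<and>
    H_real_norm t (interpolation_error \<beta> n f) \<le> C * real n powr (t - s) * H_circle_norm s (pullback \<beta> f)"
proof -
  have s: "s > 1/2" using t by simp
  obtain C where C: "C \<ge> 0" "\<And>n a d t. n > 1 \<Longrightarrow> 0 \<le> t \<Longrightarrow> t \<le> s \<Longrightarrow> (\<lambda>k. wt k powr (2 * s) * (norm (a k))\<^sup>2) summable_on UNIV \<Longrightarrow>
     (\<And>k. (a has_sum d k) {m. int n dvd m - k}) \<Longrightarrow>
     (\<lambda>k. wt k powr (2 * t) * (norm (err_coeff n d a k))\<^sup>2) summable_on UNIV \<and>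
     (\<Sum>\<^sub>\<infinity>k. wt k powr (2 * t) * (norm (err_coeff n d a k))\<^sup>2)
       \<le> C * real n powr (2 * (t - s)) * (\<Sum>\<^sub>\<infinity>k. wt k powr (2 * s) * (norm (a k))\<^sup>2)"
    using err_coeff_weighted_L2[OF s] by blast
  obtain M where M: "M \<ge> 0" "\<And>c u n E. (n::nat) > 0 \<Longrightarrow> E > 0 \<Longrightarrow>
     (\<lambda>k. (norm (c k))\<^sup>2) summable_on UNIV \<Longrightarrow> (\<Sum>\<^sub>\<infinity>k. (norm (c k))\<^sup>2) \<le> (real n powr - s * E)\<^sup>2 \<Longrightarrow>
     (\<lambda>k. wt k powr (2 * s) * (norm (c k))\<^sup>2) summable_on UNIV \<Longrightarrow> (\<Sum>\<^sub>\<infinity>k. wt k powr (2 * s) * (norm (c k))\<^sup>2) \<le> E\<^sup>2 \<Longrightarrow>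
     (\<lambda>k. norm (c k)) summable_on UNIV \<Longrightarrow> (c has_sum 0) UNIV \<Longrightarrow>
     (\<And>x. ((\<lambda>k. c k * wave \<beta> k x) has_sum u x) UNIV) \<Longrightarrow>
     in_H_real t u \<and> H_real_norm t u \<le> M * real n powr (t - s) * E"
    using wave_series_Sobolev[OF \<beta> t] by blast
  show ?thesis
  proof (intro exI[of _ "M * sqrt C"] allI impI)
    fix f n assume adm: "admissible \<beta> s f n"
    obtain a d where e: "n > 1" "(\<lambda>k. wt k powr (2 * s) * (norm (a k))\<^sup>2) summable_on UNIV"
      "\<And>k. (a has_sum d k) {m. int n dvd m - k}" "(err_coeff n d a has_sum 0) UNIV"
      "\<And>x. ((\<lambda>k. err_coeff n d a k * wave \<beta> k x) has_sum interpolation_error \<beta> n f x) UNIV"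
      "H_circle_norm s (pullback \<beta> f) = sqrt (\<Sum>\<^sub>\<infinity>k. wt k powr (2 * s) * (norm (a k))\<^sup>2)"
      using admissible_expansion[OF \<beta> s adm] by blast
    let ?c = "err_coeff n d a" and ?H = "H_circle_norm s (pullback \<beta> f)"
    have n0: "n > 0" using e(1) by simp
    have H2: "(\<Sum>\<^sub>\<infinity>k. wt k powr (2 * s) * (norm (a k))\<^sup>2) = ?H\<^sup>2"
      unfolding e(6) by (simp add: infsum_nonneg)
    define E0 where "E0 = sqrt C * ?H"
    have E00: "E0 \<ge> 0" unfolding E0_def using C(1) H_circle_norm_nonneg by simp
    have E02: "E0\<^sup>2 = C * ?H\<^sup>2" unfolding E0_def using C(1) by (simp add: power_mult_distrib)
    have cs: "(\<lambda>k. wt k powr (2 * s) * (norm (?c k))\<^sup>2) summable_on UNIV" "(\<Sum>\<^sub>\<infinity>k. wt k powr (2 * s) * (norm (?c k))\<^sup>2) \<le> E0\<^sup>2"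
      using C(2)[OF e(1) _ _ e(2,3), of s] s e(1) unfolding H2 E02 by auto
    have c1: "(\<lambda>k. norm (?c k)) summable_on UNIV" by (rule weighted_L2_imp_abs_summable[OF s cs(1)])
    have w0: "wt k powr (2 * 0) = 1" for k using wt_pos[of k] by simp
    have np: "(real n powr - s)\<^sup>2 = real n powr (2 * (0 - s))" by (simp add: power2_eq_square powr_add[symmetric])
    have c2: "(\<lambda>k. (norm (?c k))\<^sup>2) summable_on UNIV" "(\<Sum>\<^sub>\<infinity>k. (norm (?c k))\<^sup>2) \<le> (real n powr - s * E0)\<^sup>2"
      using C(2)[OF e(1) _ _ e(2,3), of 0] s unfolding w0 H2 power_mult_distrib np E02 by (auto simp: mult_ac)
    have step: "in_H_real t (interpolation_error \<beta> n f) \<and> H_real_norm t (interpolation_error \<beta> n f) \<le> M * real n powr (t - s) * E" if "E > E0" for E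
    proof -
      have "E0\<^sup>2 \<le> E\<^sup>2" using that E00 by (intro power_mono) auto
      moreover have "(real n powr - s * E0)\<^sup>2 \<le> (real n powr - s * E)\<^sup>2" using that E00 by (intro power_mono mult_left_mono) auto
      ultimately have le: "(\<Sum>\<^sub>\<infinity>k. wt k powr (2 * s) * (norm (?c k))\<^sup>2) \<le> E\<^sup>2" "(\<Sum>\<^sub>\<infinity>k. (norm (?c k))\<^sup>2) \<le> (real n powr - s * E)\<^sup>2"
        using order_trans[OF cs(2)] order_trans[OF c2(2)] by blast+
      have "E > 0" using that E00 by simp
      from M(2)[OF n0 this c2(1) le(2) cs(1) le(1) c1 e(4,5)] show ?thesis .
    qed
    \<comment> \<open>\<open>E0\<close> may be zero, so the bound is again obtained as a limit from
      the right.\<close>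
    have "H_real_norm t (interpolation_error \<beta> n f) \<le> M * real n powr (t - s) * E0"
    proof (rule tendsto_lowerbound)
      show "((\<lambda>E. M * real n powr (t - s) * E) \<longlongrightarrow> M * real n powr (t - s) * E0) (at_right E0)" by (intro tendsto_intros)
      show "\<forall>\<^sub>F E in at_right E0. H_real_norm t (interpolation_error \<beta> n f) \<le> M * real n powr (t - s) * E"
        using eventually_at_right_less[of E0] by eventually_elim (use step in blast)
    qed simp
    then show "in_H_real t (interpolation_error \<beta> n f) \<and> H_real_norm t (interpolation_error \<beta> n f) \<le> M * sqrt C * real n powr (t - s) * ?H"
      using step[of "E0 + 1"] unfolding E0_def by (simp add: mult_ac)
  qed
qed

lemma in_H_real_mono:
  assumes "in_H_real t' u" "t \<le> t'" shows "in_H_real t u" "H_real_norm t u \<le> H_real_norm t' u"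
proof -
  have i: "integrable lborel (\<lambda>k. (1 + \<bar>k\<bar>) powr (2 * t') * (norm (fourier u k))\<^sup>2)"
    using assms(1) unfolding in_H_real_def by simp
  have le: "(1 + \<bar>k\<bar>) powr (2 * t) * (norm (fourier u k))\<^sup>2 \<le> (1 + \<bar>k\<bar>) powr (2 * t') * (norm (fourier u k))\<^sup>2" for k
    using assms(2) by (intro mult_right_mono powr_mono) auto
  \<comment> \<open>Measurability is inherited from the integrable weighted square at order t' by
    rescaling with a power of 1 + |k|, since \<open>fourier u\<close> as such comes without a
    measurability statement.\<close>
  have "(\<lambda>k. (1 + \<bar>k\<bar>) powr (2 * t) * (norm (fourier u k))\<^sup>2) \<in> borel_measurable borel"
  proof -
    have [measurable]: "(\<lambda>k. (1 + \<bar>k\<bar>) powr (2 * t') * (norm (fourier u k))\<^sup>2) \<in> borel_measurable borel" using i by auto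
    have e: "(1 + \<bar>k\<bar>) powr (2 * t) * (norm (fourier u k))\<^sup>2 = (1 + \<bar>k\<bar>) powr (2 * (t - t')) * ((1 + \<bar>k\<bar>) powr (2 * t') * (norm (fourier u k))\<^sup>2)" for k :: real
    proof -
      have "2 * (t - t') + 2 * t' = 2 * t" by simp
      then show ?thesis unfolding mult.assoc[symmetric] powr_add[symmetric] by simp
    qed
    show ?thesis unfolding e by measurable
  qed
  then have i': "integrable lborel (\<lambda>k. (1 + \<bar>k\<bar>) powr (2 * t) * (norm (fourier u k))\<^sup>2)"
    by (intro Bochner_Integration.integrable_bound[OF i] AE_I2) (use le in auto)
  then show "in_H_real t u" using assms(1) unfolding in_H_real_def by simp
  show "H_real_norm t u \<le> H_real_norm t' u"
    unfolding H_real_norm_def by (intro real_sqrt_le_mono integral_mono i i' le)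
qed

lemma not_bdd_above_inverse:
  assumes "\<delta> > 0" "\<And>\<epsilon>. \<epsilon> > 0 \<Longrightarrow> C \<epsilon> \<ge> 1 / (\<epsilon>::real)" shows "\<not> bdd_above (C ` {0<..<\<delta>})"
proof
  assume "bdd_above (C ` {0<..<\<delta>})"
  then obtain B where "\<forall>x\<in>C ` {0<..<\<delta>}. x \<le> B" unfolding bdd_above_def by blast
  then have B: "C \<epsilon> \<le> B" if "\<epsilon> \<in> {0<..<\<delta>}" for \<epsilon> using that by blast
  \<comment> \<open>Small enough to lie in the interval and to make 1 / \<epsilon> exceed
    \<open>B\<close>.\<close>
  define \<epsilon> where "\<epsilon> = min (\<delta> / 2) (1 / (\<bar>B\<bar> + 1))"
  have "\<epsilon> > 0" "\<epsilon> < \<delta>" unfolding \<epsilon>_def using assms(1) by (auto simp: min_def)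
  moreover have "\<bar>B\<bar> + 1 \<le> 1 / \<epsilon>"
  proof -
    have "\<epsilon> \<le> 1 / (\<bar>B\<bar> + 1)" unfolding \<epsilon>_def by simp
    then show ?thesis using \<open>\<epsilon> > 0\<close> by (simp add: field_simps)
  qed
  ultimately show False using B[of \<epsilon>] assms(2)[of \<epsilon>] by simp
qed

section \<open>Choice of the constants\<close>

theorem theorem4p1:
  fixes \<beta> :: real
  assumes "\<beta> > 0"
  shows
    "\<exists>(C1 :: nat \<Rightarrow> real \<Rightarrow> real) (C2 :: real \<Rightarrow> real \<Rightarrow> real) (C2' :: real \<Rightarrow> real \<Rightarrow> real)
       (C3 :: real \<Rightarrow> real \<Rightarrow> real) (C4 :: nat \<Rightarrow> real \<Rightarrow> real).
       (\<forall>s>1. \<forall>\<delta>>0. \<not> bdd_above ((\<lambda>\<epsilon>. C2 \<epsilon> s) ` {0<..<\<delta>})) \<and>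
       (\<forall>s>3/2. \<forall>\<delta>>0. \<not> bdd_above ((\<lambda>\<epsilon>. C3 \<epsilon> s) ` {0<..<\<delta>})) \<and>
       (\<forall>s>1/2. \<forall>(f :: real \<Rightarrow> complex) (n :: nat).
          continuous_on UNIV f \<longrightarrow> (f \<longlongrightarrow> 0) at_infinity \<longrightarrow>
          in_H_circle s (pullback \<beta> f) \<longrightarrow> n > 1 \<longrightarrow>
          (let err = (\<lambda>x. rational_interpolant \<beta> n f x - f x);
               N = H_circle_norm s (pullback \<beta> f)
           in
             (\<forall>r::nat. real r < s - 1/2 \<longrightarrow> in_C0 r f \<longrightarrow>
                in_C0 r err \<and> C0_norm r err \<le> C1 r s * real n powr (1/2 + real r - s) * N) \<and>
             (\<forall>\<epsilon>>0. \<forall>t<s. s > 1 + \<epsilon> \<longrightarrow> in_H_real t f \<longrightarrow>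
                in_H_real t err \<and>
                H_real_norm t err
                  \<le> (C2 \<epsilon> s * real n powr (1 + \<epsilon> - s) + C2' s t * real n powr (t - s)) * N) \<and>
             (\<forall>\<epsilon>>0. s > 3/2 + \<epsilon> \<longrightarrow>
                (\<exists>L. has_pv_integral err L \<and>
                     norm L \<le> C3 \<epsilon> s * real n powr (3/2 + \<epsilon> - s) * N)) \<and>
             (\<forall>j::nat. j > 0 \<longrightarrow> real j \<le> s \<longrightarrow> deriv_in_L1 j f \<longrightarrow>
                deriv_in_L1 j err \<and>
                L1_norm (weak_deriv j err) \<le> C4 j s * real n powr (real j - s) * N)))"
proof -
  \<comment> \<open>The conditions on the parameters are moved under the existential, so that choice
    yields constants as functions of all parameter values; likewise below.\<close>
  have "\<forall>r s. \<exists>C. s > 1/2 \<and> real r < s - 1/2 \<longrightarrow> (\<forall>f n. admissible \<beta> s f n \<longrightarrow> in_C0 r (interpolation_error \<beta> n f) \<and>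
    C0_norm r (interpolation_error \<beta> n f) \<le> C * real n powr (1/2 + real r - s) * H_circle_norm s (pullback \<beta> f))"
    using error_C0_bound[OF assms] by blast
  then obtain C1 where C1: "\<And>r s f n. s > 1/2 \<Longrightarrow> real r < s - 1/2 \<Longrightarrow> admissible \<beta> s f n \<Longrightarrow> in_C0 r (interpolation_error \<beta> n f) \<and>
    C0_norm r (interpolation_error \<beta> n f) \<le> C1 r s * real n powr (1/2 + real r - s) * H_circle_norm s (pullback \<beta> f)"
    by metis
  have "\<forall>s t. \<exists>C. 1 \<le> t \<and> t < s \<longrightarrow> (\<forall>f n. admissible \<beta> s f n \<longrightarrow> in_H_real t (interpolation_error \<beta> n f) \<and>
    H_real_norm t (interpolation_error \<beta> n f) \<le> C * real n powr (t - s) * H_circle_norm s (pullback \<beta> f))"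
    using error_Sobolev_bound_ge_1[OF assms] by blast
  then obtain D where D: "\<And>s t f n. 1 \<le> t \<Longrightarrow> t < s \<Longrightarrow> admissible \<beta> s f n \<Longrightarrow> in_H_real t (interpolation_error \<beta> n f) \<and>
    H_real_norm t (interpolation_error \<beta> n f) \<le> D s t * real n powr (t - s) * H_circle_norm s (pullback \<beta> f)"
    by metis
  have "\<forall>s. \<exists>C. s > 3/2 \<longrightarrow> (\<forall>f n. admissible \<beta> s f n \<longrightarrow> (\<exists>L. has_pv_integral (interpolation_error \<beta> n f) L \<and>
    norm L \<le> C * real n powr (3/2 - s) * H_circle_norm s (pullback \<beta> f)))"
    using error_pv_bound[OF assms] by blast
  then obtain P where P: "\<And>s f n. s > 3/2 \<Longrightarrow> admissible \<beta> s f n \<Longrightarrow> \<exists>L. has_pv_integral (interpolation_error \<beta> n f) L \<and>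
    norm L \<le> P s * real n powr (3/2 - s) * H_circle_norm s (pullback \<beta> f)"
    by metis
  have "\<forall>j s. \<exists>C. s > 1/2 \<and> j > 0 \<and> real j \<le> s \<longrightarrow> (\<forall>f n. admissible \<beta> s f n \<longrightarrow> deriv_in_L1 j (interpolation_error \<beta> n f) \<and>
    L1_norm (weak_deriv j (interpolation_error \<beta> n f)) \<le> C * real n powr (real j - s) * H_circle_norm s (pullback \<beta> f))"
    using error_L1_bound[OF assms] by blast
  then obtain C4 where C4: "\<And>j s f n. s > 1/2 \<Longrightarrow> j > 0 \<Longrightarrow> real j \<le> s \<Longrightarrow> admissible \<beta> s f n \<Longrightarrow> deriv_in_L1 j (interpolation_error \<beta> n f) \<and>
    L1_norm (weak_deriv j (interpolation_error \<beta> n f)) \<le> C4 j s * real n powr (real j - s) * H_circle_norm s (pullback \<beta> f)"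
    by metis
  \<comment> \<open>Orders below 1 are treated through order 1, whence \<open>D s 1\<close>. The
    absolute values provide the sign that monotonicity in the power of n requires.\<close>
  define C2 where "C2 \<epsilon> s = \<bar>D s 1\<bar> + 1 / \<epsilon>" for \<epsilon> s
  define C2' where "C2' s t = \<bar>D s t\<bar>" for s t
  define C3 where "C3 \<epsilon> s = \<bar>P s\<bar> + 1 / \<epsilon>" for \<epsilon> s
  have unbounded: "\<not> bdd_above ((\<lambda>\<epsilon>. C2 \<epsilon> s) ` {0<..<\<delta>})" "\<not> bdd_above ((\<lambda>\<epsilon>. C3 \<epsilon> s) ` {0<..<\<delta>})" if "\<delta> > 0" for s \<delta>
    by (rule not_bdd_above_inverse[OF that], simp add: C2_def C3_def)+
  have Sobolev: "in_H_real t (interpolation_error \<beta> n f) \<and> H_real_norm t (interpolation_error \<beta> n f)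
      \<le> (C2 \<epsilon> s * real n powr (1 + \<epsilon> - s) + C2' s t * real n powr (t - s)) * H_circle_norm s (pullback \<beta> f)"
    if "\<epsilon> > 0" "t < s" "s > 1 + \<epsilon>" and adm: "admissible \<beta> s f n" for \<epsilon> s t f n
  proof -
    let ?N = "H_circle_norm s (pullback \<beta> f)"
    have n: "real n \<ge> 1" using adm unfolding admissible_def by simp
    have C2n: "C2 \<epsilon> s \<ge> 0" "D s 1 \<le> C2 \<epsilon> s" unfolding C2_def using that(1) abs_ge_self[of "D s 1"] by (auto intro: add_increasing2)
    show ?thesis
    proof (cases "1 \<le> t")
      case True
      note d = D[OF True that(2) adm]
      have "D s t * real n powr (t - s) \<le> C2 \<epsilon> s * real n powr (1 + \<epsilon> - s) + C2' s t * real n powr (t - s)"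
        using C2n(1) by (intro add_increasing mult_right_mono) (auto simp: C2'_def)
      from mult_right_mono[OF this H_circle_norm_nonneg] d show ?thesis by (meson order_trans)
    next
      \<comment> \<open>Below order 1 the norm is dominated by the one of order 1. Its rate
        \<open>n powr (1 - s)\<close> is absorbed by the first term, since n \<ge> 1 and \<epsilon>
        > 0.\<close>
      case False
      note d = D[of 1 s f n, OF _ _ adm]
      have "D s 1 * real n powr (1 - s) \<le> C2 \<epsilon> s * real n powr (1 + \<epsilon> - s) + C2' s t * real n powr (t - s)"
        using C2n n that(1) by (intro add_increasing2 mult_mono powr_mono) (auto simp: C2'_def)
      from mult_right_mono[OF this H_circle_norm_nonneg]
      have "H_real_norm 1 (interpolation_error \<beta> n f) \<le> (C2 \<epsilon> s * real n powr (1 + \<epsilon> - s) + C2' s t * real n powr (t - s)) * ?N"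
        using d that by (meson order_trans order_refl less_trans less_add_same_cancel1)
      then show ?thesis using in_H_real_mono[of 1 "interpolation_error \<beta> n f" t] d that False by force
    qed
  qed
  have pv: "\<exists>L. has_pv_integral (interpolation_error \<beta> n f) L \<and> norm L \<le> C3 \<epsilon> s * real n powr (3/2 + \<epsilon> - s) * H_circle_norm s (pullback \<beta> f)"
    if "\<epsilon> > 0" "s > 3/2 + \<epsilon>" and adm: "admissible \<beta> s f n" for \<epsilon> s f n
  proof -
    have n: "real n \<ge> 1" using adm unfolding admissible_def by simp
    have C3n: "C3 \<epsilon> s \<ge> 0" "P s \<le> C3 \<epsilon> s" unfolding C3_def using that(1) abs_ge_self[of "P s"] by (auto intro: add_increasing2)
    have "P s * real n powr (3/2 - s) \<le> C3 \<epsilon> s * real n powr (3/2 + \<epsilon> - s)"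
      using C3n n that(1) by (intro mult_mono powr_mono) auto
    from mult_right_mono[OF this H_circle_norm_nonneg]
    show ?thesis using P[OF _ adm] that by (meson order_trans less_trans less_add_same_cancel1)
  qed
  show ?thesis
    using unbounded C1 Sobolev pv C4
    by (intro exI[of _ C1] exI[of _ C2] exI[of _ C2'] exI[of _ C3] exI[of _ C4])
      (simp add: Let_def admissible_def interpolation_error_def)
qed

end
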